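(* Suppose $\mathcal K$ is nice and let $A$ be a separable ring of finite degree in $\mathcal K$. An indecomposable ring $B$ in $\mathcal K$ is a splitting ring of $A$ if and only if $B$ is a ring factor of $A^{[\deg(A)]}$. In particular, any separable ring of finite degree in $\mathcal K$ has a splitting ring, and has at most finitely many splitting rings up to isomorphism.
   Context: $(\mathcal K,\otimes,\mathbb 1)$ is an idempotent-complete symmetric monoidal category: $\mathcal K$ is additive, $\otimes$ is additive in each variable, and every $e:x\to x$ with $e^2=e$ yields a decomposition $x\cong x_1\oplus x_2$ under which $e$ becomes $\left(\begin{smallmatrix}1&0\\0&0\end{smallmatrix}\right)$. Rings. A ring in $\mathcal K$ is a commutative monoid $(A,\mu:A\otimes A\to A,\eta:\mathbb 1\to A)$ in $\mathcal K$. Ring morphisms are morphisms in $\mathcal K$ compatible with multiplication and unit. $A\otimes B$ is the ring with multiplication $\mu_A\otimes\mu_B$ precomposed with the swap of the two middle factors; $A\times B$ is $A\oplus B$ with componentwise multiplication. $B$ is a ring factor of $A$ if $A\cong B\times C$ for some ring $C$. $A$ is separable if there is $\sigma:A\to A\otimes A$ with $\mu\sigma=1_A$ and $(1\otimes\mu)(\sigma\otimes1)=\sigma\mu=(\mu\otimes1)(1\otimes\sigma)$. An $A$-algebra is a ring $B$ with a ring morphism $A\to B$. A ring $A$ is indecomposable if it is nonzero and the only idempotent $A$-linear endomorphisms $A\to A$ are $1_A$ and $0$ (equivalently, $A$ is nonzero and is not a product of two nonzero rings). Modules. For $A$ separable, $A\text{-}\mathrm{Mod}_{\mathcal K}$ is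 the category of left $A$-modules in $\mathcal K$ with $A$-linear morphisms; it is idempotent-complete symmetric monoidal under $\otimes_A$, where $x\otimes_A y$ is the coequaliser of the two action maps $x\otimes A\otimes y\rightrightarrows x\otimes y$, with unit $\mathbb 1_A=A$. Extension-of-scalars $F_A:\mathcal K\to A\text{-}\mathrm{Mod}_{\mathcal K}$, $F_A(x)=A\otimes x$, is monoidal. $A$-algebras in $\mathcal K$ correspond to rings in $A\text{-}\mathrm{Mod}_{\mathcal K}$, and separability is the same in both senses. Degree. For a separable ring $A$ there is a separable $A$-algebra $A'$, unique up to isomorphism of $A$-algebras, with a ring isomorphism $h:A\otimes A\to A\times A'$ such that $\mathrm{pr}_1h=\mu$, where $A'$ is an $A$-algebra via $\mathrm{pr}_2h(1_A\otimes\eta)$. Define $A^{[0]}=\mathbb 1$, $A^{[1]}=A$, and inductively $A^{[n+1]}=(A^{[n]})'$, where $A^{[n]}$ is regarded as a ring in $A^{[n-1]}\text{-}\mathrm{Mod}_{\mathcal K}$. The degree $\deg(A)$ is $d$ if $A^{[d]}\ne0$ and $A^{[d+1]}=0$; it is infinite if $A^{[d]}\neq0$ for all $d\ge 0$. Splitting. For separable rings $A,B$ of finite degree, $B$ splits $A$ if $F_B(A)\cong\mathbb 1_B^{\times\deg(A)}$ as rings in $B\text{-}\mathrm{Mod}_{\mathcal K}$. An indecomposable (separable, finite degree) ring $B$ is a splitting ring of $A$ if $B$ splits $A$ and any ring morphism $C\to B$, where $C$ is an indecomposable (separable, finite degree) ring splitting $A$, is an isomorphism. $\mathcal K$ is nice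 if for every separable ring $A$ of finite degree in $\mathcal K$ there are indecomposable rings $A_1,\dots,A_n$ in $\mathcal K$ with $A\cong A_1\times\dots\times A_n$. *)

theory Defs
  imports "HOL-Algebra.Group"
begin

section \<open>Idempotent-complete symmetric monoidal categories\<close>

text \<open>
  Categories are records with explicit sets of objects and arrows, so that the category of modules
  over a ring in \<open>K\<close> is again a record of the same kind.  The operations are only constrained on
  actual objects and composable (respectively parallel) arrows.
\<close>

record ('o, 'm) smc =
  objs :: "'o set"
  arrs :: "'m set"
  src :: "'m \<Rightarrow> 'o"
  tgt :: "'m \<Rightarrow> 'o"
  idt :: "'o \<Rightarrow> 'm"
  cmp :: "'m \<Rightarrow> 'm \<Rightarrow> 'm" (infixr "\<cdot>\<index>" 70)
  add :: "'m \<Rightarrow> 'm \<Rightarrow> 'm" (infixl "\<boxplus>\<index>" 65)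
  zro :: "'o \<Rightarrow> 'o \<Rightarrow> 'm"
  tobj :: "'o \<Rightarrow> 'o \<Rightarrow> 'o" (infixr "\<boxtimes>\<index>" 75)
  tarr :: "'m \<Rightarrow> 'm \<Rightarrow> 'm" (infixr "\<odot>\<index>" 75)
  unt :: 'o
  asc :: "'o \<Rightarrow> 'o \<Rightarrow> 'o \<Rightarrow> 'm"
  lun :: "'o \<Rightarrow> 'm"
  run :: "'o \<Rightarrow> 'm"
  brd :: "'o \<Rightarrow> 'o \<Rightarrow> 'm"

definition Hom :: "('o, 'm) smc \<Rightarrow> 'o \<Rightarrow> 'o \<Rightarrow> 'm set" where
  "Hom K x y = {f \<in> arrs K. src K f = x \<and> tgt K f = y}"

definition hom_group :: "('o, 'm) smc \<Rightarrow> 'o \<Rightarrow> 'o \<Rightarrow> 'm monoid" where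
  "hom_group K x y = \<lparr>carrier = Hom K x y, monoid.mult = add K, one = zro K x y\<rparr>"

definition inverse_arrows :: "('o, 'm) smc \<Rightarrow> 'm \<Rightarrow> 'm \<Rightarrow> bool" where
  "inverse_arrows K f g \<longleftrightarrow> f \<in> arrs K \<and> g \<in> Hom K (tgt K f) (src K f) \<and>
     g \<cdot>\<^bsub>K\<^esub> f = idt K (src K f) \<and> f \<cdot>\<^bsub>K\<^esub> g = idt K (tgt K f)"

definition iso_arrow :: "('o, 'm) smc \<Rightarrow> 'm \<Rightarrow> bool" where
  "iso_arrow K f \<longleftrightarrow> (\<exists>g. inverse_arrows K f g)"

definition inv_arrow :: "('o, 'm) smc \<Rightarrow> 'm \<Rightarrow> 'm" where
  "inv_arrow K f = (THE g. inverse_arrows K f g)"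

definition zero_object :: "('o, 'm) smc \<Rightarrow> 'o \<Rightarrow> bool" where
  "zero_object K z \<longleftrightarrow> z \<in> objs K \<and> idt K z = zro K z z"

definition biproduct :: "('o, 'm) smc \<Rightarrow> 'o \<Rightarrow> 'o \<Rightarrow> 'o \<Rightarrow> 'm \<Rightarrow> 'm \<Rightarrow> 'm \<Rightarrow> 'm \<Rightarrow> bool" where
  "biproduct K x y s i j p q \<longleftrightarrow>
     i \<in> Hom K x s \<and> j \<in> Hom K y s \<and> p \<in> Hom K s x \<and> q \<in> Hom K s y \<and>
     p \<cdot>\<^bsub>K\<^esub> i = idt K x \<and> q \<cdot>\<^bsub>K\<^esub> j = idt K y \<and>
     p \<cdot>\<^bsub>K\<^esub> j = zro K y x \<and> q \<cdot>\<^bsub>K\<^esub> i = zro K x y \<and>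
     (i \<cdot>\<^bsub>K\<^esub> p) \<boxplus>\<^bsub>K\<^esub> (j \<cdot>\<^bsub>K\<^esub> q) = idt K s"

locale category =
  fixes K :: "('o, 'm) smc" (structure)
  assumes src_obj: "f \<in> arrs K \<Longrightarrow> src K f \<in> objs K"
    and tgt_obj: "f \<in> arrs K \<Longrightarrow> tgt K f \<in> objs K"
    and idt_hom: "x \<in> objs K \<Longrightarrow> idt K x \<in> Hom K x x"
    and cmp_hom: "\<lbrakk>f \<in> Hom K x y; g \<in> Hom K y z\<rbrakk> \<Longrightarrow> g \<cdot> f \<in> Hom K x z"
    and idt_left: "f \<in> Hom K x y \<Longrightarrow> idt K y \<cdot> f = f"
    and idt_right: "f \<in> Hom K x y \<Longrightarrow> f \<cdot> idt K x = f"
    and cmp_assoc: "\<lbrakk>f \<in> Hom K w x; g \<in> Hom K x y; h \<in> Hom K y z\<rbrakk> \<Longrightarrow> (h \<cdot> g) \<cdot> f = h \<cdot> (g \<cdot> f)"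

locale additive_category = category +
  assumes hom_comm_group: "\<lbrakk>x \<in> objs K; y \<in> objs K\<rbrakk> \<Longrightarrow> comm_group (hom_group K x y)"
    and cmp_add_left:
      "\<lbrakk>f \<in> Hom K x y; g \<in> Hom K y z; g' \<in> Hom K y z\<rbrakk> \<Longrightarrow> (g \<boxplus> g') \<cdot> f = (g \<cdot> f) \<boxplus> (g' \<cdot> f)"
    and cmp_add_right:
      "\<lbrakk>f \<in> Hom K x y; f' \<in> Hom K x y; g \<in> Hom K y z\<rbrakk> \<Longrightarrow> g \<cdot> (f \<boxplus> f') = (g \<cdot> f) \<boxplus> (g \<cdot> f')"
    and ex_zero_object: "\<exists>z. zero_object K z"
    and ex_biproduct:
      "\<lbrakk>x \<in> objs K; y \<in> objs K\<rbrakk> \<Longrightarrow> \<exists>s i j p q. biproduct K x y s i j p q"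

locale symmetric_monoidal_category = category +
  assumes unt_obj: "unt K \<in> objs K"
    and tobj_obj: "\<lbrakk>x \<in> objs K; y \<in> objs K\<rbrakk> \<Longrightarrow> x \<boxtimes> y \<in> objs K"
    and tarr_hom: "\<lbrakk>f \<in> Hom K x x'; g \<in> Hom K y y'\<rbrakk> \<Longrightarrow> f \<odot> g \<in> Hom K (x \<boxtimes> y) (x' \<boxtimes> y')"
    and tarr_idt: "\<lbrakk>x \<in> objs K; y \<in> objs K\<rbrakk> \<Longrightarrow> idt K x \<odot> idt K y = idt K (x \<boxtimes> y)"
    and tarr_cmp:
      "\<lbrakk>f \<in> Hom K x x'; f' \<in> Hom K x' x''; g \<in> Hom K y y'; g' \<in> Hom K y' y''\<rbrakk> \<Longrightarrow>
       (f' \<cdot> f) \<odot> (g' \<cdot> g) = (f' \<odot> g') \<cdot> (f \<odot> g)"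
    and asc_hom:
      "\<lbrakk>x \<in> objs K; y \<in> objs K; z \<in> objs K\<rbrakk> \<Longrightarrow> asc K x y z \<in> Hom K ((x \<boxtimes> y) \<boxtimes> z) (x \<boxtimes> (y \<boxtimes> z))"
    and asc_iso: "\<lbrakk>x \<in> objs K; y \<in> objs K; z \<in> objs K\<rbrakk> \<Longrightarrow> iso_arrow K (asc K x y z)"
    and asc_natural:
      "\<lbrakk>f \<in> Hom K x x'; g \<in> Hom K y y'; h \<in> Hom K z z'\<rbrakk> \<Longrightarrow>
       asc K x' y' z' \<cdot> ((f \<odot> g) \<odot> h) = (f \<odot> (g \<odot> h)) \<cdot> asc K x y z"
    and lun_hom: "x \<in> objs K \<Longrightarrow> lun K x \<in> Hom K (unt K \<boxtimes> x) x"
    and lun_iso: "x \<in> objs K \<Longrightarrow> iso_arrow K (lun K x)"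
    and lun_natural: "f \<in> Hom K x y \<Longrightarrow> lun K y \<cdot> (idt K (unt K) \<odot> f) = f \<cdot> lun K x"
    and run_hom: "x \<in> objs K \<Longrightarrow> run K x \<in> Hom K (x \<boxtimes> unt K) x"
    and run_iso: "x \<in> objs K \<Longrightarrow> iso_arrow K (run K x)"
    and run_natural: "f \<in> Hom K x y \<Longrightarrow> run K y \<cdot> (f \<odot> idt K (unt K)) = f \<cdot> run K x"
    and brd_hom: "\<lbrakk>x \<in> objs K; y \<in> objs K\<rbrakk> \<Longrightarrow> brd K x y \<in> Hom K (x \<boxtimes> y) (y \<boxtimes> x)"
    and brd_natural:
      "\<lbrakk>f \<in> Hom K x x'; g \<in> Hom K y y'\<rbrakk> \<Longrightarrow> brd K x' y' \<cdot> (f \<odot> g) = (g \<odot> f) \<cdot> brd K x y"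
    and brd_symmetric: "\<lbrakk>x \<in> objs K; y \<in> objs K\<rbrakk> \<Longrightarrow> brd K y x \<cdot> brd K x y = idt K (x \<boxtimes> y)"
    and pentagon:
      "\<lbrakk>w \<in> objs K; x \<in> objs K; y \<in> objs K; z \<in> objs K\<rbrakk> \<Longrightarrow>
       asc K w x (y \<boxtimes> z) \<cdot> asc K (w \<boxtimes> x) y z =
       (idt K w \<odot> asc K x y z) \<cdot> asc K w (x \<boxtimes> y) z \<cdot> (asc K w x y \<odot> idt K z)"
    and triangle:
      "\<lbrakk>x \<in> objs K; y \<in> objs K\<rbrakk> \<Longrightarrow> (idt K x \<odot> lun K y) \<cdot> asc K x (unt K) y = run K x \<odot> idt K y"
    and hexagon:
      "\<lbrakk>x \<in> objs K; y \<in> objs K; z \<in> objs K\<rbrakk> \<Longrightarrow>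
       asc K y z x \<cdot> brd K x (y \<boxtimes> z) \<cdot> asc K x y z =
       (idt K y \<odot> brd K x z) \<cdot> asc K y x z \<cdot> (brd K x y \<odot> idt K z)"

locale idempotent_complete_symmetric_monoidal_category =
  additive_category + symmetric_monoidal_category +
  assumes tarr_add_left:
      "\<lbrakk>f \<in> Hom K x x'; f' \<in> Hom K x x'; g \<in> Hom K y y'\<rbrakk> \<Longrightarrow>
       (f \<boxplus> f') \<odot> g = (f \<odot> g) \<boxplus> (f' \<odot> g)"
    and tarr_add_right:
      "\<lbrakk>f \<in> Hom K x x'; g \<in> Hom K y y'; g' \<in> Hom K y y'\<rbrakk> \<Longrightarrow>
       f \<odot> (g \<boxplus> g') = (f \<odot> g) \<boxplus> (f \<odot> g')"
    and idempotent_splits: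
      "\<lbrakk>x \<in> objs K; e \<in> Hom K x x; e \<cdot> e = e\<rbrakk> \<Longrightarrow>
       \<exists>x\<^sub>1 x\<^sub>2 i j p q. biproduct K x\<^sub>1 x\<^sub>2 x i j p q \<and> e = i \<cdot> p"


section \<open>Rings\<close>

record ('o, 'm) ring_obj =
  r_ob :: 'o
  r_mul :: 'm
  r_unit :: 'm

definition is_ring :: "('o, 'm) smc \<Rightarrow> ('o, 'm) ring_obj \<Rightarrow> bool" where
  "is_ring K A \<longleftrightarrow> (let a = r_ob A; \<mu> = r_mul A; \<eta> = r_unit A in
     a \<in> objs K \<and> \<mu> \<in> Hom K (a \<boxtimes>\<^bsub>K\<^esub> a) a \<and> \<eta> \<in> Hom K (unt K) a \<and>
     \<mu> \<cdot>\<^bsub>K\<^esub> (\<mu> \<odot>\<^bsub>K\<^esub> idt K a) = \<mu> \<cdot>\<^bsub>K\<^esub> (idt K a \<odot>\<^bsub>K\<^esub> \<mu>) \<cdot>\<^bsub>K\<^esub> asc K a a a \<and>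
     \<mu> \<cdot>\<^bsub>K\<^esub> (\<eta> \<odot>\<^bsub>K\<^esub> idt K a) = lun K a \<and>
     \<mu> \<cdot>\<^bsub>K\<^esub> (idt K a \<odot>\<^bsub>K\<^esub> \<eta>) = run K a \<and>
     \<mu> \<cdot>\<^bsub>K\<^esub> brd K a a = \<mu>)"

definition ring_mor :: "('o, 'm) smc \<Rightarrow> ('o, 'm) ring_obj \<Rightarrow> ('o, 'm) ring_obj \<Rightarrow> 'm \<Rightarrow> bool" where
  "ring_mor K A B f \<longleftrightarrow> f \<in> Hom K (r_ob A) (r_ob B) \<and>
     f \<cdot>\<^bsub>K\<^esub> r_mul A = r_mul B \<cdot>\<^bsub>K\<^esub> (f \<odot>\<^bsub>K\<^esub> f) \<and> f \<cdot>\<^bsub>K\<^esub> r_unit A = r_unit B"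

definition ring_iso :: "('o, 'm) smc \<Rightarrow> ('o, 'm) ring_obj \<Rightarrow> ('o, 'm) ring_obj \<Rightarrow> 'm \<Rightarrow> bool" where
  "ring_iso K A B f \<longleftrightarrow> ring_mor K A B f \<and> iso_arrow K f"

definition rings_isomorphic :: "('o, 'm) smc \<Rightarrow> ('o, 'm) ring_obj \<Rightarrow> ('o, 'm) ring_obj \<Rightarrow> bool" where
  "rings_isomorphic K A B \<longleftrightarrow> (\<exists>f. ring_iso K A B f)"

definition nonzero_ring :: "('o, 'm) smc \<Rightarrow> ('o, 'm) ring_obj \<Rightarrow> bool" where
  "nonzero_ring K A \<longleftrightarrow> \<not> zero_object K (r_ob A)"

definition unit_ring :: "('o, 'm) smc \<Rightarrow> ('o, 'm) ring_obj" where
  "unit_ring K = \<lparr>r_ob = unt K, r_mul = lun K (unt K), r_unit = idt K (unt K)\<rparr>"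

text \<open>The canonical isomorphism from \<open>(a \<otimes> b) \<otimes> (c \<otimes> d)\<close> to \<open>(a \<otimes> c) \<otimes> (b \<otimes> d)\<close>.\<close>

definition middle_swap :: "('o, 'm) smc \<Rightarrow> 'o \<Rightarrow> 'o \<Rightarrow> 'o \<Rightarrow> 'o \<Rightarrow> 'm" where
  "middle_swap K a b c d =
     inv_arrow K (asc K a c (b \<boxtimes>\<^bsub>K\<^esub> d)) \<cdot>\<^bsub>K\<^esub>
     (idt K a \<odot>\<^bsub>K\<^esub>
       (asc K c b d \<cdot>\<^bsub>K\<^esub> (brd K b c \<odot>\<^bsub>K\<^esub> idt K d) \<cdot>\<^bsub>K\<^esub> inv_arrow K (asc K b c d))) \<cdot>\<^bsub>K\<^esub>
     asc K a b (c \<boxtimes>\<^bsub>K\<^esub> d)"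

definition tensor_ring :: "('o, 'm) smc \<Rightarrow> ('o, 'm) ring_obj \<Rightarrow> ('o, 'm) ring_obj \<Rightarrow> ('o, 'm) ring_obj" where
  "tensor_ring K A B =
     \<lparr>r_ob = r_ob A \<boxtimes>\<^bsub>K\<^esub> r_ob B,
      r_mul = (r_mul A \<odot>\<^bsub>K\<^esub> r_mul B) \<cdot>\<^bsub>K\<^esub> middle_swap K (r_ob A) (r_ob B) (r_ob A) (r_ob B),
      r_unit = (r_unit A \<odot>\<^bsub>K\<^esub> r_unit B) \<cdot>\<^bsub>K\<^esub> inv_arrow K (lun K (unt K))\<rparr>"

text \<open>
  Additivity only asserts that direct sums exist.  The product ring lives on an arbitrary but fixed
  choice \<open>chosen_sum K x y = (s, i, j, p, q)\<close> of direct sum, with inclusions \<open>i, j\<close> and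
  projections \<open>p, q\<close>; it does not depend on the choice up to isomorphism.
\<close>

definition chosen_sum :: "('o, 'm) smc \<Rightarrow> 'o \<Rightarrow> 'o \<Rightarrow> 'o \<times> 'm \<times> 'm \<times> 'm \<times> 'm" where
  "chosen_sum K x y = (SOME (s, i, j, p, q). biproduct K x y s i j p q)"

definition prod_ring :: "('o, 'm) smc \<Rightarrow> ('o, 'm) ring_obj \<Rightarrow> ('o, 'm) ring_obj \<Rightarrow> ('o, 'm) ring_obj" where
  "prod_ring K A B = (case chosen_sum K (r_ob A) (r_ob B) of (s, i, j, p, q) \<Rightarrow>
     \<lparr>r_ob = s,
      r_mul = (i \<cdot>\<^bsub>K\<^esub> r_mul A \<cdot>\<^bsub>K\<^esub> (p \<odot>\<^bsub>K\<^esub> p)) \<boxplus>\<^bsub>K\<^esub> (j \<cdot>\<^bsub>K\<^esub> r_mul B \<cdot>\<^bsub>K\<^esub> (q \<odot>\<^bsub>K\<^esub> q)),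
      r_unit = (i \<cdot>\<^bsub>K\<^esub> r_unit A) \<boxplus>\<^bsub>K\<^esub> (j \<cdot>\<^bsub>K\<^esub> r_unit B)\<rparr>)"

definition prod_pr1 :: "('o, 'm) smc \<Rightarrow> ('o, 'm) ring_obj \<Rightarrow> ('o, 'm) ring_obj \<Rightarrow> 'm" where
  "prod_pr1 K A B = (case chosen_sum K (r_ob A) (r_ob B) of (s, i, j, p, q) \<Rightarrow> p)"

definition prod_pr2 :: "('o, 'm) smc \<Rightarrow> ('o, 'm) ring_obj \<Rightarrow> ('o, 'm) ring_obj \<Rightarrow> 'm" where
  "prod_pr2 K A B = (case chosen_sum K (r_ob A) (r_ob B) of (s, i, j, p, q) \<Rightarrow> q)"

definition zero_ring :: "('o, 'm) smc \<Rightarrow> ('o, 'm) ring_obj" where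
  "zero_ring K = (let z = (SOME z. zero_object K z) in
     \<lparr>r_ob = z, r_mul = zro K (z \<boxtimes>\<^bsub>K\<^esub> z) z, r_unit = zro K (unt K) z\<rparr>)"

definition prod_ring_list :: "('o, 'm) smc \<Rightarrow> ('o, 'm) ring_obj list \<Rightarrow> ('o, 'm) ring_obj" where
  "prod_ring_list K As = foldr (prod_ring K) As (zero_ring K)"

definition ring_factor :: "('o, 'm) smc \<Rightarrow> ('o, 'm) ring_obj \<Rightarrow> ('o, 'm) ring_obj \<Rightarrow> bool" where
  "ring_factor K B A \<longleftrightarrow> (\<exists>C. is_ring K C \<and> rings_isomorphic K A (prod_ring K B C))"

definition separable :: "('o, 'm) smc \<Rightarrow> ('o, 'm) ring_obj \<Rightarrow> bool" where
  "separable K A \<longleftrightarrow> (let a = r_ob A; \<mu> = r_mul A in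
     \<exists>\<sigma>. \<sigma> \<in> Hom K a (a \<boxtimes>\<^bsub>K\<^esub> a) \<and>
       \<mu> \<cdot>\<^bsub>K\<^esub> \<sigma> = idt K a \<and>
       (idt K a \<odot>\<^bsub>K\<^esub> \<mu>) \<cdot>\<^bsub>K\<^esub> asc K a a a \<cdot>\<^bsub>K\<^esub> (\<sigma> \<odot>\<^bsub>K\<^esub> idt K a) = \<sigma> \<cdot>\<^bsub>K\<^esub> \<mu> \<and>
       (\<mu> \<odot>\<^bsub>K\<^esub> idt K a) \<cdot>\<^bsub>K\<^esub> inv_arrow K (asc K a a a) \<cdot>\<^bsub>K\<^esub> (idt K a \<odot>\<^bsub>K\<^esub> \<sigma>) = \<sigma> \<cdot>\<^bsub>K\<^esub> \<mu>)"


section \<open>Modules\<close>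

text \<open>A left \<open>A\<close>-module is a pair of an object \<open>x\<close> and an action \<open>A \<otimes> x \<rightarrow> x\<close>.\<close>

type_synonym ('o, 'm) module_obj = "'o \<times> 'm"

definition is_module :: "('o, 'm) smc \<Rightarrow> ('o, 'm) ring_obj \<Rightarrow> ('o, 'm) module_obj \<Rightarrow> bool" where
  "is_module K A M \<longleftrightarrow> (case M of (x, \<rho>) \<Rightarrow>
     x \<in> objs K \<and> \<rho> \<in> Hom K (r_ob A \<boxtimes>\<^bsub>K\<^esub> x) x \<and>
     \<rho> \<cdot>\<^bsub>K\<^esub> (r_mul A \<odot>\<^bsub>K\<^esub> idt K x) =
       \<rho> \<cdot>\<^bsub>K\<^esub> (idt K (r_ob A) \<odot>\<^bsub>K\<^esub> \<rho>) \<cdot>\<^bsub>K\<^esub> asc K (r_ob A) (r_ob A) x \<and>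
     \<rho> \<cdot>\<^bsub>K\<^esub> (r_unit A \<odot>\<^bsub>K\<^esub> idt K x) = lun K x)"

definition linear :: "('o, 'm) smc \<Rightarrow> ('o, 'm) ring_obj \<Rightarrow>
    ('o, 'm) module_obj \<Rightarrow> ('o, 'm) module_obj \<Rightarrow> 'm \<Rightarrow> bool" where
  "linear K A M N f \<longleftrightarrow> f \<in> Hom K (fst M) (fst N) \<and>
     f \<cdot>\<^bsub>K\<^esub> snd M = snd N \<cdot>\<^bsub>K\<^esub> (idt K (r_ob A) \<odot>\<^bsub>K\<^esub> f)"

definition regular_module :: "('o, 'm) ring_obj \<Rightarrow> ('o, 'm) module_obj" where
  "regular_module A = (r_ob A, r_mul A)"

definition indecomposable :: "('o, 'm) smc \<Rightarrow> ('o, 'm) ring_obj \<Rightarrow> bool" where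
  "indecomposable K A \<longleftrightarrow> is_ring K A \<and> nonzero_ring K A \<and>
     (\<forall>e. linear K A (regular_module A) (regular_module A) e \<and> e \<cdot>\<^bsub>K\<^esub> e = e \<longrightarrow>
        e = idt K (r_ob A) \<or> e = zro K (r_ob A) (r_ob A))"

definition coequaliser :: "('o, 'm) smc \<Rightarrow> 'm \<Rightarrow> 'm \<Rightarrow> 'm \<Rightarrow> bool" where
  "coequaliser K f g q \<longleftrightarrow>
     f \<in> arrs K \<and> g \<in> Hom K (src K f) (tgt K f) \<and> q \<in> arrs K \<and> src K q = tgt K f \<and>
     q \<cdot>\<^bsub>K\<^esub> f = q \<cdot>\<^bsub>K\<^esub> g \<and>
     (\<forall>h \<in> arrs K. src K h = tgt K f \<and> h \<cdot>\<^bsub>K\<^esub> f = h \<cdot>\<^bsub>K\<^esub> g \<longrightarrow>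
        (\<exists>!k. k \<in> Hom K (tgt K q) (tgt K h) \<and> k \<cdot>\<^bsub>K\<^esub> q = h))"

text \<open>
  \<open>tens_proj K A M N\<close> is a chosen coequaliser \<open>x \<otimes> y \<rightarrow> x \<otimes>\<^sub>A y\<close> of the two actions
  \<open>(x \<otimes> A) \<otimes> y \<rightarrow> x \<otimes> y\<close>, where \<open>M = (x, \<rho>)\<close> and \<open>N = (y, \<tau>)\<close>; the right action on \<open>x\<close> is
  obtained from the left one with the braiding.  It exists when \<open>A\<close> is separable.
\<close>

definition tens_proj :: "('o, 'm) smc \<Rightarrow> ('o, 'm) ring_obj \<Rightarrow>
    ('o, 'm) module_obj \<Rightarrow> ('o, 'm) module_obj \<Rightarrow> 'm" where
  "tens_proj K A M N = (case M of (x, \<rho>) \<Rightarrow> case N of (y, \<tau>) \<Rightarrow>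
     SOME q. coequaliser K
       ((\<rho> \<cdot>\<^bsub>K\<^esub> brd K x (r_ob A)) \<odot>\<^bsub>K\<^esub> idt K y)
       ((idt K x \<odot>\<^bsub>K\<^esub> \<tau>) \<cdot>\<^bsub>K\<^esub> asc K x (r_ob A) y) q)"

text \<open>The arrow induced by \<open>f\<close> on the target of the (split) epimorphism \<open>q\<close>.\<close>

definition descend :: "('o, 'm) smc \<Rightarrow> 'm \<Rightarrow> 'm \<Rightarrow> 'm" where
  "descend K q f = (THE k. k \<in> Hom K (tgt K q) (tgt K f) \<and> k \<cdot>\<^bsub>K\<^esub> q = f)"

definition tens_obj :: "('o, 'm) smc \<Rightarrow> ('o, 'm) ring_obj \<Rightarrow>
    ('o, 'm) module_obj \<Rightarrow> ('o, 'm) module_obj \<Rightarrow> ('o, 'm) module_obj" where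
  "tens_obj K A M N = (let \<pi> = tens_proj K A M N in
     (tgt K \<pi>,
      descend K (idt K (r_ob A) \<odot>\<^bsub>K\<^esub> \<pi>)
        (\<pi> \<cdot>\<^bsub>K\<^esub> (snd M \<odot>\<^bsub>K\<^esub> idt K (fst N)) \<cdot>\<^bsub>K\<^esub> inv_arrow K (asc K (r_ob A) (fst M) (fst N)))))"

text \<open>Arrows of the module category are triples of source, underlying arrow and target.\<close>

type_synonym ('o, 'm) module_arr = "('o, 'm) module_obj \<times> 'm \<times> ('o, 'm) module_obj"

abbreviation under :: "('o, 'm) module_arr \<Rightarrow> 'm" where
  "under t \<equiv> fst (snd t)"

definition Mod :: "('o, 'm) smc \<Rightarrow> ('o, 'm) ring_obj \<Rightarrow>
    (('o, 'm) module_obj, ('o, 'm) module_arr) smc" where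
  "Mod K A =
     \<lparr>objs = {M. is_module K A M},
      arrs = {(M, f, N). is_module K A M \<and> is_module K A N \<and> linear K A M N f},
      src = (\<lambda>t. fst t),
      tgt = (\<lambda>t. snd (snd t)),
      idt = (\<lambda>M. (M, idt K (fst M), M)),
      cmp = (\<lambda>t u. (fst u, under t \<cdot>\<^bsub>K\<^esub> under u, snd (snd t))),
      add = (\<lambda>t u. (fst t, under t \<boxplus>\<^bsub>K\<^esub> under u, snd (snd t))),
      zro = (\<lambda>M N. (M, zro K (fst M) (fst N), N)),
      tobj = tens_obj K A,
      tarr = (\<lambda>(M, f, M') (N, g, N').
        (tens_obj K A M N,
         descend K (tens_proj K A M N) (tens_proj K A M' N' \<cdot>\<^bsub>K\<^esub> (f \<odot>\<^bsub>K\<^esub> g)),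
         tens_obj K A M' N')),
      unt = regular_module A,
      asc = (\<lambda>M N P.
        (tens_obj K A (tens_obj K A M N) P,
         descend K (tens_proj K A (tens_obj K A M N) P \<cdot>\<^bsub>K\<^esub> (tens_proj K A M N \<odot>\<^bsub>K\<^esub> idt K (fst P)))
           (tens_proj K A M (tens_obj K A N P) \<cdot>\<^bsub>K\<^esub> (idt K (fst M) \<odot>\<^bsub>K\<^esub> tens_proj K A N P)
             \<cdot>\<^bsub>K\<^esub> asc K (fst M) (fst N) (fst P)),
         tens_obj K A M (tens_obj K A N P))),
      lun = (\<lambda>M.
        (tens_obj K A (regular_module A) M,
         descend K (tens_proj K A (regular_module A) M) (snd M),
         M)),
      run = (\<lambda>M.
        (tens_obj K A M (regular_module A),
         descend K (tens_proj K A M (regular_module A)) (snd M \<cdot>\<^bsub>K\<^esub> brd K (fst M) (r_ob A)),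
         M)),
      brd = (\<lambda>M N.
        (tens_obj K A M N,
         descend K (tens_proj K A M N) (tens_proj K A N M \<cdot>\<^bsub>K\<^esub> brd K (fst M) (fst N)),
         tens_obj K A N M))\<rparr>"

text \<open>
  The monoidal functor \<open>F\<^sub>B = B \<otimes> -\<close> into \<open>B\<close>-modules, with its structure arrows
  \<open>F\<^sub>B x \<otimes>\<^sub>B F\<^sub>B y \<rightarrow> F\<^sub>B (x \<otimes> y)\<close> and \<open>B \<rightarrow> F\<^sub>B \<one>\<close>, and the ring \<open>F\<^sub>B A\<close> in
  \<open>B\<close>-modules which is the image of a ring \<open>A\<close>.
\<close>

definition ext_obj :: "('o, 'm) smc \<Rightarrow> ('o, 'm) ring_obj \<Rightarrow> 'o \<Rightarrow> ('o, 'm) module_obj" where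
  "ext_obj K B x =
     (r_ob B \<boxtimes>\<^bsub>K\<^esub> x,
      (r_mul B \<odot>\<^bsub>K\<^esub> idt K x) \<cdot>\<^bsub>K\<^esub> inv_arrow K (asc K (r_ob B) (r_ob B) x))"

definition ext_arr :: "('o, 'm) smc \<Rightarrow> ('o, 'm) ring_obj \<Rightarrow> 'm \<Rightarrow> ('o, 'm) module_arr" where
  "ext_arr K B f = (ext_obj K B (src K f), idt K (r_ob B) \<odot>\<^bsub>K\<^esub> f, ext_obj K B (tgt K f))"

definition ext_tensor :: "('o, 'm) smc \<Rightarrow> ('o, 'm) ring_obj \<Rightarrow> 'o \<Rightarrow> 'o \<Rightarrow> ('o, 'm) module_arr" where
  "ext_tensor K B x y =
     (tens_obj K B (ext_obj K B x) (ext_obj K B y),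
      descend K (tens_proj K B (ext_obj K B x) (ext_obj K B y))
        ((r_mul B \<odot>\<^bsub>K\<^esub> idt K (x \<boxtimes>\<^bsub>K\<^esub> y)) \<cdot>\<^bsub>K\<^esub> middle_swap K (r_ob B) x (r_ob B) y),
      ext_obj K B (x \<boxtimes>\<^bsub>K\<^esub> y))"

definition ext_unit :: "('o, 'm) smc \<Rightarrow> ('o, 'm) ring_obj \<Rightarrow> ('o, 'm) module_arr" where
  "ext_unit K B = (regular_module B, inv_arrow K (run K (r_ob B)), ext_obj K B (unt K))"

definition ext_ring :: "('o, 'm) smc \<Rightarrow> ('o, 'm) ring_obj \<Rightarrow> ('o, 'm) ring_obj \<Rightarrow>
    (('o, 'm) module_obj, ('o, 'm) module_arr) ring_obj" where
  "ext_ring K B A =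
     \<lparr>r_ob = ext_obj K B (r_ob A),
      r_mul = ext_arr K B (r_mul A) \<cdot>\<^bsub>Mod K B\<^esub> ext_tensor K B (r_ob A) (r_ob A),
      r_unit = ext_arr K B (r_unit A) \<cdot>\<^bsub>Mod K B\<^esub> ext_unit K B\<rparr>"

text \<open>
  The correspondence between \<open>R\<close>-algebras \<open>\<phi> : R \<rightarrow> B\<close> in \<open>K\<close> and rings in \<open>R\<close>-modules.
\<close>

definition ring_of_algebra :: "('o, 'm) smc \<Rightarrow> ('o, 'm) ring_obj \<Rightarrow> ('o, 'm) ring_obj \<Rightarrow> 'm \<Rightarrow>
    (('o, 'm) module_obj, ('o, 'm) module_arr) ring_obj" where
  "ring_of_algebra K R B \<phi> =
     (let M = (r_ob B, r_mul B \<cdot>\<^bsub>K\<^esub> (\<phi> \<odot>\<^bsub>K\<^esub> idt K (r_ob B))) in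
      \<lparr>r_ob = M,
       r_mul = (tens_obj K R M M, descend K (tens_proj K R M M) (r_mul B), M),
       r_unit = (regular_module R, \<phi>, M)\<rparr>)"

definition underlying_ring :: "('o, 'm) smc \<Rightarrow> ('o, 'm) ring_obj \<Rightarrow>
    (('o, 'm) module_obj, ('o, 'm) module_arr) ring_obj \<Rightarrow> ('o, 'm) ring_obj" where
  "underlying_ring K R C =
     \<lparr>r_ob = fst (r_ob C),
      r_mul = under (r_mul C) \<cdot>\<^bsub>K\<^esub> tens_proj K R (r_ob C) (r_ob C),
      r_unit = under (r_unit C) \<cdot>\<^bsub>K\<^esub> r_unit R\<rparr>"


section \<open>Splitting tower and degree\<close>

text \<open>
  \<open>is_derived_algebra K A A' \<iota>\<close> says that \<open>A'\<close>, with structure map \<open>\<iota> : A \<rightarrow> A'\<close>, is a separable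
  \<open>A\<close>-algebra of the kind that defines \<open>A'\<close>.  For separable \<open>A\<close> it exists and is unique up to
  isomorphism of \<open>A\<close>-algebras; \<open>derived_algebra\<close> fixes a choice.
\<close>

definition is_derived_algebra :: "('o, 'm) smc \<Rightarrow> ('o, 'm) ring_obj \<Rightarrow> ('o, 'm) ring_obj \<Rightarrow> 'm \<Rightarrow> bool" where
  "is_derived_algebra K A A' \<iota> \<longleftrightarrow>
     is_ring K A' \<and> separable K A' \<and> ring_mor K A A' \<iota> \<and>
     (\<exists>h. ring_iso K (tensor_ring K A A) (prod_ring K A A') h \<and>
        prod_pr1 K A A' \<cdot>\<^bsub>K\<^esub> h = r_mul A \<and>
        \<iota> = prod_pr2 K A A' \<cdot>\<^bsub>K\<^esub> h \<cdot>\<^bsub>K\<^esub> (idt K (r_ob A) \<odot>\<^bsub>K\<^esub> r_unit A) \<cdot>\<^bsub>K\<^esub>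
              inv_arrow K (run K (r_ob A)))"

definition derived_algebra :: "('o, 'm) smc \<Rightarrow> ('o, 'm) ring_obj \<Rightarrow> ('o, 'm) ring_obj \<times> 'm" where
  "derived_algebra K A = (SOME (A', \<iota>). is_derived_algebra K A A' \<iota>)"

text \<open>
  \<open>tower_step\<close> sends an algebra \<open>\<phi> : R \<rightarrow> B\<close> to the algebra \<open>B \<rightarrow> B'\<close>, where \<open>B'\<close> is formed
  in the category of \<open>R\<close>-modules.  Hence \<open>tower K A n\<close> is the algebra \<open>A\<^bsup>[n]\<^esup> \<rightarrow> A\<^bsup>[n+1]\<^esup>\<close>.
\<close>

definition tower_step :: "('o, 'm) smc \<Rightarrow> ('o, 'm) ring_obj \<times> ('o, 'm) ring_obj \<times> 'm \<Rightarrow>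
    ('o, 'm) ring_obj \<times> ('o, 'm) ring_obj \<times> 'm" where
  "tower_step K = (\<lambda>(R, B, \<phi>).
     case derived_algebra (Mod K R) (ring_of_algebra K R B \<phi>) of (C, \<iota>) \<Rightarrow>
       (B, underlying_ring K R C, under \<iota>))"

primrec tower :: "('o, 'm) smc \<Rightarrow> ('o, 'm) ring_obj \<Rightarrow> nat \<Rightarrow>
    ('o, 'm) ring_obj \<times> ('o, 'm) ring_obj \<times> 'm" where
  "tower K A 0 = (unit_ring K, A, r_unit A)"
| "tower K A (Suc n) = tower_step K (tower K A n)"

definition tower_ring :: "('o, 'm) smc \<Rightarrow> ('o, 'm) ring_obj \<Rightarrow> nat \<Rightarrow> ('o, 'm) ring_obj" where
  "tower_ring K A n = fst (tower K A n)"

definition has_degree :: "('o, 'm) smc \<Rightarrow> ('o, 'm) ring_obj \<Rightarrow> nat \<Rightarrow> bool" where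
  "has_degree K A d \<longleftrightarrow>
     nonzero_ring K (tower_ring K A d) \<and> \<not> nonzero_ring K (tower_ring K A (Suc d))"

definition finite_degree :: "('o, 'm) smc \<Rightarrow> ('o, 'm) ring_obj \<Rightarrow> bool" where
  "finite_degree K A \<longleftrightarrow> (\<exists>d. has_degree K A d)"

definition degree :: "('o, 'm) smc \<Rightarrow> ('o, 'm) ring_obj \<Rightarrow> nat" where
  "degree K A = (THE d. has_degree K A d)"

definition sep_ring_fin :: "('o, 'm) smc \<Rightarrow> ('o, 'm) ring_obj \<Rightarrow> bool" where
  "sep_ring_fin K A \<longleftrightarrow> is_ring K A \<and> separable K A \<and> finite_degree K A"


section \<open>Splitting rings\<close>

definition splits :: "('o, 'm) smc \<Rightarrow> ('o, 'm) ring_obj \<Rightarrow> ('o, 'm) ring_obj \<Rightarrow> bool" where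
  "splits K B A \<longleftrightarrow> rings_isomorphic (Mod K B) (ext_ring K B A)
     (prod_ring_list (Mod K B) (replicate (degree K A) (unit_ring (Mod K B))))"

definition splitting_ring :: "('o, 'm) smc \<Rightarrow> ('o, 'm) ring_obj \<Rightarrow> ('o, 'm) ring_obj \<Rightarrow> bool" where
  "splitting_ring K B A \<longleftrightarrow>
     sep_ring_fin K B \<and> indecomposable K B \<and> splits K B A \<and>
     (\<forall>C f. sep_ring_fin K C \<and> indecomposable K C \<and> splits K C A \<and> ring_mor K C B f \<longrightarrow>
        iso_arrow K f)"

definition nice :: "('o, 'm) smc \<Rightarrow> bool" where
  "nice K \<longleftrightarrow> (\<forall>A. sep_ring_fin K A \<longrightarrow>
     (\<exists>As. (\<forall>A\<^sub>i \<in> set As. indecomposable K A\<^sub>i) \<and> rings_isomorphic K A (prod_ring_list K As)))"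

end

theory Submission
  imports Defs
begin

text \<open>
  The ring \<open>A\<^bsup>[n]\<^esup>\<close> represents the functor sending a ring \<open>R\<close> to the \<open>n\<close>-tuples of pairwise disjoint
  ring morphisms \<open>A \<rightarrow> R\<close>, where \<open>f\<close> and \<open>g\<close> are disjoint if only the zero element of \<open>R\<close> scales them
  to the same arrow.  A choice of \<open>d = deg A\<close> pairwise disjoint morphisms \<open>A \<rightarrow> B\<close> is the same thing as a
  splitting of \<open>F\<^sub>B A\<close>: the \<open>d\<close> idempotents of \<open>B \<otimes> A\<close> they define are orthogonal, and the complementary
  factor vanishes since over it there would be \<open>d + 1\<close> disjoint morphisms.  Thus \<open>B\<close> splits \<open>A\<close> iff
  there is a ring morphism \<open>A\<^bsup>[d]\<^esup> \<rightarrow> B\<close>.  If \<open>B\<close> is indecomposable, such a morphism factors through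
  one of the finitely many indecomposable factors of \<open>A\<^bsup>[d]\<^esup>\<close>.  Conversely let \<open>p : A\<^bsup>[d]\<^esup> \<rightarrow> B\<close> be the
  projection to an indecomposable factor and \<open>f : C \<rightarrow> B\<close> a morphism from an indecomposable ring that splits \<open>A\<close>.
  There are only \<open>d\<close> morphisms \<open>A \<rightarrow> B\<close>, so those coming from \<open>C\<close> permute those coming from \<open>p\<close>; hence
  \<open>p\<close> lifts along \<open>f\<close>, the lift factors through \<open>p\<close>, and \<open>f\<close> is invertible.
\<close>

section \<open>Calculus in symmetric monoidal additive categories\<close>

text \<open>Each stage of the tower lives in another category: A^[n+1] is formed in modules over
  A^[n-1]. Underlying rings bring it back to \<open>K\<close>, but existence and universal property
  of the new stage have to be proved in \<open>Mod K R\<close>. This is why modules over a separable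
  ring are verified in full to form an idempotent-complete symmetric monoidal category again, and
  why the general theory is developed for an arbitrary category of this kind, to be instantiated at
  modules. Disjointness is preferred to mere difference because it survives every ring morphism:
  separability of A provides an idempotent element of the target that measures where two morphisms
  agree, and this element is natural in the target. Over an indecomposable ring it is 0 or 1, and
  disjoint means different. A further obstacle is that \<open>nice\<close> decomposes only rings of
  finite degree, so A^[d] must itself be shown to have finite degree. The bound d^d counts self-maps
  of a set with d elements: over a suitable nonzero localisation, a morphism out of A^[d] is
  described by such a map.\<close>

context category
begin

lemma in_Hom_iff [simp]: "f \<in> Hom K x y \<longleftrightarrow> f \<in> arrs K \<and> src K f = x \<and> tgt K f = y"
  by (auto simp: Hom_def)

lemma src_in_objs [simp]: "f \<in> arrs K \<Longrightarrow> src K f \<in> objs K"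
  and tgt_in_objs [simp]: "f \<in> arrs K \<Longrightarrow> tgt K f \<in> objs K"
  by (auto intro: src_obj tgt_obj)

lemma idt_arr [simp]: "x \<in> objs K \<Longrightarrow> idt K x \<in> arrs K"
  and idt_src [simp]: "x \<in> objs K \<Longrightarrow> src K (idt K x) = x"
  and idt_tgt [simp]: "x \<in> objs K \<Longrightarrow> tgt K (idt K x) = x"
  using idt_hom by auto

lemma cmp_arr [simp]: "\<lbrakk>f \<in> arrs K; g \<in> arrs K; src K g = tgt K f\<rbrakk> \<Longrightarrow> g \<cdot> f \<in> arrs K"
  and cmp_src [simp]: "\<lbrakk>f \<in> arrs K; g \<in> arrs K; src K g = tgt K f\<rbrakk> \<Longrightarrow> src K (g \<cdot> f) = src K f"
  and cmp_tgt [simp]: "\<lbrakk>f \<in> arrs K; g \<in> arrs K; src K g = tgt K f\<rbrakk> \<Longrightarrow> tgt K (g \<cdot> f) = tgt K g"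
  using cmp_hom[of f "src K f" "tgt K f" g "tgt K g"] by auto

lemma idt_cmp [simp]: "\<lbrakk>f \<in> arrs K; tgt K f = y\<rbrakk> \<Longrightarrow> idt K y \<cdot> f = f"
  and cmp_idt [simp]: "\<lbrakk>f \<in> arrs K; src K f = x\<rbrakk> \<Longrightarrow> f \<cdot> idt K x = f"
  using idt_left[of f "src K f" "tgt K f"] idt_right[of f "src K f" "tgt K f"] by auto

lemma cmp_cmp [simp]:
  "\<lbrakk>f \<in> arrs K; g \<in> arrs K; h \<in> arrs K; src K g = tgt K f; src K h = tgt K g\<rbrakk> \<Longrightarrow>
   (h \<cdot> g) \<cdot> f = h \<cdot> (g \<cdot> f)"
  using cmp_assoc[of f "src K f" "tgt K f" g "tgt K g" h "tgt K h"] by auto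

text \<open>Simplification brings composites into right-nested form, where an equation for
  \<open>g \<cdot> f\<close> no longer matches once something stands to its right. This supplies the
  missing instance.\<close>

lemma reassoc:
  assumes "g \<cdot> f = k" and "f \<in> arrs K" "g \<in> arrs K" "h \<in> arrs K" "src K g = tgt K f" "src K f = tgt K h"
  shows "g \<cdot> (f \<cdot> h) = k \<cdot> h"
  using assms cmp_cmp[of h f g] by simp

lemma inverse_arrows_unique:
  assumes "inverse_arrows K f g" "inverse_arrows K f g'"
  shows "g = g'"
proof -
  have "g = (g' \<cdot> f) \<cdot> g"
    using assms unfolding inverse_arrows_def by (simp del: cmp_cmp)
  also have "\<dots> = g' \<cdot> (f \<cdot> g)"
    by (rule cmp_cmp) (use assms in \<open>auto simp: inverse_arrows_def\<close>)
  also have "\<dots> = g'"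
    using assms unfolding inverse_arrows_def by simp
  finally show ?thesis .
qed

lemma inv_arrow_eqI: "inverse_arrows K f g \<Longrightarrow> inv_arrow K f = g"
  unfolding inv_arrow_def by (blast intro: inverse_arrows_unique)

lemma iso_arrow_inverse: "iso_arrow K f \<Longrightarrow> inverse_arrows K f (inv_arrow K f)"
  unfolding iso_arrow_def using inv_arrow_eqI by blast

lemma iso_inv:
  assumes "iso_arrow K f"
  shows "f \<in> arrs K" "inv_arrow K f \<in> arrs K" "src K (inv_arrow K f) = tgt K f"
    "tgt K (inv_arrow K f) = src K f" "inv_arrow K f \<cdot> f = idt K (src K f)"
    "f \<cdot> inv_arrow K f = idt K (tgt K f)"
  using iso_arrow_inverse[OF assms] unfolding inverse_arrows_def by auto

lemma iso_cancel_left: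
  assumes "iso_arrow K h" "h \<cdot> f = h \<cdot> g" "f \<in> arrs K" "g \<in> arrs K" "src K h = tgt K f" "src K h = tgt K g"
  shows "f = g"
proof -
  note [simp] = iso_inv[OF assms(1)]
  have "f = inv_arrow K h \<cdot> (h \<cdot> f)"
    using assms(3-6) by (subst cmp_cmp[symmetric]) auto
  also have "\<dots> = inv_arrow K h \<cdot> (h \<cdot> g)" using assms by simp
  also have "\<dots> = g"
    using assms(3-6) by (subst cmp_cmp[symmetric]) auto
  finally show ?thesis .
qed

text \<open>Right cancellation requires only a one-sided inverse. Many cancellations below are along
  projections onto retracts, which are not isomorphisms.\<close>

lemma sect_cancel_right:
  assumes "h \<cdot> s = idt K y" "f \<cdot> h = g \<cdot> h" "f \<in> arrs K" "g \<in> arrs K" "h \<in> arrs K" "s \<in> arrs K"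
    "src K f = y" "src K g = y" "tgt K h = y" "src K h = tgt K s"
  shows "f = g"
proof -
  have "f = (f \<cdot> h) \<cdot> s" using assms(1,3-) by simp
  also have "\<dots> = g" unfolding assms(2) using assms(1,3-) by simp
  finally show ?thesis .
qed

lemma iso_cancel_right:
  assumes "iso_arrow K h" "f \<cdot> h = g \<cdot> h" "f \<in> arrs K" "g \<in> arrs K" "src K f = tgt K h" "src K g = tgt K h"
  shows "f = g"
  by (rule sect_cancel_right[OF iso_inv(6)[OF assms(1)] assms(2)])
    (use iso_inv[OF assms(1)] assms(3-) in auto)

lemma inverse_arrowsI:
  assumes "f \<in> arrs K" "g \<in> arrs K" "src K g = tgt K f" "tgt K g = src K f"
    "g \<cdot> f = idt K (src K f)" "f \<cdot> g = idt K (tgt K f)"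
  shows "inverse_arrows K f g"
  using assms unfolding inverse_arrows_def by simp

lemma iso_arrowI:
  assumes "f \<in> arrs K" "g \<in> arrs K" "src K g = tgt K f" "tgt K g = src K f"
    "g \<cdot> f = idt K (src K f)" "f \<cdot> g = idt K (tgt K f)"
  shows "iso_arrow K f"
  using inverse_arrowsI[OF assms] unfolding iso_arrow_def by blast

end

section \<open>Arithmetic of arrows in an additive category\<close>

context additive_category
begin

lemma add_arr [simp]: "\<lbrakk>f \<in> arrs K; g \<in> arrs K; src K g = src K f; tgt K g = tgt K f\<rbrakk> \<Longrightarrow> f \<boxplus> g \<in> arrs K"
  and add_src [simp]: "\<lbrakk>f \<in> arrs K; g \<in> arrs K; src K g = src K f; tgt K g = tgt K f\<rbrakk> \<Longrightarrow> src K (f \<boxplus> g) = src K f"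
  and add_tgt [simp]: "\<lbrakk>f \<in> arrs K; g \<in> arrs K; src K g = src K f; tgt K g = tgt K f\<rbrakk> \<Longrightarrow> tgt K (f \<boxplus> g) = tgt K f"
proof -
  assume a: "f \<in> arrs K" "g \<in> arrs K" "src K g = src K f" "tgt K g = tgt K f"
  interpret comm_group "hom_group K (src K f) (tgt K f)" using a by (simp add: hom_comm_group)
  have "f \<boxplus> g \<in> Hom K (src K f) (tgt K f)" using m_closed[of f g] a by (simp add: hom_group_def)
  then show "f \<boxplus> g \<in> arrs K" "src K (f \<boxplus> g) = src K f" "tgt K (f \<boxplus> g) = tgt K f" by auto
qed

lemma zro_arr [simp]: "\<lbrakk>x \<in> objs K; y \<in> objs K\<rbrakk> \<Longrightarrow> zro K x y \<in> arrs K"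
  and zro_src [simp]: "\<lbrakk>x \<in> objs K; y \<in> objs K\<rbrakk> \<Longrightarrow> src K (zro K x y) = x"
  and zro_tgt [simp]: "\<lbrakk>x \<in> objs K; y \<in> objs K\<rbrakk> \<Longrightarrow> tgt K (zro K x y) = y"
proof -
  assume a: "x \<in> objs K" "y \<in> objs K"
  interpret comm_group "hom_group K x y" using a by (simp add: hom_comm_group)
  have "zro K x y \<in> Hom K x y" using one_closed by (simp add: hom_group_def)
  then show "zro K x y \<in> arrs K" "src K (zro K x y) = x" "tgt K (zro K x y) = y" by auto
qed

lemma add_zro [simp]: "\<lbrakk>f \<in> arrs K; src K f = x; tgt K f = y\<rbrakk> \<Longrightarrow> f \<boxplus> zro K x y = f"
  and zro_add [simp]: "\<lbrakk>f \<in> arrs K; src K f = x; tgt K f = y\<rbrakk> \<Longrightarrow> zro K x y \<boxplus> f = f"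
proof -
  assume a: "f \<in> arrs K" "src K f = x" "tgt K f = y"
  interpret comm_group "hom_group K x y" using a by (auto intro!: hom_comm_group)
  show "f \<boxplus> zro K x y = f" "zro K x y \<boxplus> f = f"
    using r_one[of f] l_one[of f] a by (simp_all add: hom_group_def)
qed

lemma add_comm:
  assumes a: "f \<in> arrs K" "g \<in> arrs K" "src K g = src K f" "tgt K g = tgt K f"
  shows "f \<boxplus> g = g \<boxplus> f"
proof -
  interpret comm_group "hom_group K (src K f) (tgt K f)" using a by (simp add: hom_comm_group)
  show ?thesis using m_comm[of f g] a by (simp add: hom_group_def)
qed

lemma add_assoc:
  assumes a: "f \<in> arrs K" "g \<in> arrs K" "h \<in> arrs K" "src K g = src K f" "tgt K g = tgt K f"
    "src K h = src K f" "tgt K h = tgt K f"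
  shows "(f \<boxplus> g) \<boxplus> h = f \<boxplus> (g \<boxplus> h)"
proof -
  interpret comm_group "hom_group K (src K f) (tgt K f)" using a by (simp add: hom_comm_group)
  show ?thesis using m_assoc[of f g h] a by (simp add: hom_group_def)
qed

lemma add_left_cancel:
  assumes e: "f \<boxplus> g = f \<boxplus> h" and a: "f \<in> arrs K" "g \<in> arrs K" "h \<in> arrs K" "src K g = src K f" "tgt K g = tgt K f"
    "src K h = src K f" "tgt K h = tgt K f"
  shows "g = h"
proof -
  interpret comm_group "hom_group K (src K f) (tgt K f)" using a by (simp add: hom_comm_group)
  show ?thesis using Units_l_cancel[of f g h] a e by (simp add: hom_group_def Units_eq[unfolded hom_group_def])
qed

text \<open>The signature has no subtraction. The difference of \<open>g\<close> and
  \<open>f\<close> is extracted here from the inverses of the hom-group; it serves for complements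
  of idempotents and for negatives of linear arrows.\<close>

lemma ex_complement:
  assumes a: "f \<in> arrs K" "g \<in> arrs K" "src K g = src K f" "tgt K g = tgt K f"
  obtains h where "h \<in> arrs K" "src K h = src K f" "tgt K h = tgt K f" "f \<boxplus> h = g"
proof -
  interpret comm_group "hom_group K (src K f) (tgt K f)" using a by (simp add: hom_comm_group)
  let ?G = "hom_group K (src K f) (tgt K f)"
  have c: "f \<in> carrier ?G" "g \<in> carrier ?G" using a by (auto simp: hom_group_def)
  have "inv\<^bsub>?G\<^esub> f \<otimes>\<^bsub>?G\<^esub> g \<in> carrier ?G" "f \<otimes>\<^bsub>?G\<^esub> (inv\<^bsub>?G\<^esub> f \<otimes>\<^bsub>?G\<^esub> g) = g"
    using c by (simp_all add: m_assoc[symmetric])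
  then show ?thesis using that[of "inv\<^bsub>?G\<^esub> f \<otimes>\<^bsub>?G\<^esub> g"] by (simp add: hom_group_def)
qed

lemma add_cmp:
  "\<lbrakk>f \<in> arrs K; g \<in> arrs K; g' \<in> arrs K; src K g = tgt K f; src K g' = src K g; tgt K g' = tgt K g\<rbrakk> \<Longrightarrow>
   (g \<boxplus> g') \<cdot> f = (g \<cdot> f) \<boxplus> (g' \<cdot> f)"
  using cmp_add_left[of f "src K f" "tgt K f" g "tgt K g" g'] by auto

lemma cmp_add:
  "\<lbrakk>f \<in> arrs K; f' \<in> arrs K; g \<in> arrs K; src K g = tgt K f; src K f' = src K f; tgt K f' = tgt K f\<rbrakk> \<Longrightarrow>
   g \<cdot> (f \<boxplus> f') = (g \<cdot> f) \<boxplus> (g \<cdot> f')"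
  using cmp_add_right[of f "src K f" "tgt K f" f' g "tgt K g"] by auto

text \<open>For the composite z, distributivity gives z + z = z = z + 0, and cancellation in the
  hom-group finishes. The same trick handles composition on the other side and the tensor
  product.\<close>

lemma zro_cmp [simp]: "\<lbrakk>f \<in> arrs K; y = tgt K f; z \<in> objs K\<rbrakk> \<Longrightarrow> zro K y z \<cdot> f = zro K (src K f) z"
proof -
  assume a: "f \<in> arrs K" "y = tgt K f" "z \<in> objs K"
  let ?z = "zro K y z \<cdot> f"
  have "?z \<boxplus> ?z = ?z \<boxplus> zro K (src K f) z"
    using a add_cmp[of f "zro K y z" "zro K y z"] by simp
  then show ?thesis by (rule add_left_cancel) (use a in auto)
qed

lemma cmp_zro [simp]: "\<lbrakk>f \<in> arrs K; y = src K f; x \<in> objs K\<rbrakk> \<Longrightarrow> f \<cdot> zro K x y = zro K x (tgt K f)"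
proof -
  assume a: "f \<in> arrs K" "y = src K f" "x \<in> objs K"
  let ?z = "f \<cdot> zro K x (src K f)"
  have "?z \<boxplus> ?z = ?z \<boxplus> zro K x (tgt K f)"
    using a cmp_add[of "zro K x (src K f)" "zro K x (src K f)" f] by simp
  then have "?z = zro K x (tgt K f)"
    by (rule add_left_cancel) (use a(1,3) in simp_all)
  then show ?thesis using a(2) by simp
qed

end

section \<open>Naturality of the structure isomorphisms and coherence of the unitors\<close>

context symmetric_monoidal_category
begin

lemma unt_in_objs [simp]: "unt K \<in> objs K"
  and tobj_in_objs [simp]: "\<lbrakk>x \<in> objs K; y \<in> objs K\<rbrakk> \<Longrightarrow> x \<boxtimes> y \<in> objs K"
  by (auto intro: unt_obj tobj_obj)

lemma tarr_arr [simp]: "\<lbrakk>f \<in> arrs K; g \<in> arrs K\<rbrakk> \<Longrightarrow> f \<odot> g \<in> arrs K"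
  and tarr_src [simp]: "\<lbrakk>f \<in> arrs K; g \<in> arrs K\<rbrakk> \<Longrightarrow> src K (f \<odot> g) = src K f \<boxtimes> src K g"
  and tarr_tgt [simp]: "\<lbrakk>f \<in> arrs K; g \<in> arrs K\<rbrakk> \<Longrightarrow> tgt K (f \<odot> g) = tgt K f \<boxtimes> tgt K g"
  using tarr_hom[of f "src K f" "tgt K f" g "src K g" "tgt K g"] by auto

lemma tarr_idt_idt [simp]: "\<lbrakk>x \<in> objs K; y \<in> objs K\<rbrakk> \<Longrightarrow> idt K x \<odot> idt K y = idt K (x \<boxtimes> y)"
  by (rule tarr_idt)

lemma tarr_cmp_tarr:
  "\<lbrakk>f \<in> arrs K; f' \<in> arrs K; g \<in> arrs K; g' \<in> arrs K; src K f' = tgt K f; src K g' = tgt K g\<rbrakk> \<Longrightarrow>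
   (f' \<odot> g') \<cdot> (f \<odot> g) = (f' \<cdot> f) \<odot> (g' \<cdot> g)"
  using tarr_cmp[of f "src K f" "tgt K f" f' "tgt K f'" g "src K g" "tgt K g" g' "tgt K g'"] by auto

lemma tarr_cmp_tarr_assoc:
  "\<lbrakk>f \<in> arrs K; f' \<in> arrs K; g \<in> arrs K; g' \<in> arrs K; h \<in> arrs K; src K f' = tgt K f; src K g' = tgt K g;
    tgt K h = src K f \<boxtimes> src K g\<rbrakk> \<Longrightarrow>
   (f' \<odot> g') \<cdot> ((f \<odot> g) \<cdot> h) = ((f' \<cdot> f) \<odot> (g' \<cdot> g)) \<cdot> h"
  by (subst cmp_cmp[symmetric]) (auto simp: tarr_cmp_tarr)

abbreviation asc' :: "'a \<Rightarrow> 'a \<Rightarrow> 'a \<Rightarrow> 'b" where "asc' x y z \<equiv> inv_arrow K (asc K x y z)"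
abbreviation lun' :: "'a \<Rightarrow> 'b" where "lun' x \<equiv> inv_arrow K (lun K x)"
abbreviation run' :: "'a \<Rightarrow> 'b" where "run' x \<equiv> inv_arrow K (run K x)"

lemma asc_arr [simp]: "\<lbrakk>x \<in> objs K; y \<in> objs K; z \<in> objs K\<rbrakk> \<Longrightarrow> asc K x y z \<in> arrs K"
  and asc_src [simp]: "\<lbrakk>x \<in> objs K; y \<in> objs K; z \<in> objs K\<rbrakk> \<Longrightarrow> src K (asc K x y z) = (x \<boxtimes> y) \<boxtimes> z"
  and asc_tgt [simp]: "\<lbrakk>x \<in> objs K; y \<in> objs K; z \<in> objs K\<rbrakk> \<Longrightarrow> tgt K (asc K x y z) = x \<boxtimes> (y \<boxtimes> z)"
  using asc_hom[of x y z] by auto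

lemma lun_arr [simp]: "x \<in> objs K \<Longrightarrow> lun K x \<in> arrs K"
  and lun_src [simp]: "x \<in> objs K \<Longrightarrow> src K (lun K x) = unt K \<boxtimes> x"
  and lun_tgt [simp]: "x \<in> objs K \<Longrightarrow> tgt K (lun K x) = x"
  using lun_hom[of x] by auto

lemma run_arr [simp]: "x \<in> objs K \<Longrightarrow> run K x \<in> arrs K"
  and run_src [simp]: "x \<in> objs K \<Longrightarrow> src K (run K x) = x \<boxtimes> unt K"
  and run_tgt [simp]: "x \<in> objs K \<Longrightarrow> tgt K (run K x) = x"
  using run_hom[of x] by auto

lemma brd_arr [simp]: "\<lbrakk>x \<in> objs K; y \<in> objs K\<rbrakk> \<Longrightarrow> brd K x y \<in> arrs K"
  and brd_src [simp]: "\<lbrakk>x \<in> objs K; y \<in> objs K\<rbrakk> \<Longrightarrow> src K (brd K x y) = x \<boxtimes> y"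
  and brd_tgt [simp]: "\<lbrakk>x \<in> objs K; y \<in> objs K\<rbrakk> \<Longrightarrow> tgt K (brd K x y) = y \<boxtimes> x"
  using brd_hom[of x y] by auto

lemma asc'_arr [simp]: "\<lbrakk>x \<in> objs K; y \<in> objs K; z \<in> objs K\<rbrakk> \<Longrightarrow> asc' x y z \<in> arrs K"
  and asc'_src [simp]: "\<lbrakk>x \<in> objs K; y \<in> objs K; z \<in> objs K\<rbrakk> \<Longrightarrow> src K (asc' x y z) = x \<boxtimes> (y \<boxtimes> z)"
  and asc'_tgt [simp]: "\<lbrakk>x \<in> objs K; y \<in> objs K; z \<in> objs K\<rbrakk> \<Longrightarrow> tgt K (asc' x y z) = (x \<boxtimes> y) \<boxtimes> z"
  and asc'_asc [simp]: "\<lbrakk>x \<in> objs K; y \<in> objs K; z \<in> objs K\<rbrakk> \<Longrightarrow> asc' x y z \<cdot> asc K x y z = idt K ((x \<boxtimes> y) \<boxtimes> z)"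
  and asc_asc' [simp]: "\<lbrakk>x \<in> objs K; y \<in> objs K; z \<in> objs K\<rbrakk> \<Longrightarrow> asc K x y z \<cdot> asc' x y z = idt K (x \<boxtimes> (y \<boxtimes> z))"
  using iso_inv[OF asc_iso[of x y z]] by auto

lemma lun'_arr [simp]: "x \<in> objs K \<Longrightarrow> lun' x \<in> arrs K"
  and lun'_src [simp]: "x \<in> objs K \<Longrightarrow> src K (lun' x) = x"
  and lun'_tgt [simp]: "x \<in> objs K \<Longrightarrow> tgt K (lun' x) = unt K \<boxtimes> x"
  and lun'_lun [simp]: "x \<in> objs K \<Longrightarrow> lun' x \<cdot> lun K x = idt K (unt K \<boxtimes> x)"
  and lun_lun' [simp]: "x \<in> objs K \<Longrightarrow> lun K x \<cdot> lun' x = idt K x"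
  using iso_inv[OF lun_iso[of x]] by auto

lemma run'_arr [simp]: "x \<in> objs K \<Longrightarrow> run' x \<in> arrs K"
  and run'_src [simp]: "x \<in> objs K \<Longrightarrow> src K (run' x) = x"
  and run'_tgt [simp]: "x \<in> objs K \<Longrightarrow> tgt K (run' x) = x \<boxtimes> unt K"
  and run'_run [simp]: "x \<in> objs K \<Longrightarrow> run' x \<cdot> run K x = idt K (x \<boxtimes> unt K)"
  and run_run' [simp]: "x \<in> objs K \<Longrightarrow> run K x \<cdot> run' x = idt K x"
  using iso_inv[OF run_iso[of x]] by auto

lemma brd_brd [simp]: "\<lbrakk>x \<in> objs K; y \<in> objs K\<rbrakk> \<Longrightarrow> brd K y x \<cdot> brd K x y = idt K (x \<boxtimes> y)"
  by (rule brd_symmetric)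

lemma inv_assoc [simp]:
  "\<lbrakk>x \<in> objs K; y \<in> objs K; z \<in> objs K; h \<in> arrs K; tgt K h = (x \<boxtimes> y) \<boxtimes> z\<rbrakk> \<Longrightarrow> asc' x y z \<cdot> (asc K x y z \<cdot> h) = h"
  "\<lbrakk>x \<in> objs K; y \<in> objs K; z \<in> objs K; h \<in> arrs K; tgt K h = x \<boxtimes> (y \<boxtimes> z)\<rbrakk> \<Longrightarrow> asc K x y z \<cdot> (asc' x y z \<cdot> h) = h"
  "\<lbrakk>x \<in> objs K; h \<in> arrs K; tgt K h = unt K \<boxtimes> x\<rbrakk> \<Longrightarrow> lun' x \<cdot> (lun K x \<cdot> h) = h"
  "\<lbrakk>x \<in> objs K; h \<in> arrs K; tgt K h = x\<rbrakk> \<Longrightarrow> lun K x \<cdot> (lun' x \<cdot> h) = h"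
  "\<lbrakk>x \<in> objs K; h \<in> arrs K; tgt K h = x \<boxtimes> unt K\<rbrakk> \<Longrightarrow> run' x \<cdot> (run K x \<cdot> h) = h"
  "\<lbrakk>x \<in> objs K; h \<in> arrs K; tgt K h = x\<rbrakk> \<Longrightarrow> run K x \<cdot> (run' x \<cdot> h) = h"
  "\<lbrakk>x \<in> objs K; y \<in> objs K; h \<in> arrs K; tgt K h = x \<boxtimes> y\<rbrakk> \<Longrightarrow> brd K y x \<cdot> (brd K x y \<cdot> h) = h"
  by (subst cmp_cmp[symmetric]; simp)+

lemma asc_nat:
  "\<lbrakk>f \<in> arrs K; g \<in> arrs K; h \<in> arrs K; x' = tgt K f; y' = tgt K g; z' = tgt K h\<rbrakk> \<Longrightarrow>
   asc K x' y' z' \<cdot> ((f \<odot> g) \<odot> h) = (f \<odot> (g \<odot> h)) \<cdot> asc K (src K f) (src K g) (src K h)"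
  by (rule asc_natural) auto

lemma asc_nat_assoc:
  "\<lbrakk>f \<in> arrs K; g \<in> arrs K; h \<in> arrs K; x' = tgt K f; y' = tgt K g; z' = tgt K h; k \<in> arrs K;
    tgt K k = (src K f \<boxtimes> src K g) \<boxtimes> src K h\<rbrakk> \<Longrightarrow>
   asc K x' y' z' \<cdot> (((f \<odot> g) \<odot> h) \<cdot> k) = (f \<odot> (g \<odot> h)) \<cdot> (asc K (src K f) (src K g) (src K h) \<cdot> k)"
  by (subst cmp_cmp[symmetric]) (auto simp: asc_nat)

lemma asc'_nat:
  assumes a: "f \<in> arrs K" "g \<in> arrs K" "h \<in> arrs K" "x' = tgt K f" "y' = tgt K g" "z' = tgt K h"
  shows "asc' x' y' z' \<cdot> (f \<odot> (g \<odot> h)) = ((f \<odot> g) \<odot> h) \<cdot> asc' (src K f) (src K g) (src K h)"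
proof -
  have "asc' x' y' z' \<cdot> (f \<odot> (g \<odot> h)) =
      asc' x' y' z' \<cdot> ((f \<odot> (g \<odot> h)) \<cdot> (asc K (src K f) (src K g) (src K h) \<cdot> asc' (src K f) (src K g) (src K h)))"
    using a by simp
  also have "\<dots> = asc' x' y' z' \<cdot> (asc K x' y' z' \<cdot> (((f \<odot> g) \<odot> h) \<cdot> asc' (src K f) (src K g) (src K h)))"
    using a asc_nat_assoc[of f g h x' y' z'  "asc' (src K f) (src K g) (src K h)"] by simp
  also have "\<dots> = ((f \<odot> g) \<odot> h) \<cdot> asc' (src K f) (src K g) (src K h)"
    using a by simp
  finally show ?thesis .
qed

lemma asc'_nat_assoc:
  "\<lbrakk>f \<in> arrs K; g \<in> arrs K; h \<in> arrs K; x' = tgt K f; y' = tgt K g; z' = tgt K h; k \<in> arrs K;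
    tgt K k = src K f \<boxtimes> (src K g \<boxtimes> src K h)\<rbrakk> \<Longrightarrow>
   asc' x' y' z' \<cdot> ((f \<odot> (g \<odot> h)) \<cdot> k) = ((f \<odot> g) \<odot> h) \<cdot> (asc' (src K f) (src K g) (src K h) \<cdot> k)"
  by (subst cmp_cmp[symmetric]) (auto simp: asc'_nat)

lemma lun_nat: "\<lbrakk>f \<in> arrs K; y = tgt K f\<rbrakk> \<Longrightarrow> lun K y \<cdot> (idt K (unt K) \<odot> f) = f \<cdot> lun K (src K f)"
  and run_nat: "\<lbrakk>f \<in> arrs K; y = tgt K f\<rbrakk> \<Longrightarrow> run K y \<cdot> (f \<odot> idt K (unt K)) = f \<cdot> run K (src K f)"
  using lun_natural[of f "src K f" y] run_natural[of f "src K f" y] by auto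

lemma lun_nat_assoc: "\<lbrakk>f \<in> arrs K; y = tgt K f; k \<in> arrs K; tgt K k = unt K \<boxtimes> src K f\<rbrakk> \<Longrightarrow>
    lun K y \<cdot> ((idt K (unt K) \<odot> f) \<cdot> k) = f \<cdot> (lun K (src K f) \<cdot> k)"
  and run_nat_assoc: "\<lbrakk>f \<in> arrs K; y = tgt K f; k \<in> arrs K; tgt K k = src K f \<boxtimes> unt K\<rbrakk> \<Longrightarrow>
    run K y \<cdot> ((f \<odot> idt K (unt K)) \<cdot> k) = f \<cdot> (run K (src K f) \<cdot> k)"
  by (subst cmp_cmp[symmetric]; simp add: lun_nat run_nat)+

lemma lun'_nat: assumes "f \<in> arrs K" "y = tgt K f" shows "lun' y \<cdot> f = (idt K (unt K) \<odot> f) \<cdot> lun' (src K f)"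
  by (rule iso_cancel_left[OF lun_iso[of y]]) (use assms in \<open>auto simp: lun_nat_assoc\<close>)

lemma run'_nat: assumes "f \<in> arrs K" "y = tgt K f" shows "run' y \<cdot> f = (f \<odot> idt K (unt K)) \<cdot> run' (src K f)"
  by (rule iso_cancel_left[OF run_iso[of y]]) (use assms in \<open>auto simp: run_nat_assoc\<close>)

lemma brd_nat:
  "\<lbrakk>f \<in> arrs K; g \<in> arrs K; x' = tgt K f; y' = tgt K g\<rbrakk> \<Longrightarrow>
   brd K x' y' \<cdot> (f \<odot> g) = (g \<odot> f) \<cdot> brd K (src K f) (src K g)"
  by (rule brd_natural) auto

lemma brd_nat_assoc:
  "\<lbrakk>f \<in> arrs K; g \<in> arrs K; x' = tgt K f; y' = tgt K g; k \<in> arrs K; tgt K k = src K f \<boxtimes> src K g\<rbrakk> \<Longrightarrow>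
   brd K x' y' \<cdot> ((f \<odot> g) \<cdot> k) = (g \<odot> f) \<cdot> (brd K (src K f) (src K g) \<cdot> k)"
  by (subst cmp_cmp[symmetric]) (auto simp: brd_nat)

lemma brd_iso: "\<lbrakk>x \<in> objs K; y \<in> objs K\<rbrakk> \<Longrightarrow> iso_arrow K (brd K x y)"
  by (rule iso_arrowI[where g = "brd K y x"]) auto

lemma tarr_iso: "\<lbrakk>iso_arrow K f; iso_arrow K g\<rbrakk> \<Longrightarrow> iso_arrow K (f \<odot> g)"
  by (rule iso_arrowI[where g = "inv_arrow K f \<odot> inv_arrow K g"]) (auto simp: iso_inv tarr_cmp_tarr)

lemma idt_iso: "x \<in> objs K \<Longrightarrow> iso_arrow K (idt K x)"
  by (rule iso_arrowI[where g = "idt K x"]) auto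

lemma cmp_iso: "\<lbrakk>iso_arrow K f; iso_arrow K g; src K g = tgt K f\<rbrakk> \<Longrightarrow> iso_arrow K (g \<cdot> f)"
proof -
  assume a: "iso_arrow K f" "iso_arrow K g" "src K g = tgt K f"
  note [simp] = iso_inv[OF a(1)] iso_inv[OF a(2)]
  show ?thesis
    by (rule iso_arrowI[where g = "inv_arrow K f \<cdot> inv_arrow K g"])
      (use a(3) in \<open>simp_all add: reassoc[OF iso_inv(5)[OF a(2)]] reassoc[OF iso_inv(6)[OF a(1)]]\<close>)
qed

text \<open>Naturality of the invertible left unitor conjugates
  \<open>idt K (unt K) \<odot> f\<close> into \<open>f\<close>, so tensoring with the unit is
  faithful. Coherence identities for units may therefore be proved after adding one more unit
  factor, where pentagon and triangle apply.\<close>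

lemma unt_tarr_cancel:
  assumes "idt K (unt K) \<odot> f = idt K (unt K) \<odot> g" "f \<in> arrs K" "g \<in> arrs K" "src K g = src K f" "tgt K g = tgt K f"
  shows "f = g"
proof (rule iso_cancel_right[OF lun_iso[of "src K f"]])
  show "f \<cdot> lun K (src K f) = g \<cdot> lun K (src K f)"
    using assms lun_nat[of f "tgt K f"] lun_nat[of g "tgt K f"] by simp
qed (use assms in auto)

lemma tarr_unt_cancel:
  assumes "f \<odot> idt K (unt K) = g \<odot> idt K (unt K)" "f \<in> arrs K" "g \<in> arrs K" "src K g = src K f" "tgt K g = tgt K f"
  shows "f = g"
proof (rule iso_cancel_right[OF run_iso[of "src K f"]])
  show "f \<cdot> run K (src K f) = g \<cdot> run K (src K f)"
    using assms run_nat[of f "tgt K f"] run_nat[of g "tgt K f"] by simp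
qed (use assms in auto)

text \<open>Kelly's argument. The triangle axiom places the unit in the middle of two factors;
  tensoring with a second unit on the left turns the leftmost unit into a middle one, and the
  pentagon compares the bracketings.\<close>

lemma lun_tobj:
  assumes [simp]: "x \<in> objs K" "y \<in> objs K"
  shows "lun K (x \<boxtimes> y) \<cdot> asc K (unt K) x y = lun K x \<odot> idt K y"
proof (rule unt_tarr_cancel)
  let ?u = "unt K" and ?i = "idt K"
  \<comment> \<open>Precomposition with \<open>?c\<close> completes one side of the pentagon at
    unit, unit, \<open>x\<close>, \<open>y\<close>; being invertible, it can be cancelled
    afterwards.\<close>
  let ?c = "asc K ?u (?u \<boxtimes> x) y \<cdot> (asc K ?u ?u x \<odot> ?i y)"
  have iso: "iso_arrow K ?c"
    by (intro cmp_iso tarr_iso asc_iso idt_iso) auto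
  show "?i ?u \<odot> (lun K (x \<boxtimes> y) \<cdot> asc K ?u x y) = ?i ?u \<odot> (lun K x \<odot> ?i y)"
  proof (rule iso_cancel_right[OF iso])
    have "(?i ?u \<odot> (lun K (x \<boxtimes> y) \<cdot> asc K ?u x y)) \<cdot> ?c
        = (?i ?u \<odot> lun K (x \<boxtimes> y)) \<cdot> ((?i ?u \<odot> asc K ?u x y) \<cdot> ?c)"
      by (simp add: tarr_cmp_tarr_assoc)
    also have "\<dots> = ((?i ?u \<odot> lun K (x \<boxtimes> y)) \<cdot> asc K ?u ?u (x \<boxtimes> y)) \<cdot> asc K (?u \<boxtimes> ?u) x y"
      by (simp add: pentagon)
    also have "\<dots> = (run K ?u \<odot> ?i (x \<boxtimes> y)) \<cdot> asc K (?u \<boxtimes> ?u) x y"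
      by (subst triangle) auto
    also have "\<dots> = asc K ?u x y \<cdot> ((run K ?u \<odot> ?i x) \<odot> ?i y)"
      by (simp add: asc_nat)
    also have "\<dots> = asc K ?u x y \<cdot> (((?i ?u \<odot> lun K x) \<odot> ?i y) \<cdot> (asc K ?u ?u x \<odot> ?i y))"
      by (simp add: tarr_cmp_tarr triangle)
    also have "\<dots> = (?i ?u \<odot> (lun K x \<odot> ?i y)) \<cdot> ?c"
      by (simp add: asc_nat_assoc)
    finally show "(?i ?u \<odot> (lun K (x \<boxtimes> y) \<cdot> asc K ?u x y)) \<cdot> ?c = (?i ?u \<odot> (lun K x \<odot> ?i y)) \<cdot> ?c" .
  qed auto
qed auto

lemma run_tobj:
  assumes [simp]: "x \<in> objs K" "y \<in> objs K"
  shows "run K (x \<boxtimes> y) = (idt K x \<odot> run K y) \<cdot> asc K x y (unt K)"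
proof (rule tarr_unt_cancel)
  let ?u = "unt K" and ?i = "idt K"
  show "run K (x \<boxtimes> y) \<odot> ?i ?u = ((?i x \<odot> run K y) \<cdot> asc K x y ?u) \<odot> ?i ?u"
  proof (rule iso_cancel_left[OF asc_iso[of x y ?u]])
    have "asc K x y ?u \<cdot> (run K (x \<boxtimes> y) \<odot> ?i ?u) =
      asc K x y ?u \<cdot> ((?i x \<odot> ?i y) \<odot> lun K ?u) \<cdot> asc K (x \<boxtimes> y) ?u ?u"
      by (simp add: triangle)
    also have "\<dots> = (?i x \<odot> (?i y \<odot> lun K ?u)) \<cdot> (asc K x y (?u \<boxtimes> ?u) \<cdot> asc K (x \<boxtimes> y) ?u ?u)"
      by (subst asc_nat_assoc) auto
    also have "\<dots> = (?i x \<odot> (run K y \<odot> ?i ?u)) \<cdot> asc K x (y \<boxtimes> ?u) ?u \<cdot> (asc K x y ?u \<odot> ?i ?u)"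
      by (simp add: pentagon tarr_cmp_tarr_assoc triangle)
    also have "\<dots> = asc K x y ?u \<cdot> ((?i x \<odot> run K y) \<odot> ?i ?u) \<cdot> (asc K x y ?u \<odot> ?i ?u)"
      by (simp add: asc_nat_assoc)
    also have "\<dots> = asc K x y ?u \<cdot> (((?i x \<odot> run K y) \<cdot> asc K x y ?u) \<odot> ?i ?u)"
      by (simp add: tarr_cmp_tarr)
    finally show "asc K x y ?u \<cdot> (run K (x \<boxtimes> y) \<odot> ?i ?u)
        = asc K x y ?u \<cdot> (((?i x \<odot> run K y) \<cdot> asc K x y ?u) \<odot> ?i ?u)" .
  qed auto
qed auto

text \<open>Naturality of the left unitor along itself shows that \<open>lun K\<close> of unit
  tensor unit is the identity tensored with \<open>lun K (unt K)\<close>. Comparing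
  \<open>lun_tobj\<close> with the triangle then makes both unitors equal after tensoring with the
  unit.\<close>

lemma lun_unt: "lun K (unt K) = run K (unt K)"
proof (rule tarr_unt_cancel)
  let ?u = "unt K"
  have "lun K (?u \<boxtimes> ?u) = idt K ?u \<odot> lun K ?u"
    by (rule iso_cancel_left[OF lun_iso[of ?u]]) (auto simp: lun_nat)
  then show "lun K ?u \<odot> idt K ?u = run K ?u \<odot> idt K ?u"
    using lun_tobj[of ?u ?u] triangle[of ?u ?u] by simp
qed auto

text \<open>Compatibility of the braiding with the unitors is not an axiom. It follows from the
  hexagon at \<open>x\<close>, unit, unit, after composing with an invertible braiding and tensoring
  with the unit.\<close>

lemma lun_brd:
  assumes [simp]: "x \<in> objs K"
  shows "lun K x \<cdot> brd K x (unt K) = run K x"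
proof (rule tarr_unt_cancel)
  let ?u = "unt K" and ?i = "idt K"
  show "(lun K x \<cdot> brd K x ?u) \<odot> ?i ?u = run K x \<odot> ?i ?u"
  proof (rule iso_cancel_left[OF brd_iso[of x ?u]])
    have "brd K x ?u \<cdot> (run K x \<odot> ?i ?u) = brd K x ?u \<cdot> ((?i x \<odot> lun K ?u) \<cdot> asc K x ?u ?u)"
      by (simp add: triangle)
    also have "\<dots> = (lun K ?u \<odot> ?i x) \<cdot> brd K x (?u \<boxtimes> ?u) \<cdot> asc K x ?u ?u"
      by (simp add: brd_nat_assoc)
    also have "\<dots> = lun K (?u \<boxtimes> x) \<cdot> (asc K ?u ?u x \<cdot> brd K x (?u \<boxtimes> ?u) \<cdot> asc K x ?u ?u)"
      by (subst lun_tobj[symmetric]) auto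
    also have "\<dots> = brd K x ?u \<cdot> (lun K (x \<boxtimes> ?u) \<cdot> asc K ?u x ?u) \<cdot> (brd K x ?u \<odot> ?i ?u)"
      by (simp add: hexagon lun_nat_assoc)
    also have "\<dots> = brd K x ?u \<cdot> ((lun K x \<cdot> brd K x ?u) \<odot> ?i ?u)"
      by (simp add: lun_tobj tarr_cmp_tarr)
    finally show "brd K x ?u \<cdot> ((lun K x \<cdot> brd K x ?u) \<odot> ?i ?u) = brd K x ?u \<cdot> (run K x \<odot> ?i ?u)" by simp
  qed auto
qed auto

end

section \<open>Coherence of associators and braidings; permutations of tensor factors\<close>

context symmetric_monoidal_category
begin

lemma whisker_left: "\<lbrakk>x \<in> objs K; f \<in> arrs K; g \<in> arrs K; src K f = tgt K g\<rbrakk> \<Longrightarrow>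
    idt K x \<odot> (f \<cdot> g) = (idt K x \<odot> f) \<cdot> (idt K x \<odot> g)"
  and whisker_right: "\<lbrakk>x \<in> objs K; f \<in> arrs K; g \<in> arrs K; src K f = tgt K g\<rbrakk> \<Longrightarrow>
    (f \<cdot> g) \<odot> idt K x = (f \<odot> idt K x) \<cdot> (g \<odot> idt K x)"
  by (simp_all add: tarr_cmp_tarr)

lemma tarr_cmp_left: "\<lbrakk>f \<in> arrs K; g \<in> arrs K; h \<in> arrs K; src K f = tgt K g\<rbrakk> \<Longrightarrow>
    (f \<cdot> g) \<odot> h = (f \<odot> h) \<cdot> (g \<odot> idt K (src K h))"
  and tarr_cmp_right: "\<lbrakk>f \<in> arrs K; g \<in> arrs K; h \<in> arrs K; src K f = tgt K g\<rbrakk> \<Longrightarrow>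
    h \<odot> (f \<cdot> g) = (h \<odot> f) \<cdot> (idt K (src K h) \<odot> g)"
  by (simp_all add: tarr_cmp_tarr)

lemma whisker_inv:
  assumes "x \<in> objs K" "f \<in> arrs K" "g \<in> arrs K" "src K f = tgt K g" "f \<cdot> g = idt K (tgt K f)"
  shows "(idt K x \<odot> f) \<cdot> (idt K x \<odot> g) = idt K (x \<boxtimes> tgt K f)"
    "(f \<odot> idt K x) \<cdot> (g \<odot> idt K x) = idt K (tgt K f \<boxtimes> x)"
    "\<lbrakk>h \<in> arrs K; tgt K h = x \<boxtimes> src K g\<rbrakk> \<Longrightarrow> (idt K x \<odot> f) \<cdot> ((idt K x \<odot> g) \<cdot> h) = idt K (x \<boxtimes> tgt K f) \<cdot> h"
    "\<lbrakk>h \<in> arrs K; tgt K h = src K g \<boxtimes> x\<rbrakk> \<Longrightarrow> (f \<odot> idt K x) \<cdot> ((g \<odot> idt K x) \<cdot> h) = idt K (tgt K f \<boxtimes> x) \<cdot> h"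
  using assms by (simp_all add: tarr_cmp_tarr tarr_cmp_tarr_assoc)

lemma pentagon_assoc:
  assumes [simp]: "w \<in> objs K" "x \<in> objs K" "y \<in> objs K" "z \<in> objs K" "h \<in> arrs K" "tgt K h = ((w \<boxtimes> x) \<boxtimes> y) \<boxtimes> z"
  shows "asc K w x (y \<boxtimes> z) \<cdot> (asc K (w \<boxtimes> x) y z \<cdot> h) =
       (idt K w \<odot> asc K x y z) \<cdot> asc K w (x \<boxtimes> y) z \<cdot> ((asc K w x y \<odot> idt K z) \<cdot> h)"
  using reassoc[OF pentagon, of w x y z h] by simp

text \<open>The pentagon solved for other corners. Inverse associators occur in
  \<open>middle_swap\<close> and in module actions, and each orientation is wanted as a rewrite rule
  of its own.\<close>

lemma pentagon_2:
  assumes [simp]: "w \<in> objs K" "x \<in> objs K" "y \<in> objs K" "z \<in> objs K"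
  shows "asc' w x (y \<boxtimes> z) \<cdot> (idt K w \<odot> asc K x y z) =
     asc K (w \<boxtimes> x) y z \<cdot> (asc' w x y \<odot> idt K z) \<cdot> asc' w (x \<boxtimes> y) z"
proof (rule iso_cancel_left[OF asc_iso[of w x "y \<boxtimes> z"]])
  show "asc K w x (y \<boxtimes> z) \<cdot> asc' w x (y \<boxtimes> z) \<cdot> (idt K w \<odot> asc K x y z) =
    asc K w x (y \<boxtimes> z) \<cdot> asc K (w \<boxtimes> x) y z \<cdot> (asc' w x y \<odot> idt K z) \<cdot> asc' w (x \<boxtimes> y) z"
    by (simp add: pentagon_assoc whisker_inv)
qed auto

lemma pentagon_3:
  assumes [simp]: "w \<in> objs K" "x \<in> objs K" "y \<in> objs K" "z \<in> objs K"
  shows "(idt K w \<odot> asc' x y z) \<cdot> asc K w x (y \<boxtimes> z) =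
     asc K w (x \<boxtimes> y) z \<cdot> (asc K w x y \<odot> idt K z) \<cdot> asc' (w \<boxtimes> x) y z"
proof (rule iso_cancel_left[OF tarr_iso[OF idt_iso asc_iso[of x y z]], of w])
  have "asc K w x (y \<boxtimes> z) \<cdot> asc K (w \<boxtimes> x) y z \<cdot> asc' (w \<boxtimes> x) y z =
       (idt K w \<odot> asc K x y z) \<cdot> asc K w (x \<boxtimes> y) z \<cdot> ((asc K w x y \<odot> idt K z) \<cdot> asc' (w \<boxtimes> x) y z)"
    by (rule pentagon_assoc) auto
  then show "(idt K w \<odot> asc K x y z) \<cdot> (idt K w \<odot> asc' x y z) \<cdot> asc K w x (y \<boxtimes> z) =
    (idt K w \<odot> asc K x y z) \<cdot> asc K w (x \<boxtimes> y) z \<cdot> (asc K w x y \<odot> idt K z) \<cdot> asc' (w \<boxtimes> x) y z"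
    by (simp add: whisker_inv)
qed auto

lemma pentagon_4:
  assumes [simp]: "w \<in> objs K" "x \<in> objs K" "y \<in> objs K" "z \<in> objs K"
  shows "(asc' w x y \<odot> idt K z) \<cdot> asc' w (x \<boxtimes> y) z \<cdot> (idt K w \<odot> asc' x y z) =
    asc' (w \<boxtimes> x) y z \<cdot> asc' w x (y \<boxtimes> z)"
proof (rule iso_cancel_left[OF asc_iso[of "w \<boxtimes> x" y z]])
  have "asc K (w \<boxtimes> x) y z \<cdot> (asc' w x y \<odot> idt K z) \<cdot> asc' w (x \<boxtimes> y) z \<cdot> (idt K w \<odot> asc' x y z)
     = (asc' w x (y \<boxtimes> z) \<cdot> (idt K w \<odot> asc K x y z)) \<cdot> (idt K w \<odot> asc' x y z)"
    unfolding pentagon_2[OF assms] by simp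
  then show "asc K (w \<boxtimes> x) y z \<cdot> (asc' w x y \<odot> idt K z) \<cdot> asc' w (x \<boxtimes> y) z \<cdot> (idt K w \<odot> asc' x y z)
     = asc K (w \<boxtimes> x) y z \<cdot> asc' (w \<boxtimes> x) y z \<cdot> asc' w x (y \<boxtimes> z)"
    by (simp add: whisker_inv)
qed auto

lemma pentagon_2_assoc:
  assumes [simp]: "w \<in> objs K" "x \<in> objs K" "y \<in> objs K" "z \<in> objs K" "h \<in> arrs K" "tgt K h = w \<boxtimes> ((x \<boxtimes> y) \<boxtimes> z)"
  shows "asc' w x (y \<boxtimes> z) \<cdot> ((idt K w \<odot> asc K x y z) \<cdot> h) =
     asc K (w \<boxtimes> x) y z \<cdot> (asc' w x y \<odot> idt K z) \<cdot> asc' w (x \<boxtimes> y) z \<cdot> h"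
  using reassoc[OF pentagon_2, of w x y z h] by simp

lemma pentagon_3_assoc:
  assumes [simp]: "w \<in> objs K" "x \<in> objs K" "y \<in> objs K" "z \<in> objs K" "h \<in> arrs K" "tgt K h = (w \<boxtimes> x) \<boxtimes> (y \<boxtimes> z)"
  shows "(idt K w \<odot> asc' x y z) \<cdot> (asc K w x (y \<boxtimes> z) \<cdot> h) =
     asc K w (x \<boxtimes> y) z \<cdot> (asc K w x y \<odot> idt K z) \<cdot> asc' (w \<boxtimes> x) y z \<cdot> h"
  using reassoc[OF pentagon_3, of w x y z h] by simp

lemma hexagon_brd:
  assumes [simp]: "x \<in> objs K" "y \<in> objs K" "z \<in> objs K"
  shows "brd K x (y \<boxtimes> z) = asc' y z x \<cdot> (idt K y \<odot> brd K x z) \<cdot> asc K y x z \<cdot> (brd K x y \<odot> idt K z) \<cdot> asc' x y z"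
proof -
  have "brd K x (y \<boxtimes> z) = asc' y z x \<cdot> (asc K y z x \<cdot> brd K x (y \<boxtimes> z) \<cdot> asc K x y z) \<cdot> asc' x y z"
    by simp
  also have "\<dots> = asc' y z x \<cdot> (idt K y \<odot> brd K x z) \<cdot> asc K y x z \<cdot> (brd K x y \<odot> idt K z) \<cdot> asc' x y z"
    unfolding hexagon[OF assms] by simp
  finally show ?thesis .
qed

text \<open>The second hexagon is the inverse of the first: the right-hand side is a left inverse of
  \<open>brd K z (x \<boxtimes> y)\<close>, and by symmetry so is
  \<open>brd K (x \<boxtimes> y) z\<close>.\<close>

lemma hexagon_brd_2:
  assumes [simp]: "x \<in> objs K" "y \<in> objs K" "z \<in> objs K"
  shows "brd K (x \<boxtimes> y) z = asc K z x y \<cdot> (brd K x z \<odot> idt K y) \<cdot> asc' x z y \<cdot> (idt K x \<odot> brd K y z) \<cdot> asc K x y z"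
proof (rule iso_cancel_right[OF brd_iso[of z "x \<boxtimes> y"]])
  have "(asc K z x y \<cdot> (brd K x z \<odot> idt K y) \<cdot> asc' x z y \<cdot> (idt K x \<odot> brd K y z) \<cdot> asc K x y z) \<cdot> brd K z (x \<boxtimes> y)
      = idt K (z \<boxtimes> (x \<boxtimes> y))"
    by (simp add: hexagon_brd[of z x y] whisker_inv)
  then show "brd K (x \<boxtimes> y) z \<cdot> brd K z (x \<boxtimes> y) =
    (asc K z x y \<cdot> (brd K x z \<odot> idt K y) \<cdot> asc' x z y \<cdot> (idt K x \<odot> brd K y z) \<cdot> asc K x y z) \<cdot> brd K z (x \<boxtimes> y)"
    by simp
qed auto

text \<open>Moves the first of three factors past the second; with right-nested products these
  transpositions generate all the permutations needed below.\<close>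

definition sw :: "'a \<Rightarrow> 'a \<Rightarrow> 'a \<Rightarrow> 'b" where
  "sw x y z = asc K y x z \<cdot> (brd K x y \<odot> idt K z) \<cdot> asc' x y z"

lemma sw_arr [simp]: "\<lbrakk>x \<in> objs K; y \<in> objs K; z \<in> objs K\<rbrakk> \<Longrightarrow> sw x y z \<in> arrs K"
  and sw_src [simp]: "\<lbrakk>x \<in> objs K; y \<in> objs K; z \<in> objs K\<rbrakk> \<Longrightarrow> src K (sw x y z) = x \<boxtimes> (y \<boxtimes> z)"
  and sw_tgt [simp]: "\<lbrakk>x \<in> objs K; y \<in> objs K; z \<in> objs K\<rbrakk> \<Longrightarrow> tgt K (sw x y z) = y \<boxtimes> (x \<boxtimes> z)"
  by (auto simp: sw_def)

lemma sw_sw [simp]: "\<lbrakk>x \<in> objs K; y \<in> objs K; z \<in> objs K\<rbrakk> \<Longrightarrow> sw y x z \<cdot> sw x y z = idt K (x \<boxtimes> (y \<boxtimes> z))"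
  by (simp add: sw_def whisker_inv)

lemma sw_iso: "\<lbrakk>x \<in> objs K; y \<in> objs K; z \<in> objs K\<rbrakk> \<Longrightarrow> iso_arrow K (sw x y z)"
  by (rule iso_arrowI[where g = "sw y x z"]) auto

lemma sw_nat:
  "\<lbrakk>f \<in> arrs K; g \<in> arrs K; h \<in> arrs K; x' = tgt K f; y' = tgt K g; z' = tgt K h\<rbrakk> \<Longrightarrow>
   sw x' y' z' \<cdot> (f \<odot> (g \<odot> h)) = (g \<odot> (f \<odot> h)) \<cdot> sw (src K f) (src K g) (src K h)"
  by (simp add: sw_def asc'_nat asc_nat_assoc tarr_cmp_tarr_assoc brd_nat tarr_cmp_tarr)
    (simp add: tarr_cmp_left asc_nat_assoc)

lemma sw_nat_assoc:
  "\<lbrakk>f \<in> arrs K; g \<in> arrs K; h \<in> arrs K; x' = tgt K f; y' = tgt K g; z' = tgt K h; k \<in> arrs K;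
    tgt K k = src K f \<boxtimes> (src K g \<boxtimes> src K h)\<rbrakk> \<Longrightarrow>
   sw x' y' z' \<cdot> ((f \<odot> (g \<odot> h)) \<cdot> k) = (g \<odot> (f \<odot> h)) \<cdot> (sw (src K f) (src K g) (src K h) \<cdot> k)"
  by (subst cmp_cmp[symmetric]) (auto simp: sw_nat)

text \<open>The hexagon transported to right-nested products: a factor passes a tensor product by
  passing its two components in turn.\<close>

lemma sw_tobj_2:
  assumes [simp]: "g \<in> objs K" "f \<in> objs K" "h \<in> objs K" "k \<in> objs K"
  shows "sw g (f \<boxtimes> h) k \<cdot> (idt K g \<odot> asc' f h k) = asc' f h (g \<boxtimes> k) \<cdot> (idt K f \<odot> sw g h k) \<cdot> sw g f (h \<boxtimes> k)"
proof -
  let ?i = "idt K"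
  have "asc' f h (g \<boxtimes> k) \<cdot> (?i f \<odot> sw g h k) \<cdot> sw g f (h \<boxtimes> k) =
     asc' f h (g \<boxtimes> k) \<cdot> (?i f \<odot> asc K h g k) \<cdot> (?i f \<odot> (brd K g h \<odot> ?i k)) \<cdot>
      (?i f \<odot> asc' g h k) \<cdot> asc K f g (h \<boxtimes> k) \<cdot> (brd K g f \<odot> ?i (h \<boxtimes> k)) \<cdot> asc' g f (h \<boxtimes> k)"
    by (simp add: sw_def whisker_left)
  also have "\<dots> = asc K (f \<boxtimes> h) g k \<cdot> (asc' f h g \<odot> ?i k) \<cdot> asc' f (h \<boxtimes> g) k \<cdot> (?i f \<odot> (brd K g h \<odot> ?i k)) \<cdot>
      asc K f (g \<boxtimes> h) k \<cdot> (asc K f g h \<odot> ?i k) \<cdot> asc' (f \<boxtimes> g) h k \<cdot> (brd K g f \<odot> (?i h \<odot> ?i k)) \<cdot> asc' g f (h \<boxtimes> k)"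
    by (simp add: pentagon_2_assoc pentagon_3_assoc)
  also have "\<dots> = asc K (f \<boxtimes> h) g k \<cdot> (asc' f h g \<odot> ?i k) \<cdot> ((?i f \<odot> brd K g h) \<odot> ?i k) \<cdot>
      (asc K f g h \<odot> ?i k) \<cdot> ((brd K g f \<odot> ?i h) \<odot> ?i k) \<cdot> (asc' (g \<boxtimes> f) h k \<cdot> asc' g f (h \<boxtimes> k))"
    by (simp add: asc'_nat_assoc del: tarr_idt_idt)
  also have "\<dots> = asc K (f \<boxtimes> h) g k \<cdot> (asc' f h g \<odot> ?i k) \<cdot> ((?i f \<odot> brd K g h) \<odot> ?i k) \<cdot>
      (asc K f g h \<odot> ?i k) \<cdot> ((brd K g f \<odot> ?i h) \<odot> ?i k) \<cdot> (asc' g f h \<odot> ?i k) \<cdot> asc' g (f \<boxtimes> h) k \<cdot> (?i g \<odot> asc' f h k)"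
    by (simp add: pentagon_4)
  also have "\<dots> = sw g (f \<boxtimes> h) k \<cdot> (?i g \<odot> asc' f h k)"
    by (simp add: sw_def hexagon_brd[of g f h] whisker_right)
  finally show ?thesis by simp
qed

text \<open>Obtained from \<open>sw_tobj_2\<close> by inversion, since the inverse of
  \<open>sw\<close> is \<open>sw\<close> with its first two arguments exchanged.\<close>

lemma sw_tobj_1:
  assumes [simp]: "b \<in> objs K" "b' \<in> objs K" "h \<in> objs K" "d \<in> objs K"
  shows "(idt K h \<odot> asc K b b' d) \<cdot> sw (b \<boxtimes> b') h d = sw b h (b' \<boxtimes> d) \<cdot> (idt K b \<odot> sw b' h d) \<cdot> asc K b b' (h \<boxtimes> d)"
proof (rule iso_cancel_right[OF cmp_iso[OF tarr_iso[OF idt_iso[of h] iso_arrowI[where f = "asc' b b' d" and g = "asc K b b' d"]] sw_iso[of h "b \<boxtimes> b'" d]]])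
  let ?c = "sw h (b \<boxtimes> b') d \<cdot> (idt K h \<odot> asc' b b' d)"
  have "(sw b h (b' \<boxtimes> d) \<cdot> (idt K b \<odot> sw b' h d) \<cdot> asc K b b' (h \<boxtimes> d)) \<cdot> ?c =
     sw b h (b' \<boxtimes> d) \<cdot> (idt K b \<odot> sw b' h d) \<cdot> (idt K b \<odot> sw h b' d) \<cdot> sw h b (b' \<boxtimes> d)"
    by (simp add: sw_tobj_2)
  also have "\<dots> = idt K (h \<boxtimes> (b \<boxtimes> (b' \<boxtimes> d)))"
    by (simp add: whisker_inv)
  also have "\<dots> = (idt K h \<odot> asc K b b' d) \<cdot> (sw (b \<boxtimes> b') h d \<cdot> sw h (b \<boxtimes> b') d) \<cdot> (idt K h \<odot> asc' b b' d)"
    by (simp add: whisker_inv)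
  finally show "((idt K h \<odot> asc K b b' d) \<cdot> sw (b \<boxtimes> b') h d) \<cdot> ?c
      = (sw b h (b' \<boxtimes> d) \<cdot> (idt K b \<odot> sw b' h d) \<cdot> asc K b b' (h \<boxtimes> d)) \<cdot> ?c"
    by (simp del: sw_sw)
qed auto

text \<open>Two pentagons and naturality of the associator let a transposition ignore a spectator
  \<open>e\<close> on the right. This is used when the action of one tensor factor meets a third
  argument in the associativity of a tensor ring.\<close>

lemma sw_tobj_3:
  assumes [simp]: "b \<in> objs K" "c \<in> objs K" "d \<in> objs K" "e \<in> objs K"
  shows "sw b c (d \<boxtimes> e) \<cdot> (idt K b \<odot> asc K c d e) \<cdot> asc K b (c \<boxtimes> d) e =
    (idt K c \<odot> asc K b d e) \<cdot> asc K c (b \<boxtimes> d) e \<cdot> (sw b c d \<odot> idt K e)"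
proof -
  let ?i = "idt K"
  have "sw b c (d \<boxtimes> e) \<cdot> (?i b \<odot> asc K c d e) \<cdot> asc K b (c \<boxtimes> d) e =
    asc K c b (d \<boxtimes> e) \<cdot> (brd K b c \<odot> (?i d \<odot> ?i e)) \<cdot> asc K (b \<boxtimes> c) d e \<cdot> (asc' b c d \<odot> ?i e)"
    by (simp add: sw_def pentagon_2_assoc)
  also have "\<dots> = (asc K c b (d \<boxtimes> e) \<cdot> asc K (c \<boxtimes> b) d e) \<cdot> ((brd K b c \<odot> ?i d) \<odot> ?i e) \<cdot> (asc' b c d \<odot> ?i e)"
    by (simp add: asc_nat_assoc del: tarr_idt_idt)
  also have "\<dots> = (?i c \<odot> asc K b d e) \<cdot> asc K c (b \<boxtimes> d) e \<cdot> (sw b c d \<odot> ?i e)"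
    by (simp add: pentagon_assoc sw_def whisker_right)
  finally show ?thesis .
qed

lemma sw_brd:
  assumes [simp]: "x \<in> objs K" "y \<in> objs K" "z \<in> objs K"
  shows "sw z x y \<cdot> brd K (x \<boxtimes> y) z = (idt K x \<odot> brd K y z) \<cdot> asc K x y z"
  by (simp add: sw_def hexagon_brd_2 whisker_inv)

lemma lun_sw:
  assumes [simp]: "x \<in> objs K" "y \<in> objs K"
  shows "lun K (x \<boxtimes> y) \<cdot> sw x (unt K) y = idt K x \<odot> lun K y"
    "(idt K x \<odot> lun K y) \<cdot> sw (unt K) x y = lun K (x \<boxtimes> y)"
proof -
  have t: "run K x \<odot> idt K y = (idt K x \<odot> lun K y) \<cdot> asc K x (unt K) y"
    by (simp add: triangle)
  have "lun K (x \<boxtimes> y) \<cdot> sw x (unt K) y = ((lun K (x \<boxtimes> y) \<cdot> asc K (unt K) x y) \<cdot> (brd K x (unt K) \<odot> idt K y)) \<cdot> asc' x (unt K) y"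
    by (simp add: sw_def)
  also have "\<dots> = (run K x \<odot> idt K y) \<cdot> asc' x (unt K) y"
    unfolding lun_tobj[OF assms] by (simp add: tarr_cmp_tarr lun_brd)
  also have "\<dots> = idt K x \<odot> lun K y" unfolding t by simp
  finally show 1: "lun K (x \<boxtimes> y) \<cdot> sw x (unt K) y = idt K x \<odot> lun K y" .
  show "(idt K x \<odot> lun K y) \<cdot> sw (unt K) x y = lun K (x \<boxtimes> y)"
    by (simp add: 1[symmetric])
qed

lemma middle_swap_sw:
  assumes "a \<in> objs K" "b \<in> objs K" "c \<in> objs K" "d \<in> objs K"
  shows "middle_swap K a b c d = asc' a c (b \<boxtimes> d) \<cdot> (idt K a \<odot> sw b c d) \<cdot> asc K a b (c \<boxtimes> d)"
  by (simp add: middle_swap_def sw_def)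

lemma middle_swap_arr [simp]: "\<lbrakk>a \<in> objs K; b \<in> objs K; c \<in> objs K; d \<in> objs K\<rbrakk> \<Longrightarrow> middle_swap K a b c d \<in> arrs K"
  and middle_swap_src [simp]: "\<lbrakk>a \<in> objs K; b \<in> objs K; c \<in> objs K; d \<in> objs K\<rbrakk> \<Longrightarrow> src K (middle_swap K a b c d) = (a \<boxtimes> b) \<boxtimes> (c \<boxtimes> d)"
  and middle_swap_tgt [simp]: "\<lbrakk>a \<in> objs K; b \<in> objs K; c \<in> objs K; d \<in> objs K\<rbrakk> \<Longrightarrow> tgt K (middle_swap K a b c d) = (a \<boxtimes> c) \<boxtimes> (b \<boxtimes> d)"
  by (auto simp: middle_swap_sw)

text \<open>This is what makes a tensor product of commutative rings commutative: after regrouping,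
  the braiding of a product with a product becomes the braidings of the components.\<close>

lemma brd_middle_swap:
  assumes [simp]: "a \<in> objs K" "b \<in> objs K" "c \<in> objs K" "d \<in> objs K"
  shows "middle_swap K c d a b \<cdot> brd K (a \<boxtimes> b) (c \<boxtimes> d) = (brd K a c \<odot> brd K b d) \<cdot> middle_swap K a b c d"
proof -
  let ?i = "idt K"
  have "middle_swap K c d a b \<cdot> brd K (a \<boxtimes> b) (c \<boxtimes> d) =
     asc' c a (d \<boxtimes> b) \<cdot> (?i c \<odot> (sw d a b \<cdot> brd K (a \<boxtimes> b) d)) \<cdot> asc K c (a \<boxtimes> b) d \<cdot> (brd K (a \<boxtimes> b) c \<odot> ?i d) \<cdot> asc' (a \<boxtimes> b) c d"
    by (simp add: middle_swap_sw hexagon_brd[of "a \<boxtimes> b" c d] whisker_left)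
  also have "\<dots> = asc' c a (d \<boxtimes> b) \<cdot> (?i c \<odot> (?i a \<odot> brd K b d)) \<cdot> (?i c \<odot> asc K a b d) \<cdot> asc K c (a \<boxtimes> b) d \<cdot> (brd K (a \<boxtimes> b) c \<odot> ?i d) \<cdot> asc' (a \<boxtimes> b) c d"
    by (simp add: sw_brd whisker_left)
  also have "\<dots> = (?i (c \<boxtimes> a) \<odot> brd K b d) \<cdot> (asc' c a (b \<boxtimes> d) \<cdot> (?i c \<odot> asc K a b d) \<cdot> asc K c (a \<boxtimes> b) d \<cdot> (brd K (a \<boxtimes> b) c \<odot> ?i d) \<cdot> asc' (a \<boxtimes> b) c d)"
    by (simp add: asc'_nat_assoc)
  also have "\<dots> = (?i (c \<boxtimes> a) \<odot> brd K b d) \<cdot> (asc K (c \<boxtimes> a) b d \<cdot> (asc' c a b \<odot> ?i d) \<cdot> (brd K (a \<boxtimes> b) c \<odot> ?i d) \<cdot> asc' (a \<boxtimes> b) c d)"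
    by (simp add: pentagon_2_assoc)
  also have "\<dots> = (?i (c \<boxtimes> a) \<odot> brd K b d) \<cdot> (asc K (c \<boxtimes> a) b d \<cdot> ((brd K a c \<odot> ?i b) \<odot> ?i d) \<cdot> (asc' a c b \<odot> ?i d) \<cdot> ((?i a \<odot> brd K b c) \<odot> ?i d) \<cdot> (asc K a b c \<odot> ?i d) \<cdot> asc' (a \<boxtimes> b) c d)"
    by (simp add: hexagon_brd_2[of a b c] whisker_right whisker_inv)
  also have "\<dots> = (?i (c \<boxtimes> a) \<odot> brd K b d) \<cdot> ((brd K a c \<odot> ?i (b \<boxtimes> d)) \<cdot> (asc K (a \<boxtimes> c) b d \<cdot> (asc' a c b \<odot> ?i d) \<cdot> ((?i a \<odot> brd K b c) \<odot> ?i d) \<cdot> (asc K a b c \<odot> ?i d) \<cdot> asc' (a \<boxtimes> b) c d))"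
    by (simp add: asc_nat_assoc)
  also have "\<dots> = (brd K a c \<odot> brd K b d) \<cdot> (asc K (a \<boxtimes> c) b d \<cdot> (asc' a c b \<odot> ?i d) \<cdot> ((?i a \<odot> brd K b c) \<odot> ?i d) \<cdot> (asc K a b c \<odot> ?i d) \<cdot> asc' (a \<boxtimes> b) c d)"
    by (subst tarr_cmp_tarr_assoc) auto
  also have "\<dots> = (brd K a c \<odot> brd K b d) \<cdot> ((asc K (a \<boxtimes> c) b d \<cdot> (asc' a c b \<odot> ?i d) \<cdot> asc' a (c \<boxtimes> b) d) \<cdot> asc K a (c \<boxtimes> b) d \<cdot> ((?i a \<odot> brd K b c) \<odot> ?i d) \<cdot> (asc K a b c \<odot> ?i d) \<cdot> asc' (a \<boxtimes> b) c d)"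
    by simp
  also have "\<dots> = (brd K a c \<odot> brd K b d) \<cdot> (asc' a c (b \<boxtimes> d) \<cdot> (?i a \<odot> asc K c b d)  \<cdot> (?i a \<odot> (brd K b c \<odot> ?i d)) \<cdot> (asc K a (b \<boxtimes> c) d \<cdot> (asc K a b c \<odot> ?i d) \<cdot> asc' (a \<boxtimes> b) c d))"
    by (subst pentagon_2[symmetric]) (simp_all add: asc_nat_assoc)
  also have "\<dots> = (brd K a c \<odot> brd K b d) \<cdot> middle_swap K a b c d"
    by (subst pentagon_3[symmetric]) (simp_all add: middle_swap_sw sw_def whisker_left)
  finally show ?thesis .
qed

end

section \<open>Rings and their elements\<close>

text \<open>Arrows into a ring are treated as generalised elements. The product of f : x -> A and g
  : y -> A lives on x \<otimes> y, so the ring axioms turn into ordinary algebraic identities, and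
  coherence isomorphisms are confined to the sources.\<close>

definition prd :: "('o, 'm) smc \<Rightarrow> ('o, 'm) ring_obj \<Rightarrow> 'm \<Rightarrow> 'm \<Rightarrow> 'm" where
  "prd K A f g = r_mul A \<cdot>\<^bsub>K\<^esub> (f \<odot>\<^bsub>K\<^esub> g)"

text \<open>An element is an arrow from the unit object. Scaling by it keeps the source of the
  scaled arrow, so idempotent elements act on all arrows into \<open>A\<close>.\<close>

definition scl :: "('o, 'm) smc \<Rightarrow> ('o, 'm) ring_obj \<Rightarrow> 'm \<Rightarrow> 'm \<Rightarrow> 'm" where
  "scl K A e f = prd K A e f \<cdot>\<^bsub>K\<^esub> inv_arrow K (lun K (src K f))"

definition in1 :: "('o, 'm) smc \<Rightarrow> ('o, 'm) ring_obj \<Rightarrow> ('o, 'm) ring_obj \<Rightarrow> 'm" where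
  "in1 K A B = (idt K (r_ob A) \<odot>\<^bsub>K\<^esub> r_unit B) \<cdot>\<^bsub>K\<^esub> inv_arrow K (run K (r_ob A))"

definition in2 :: "('o, 'm) smc \<Rightarrow> ('o, 'm) ring_obj \<Rightarrow> ('o, 'm) ring_obj \<Rightarrow> 'm" where
  "in2 K A B = (r_unit A \<odot>\<^bsub>K\<^esub> idt K (r_ob B)) \<cdot>\<^bsub>K\<^esub> inv_arrow K (lun K (r_ob B))"

lemma tensor_ring_ob [simp]: "r_ob (tensor_ring K A B) = r_ob A \<boxtimes>\<^bsub>K\<^esub> r_ob B"
  by (simp add: tensor_ring_def)

context symmetric_monoidal_category
begin

lemma ring_ob [simp]: "is_ring K A \<Longrightarrow> r_ob A \<in> objs K"
  and ring_mul_arr [simp]: "is_ring K A \<Longrightarrow> r_mul A \<in> arrs K"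
  and ring_mul_src [simp]: "is_ring K A \<Longrightarrow> src K (r_mul A) = r_ob A \<boxtimes> r_ob A"
  and ring_mul_tgt [simp]: "is_ring K A \<Longrightarrow> tgt K (r_mul A) = r_ob A"
  and ring_unit_arr [simp]: "is_ring K A \<Longrightarrow> r_unit A \<in> arrs K"
  and ring_unit_src [simp]: "is_ring K A \<Longrightarrow> src K (r_unit A) = unt K"
  and ring_unit_tgt [simp]: "is_ring K A \<Longrightarrow> tgt K (r_unit A) = r_ob A"
  unfolding is_ring_def Let_def in_Hom_iff by blast+

lemma ring_mul_assoc: "is_ring K A \<Longrightarrow> r_mul A \<cdot> (r_mul A \<odot> idt K (r_ob A)) =
    r_mul A \<cdot> (idt K (r_ob A) \<odot> r_mul A) \<cdot> asc K (r_ob A) (r_ob A) (r_ob A)"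
  and ring_mul_unit_left: "is_ring K A \<Longrightarrow> r_mul A \<cdot> (r_unit A \<odot> idt K (r_ob A)) = lun K (r_ob A)"
  and ring_mul_unit_right: "is_ring K A \<Longrightarrow> r_mul A \<cdot> (idt K (r_ob A) \<odot> r_unit A) = run K (r_ob A)"
  and ring_mul_comm: "is_ring K A \<Longrightarrow> r_mul A \<cdot> brd K (r_ob A) (r_ob A) = r_mul A"
  unfolding is_ring_def Let_def in_Hom_iff by blast+

text \<open>Commutativity carries the left unit law to the right one by means of
  \<open>lun_brd\<close>.\<close>

lemma is_ringI:
  assumes "r_ob A \<in> objs K" "r_mul A \<in> arrs K" "src K (r_mul A) = r_ob A \<boxtimes> r_ob A" "tgt K (r_mul A) = r_ob A"
    "r_unit A \<in> arrs K" "src K (r_unit A) = unt K" "tgt K (r_unit A) = r_ob A"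
    "r_mul A \<cdot> (r_mul A \<odot> idt K (r_ob A)) =
      r_mul A \<cdot> (idt K (r_ob A) \<odot> r_mul A) \<cdot> asc K (r_ob A) (r_ob A) (r_ob A)"
    "r_mul A \<cdot> (r_unit A \<odot> idt K (r_ob A)) = lun K (r_ob A)"
    "r_mul A \<cdot> brd K (r_ob A) (r_ob A) = r_mul A"
  shows "is_ring K A"
proof -
  have "r_mul A \<cdot> (idt K (r_ob A) \<odot> r_unit A) = (r_mul A \<cdot> brd K (r_ob A) (r_ob A)) \<cdot> (idt K (r_ob A) \<odot> r_unit A)"
    using assms(10) by simp
  also have "\<dots> = (r_mul A \<cdot> (r_unit A \<odot> idt K (r_ob A))) \<cdot> brd K (r_ob A) (unt K)"
    using assms(1-7) by (simp add: brd_nat)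
  also have "\<dots> = run K (r_ob A)" unfolding assms(9) by (simp add: lun_brd assms(1))
  finally show ?thesis
    unfolding is_ring_def Let_def in_Hom_iff using assms by blast
qed

lemma prd_arr [simp]: "\<lbrakk>is_ring K A; f \<in> arrs K; g \<in> arrs K; tgt K f = r_ob A; tgt K g = r_ob A\<rbrakk> \<Longrightarrow> prd K A f g \<in> arrs K"
  and prd_src [simp]: "\<lbrakk>is_ring K A; f \<in> arrs K; g \<in> arrs K; tgt K f = r_ob A; tgt K g = r_ob A\<rbrakk> \<Longrightarrow> src K (prd K A f g) = src K f \<boxtimes> src K g"
  and prd_tgt [simp]: "\<lbrakk>is_ring K A; f \<in> arrs K; g \<in> arrs K; tgt K f = r_ob A; tgt K g = r_ob A\<rbrakk> \<Longrightarrow> tgt K (prd K A f g) = r_ob A"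
  by (auto simp: prd_def)

lemma prd_cmp:
  assumes "is_ring K A" "f \<in> arrs K" "g \<in> arrs K" "tgt K f = r_ob A" "tgt K g = r_ob A"
    "h \<in> arrs K" "k \<in> arrs K" "src K f = tgt K h" "src K g = tgt K k"
  shows "prd K A f g \<cdot> (h \<odot> k) = prd K A (f \<cdot> h) (g \<cdot> k)"
  using assms by (simp add: prd_def tarr_cmp_tarr)

lemma prd_idt: "is_ring K A \<Longrightarrow> prd K A (idt K (r_ob A)) (idt K (r_ob A)) = r_mul A"
  by (simp add: prd_def)

lemma prd_assoc:
  assumes "is_ring K A" "f \<in> arrs K" "g \<in> arrs K" "h \<in> arrs K" "tgt K f = r_ob A" "tgt K g = r_ob A" "tgt K h = r_ob A"
  shows "prd K A (prd K A f g) h = prd K A f (prd K A g h) \<cdot> asc K (src K f) (src K g) (src K h)"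
proof -
  have "prd K A (prd K A f g) h = (r_mul A \<cdot> (r_mul A \<odot> idt K (r_ob A))) \<cdot> ((f \<odot> g) \<odot> h)"
    using assms by (simp add: prd_def tarr_cmp_tarr)
  also have "\<dots> = r_mul A \<cdot> (idt K (r_ob A) \<odot> r_mul A) \<cdot> (f \<odot> (g \<odot> h)) \<cdot> asc K (src K f) (src K g) (src K h)"
    using assms by (simp add: ring_mul_assoc asc_nat)
  also have "\<dots> = prd K A f (prd K A g h) \<cdot> asc K (src K f) (src K g) (src K h)"
    using assms by (simp add: prd_def tarr_cmp_tarr_assoc)
  finally show ?thesis .
qed

lemma prd_comm:
  assumes "is_ring K A" "f \<in> arrs K" "g \<in> arrs K" "tgt K f = r_ob A" "tgt K g = r_ob A"
  shows "prd K A f g = prd K A g f \<cdot> brd K (src K f) (src K g)"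
proof -
  have "prd K A f g = (r_mul A \<cdot> brd K (r_ob A) (r_ob A)) \<cdot> (f \<odot> g)"
    using assms by (simp add: prd_def ring_mul_comm)
  also have "\<dots> = prd K A g f \<cdot> brd K (src K f) (src K g)"
    using assms by (simp add: prd_def brd_nat)
  finally show ?thesis .
qed

lemma prd_unit_left:
  assumes "is_ring K A" "f \<in> arrs K" "tgt K f = r_ob A"
  shows "prd K A (r_unit A) f = f \<cdot> lun K (src K f)"
proof -
  have "prd K A (r_unit A) f = (r_mul A \<cdot> (r_unit A \<odot> idt K (r_ob A))) \<cdot> (idt K (unt K) \<odot> f)"
    using assms by (simp add: prd_def tarr_cmp_tarr)
  then show ?thesis using assms by (simp add: ring_mul_unit_left lun_nat)
qed

lemma prd_unit_right:
  assumes "is_ring K A" "f \<in> arrs K" "tgt K f = r_ob A"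
  shows "prd K A f (r_unit A) = f \<cdot> run K (src K f)"
proof -
  have "prd K A f (r_unit A) = (r_mul A \<cdot> (idt K (r_ob A) \<odot> r_unit A)) \<cdot> (f \<odot> idt K (unt K))"
    using assms by (simp add: prd_def tarr_cmp_tarr)
  then show ?thesis using assms by (simp add: ring_mul_unit_right run_nat)
qed

lemma prd_left_comm:
  assumes "is_ring K A" "f \<in> arrs K" "g \<in> arrs K" "h \<in> arrs K" "tgt K f = r_ob A" "tgt K g = r_ob A" "tgt K h = r_ob A"
  shows "prd K A f (prd K A g h) = prd K A g (prd K A f h) \<cdot> sw (src K f) (src K g) (src K h)"
proof -
  have "prd K A f (prd K A g h) = prd K A (prd K A f g) h \<cdot> asc' (src K f) (src K g) (src K h)"
    using assms by (simp add: prd_assoc)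
  also have "\<dots> = (prd K A (prd K A g f) h \<cdot> (brd K (src K f) (src K g) \<odot> idt K (src K h))) \<cdot> asc' (src K f) (src K g) (src K h)"
    using assms by (subst prd_comm[of A f g]) (simp_all add: prd_cmp)
  also have "\<dots> = prd K A g (prd K A f h) \<cdot> sw (src K f) (src K g) (src K h)"
    using assms by (simp add: prd_assoc sw_def)
  finally show ?thesis .
qed

text \<open>\<open>middle_swap\<close> is the reordering of four factors under a commutative
  product. This identity makes the product of two ring morphisms multiplicative on a tensor
  ring.\<close>

lemma prd_prd:
  assumes "is_ring K A" "f \<in> arrs K" "g \<in> arrs K" "h \<in> arrs K" "k \<in> arrs K"
    "tgt K f = r_ob A" "tgt K g = r_ob A" "tgt K h = r_ob A" "tgt K k = r_ob A"
  shows "prd K A (prd K A f g) (prd K A h k) = prd K A (prd K A f h) (prd K A g k) \<cdot> middle_swap K (src K f) (src K g) (src K h) (src K k)"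
proof -
  have "prd K A (prd K A f g) (prd K A h k) = prd K A f (prd K A h (prd K A g k) \<cdot> sw (src K g) (src K h) (src K k)) \<cdot> asc K (src K f) (src K g) (src K h \<boxtimes> src K k)"
    using assms by (simp add: prd_assoc prd_left_comm[of A g h k])
  also have "\<dots> = (prd K A f (prd K A h (prd K A g k)) \<cdot> (idt K (src K f) \<odot> sw (src K g) (src K h) (src K k))) \<cdot> asc K (src K f) (src K g) (src K h \<boxtimes> src K k)"
    using assms by (simp add: prd_cmp)
  also have "\<dots> = prd K A (prd K A f h) (prd K A g k) \<cdot> middle_swap K (src K f) (src K g) (src K h) (src K k)"
    using assms by (simp add: prd_assoc middle_swap_sw)
  finally show ?thesis .
qed

lemma ring_morD:
  assumes "ring_mor K A B f"
  shows "f \<in> arrs K" "src K f = r_ob A" "tgt K f = r_ob B" "f \<cdot> r_unit A = r_unit B"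
  using assms by (auto simp: ring_mor_def)

lemma ring_mor_prd:
  assumes "ring_mor K A B u" "is_ring K A" "is_ring K B" "f \<in> arrs K" "g \<in> arrs K" "tgt K f = r_ob A" "tgt K g = r_ob A"
  shows "u \<cdot> prd K A f g = prd K B (u \<cdot> f) (u \<cdot> g)"
proof -
  have "u \<cdot> prd K A f g = (u \<cdot> r_mul A) \<cdot> (f \<odot> g)"
    using assms ring_morD[OF assms(1)] by (simp add: prd_def)
  also have "\<dots> = (r_mul B \<cdot> (u \<odot> u)) \<cdot> (f \<odot> g)"
    using assms(1) by (simp add: ring_mor_def)
  also have "\<dots> = prd K B (u \<cdot> f) (u \<cdot> g)"
    using assms ring_morD[OF assms(1)] by (simp add: prd_def tarr_cmp_tarr)
  finally show ?thesis .
qed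

lemma ring_mor_idt: "is_ring K A \<Longrightarrow> ring_mor K A A (idt K (r_ob A))"
  by (simp add: ring_mor_def)

lemma ring_mor_cmp:
  assumes "ring_mor K A B f" "ring_mor K B C g" "is_ring K A" "is_ring K B" "is_ring K C"
  shows "ring_mor K A C (g \<cdot> f)"
proof -
  note [simp] = ring_morD[OF assms(1)] ring_morD[OF assms(2)] assms(3-5)
  have "(g \<cdot> f) \<cdot> r_mul A = g \<cdot> (f \<cdot> prd K A (idt K (r_ob A)) (idt K (r_ob A)))"
    by (simp add: prd_idt)
  also have "\<dots> = prd K C (g \<cdot> f) (g \<cdot> f)"
    by (simp add: ring_mor_prd[OF assms(1)] ring_mor_prd[OF assms(2)])
  finally show ?thesis by (simp add: ring_mor_def prd_def)
qed

lemma ring_morI: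
  assumes "is_ring K A" "is_ring K B" "f \<in> arrs K" "src K f = r_ob A" "tgt K f = r_ob B"
    "f \<cdot> r_mul A = prd K B f f" "f \<cdot> r_unit A = r_unit B"
  shows "ring_mor K A B f"
  using assms by (simp add: ring_mor_def prd_def)

lemma ring_mor_mul: "ring_mor K A B f \<Longrightarrow> f \<cdot> r_mul A = prd K B f f"
  by (simp add: ring_mor_def prd_def)

lemma tensor_ring_mul_arr:
  assumes "is_ring K A" "is_ring K B"
  shows "r_mul (tensor_ring K A B) \<in> arrs K"
    "src K (r_mul (tensor_ring K A B)) = (r_ob A \<boxtimes> r_ob B) \<boxtimes> (r_ob A \<boxtimes> r_ob B)"
    "tgt K (r_mul (tensor_ring K A B)) = r_ob A \<boxtimes> r_ob B"
    "r_unit (tensor_ring K A B) \<in> arrs K" "src K (r_unit (tensor_ring K A B)) = unt K"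
    "tgt K (r_unit (tensor_ring K A B)) = r_ob A \<boxtimes> r_ob B"
  using assms by (simp_all add: tensor_ring_def)

text \<open>The multiplication of \<open>A \<otimes> B\<close> is assembled from the commuting actions \<open>LA\<close> of \<open>A\<close> and
  \<open>LB\<close> of \<open>B\<close>, which keeps the number of factors in each coherence step small.\<close>

lemma is_ring_tensor_aux:
  assumes A: "is_ring K A" and B: "is_ring K B"
  defines "T \<equiv> tensor_ring K A B"
  shows "is_ring K T" "prd K T (in1 K A B) (in2 K A B) = idt K (r_ob T)"
    "ring_mor K A T (in1 K A B)" "ring_mor K B T (in2 K A B)"
proof -
  define a b where "a = r_ob A" and "b = r_ob B"
  define \<mu> \<nu> \<eta> \<theta> where "\<mu> = r_mul A" and "\<nu> = r_mul B" and "\<eta> = r_unit A" and "\<theta> = r_unit B"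
  define ab where "ab = a \<boxtimes> b"
  let ?i = "idt K"
  have [simp]: "a \<in> objs K" "b \<in> objs K" "\<mu> \<in> arrs K" "src K \<mu> = a \<boxtimes> a" "tgt K \<mu> = a"
    "\<nu> \<in> arrs K" "src K \<nu> = b \<boxtimes> b" "tgt K \<nu> = b" "\<eta> \<in> arrs K" "\<theta> \<in> arrs K"
    "src K \<eta> = unt K" "tgt K \<eta> = a" "src K \<theta> = unt K" "tgt K \<theta> = b"
    using A B by (simp_all add: a_def b_def \<mu>_def \<nu>_def \<eta>_def \<theta>_def)
  have ma: "\<mu> \<cdot> (\<mu> \<odot> ?i a) = \<mu> \<cdot> (?i a \<odot> \<mu>) \<cdot> asc K a a a" "\<mu> \<cdot> (\<eta> \<odot> ?i a) = lun K a"
      "\<mu> \<cdot> (?i a \<odot> \<eta>) = run K a" "\<mu> \<cdot> brd K a a = \<mu>"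
    using A unfolding is_ring_def Let_def a_def \<mu>_def \<eta>_def by blast+
  have mb: "\<nu> \<cdot> (\<nu> \<odot> ?i b) = \<nu> \<cdot> (?i b \<odot> \<nu>) \<cdot> asc K b b b" "\<nu> \<cdot> (\<theta> \<odot> ?i b) = lun K b"
      "\<nu> \<cdot> (?i b \<odot> \<theta>) = run K b" "\<nu> \<cdot> brd K b b = \<nu>"
    using B unfolding is_ring_def Let_def b_def \<nu>_def \<theta>_def by blast+
  have [simp]: "ab \<in> objs K" by (simp add: ab_def)
  define M where "M = r_mul T"
  define H where "H = r_unit T"
  have M_def': "M = (\<mu> \<odot> \<nu>) \<cdot> middle_swap K a b a b"
    by (simp add: M_def T_def tensor_ring_def \<mu>_def \<nu>_def a_def b_def)
  have H_def': "H = (\<eta> \<odot> \<theta>) \<cdot> lun' (unt K)"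
    by (simp add: H_def T_def tensor_ring_def \<eta>_def \<theta>_def)
  have Tob: "r_ob T = ab" by (simp add: T_def tensor_ring_def ab_def a_def b_def)
  have [simp]: "M \<in> arrs K" "src K M = ab \<boxtimes> ab" "tgt K M = ab" "H \<in> arrs K" "src K H = unt K" "tgt K H = ab"
    by (simp_all add: M_def' H_def' ab_def)
  define LA LB where "LA = (\<mu> \<odot> ?i b) \<cdot> asc' a a b" and "LB = (?i a \<odot> \<nu>) \<cdot> sw b a b"
  have [simp]: "LA \<in> arrs K" "src K LA = a \<boxtimes> ab" "tgt K LA = ab" "LB \<in> arrs K" "src K LB = b \<boxtimes> ab" "tgt K LB = ab"
    by (simp_all add: LA_def LB_def ab_def)
  \<comment> \<open>Multiplication by a \<otimes> b: let b act, then a. The unit law and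
    associativity can now be checked for one action at a time.\<close>
  have m0: "M = LA \<cdot> (?i a \<odot> LB) \<cdot> asc K a b ab"
  proof -
    have "LA \<cdot> (?i a \<odot> LB) \<cdot> asc K a b ab = (\<mu> \<odot> ?i b) \<cdot> asc' a a b \<cdot> (?i a \<odot> (?i a \<odot> \<nu>)) \<cdot> (?i a \<odot> sw b a b) \<cdot> asc K a b (a \<boxtimes> b)"
      by (simp add: LA_def LB_def ab_def whisker_left)
    also have "\<dots> = (\<mu> \<odot> ?i b) \<cdot> (((?i a \<odot> ?i a) \<odot> \<nu>) \<cdot> (asc' a a (b \<boxtimes> b) \<cdot> (?i a \<odot> sw b a b) \<cdot> asc K a b (a \<boxtimes> b)))"
      by (subst asc'_nat_assoc) simp_all
    also have "\<dots> = M"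
      by (subst tarr_cmp_tarr_assoc) (simp_all add: M_def' middle_swap_sw)
    finally show ?thesis ..
  qed
  have m1: "LA \<cdot> (\<mu> \<odot> ?i ab) = LA \<cdot> (?i a \<odot> LA) \<cdot> asc K a a ab"
  proof -
    have "LA \<cdot> (\<mu> \<odot> ?i ab) = ((\<mu> \<cdot> (\<mu> \<odot> ?i a)) \<odot> ?i b) \<cdot> asc' (a \<boxtimes> a) a b"
      by (simp add: LA_def ab_def asc'_nat tarr_cmp_tarr_assoc tarr_idt_idt[symmetric] del: tarr_idt_idt)
    also have "\<dots> = ((\<mu> \<cdot> (?i a \<odot> \<mu>)) \<odot> ?i b) \<cdot> (asc K a a a \<odot> ?i b) \<cdot> asc' (a \<boxtimes> a) a b"
      by (simp add: ma tarr_cmp_tarr_assoc)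
    also have "\<dots> = ((\<mu> \<cdot> (?i a \<odot> \<mu>)) \<odot> ?i b) \<cdot> (asc' a (a \<boxtimes> a) b \<cdot> (?i a \<odot> asc' a a b) \<cdot> asc K a a (a \<boxtimes> b))"
      by (simp add: pentagon_3)
    also have "\<dots> = LA \<cdot> (?i a \<odot> LA) \<cdot> asc K a a ab"
      by (simp add: LA_def ab_def whisker_left whisker_right asc'_nat_assoc)
    finally show ?thesis .
  qed
  have m2: "LB \<cdot> (\<nu> \<odot> ?i ab) = LB \<cdot> (?i b \<odot> LB) \<cdot> asc K b b ab"
  proof -
    have "LB \<cdot> (\<nu> \<odot> ?i ab) = (?i a \<odot> (\<nu> \<cdot> (\<nu> \<odot> ?i b))) \<cdot> sw (b \<boxtimes> b) a b"
      by (simp add: LB_def ab_def sw_nat tarr_cmp_tarr_assoc tarr_idt_idt[symmetric] del: tarr_idt_idt)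
    also have "\<dots> = (?i a \<odot> (\<nu> \<cdot> (?i b \<odot> \<nu>))) \<cdot> (?i a \<odot> asc K b b b) \<cdot> sw (b \<boxtimes> b) a b"
      by (simp add: mb tarr_cmp_tarr_assoc)
    also have "\<dots> = LB \<cdot> (?i b \<odot> LB) \<cdot> asc K b b ab"
      by (simp add: sw_tobj_1 LB_def ab_def whisker_left sw_nat_assoc)
    finally show ?thesis .
  qed
  \<comment> \<open>The actions of the two factors commute; this is the interaction between them
    that associativity requires.\<close>
  have m3: "LB \<cdot> (?i b \<odot> LA) = LA \<cdot> (?i a \<odot> LB) \<cdot> sw b a ab"
  proof -
    have "LB \<cdot> (?i b \<odot> LA) = (\<mu> \<odot> \<nu>) \<cdot> sw b (a \<boxtimes> a) b \<cdot> (?i b \<odot> asc' a a b)"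
      by (simp add: LB_def LA_def whisker_left sw_nat_assoc tarr_cmp_tarr_assoc)
    also have "\<dots> = (\<mu> \<odot> ?i b) \<cdot> ((?i (a \<boxtimes> a) \<odot> \<nu>) \<cdot> (asc' a a (b \<boxtimes> b) \<cdot> (?i a \<odot> sw b a b) \<cdot> sw b a (a \<boxtimes> b)))"
      by (simp add: sw_tobj_2 tarr_cmp_tarr_assoc)
    also have "\<dots> = LA \<cdot> (?i a \<odot> LB) \<cdot> sw b a ab"
      by (simp add: LA_def LB_def ab_def whisker_left asc'_nat_assoc)
    finally show ?thesis .
  qed
  have m4: "LA \<cdot> (\<eta> \<odot> ?i ab) = lun K ab" "LB \<cdot> (\<theta> \<odot> ?i ab) = lun K ab"
  proof -
    have "LA \<cdot> (\<eta> \<odot> ?i ab) = ((\<mu> \<cdot> (\<eta> \<odot> ?i a)) \<odot> ?i b) \<cdot> asc' (unt K) a b"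
      by (simp add: LA_def ab_def asc'_nat tarr_cmp_tarr_assoc tarr_idt_idt[symmetric] del: tarr_idt_idt)
    then show "LA \<cdot> (\<eta> \<odot> ?i ab) = lun K ab"
      by (simp add: ma lun_tobj[symmetric] ab_def)
    have "LB \<cdot> (\<theta> \<odot> ?i ab) = (?i a \<odot> (\<nu> \<cdot> (\<theta> \<odot> ?i b))) \<cdot> sw (unt K) a b"
      by (simp add: LB_def ab_def sw_nat tarr_cmp_tarr_assoc tarr_idt_idt[symmetric] del: tarr_idt_idt)
    then show "LB \<cdot> (\<theta> \<odot> ?i ab) = lun K ab"
      by (simp add: mb lun_sw ab_def)
  qed
  have m1a: "LA \<cdot> (\<mu> \<odot> ?i ab) \<cdot> h = LA \<cdot> (?i a \<odot> LA) \<cdot> asc K a a ab \<cdot> h"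
    if "h \<in> arrs K" "tgt K h = (a \<boxtimes> a) \<boxtimes> ab" for h
    using reassoc[OF m1, of h] that by simp
  have m2a: "LB \<cdot> (\<nu> \<odot> ?i ab) = LB \<cdot> (?i b \<odot> LB) \<cdot> asc K b b ab" by (rule m2)
  \<comment> \<open>Associativity of \<open>M\<close> splits into its compatibility with each
    action: \<open>M1\<close> treats that of \<open>A\<close>, \<open>M2\<close> that of
    \<open>B\<close>.\<close>
  have M1: "M \<cdot> (LA \<odot> ?i ab) = LA \<cdot> (?i a \<odot> M) \<cdot> asc K a ab ab"
  proof -
    have "M \<cdot> (LA \<odot> ?i ab) = LA \<cdot> ((?i a \<odot> LB) \<cdot> ((\<mu> \<odot> ?i (b \<boxtimes> ab)) \<cdot> (asc K (a \<boxtimes> a) b ab \<cdot> (asc' a a b \<odot> ?i ab))))"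
      by (simp add: m0 LA_def[of] whisker_right ab_def[symmetric] asc_nat_assoc)
    also have "\<dots> = LA \<cdot> ((\<mu> \<odot> ?i ab) \<cdot> ((?i (a \<boxtimes> a) \<odot> LB) \<cdot> (asc K (a \<boxtimes> a) b ab \<cdot> (asc' a a b \<odot> ?i ab))))"
      by (simp add: tarr_cmp_tarr_assoc ab_def)
    also have "\<dots> = LA \<cdot> (?i a \<odot> LA) \<cdot> asc K a a ab \<cdot> ((?i a \<odot> ?i a) \<odot> LB) \<cdot> (asc K (a \<boxtimes> a) b ab \<cdot> (asc' a a b \<odot> ?i ab))"
      by (subst m1a) (simp_all add: ab_def)
    also have "\<dots> = LA \<cdot> (?i a \<odot> LA) \<cdot> (?i a \<odot> (?i a \<odot> LB)) \<cdot> (asc K a a (b \<boxtimes> ab) \<cdot> (asc K (a \<boxtimes> a) b ab \<cdot> (asc' a a b \<odot> ?i ab)))"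
      by (subst asc_nat_assoc) (simp_all add: ab_def)
    also have "\<dots> = LA \<cdot> (?i a \<odot> M) \<cdot> asc K a ab ab"
      by (simp add: pentagon_assoc whisker_inv m0 whisker_left ab_def)
    finally show ?thesis .
  qed
  have M2: "M \<cdot> (LB \<odot> ?i ab) = LB \<cdot> (?i b \<odot> M) \<cdot> asc K b ab ab"
  proof -
    have "M \<cdot> (LB \<odot> ?i ab) = LA \<cdot> ((?i a \<odot> LB) \<cdot> ((?i a \<odot> (\<nu> \<odot> ?i ab)) \<cdot> (asc K a (b \<boxtimes> b) ab \<cdot> (sw b a b \<odot> ?i ab))))"
      by (simp add: m0 LB_def[of] whisker_right ab_def[symmetric] asc_nat_assoc)
    also have "\<dots> = LA \<cdot> (?i a \<odot> (LB \<cdot> (\<nu> \<odot> ?i ab))) \<cdot> (asc K a (b \<boxtimes> b) ab \<cdot> (sw b a b \<odot> ?i ab))"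
      by (simp add: whisker_left ab_def)
    also have "\<dots> = LA \<cdot> (?i a \<odot> LB) \<cdot> (?i a \<odot> (?i b \<odot> LB)) \<cdot> ((?i a \<odot> asc K b b ab) \<cdot> asc K a (b \<boxtimes> b) ab \<cdot> (sw b a b \<odot> ?i ab))"
      unfolding m2 by (simp add: whisker_left ab_def)
    also have "\<dots> = LA \<cdot> (?i a \<odot> LB) \<cdot> sw b a ab \<cdot> (?i b \<odot> (?i a \<odot> LB)) \<cdot> (?i b \<odot> asc K a b ab) \<cdot> asc K b ab ab"
      by (simp add: sw_tobj_3[symmetric] sw_nat_assoc ab_def)
    also have "\<dots> = (LB \<cdot> (?i b \<odot> LA)) \<cdot> (?i b \<odot> (?i a \<odot> LB)) \<cdot> (?i b \<odot> asc K a b ab) \<cdot> asc K b ab ab"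
      unfolding m3 by (simp add: ab_def)
    also have "\<dots> = LB \<cdot> (?i b \<odot> M) \<cdot> asc K b ab ab"
      by (simp add: m0 whisker_left ab_def)
    finally show ?thesis .
  qed
  have assoc: "M \<cdot> (M \<odot> ?i ab) = M \<cdot> (?i ab \<odot> M) \<cdot> asc K ab ab ab"
  proof -
    have "M \<cdot> (M \<odot> ?i ab) = (M \<cdot> (LA \<odot> ?i ab)) \<cdot> ((?i a \<odot> LB) \<odot> ?i ab) \<cdot> (asc K a b ab \<odot> ?i ab)"
      by (subst (2) m0) (simp add: whisker_right ab_def)
    also have "\<dots> = LA \<cdot> (?i a \<odot> (M \<cdot> (LB \<odot> ?i ab))) \<cdot> asc K a (b \<boxtimes> ab) ab \<cdot> (asc K a b ab \<odot> ?i ab)"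
      unfolding M1 by (simp add: asc_nat_assoc whisker_left ab_def)
    also have "\<dots> = LA \<cdot> (?i a \<odot> LB) \<cdot> (?i a \<odot> (?i b \<odot> M)) \<cdot> ((?i a \<odot> asc K b ab ab) \<cdot> asc K a (b \<boxtimes> ab) ab \<cdot> (asc K a b ab \<odot> ?i ab))"
      unfolding M2 by (simp add: whisker_left ab_def)
    also have "\<dots> = LA \<cdot> (?i a \<odot> LB) \<cdot> (?i a \<odot> (?i b \<odot> M)) \<cdot> (asc K a b (ab \<boxtimes> ab) \<cdot> asc K ab ab ab)"
      by (simp add: pentagon ab_def)
    also have "\<dots> = LA \<cdot> (?i a \<odot> LB) \<cdot> asc K a b ab \<cdot> ((?i a \<odot> ?i b) \<odot> M) \<cdot> asc K ab ab ab"
      by (subst asc_nat_assoc) (simp_all add: ab_def)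
    also have "\<dots> = M \<cdot> (?i ab \<odot> M) \<cdot> asc K ab ab ab"
      by (simp add: m0 ab_def)
    finally show ?thesis .
  qed
  \<comment> \<open>Multiplication by something whose second component is 1 acts through
    \<open>A\<close> alone. Taking \<open>x\<close> to be \<eta> gives the unit law, taking the
    identity gives the formula for \<open>in1\<close>.\<close>
  have MH: "M \<cdot> (((x \<odot> \<theta>) \<cdot> h) \<odot> f) = LA \<cdot> (x \<odot> f) \<cdot> (run K (src K x) \<odot> ?i (src K f)) \<cdot> (h \<odot> ?i (src K f))"
    if "x \<in> arrs K" "tgt K x = a" "h \<in> arrs K" "tgt K h = src K x \<boxtimes> unt K" "f \<in> arrs K" "tgt K f = ab" for x h f
  proof -
    have "M \<cdot> ((x \<odot> \<theta>) \<odot> f) = LA \<cdot> (x \<odot> ((LB \<cdot> (\<theta> \<odot> ?i ab)) \<cdot> (?i (unt K) \<odot> f))) \<cdot> asc K (src K x) (unt K) (src K f)"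
      using that by (simp add: m0 asc_nat tarr_cmp_tarr_assoc tarr_cmp_tarr)
    also have "\<dots> = LA \<cdot> (x \<odot> f) \<cdot> ((?i (src K x) \<odot> lun K (src K f)) \<cdot> asc K (src K x) (unt K) (src K f))"
      unfolding m4 using that by (simp add: lun_nat tarr_cmp_right)
    also have "\<dots> = LA \<cdot> (x \<odot> f) \<cdot> (run K (src K x) \<odot> ?i (src K f))"
      using that by (simp add: triangle)
    finally have e: "M \<cdot> ((x \<odot> \<theta>) \<odot> f) = LA \<cdot> (x \<odot> f) \<cdot> (run K (src K x) \<odot> ?i (src K f))" .
    show "M \<cdot> (((x \<odot> \<theta>) \<cdot> h) \<odot> f) = LA \<cdot> (x \<odot> f) \<cdot> (run K (src K x) \<odot> ?i (src K f)) \<cdot> (h \<odot> ?i (src K f))"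
      using that reassoc[OF e, of "h \<odot> ?i (src K f)"] by (simp add: tarr_cmp_left ab_def)
  qed
  have unit: "M \<cdot> (H \<odot> ?i ab) = lun K ab"
    by (simp add: H_def' MH lun_unt[symmetric] whisker_inv m4)
  have comm: "M \<cdot> brd K ab ab = M"
    by (simp add: M_def' ab_def brd_middle_swap tarr_cmp_tarr_assoc ma mb)
  show T: "is_ring K T"
    by (rule is_ringI) (simp_all add: Tob M_def[symmetric] H_def[symmetric] assoc unit comm)
  define j1 j2 where "j1 = in1 K A B" and "j2 = in2 K A B"
  have j1: "j1 = (?i a \<odot> \<theta>) \<cdot> run' a" and j2: "j2 = (\<eta> \<odot> ?i b) \<cdot> lun' b"
    by (simp_all add: j1_def j2_def in1_def in2_def a_def b_def \<eta>_def \<theta>_def)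
  have [simp]: "j1 \<in> arrs K" "src K j1 = a" "tgt K j1 = ab" "j2 \<in> arrs K" "src K j2 = b" "tgt K j2 = ab"
    by (simp_all add: j1 j2 ab_def)
  have Mj1: "M \<cdot> (j1 \<odot> f) = LA \<cdot> (?i a \<odot> f)" if "f \<in> arrs K" "tgt K f = ab" for f
    using that by (subst j1, subst MH) (simp_all add: whisker_inv)
  have "LA \<cdot> (?i a \<odot> j2) = ((\<mu> \<cdot> (?i a \<odot> \<eta>)) \<odot> ?i b) \<cdot> asc' a (unt K) b \<cdot> (?i a \<odot> lun' b)"
    by (simp add: LA_def j2 whisker_left asc'_nat_assoc tarr_cmp_tarr_assoc)
  also have "\<dots> = (?i a \<odot> lun K b) \<cdot> (?i a \<odot> lun' b)"
    by (simp add: ma triangle[symmetric])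
  finally have LA2: "LA \<cdot> (?i a \<odot> j2) = ?i ab"
    by (simp add: whisker_inv ab_def)
  then show "prd K T (in1 K A B) (in2 K A B) = idt K (r_ob T)"
    using Mj1[of j2] by (simp add: prd_def M_def[symmetric] j1_def[symmetric] j2_def[symmetric] Tob)
  have "M \<cdot> (j1 \<odot> j1) = LA \<cdot> (?i a \<odot> j1)" by (simp add: Mj1)
  also have "\<dots> = (\<mu> \<odot> \<theta>) \<cdot> asc' a a (unt K) \<cdot> (?i a \<odot> run' a)"
    by (simp add: LA_def j1 whisker_left asc'_nat_assoc tarr_cmp_tarr_assoc)
  also have "asc' a a (unt K) \<cdot> (?i a \<odot> run' a) = run' (a \<boxtimes> a)"
  proof (rule iso_cancel_left[OF run_iso[of "a \<boxtimes> a"]])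
    have "run K (a \<boxtimes> a) \<cdot> asc' a a (unt K) \<cdot> (?i a \<odot> run' a) = ?i (a \<boxtimes> a)"
      by (simp add: run_tobj whisker_inv)
    then show "run K (a \<boxtimes> a) \<cdot> asc' a a (unt K) \<cdot> (?i a \<odot> run' a) = run K (a \<boxtimes> a) \<cdot> run' (a \<boxtimes> a)"
      by simp
  qed simp_all
  also have "(\<mu> \<odot> \<theta>) \<cdot> run' (a \<boxtimes> a) = j1 \<cdot> \<mu>"
    by (simp add: j1 run'_nat tarr_cmp_tarr_assoc)
  finally have J1: "j1 \<cdot> \<mu> = M \<cdot> (j1 \<odot> j1)" ..
  have "j1 \<cdot> \<eta> = H"
    by (simp add: j1 H_def' run'_nat tarr_cmp_tarr_assoc lun_unt)
  then show "ring_mor K A T (in1 K A B)"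
    unfolding ring_mor_def using J1
    by (simp add: Tob M_def[symmetric] H_def[symmetric] j1_def[symmetric] a_def[symmetric] \<mu>_def[symmetric] \<eta>_def[symmetric])
  have "M \<cdot> (j2 \<odot> j2) = M \<cdot> ((\<eta> \<odot> ?i b) \<odot> j2) \<cdot> (lun' b \<odot> ?i b)"
    by (simp add: j2 tarr_cmp_left)
  also have "\<dots> = LA \<cdot> (\<eta> \<odot> (LB \<cdot> (?i b \<odot> j2))) \<cdot> asc K (unt K) b b \<cdot> (lun' b \<odot> ?i b)"
    by (simp add: m0 asc_nat_assoc tarr_cmp_tarr_assoc)
  also have "\<dots> = (LA \<cdot> (\<eta> \<odot> ?i ab)) \<cdot> (?i (unt K) \<odot> (LB \<cdot> (?i b \<odot> j2))) \<cdot> asc K (unt K) b b \<cdot> (lun' b \<odot> ?i b)"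
    by (simp add: tarr_cmp_tarr_assoc)
  also have "\<dots> = (LB \<cdot> (?i b \<odot> j2)) \<cdot> (lun K (b \<boxtimes> b) \<cdot> asc K (unt K) b b) \<cdot> (lun' b \<odot> ?i b)"
    unfolding m4 by (simp add: lun_nat_assoc)
  also have "\<dots> = LB \<cdot> (?i b \<odot> j2)"
    by (simp add: lun_tobj whisker_inv)
  also have "\<dots> = (\<eta> \<odot> \<nu>) \<cdot> sw b (unt K) b \<cdot> (?i b \<odot> lun' b)"
    by (simp add: LB_def j2 whisker_left sw_nat_assoc tarr_cmp_tarr_assoc)
  also have "sw b (unt K) b \<cdot> (?i b \<odot> lun' b) = lun' (b \<boxtimes> b)"
    by (rule iso_cancel_left[OF lun_iso[of "b \<boxtimes> b"]])
      (simp_all add: reassoc[OF lun_sw(1)] whisker_inv)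
  also have "(\<eta> \<odot> \<nu>) \<cdot> lun' (b \<boxtimes> b) = j2 \<cdot> \<nu>"
    by (simp add: j2 lun'_nat tarr_cmp_tarr_assoc)
  finally have J2: "j2 \<cdot> \<nu> = M \<cdot> (j2 \<odot> j2)" ..
  have "j2 \<cdot> \<theta> = H"
    by (simp add: j2 H_def' lun'_nat tarr_cmp_tarr_assoc)
  then show "ring_mor K B T (in2 K A B)"
    unfolding ring_mor_def using J2
    by (simp add: Tob M_def[symmetric] H_def[symmetric] j2_def[symmetric] b_def[symmetric] \<nu>_def[symmetric] \<theta>_def[symmetric])
qed

lemmas is_ring_tensor [simp] = is_ring_tensor_aux(1)
lemmas prd_in1_in2 = is_ring_tensor_aux(2)
lemmas ring_mor_in1 = is_ring_tensor_aux(3)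
lemmas ring_mor_in2 = is_ring_tensor_aux(4)

lemma in1_arr [simp]: "\<lbrakk>is_ring K A; is_ring K B\<rbrakk> \<Longrightarrow> in1 K A B \<in> arrs K"
  and in1_src [simp]: "\<lbrakk>is_ring K A; is_ring K B\<rbrakk> \<Longrightarrow> src K (in1 K A B) = r_ob A"
  and in1_tgt [simp]: "\<lbrakk>is_ring K A; is_ring K B\<rbrakk> \<Longrightarrow> tgt K (in1 K A B) = r_ob A \<boxtimes> r_ob B"
  and in2_arr [simp]: "\<lbrakk>is_ring K A; is_ring K B\<rbrakk> \<Longrightarrow> in2 K A B \<in> arrs K"
  and in2_src [simp]: "\<lbrakk>is_ring K A; is_ring K B\<rbrakk> \<Longrightarrow> src K (in2 K A B) = r_ob B"
  and in2_tgt [simp]: "\<lbrakk>is_ring K A; is_ring K B\<rbrakk> \<Longrightarrow> tgt K (in2 K A B) = r_ob A \<boxtimes> r_ob B"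
  by (simp_all add: in1_def in2_def)

text \<open>Tensor products are coproducts of commutative rings: this is the existence of the
  copairing, and \<open>prd_in1_in2_expand\<close> is its uniqueness.\<close>

lemma prd_ring_mor:
  assumes A: "is_ring K A" and B: "is_ring K B" and R: "is_ring K R"
    and f: "ring_mor K A R f" and g: "ring_mor K B R g"
  shows "ring_mor K (tensor_ring K A B) R (prd K R f g)"
    "prd K R f g \<cdot> in1 K A B = f" "prd K R f g \<cdot> in2 K A B = g"
proof -
  note [simp] = A B R ring_morD[OF f] ring_morD[OF g]
  show 1: "prd K R f g \<cdot> in1 K A B = f"
    by (simp add: in1_def reassoc[OF prd_cmp] prd_unit_right)
  show "prd K R f g \<cdot> in2 K A B = g"
    by (simp add: in2_def reassoc[OF prd_cmp] prd_unit_left)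
  show "ring_mor K (tensor_ring K A B) R (prd K R f g)"
  proof (rule ring_morI)
    have "prd K R f g \<cdot> r_mul (tensor_ring K A B) = prd K R (f \<cdot> r_mul A) (g \<cdot> r_mul B) \<cdot> middle_swap K (r_ob A) (r_ob B) (r_ob A) (r_ob B)"
      by (simp add: tensor_ring_def reassoc[OF prd_cmp])
    also have "\<dots> = prd K R (prd K R f g) (prd K R f g)"
      by (simp add: ring_mor_mul[OF f] ring_mor_mul[OF g] prd_prd[of R f g f g])
    finally show "prd K R f g \<cdot> r_mul (tensor_ring K A B) = prd K R (prd K R f g) (prd K R f g)" .
    have "prd K R f g \<cdot> in1 K A B \<cdot> r_unit A = r_unit R"
      using reassoc[OF 1, of "r_unit A"] by simp
    then show "prd K R f g \<cdot> r_unit (tensor_ring K A B) = r_unit R"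
      using ring_morD(4)[OF ring_mor_in1[OF A B]] by simp
  qed simp_all
qed

lemma prd_in1_in2_expand:
  assumes "is_ring K A" "is_ring K B" "is_ring K R" "ring_mor K (tensor_ring K A B) R u"
  shows "u = prd K R (u \<cdot> in1 K A B) (u \<cdot> in2 K A B)"
proof -
  have "u = u \<cdot> prd K (tensor_ring K A B) (in1 K A B) (in2 K A B)"
    using assms ring_morD[OF assms(4)] by (simp add: prd_in1_in2)
  also have "\<dots> = prd K R (u \<cdot> in1 K A B) (u \<cdot> in2 K A B)"
    using assms by (simp add: ring_mor_prd)
  finally show ?thesis .
qed

end

text \<open>Being different is not stable under change of ring. It is replaced by a condition saying
  that the morphisms agree nowhere, not even on a nonzero part of \<open>R\<close>. Over a zero ring
  any two arrows are disjoint, which is why counting disjoint morphisms only restricts nonzero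
  rings.\<close>

definition disjoint_mors :: "('o, 'm) smc \<Rightarrow> ('o, 'm) ring_obj \<Rightarrow> 'm \<Rightarrow> 'm \<Rightarrow> bool" where
  "disjoint_mors K R f g \<longleftrightarrow> (\<forall>e \<in> Hom K (unt K) (r_ob R).
     scl K R e f = scl K R e g \<longrightarrow> e = zro K (unt K) (r_ob R))"

text \<open>\<open>p\<close> exhibits \<open>C\<close> as the factor of \<open>X\<close> cut out by the idempotent element \<open>e\<close>.\<close>

definition is_loc :: "('o, 'm) smc \<Rightarrow> ('o, 'm) ring_obj \<Rightarrow> 'm \<Rightarrow> ('o, 'm) ring_obj \<Rightarrow> 'm \<Rightarrow> bool" where
  "is_loc K X e C p \<longleftrightarrow> is_ring K X \<and> is_ring K C \<and> e \<in> Hom K (unt K) (r_ob X) \<and> ring_mor K X C p \<and>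
     (\<exists>j \<in> Hom K (r_ob C) (r_ob X). p \<cdot>\<^bsub>K\<^esub> j = idt K (r_ob C) \<and> j \<cdot>\<^bsub>K\<^esub> p = scl K X e (idt K (r_ob X)))"

section \<open>Scaling by elements, and separability expressed by an element\<close>

context symmetric_monoidal_category
begin

lemma scl_arr [simp]: "\<lbrakk>is_ring K A; e \<in> arrs K; src K e = unt K; tgt K e = r_ob A; f \<in> arrs K; tgt K f = r_ob A\<rbrakk> \<Longrightarrow> scl K A e f \<in> arrs K"
  and scl_src [simp]: "\<lbrakk>is_ring K A; e \<in> arrs K; src K e = unt K; tgt K e = r_ob A; f \<in> arrs K; tgt K f = r_ob A\<rbrakk> \<Longrightarrow> src K (scl K A e f) = src K f"
  and scl_tgt [simp]: "\<lbrakk>is_ring K A; e \<in> arrs K; src K e = unt K; tgt K e = r_ob A; f \<in> arrs K; tgt K f = r_ob A\<rbrakk> \<Longrightarrow> tgt K (scl K A e f) = r_ob A"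
  by (simp_all add: scl_def)

lemma scl_cmp:
  assumes "is_ring K A" "e \<in> arrs K" "src K e = unt K" "tgt K e = r_ob A" "f \<in> arrs K" "tgt K f = r_ob A"
    "k \<in> arrs K" "src K f = tgt K k"
  shows "scl K A e f \<cdot> k = scl K A e (f \<cdot> k)"
  using assms by (simp add: scl_def lun'_nat reassoc[OF prd_cmp])

lemma scl_unit [simp]:
  assumes "is_ring K A" "f \<in> arrs K" "tgt K f = r_ob A"
  shows "scl K A (r_unit A) f = f"
  using assms by (simp add: scl_def prd_unit_left)

lemma scl_prd_left:
  assumes "is_ring K A" "e \<in> arrs K" "src K e = unt K" "tgt K e = r_ob A" "f \<in> arrs K" "tgt K f = r_ob A"
    "g \<in> arrs K" "tgt K g = r_ob A"
  shows "scl K A e (prd K A f g) = prd K A (scl K A e f) g"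
proof -
  have "lun K (src K f) \<odot> idt K (src K g) \<in> arrs K" using assms by simp
  have "prd K A (scl K A e f) g = prd K A (prd K A e f) g \<cdot> (lun' (src K f) \<odot> idt K (src K g))"
    using assms by (simp add: scl_def prd_cmp)
  also have "\<dots> = prd K A e (prd K A f g) \<cdot> asc K (unt K) (src K f) (src K g) \<cdot> (lun' (src K f) \<odot> idt K (src K g))"
    using assms by (simp add: prd_assoc)
  also have "asc K (unt K) (src K f) (src K g) \<cdot> (lun' (src K f) \<odot> idt K (src K g)) = lun' (src K f \<boxtimes> src K g)"
    by (rule iso_cancel_left[OF lun_iso[of "src K f \<boxtimes> src K g"]])
      (use assms in \<open>simp_all add: reassoc[OF lun_tobj] whisker_inv\<close>)
  finally show ?thesis using assms by (simp add: scl_def)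
qed

lemma scl_prd_right:
  assumes "is_ring K A" "e \<in> arrs K" "src K e = unt K" "tgt K e = r_ob A" "f \<in> arrs K" "tgt K f = r_ob A"
    "g \<in> arrs K" "tgt K g = r_ob A"
  shows "scl K A e (prd K A f g) = prd K A f (scl K A e g)"
proof -
  have "scl K A e (prd K A f g) = scl K A e (prd K A g f \<cdot> brd K (src K f) (src K g))"
    using assms by (simp add: prd_comm[of A f g])
  also have "\<dots> = prd K A (scl K A e g) f \<cdot> brd K (src K f) (src K g)"
    using assms by (simp add: scl_cmp[symmetric] scl_prd_left)
  also have "\<dots> = prd K A f (scl K A e g)"
    using assms by (simp add: prd_comm[of A f "scl K A e g"])
  finally show ?thesis .
qed

lemma scl_scl:
  assumes "is_ring K A" "e \<in> arrs K" "src K e = unt K" "tgt K e = r_ob A" "d \<in> arrs K" "src K d = unt K" "tgt K d = r_ob A"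
    "f \<in> arrs K" "tgt K f = r_ob A"
  shows "scl K A e (scl K A d f) = scl K A (scl K A e d) f"
proof -
  have "scl K A e (scl K A d f) = scl K A e (prd K A d f) \<cdot> lun' (src K f)"
    using assms by (simp add: scl_def[of K A d f] scl_cmp)
  also have "\<dots> = prd K A (scl K A e d) f \<cdot> lun' (src K f)"
    using assms by (simp add: scl_prd_left)
  finally show ?thesis using assms by (simp add: scl_def[of K A "scl K A e d"])
qed

lemma scl_element_unit [simp]:
  assumes "is_ring K A" "e \<in> arrs K" "src K e = unt K" "tgt K e = r_ob A"
  shows "scl K A e (r_unit A) = e"
  using assms by (simp add: scl_def prd_unit_right lun_unt)

lemma brd_unt: "brd K (unt K) (unt K) = idt K (unt K \<boxtimes> unt K)"
  by (rule iso_cancel_left[OF lun_iso[of "unt K"]]) (use lun_brd[of "unt K"] lun_unt in auto)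

lemma scl_comm:
  assumes "is_ring K A" "e \<in> arrs K" "src K e = unt K" "tgt K e = r_ob A" "d \<in> arrs K" "src K d = unt K" "tgt K d = r_ob A"
  shows "scl K A e d = scl K A d e"
  using assms by (simp add: scl_def prd_comm[of A e d] brd_unt)

lemma ring_mor_scl:
  assumes u: "ring_mor K A B u" and "is_ring K A" "is_ring K B" "e \<in> arrs K" "src K e = unt K" "tgt K e = r_ob A"
    "f \<in> arrs K" "tgt K f = r_ob A"
  shows "u \<cdot> scl K A e f = scl K B (u \<cdot> e) (u \<cdot> f)"
  using assms ring_morD[OF u] reassoc[OF ring_mor_prd[OF u], of e f "lun' (src K f)"] by (simp add: scl_def)

lemma ring_mor_mul_self: "is_ring K A \<Longrightarrow> ring_mor K (tensor_ring K A A) A (r_mul A)"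
  "is_ring K A \<Longrightarrow> r_mul A \<cdot> in1 K A A = idt K (r_ob A)"
  "is_ring K A \<Longrightarrow> r_mul A \<cdot> in2 K A A = idt K (r_ob A)"
  using prd_ring_mor[of A A A "idt K (r_ob A)" "idt K (r_ob A)"] by (simp_all add: ring_mor_idt prd_idt)

text \<open>A bilinear section \<sigma> of the multiplication is determined by its value s on the
  unit, and bilinearity says that a \<otimes> 1 and 1 \<otimes> a have the same product with s. This
  is the classical separability element; unlike \<sigma>, it is simply carried along by ring
  morphisms.\<close>

lemma separable_iff:
  assumes A: "is_ring K A"
  shows "separable K A \<longleftrightarrow> (\<exists>s \<in> Hom K (unt K) (r_ob A \<boxtimes> r_ob A). r_mul A \<cdot> s = r_unit A \<and>
     scl K (tensor_ring K A A) s (in1 K A A) = scl K (tensor_ring K A A) s (in2 K A A))"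
    (is "_ \<longleftrightarrow> ?R")
proof -
  let ?a = "r_ob A" and ?\<mu> = "r_mul A" and ?T = "tensor_ring K A A" and ?i = "idt K (r_ob A)"
  let ?j1 = "in1 K A A" and ?j2 = "in2 K A A"
  note [simp] = A
  have id: "prd K ?T ?j1 ?j2 = idt K (?a \<boxtimes> ?a)" using prd_in1_in2[OF A A] by simp
  \<comment> \<open>\<open>r2\<close> and \<open>r1\<close> identify the actions occurring in
    \<open>separable\<close> with multiplication by the two copies of \<open>A\<close> inside the
    tensor ring.\<close>
  have r2: "prd K ?T x ?j2 = (?i \<odot> ?\<mu>) \<cdot> asc K ?a ?a ?a \<cdot> (x \<odot> ?i)" if "x \<in> arrs K" "tgt K x = ?a \<boxtimes> ?a" for x
  proof -
    have "prd K ?T x ?j2 = prd K ?T (prd K ?T ?j1 ?j2) ?j2 \<cdot> (x \<odot> ?i)"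
      using that by (simp add: prd_cmp id)
    also have "\<dots> = prd K ?T ?j1 (?j2 \<cdot> ?\<mu>) \<cdot> asc K ?a ?a ?a \<cdot> (x \<odot> ?i)"
      using that by (simp add: prd_assoc ring_mor_mul[OF ring_mor_in2])
    also have "prd K ?T ?j1 (?j2 \<cdot> ?\<mu>) = prd K ?T ?j1 ?j2 \<cdot> (?i \<odot> ?\<mu>)"
      by (simp add: prd_cmp)
    finally show ?thesis using that by (simp add: id)
  qed
  have r1: "prd K ?T ?j1 x = (?\<mu> \<odot> ?i) \<cdot> asc' ?a ?a ?a \<cdot> (?i \<odot> x)" if "x \<in> arrs K" "tgt K x = ?a \<boxtimes> ?a" for x
  proof -
    have "prd K ?T ?j1 x = prd K ?T ?j1 (prd K ?T ?j1 ?j2) \<cdot> (?i \<odot> x)"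
      using that by (simp add: prd_cmp id)
    also have "\<dots> = (prd K ?T (prd K ?T ?j1 ?j1) ?j2 \<cdot> asc' ?a ?a ?a) \<cdot> (?i \<odot> x)"
      using that by (simp add: prd_assoc)
    also have "\<dots> = prd K ?T (?j1 \<cdot> ?\<mu>) ?j2 \<cdot> asc' ?a ?a ?a \<cdot> (?i \<odot> x)"
      using that by (simp add: ring_mor_mul[OF ring_mor_in1])
    also have "prd K ?T (?j1 \<cdot> ?\<mu>) ?j2 = prd K ?T ?j1 ?j2 \<cdot> (?\<mu> \<odot> ?i)"
      by (simp add: prd_cmp)
    finally show ?thesis using that by (simp add: id)
  qed
  show ?thesis
  proof
    assume "separable K A"
    then obtain \<sigma> where s0: "\<sigma> \<in> Hom K ?a (?a \<boxtimes> ?a)" and s: "?\<mu> \<cdot> \<sigma> = ?i"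
      "(?i \<odot> ?\<mu>) \<cdot> asc K ?a ?a ?a \<cdot> (\<sigma> \<odot> ?i) = \<sigma> \<cdot> ?\<mu>"
      "(?\<mu> \<odot> ?i) \<cdot> asc' ?a ?a ?a \<cdot> (?i \<odot> \<sigma>) = \<sigma> \<cdot> ?\<mu>"
      unfolding separable_def Let_def by blast
    have [simp]: "\<sigma> \<in> arrs K" "src K \<sigma> = ?a" "tgt K \<sigma> = ?a \<boxtimes> ?a" using s0 by auto
    let ?s = "\<sigma> \<cdot> r_unit A"
    have "scl K ?T ?s ?j2 = ((?i \<odot> ?\<mu>) \<cdot> asc K ?a ?a ?a \<cdot> (\<sigma> \<odot> ?i)) \<cdot> (r_unit A \<odot> ?i) \<cdot> lun' ?a"
      by (simp add: scl_def r2 tarr_cmp_left)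
    also have "\<dots> = \<sigma> \<cdot> (?\<mu> \<cdot> (r_unit A \<odot> ?i)) \<cdot> lun' ?a" unfolding s by simp
    also have "\<dots> = \<sigma>" by (simp add: ring_mul_unit_left)
    finally have 2: "scl K ?T ?s ?j2 = \<sigma>" .
    have "scl K ?T ?s ?j1 = prd K ?T ?j1 ?s \<cdot> brd K (unt K) ?a \<cdot> lun' ?a"
      by (simp add: scl_def prd_comm[of ?T ?s ?j1])
    also have "brd K (unt K) ?a \<cdot> lun' ?a = run' ?a"
    proof (rule iso_cancel_left[OF run_iso[of ?a]])
      have "(lun K ?a \<cdot> brd K ?a (unt K)) \<cdot> brd K (unt K) ?a \<cdot> lun' ?a = ?i" by simp
      then show "run K ?a \<cdot> brd K (unt K) ?a \<cdot> lun' ?a = run K ?a \<cdot> run' ?a"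
        unfolding lun_brd[OF ring_ob[OF A]] by simp
    qed simp_all
    also have "prd K ?T ?j1 ?s \<cdot> run' ?a = ((?\<mu> \<odot> ?i) \<cdot> asc' ?a ?a ?a \<cdot> (?i \<odot> \<sigma>)) \<cdot> (?i \<odot> r_unit A) \<cdot> run' ?a"
      by (simp add: r1 tarr_cmp_right)
    also have "\<dots> = \<sigma> \<cdot> (?\<mu> \<cdot> (?i \<odot> r_unit A)) \<cdot> run' ?a" unfolding s by simp
    also have "\<dots> = \<sigma>" by (simp add: ring_mul_unit_right)
    finally have 1: "scl K ?T ?s ?j1 = \<sigma>" .
    have "?\<mu> \<cdot> ?s = r_unit A" using reassoc[OF s(1), of "r_unit A"] by simp
    then show ?R using 1 2 by (intro bexI[of _ ?s]) auto
  next
    assume ?R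
    then obtain s where s: "s \<in> Hom K (unt K) (?a \<boxtimes> ?a)" "?\<mu> \<cdot> s = r_unit A" "scl K ?T s ?j1 = scl K ?T s ?j2"
      by blast
    have [simp]: "s \<in> arrs K" "src K s = unt K" "tgt K s = ?a \<boxtimes> ?a" using s(1) by auto
    \<comment> \<open>Conversely, \<sigma> sends a to the product of s with a \<otimes> 1.\<close>
    let ?\<sigma> = "scl K ?T s ?j1"
    have 0: "?\<mu> \<cdot> ?\<sigma> = ?i"
      by (simp add: ring_mor_scl[OF ring_mor_mul_self(1)] s(2) ring_mor_mul_self(2))
    have "?\<sigma> \<cdot> ?\<mu> = scl K ?T s (prd K ?T ?j1 ?j1)"
      by (simp add: scl_cmp ring_mor_mul[OF ring_mor_in1])
    also have "\<dots> = prd K ?T ?j1 (scl K ?T s ?j2)" by (simp add: scl_prd_right s(3))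
    also have "\<dots> = scl K ?T s (idt K (?a \<boxtimes> ?a))" by (simp add: scl_prd_right[symmetric] id)
    finally have 3: "?\<sigma> \<cdot> ?\<mu> = scl K ?T s (idt K (?a \<boxtimes> ?a))" .
    have 1: "(?i \<odot> ?\<mu>) \<cdot> asc K ?a ?a ?a \<cdot> (?\<sigma> \<odot> ?i) = ?\<sigma> \<cdot> ?\<mu>"
      unfolding 3 by (simp add: r2[symmetric] scl_prd_left[symmetric] id)
    have 2: "(?\<mu> \<odot> ?i) \<cdot> asc' ?a ?a ?a \<cdot> (?i \<odot> ?\<sigma>) = ?\<sigma> \<cdot> ?\<mu>"
      unfolding 3 by (simp add: r1[symmetric] s(3) scl_prd_right[symmetric] id)
    have "?\<sigma> \<in> Hom K ?a (?a \<boxtimes> ?a)" by simp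
    then show "separable K A" unfolding separable_def Let_def using 0 1 2 by blast
  qed
qed

text \<open>Since s identifies the two copies of \<open>A\<close>, the product s x depends only on
  \<mu>(x): it equals s (\<mu>(x) \<otimes> 1). Applied to x = s, where \<mu>(s) = 1, this makes s
  idempotent.\<close>

lemma separableE:
  assumes A: "is_ring K A" and "separable K A"
  obtains s where "s \<in> arrs K" "src K s = unt K" "tgt K s = r_ob A \<boxtimes> r_ob A" "r_mul A \<cdot> s = r_unit A"
     "scl K (tensor_ring K A A) s (in1 K A A) = scl K (tensor_ring K A A) s (in2 K A A)"
     "scl K (tensor_ring K A A) s (idt K (r_ob A \<boxtimes> r_ob A)) = scl K (tensor_ring K A A) s (in1 K A A) \<cdot> r_mul A"
     "scl K (tensor_ring K A A) s s = s"
proof -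
  let ?a = "r_ob A" and ?\<mu> = "r_mul A" and ?T = "tensor_ring K A A"
  let ?j1 = "in1 K A A" and ?j2 = "in2 K A A"
  note [simp] = A
  obtain s where s: "s \<in> Hom K (unt K) (?a \<boxtimes> ?a)" "?\<mu> \<cdot> s = r_unit A" "scl K ?T s ?j1 = scl K ?T s ?j2"
    using assms by (auto simp only: separable_iff[OF A])
  have [simp]: "s \<in> arrs K" "src K s = unt K" "tgt K s = ?a \<boxtimes> ?a" using s(1) by auto
  have "scl K ?T s (idt K (?a \<boxtimes> ?a)) = scl K ?T s (prd K ?T ?j1 ?j2)"
    using prd_in1_in2[OF A A] by simp
  also have "\<dots> = scl K ?T s (prd K ?T ?j1 ?j1)" by (simp add: scl_prd_right s(3))
  also have "\<dots> = scl K ?T s ?j1 \<cdot> ?\<mu>" by (simp add: scl_cmp ring_mor_mul[OF ring_mor_in1, symmetric])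
  finally have 1: "scl K ?T s (idt K (?a \<boxtimes> ?a)) = scl K ?T s ?j1 \<cdot> ?\<mu>" .
  have "scl K ?T s s = scl K ?T s (idt K (?a \<boxtimes> ?a)) \<cdot> s" by (simp add: scl_cmp)
  also have "\<dots> = scl K ?T s (?j1 \<cdot> r_unit A)" unfolding 1 by (simp add: s(2) scl_cmp)
  also have "\<dots> = s" by (simp add: ring_morD(4)[OF ring_mor_in1] scl_element_unit[of ?T])
  finally have 2: "scl K ?T s s = s" .
  show ?thesis by (rule that[OF _ _ _ s(2,3) 1 2]) simp_all
qed

lemma separableI:
  assumes "is_ring K A" "s \<in> arrs K" "src K s = unt K" "tgt K s = r_ob A \<boxtimes> r_ob A" "r_mul A \<cdot> s = r_unit A"
     "scl K (tensor_ring K A A) s (in1 K A A) = scl K (tensor_ring K A A) s (in2 K A A)"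
   shows "separable K A"
  unfolding separable_iff[OF assms(1)] using assms by (intro bexI[of _ s]) auto

text \<open>The image of the separability element under p \<otimes> p works for \<open>C\<close>.
  The section \<open>j\<close> is an arrow of \<open>K\<close>, not a ring morphism; it serves to
  cancel \<open>p\<close> when the two inclusions of \<open>C\<close> are compared.\<close>

lemma separable_quotient:
  assumes T: "is_ring K T" "separable K T" and C: "is_ring K C" and p: "ring_mor K T C p"
    and j: "j \<in> arrs K" "src K j = r_ob C" "tgt K j = r_ob T" "p \<cdot> j = idt K (r_ob C)"
  shows "separable K C"
proof -
  note [simp] = T(1) C ring_morD[OF p] j
  let ?U = "tensor_ring K C C" and ?V = "tensor_ring K T T"
  obtain s where s: "s \<in> arrs K" "src K s = unt K" "tgt K s = r_ob T \<boxtimes> r_ob T" "r_mul T \<cdot> s = r_unit T"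
     "scl K ?V s (in1 K T T) = scl K ?V s (in2 K T T)"
    by (rule separableE[OF T]) blast
  note [simp] = s(1-3)
  have f: "ring_mor K T ?U (in1 K C C \<cdot> p)" "ring_mor K T ?U (in2 K C C \<cdot> p)"
    by (auto intro!: ring_mor_cmp[OF p] ring_mor_in1 ring_mor_in2)
  let ?w = "prd K ?U (in1 K C C \<cdot> p) (in2 K C C \<cdot> p)"
  have w: "ring_mor K ?V ?U ?w" "?w \<cdot> in1 K T T = in1 K C C \<cdot> p" "?w \<cdot> in2 K T T = in2 K C C \<cdot> p"
    by (rule prd_ring_mor[OF _ _ _ f]; simp)+
  note [simp] = ring_morD[OF w(1)]
  let ?s = "?w \<cdot> s"
  have "r_mul C \<cdot> ?w = prd K C (r_mul C \<cdot> in1 K C C \<cdot> p) (r_mul C \<cdot> in2 K C C \<cdot> p)"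
    by (simp add: ring_mor_prd[OF ring_mor_mul_self(1)])
  also have "\<dots> = p \<cdot> r_mul T"
    by (simp add: reassoc[OF ring_mor_mul_self(2)] reassoc[OF ring_mor_mul_self(3)] ring_mor_mul[OF p])
  finally have "(r_mul C \<cdot> ?w) \<cdot> s = r_unit C"
    by (simp add: s(4))
  then have 1: "r_mul C \<cdot> ?s = r_unit C" by simp
  have "scl K ?U ?s (in1 K C C) \<cdot> p = ?w \<cdot> scl K ?V s (in1 K T T)"
    by (simp add: ring_mor_scl[OF w(1)] w(2) scl_cmp)
  also have "\<dots> = scl K ?U ?s (in2 K C C) \<cdot> p"
    unfolding s(5) by (simp add: ring_mor_scl[OF w(1)] w(3) scl_cmp)
  finally have 2: "scl K ?U ?s (in1 K C C) = scl K ?U ?s (in2 K C C)"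
    by (rule sect_cancel_right[OF j(4)]) simp_all
  show ?thesis by (rule separableI[OF C _ _ _ 1 2]) simp_all
qed

text \<open>The separability elements of \<open>A\<close> and \<open>B\<close> are moved into the
  tensor square of their tensor product, along the two inclusions of each ring. Their product there
  is the required element.\<close>

lemma separable_tensor:
  assumes A: "is_ring K A" "separable K A" and B: "is_ring K B" "separable K B"
  shows "separable K (tensor_ring K A B)"
proof -
  note [simp] = A(1) B(1)
  let ?T = "tensor_ring K A B"
  let ?U = "tensor_ring K ?T ?T"
  obtain s where s: "s \<in> arrs K" "src K s = unt K" "tgt K s = r_ob A \<boxtimes> r_ob A" "r_mul A \<cdot> s = r_unit A"
     "scl K (tensor_ring K A A) s (in1 K A A) = scl K (tensor_ring K A A) s (in2 K A A)"
    by (rule separableE[OF A]) blast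
  obtain t where t: "t \<in> arrs K" "src K t = unt K" "tgt K t = r_ob B \<boxtimes> r_ob B" "r_mul B \<cdot> t = r_unit B"
     "scl K (tensor_ring K B B) t (in1 K B B) = scl K (tensor_ring K B B) t (in2 K B B)"
    by (rule separableE[OF B]) blast
  note [simp] = s(1-3) t(1-3)
  define f1 g1 f2 g2 where "f1 = in1 K ?T ?T \<cdot> in1 K A B" and "g1 = in2 K ?T ?T \<cdot> in1 K A B"
    and "f2 = in1 K ?T ?T \<cdot> in2 K A B" and "g2 = in2 K ?T ?T \<cdot> in2 K A B"
  have m: "ring_mor K A ?U f1" "ring_mor K A ?U g1" "ring_mor K B ?U f2" "ring_mor K B ?U g2"
    unfolding f1_def g1_def f2_def g2_def
    by (auto intro!: ring_mor_cmp ring_mor_in1 ring_mor_in2)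
  note [simp] = ring_morD(1-3)[OF m(1)] ring_morD(1-3)[OF m(2)] ring_morD(1-3)[OF m(3)] ring_morD(1-3)[OF m(4)]
  have w: "ring_mor K (tensor_ring K A A) ?U (prd K ?U f1 g1)" "ring_mor K (tensor_ring K B B) ?U (prd K ?U f2 g2)"
    "prd K ?U f1 g1 \<cdot> in1 K A A = f1" "prd K ?U f1 g1 \<cdot> in2 K A A = g1"
    "prd K ?U f2 g2 \<cdot> in1 K B B = f2" "prd K ?U f2 g2 \<cdot> in2 K B B = g2"
    using prd_ring_mor[OF _ _ _ m(1,2)] prd_ring_mor[OF _ _ _ m(3,4)] by simp_all
  define e where "e = prd K ?U f1 g1 \<cdot> s"
  define d where "d = prd K ?U f2 g2 \<cdot> t"
  have [simp]: "e \<in> arrs K" "src K e = unt K" "tgt K e = r_ob ?T \<boxtimes> r_ob ?T"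
     "d \<in> arrs K" "src K d = unt K" "tgt K d = r_ob ?T \<boxtimes> r_ob ?T"
    by (simp_all add: e_def d_def)
  have e: "scl K ?U e f1 = scl K ?U e g1"
    using arg_cong[OF s(5), of "\<lambda>x. prd K ?U f1 g1 \<cdot> x"] by (simp add: ring_mor_scl[OF w(1)] w e_def)
  have d: "scl K ?U d f2 = scl K ?U d g2"
    using arg_cong[OF t(5), of "\<lambda>x. prd K ?U f2 g2 \<cdot> x"] by (simp add: ring_mor_scl[OF w(2)] w d_def)
  \<comment> \<open>Scaling a product by e d distributes as e on the first factor and d on the
    second, so the copies of \<open>A\<close> and the copies of \<open>B\<close> can be exchanged
    separately.\<close>
  have sc: "scl K ?U (scl K ?U e d) (prd K ?U x y) = prd K ?U (scl K ?U e x) (scl K ?U d y)"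
    if "x \<in> arrs K" "tgt K x = r_ob ?T \<boxtimes> r_ob ?T" "y \<in> arrs K" "tgt K y = r_ob ?T \<boxtimes> r_ob ?T" for x y
  proof -
    have "scl K ?U (scl K ?U e d) (prd K ?U x y) = scl K ?U e (prd K ?U x (scl K ?U d y))"
      using that by (simp add: scl_scl[symmetric] scl_prd_right)
    then show ?thesis using that by (simp add: scl_prd_left)
  qed
  have i1: "in1 K ?T ?T = prd K ?U f1 f2" "in2 K ?T ?T = prd K ?U g1 g2"
    unfolding f1_def g1_def f2_def g2_def
    by (rule prd_in1_in2_expand; simp add: ring_mor_in1 ring_mor_in2)+
  have 2: "scl K ?U (scl K ?U e d) (in1 K ?T ?T) = scl K ?U (scl K ?U e d) (in2 K ?T ?T)"
    unfolding i1 by (subst (1 2) sc) (simp_all add: e d)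
  have mT: "r_mul ?T \<cdot> f1 = in1 K A B" "r_mul ?T \<cdot> g1 = in1 K A B" "r_mul ?T \<cdot> f2 = in2 K A B" "r_mul ?T \<cdot> g2 = in2 K A B"
    unfolding f1_def g1_def f2_def g2_def
    using reassoc[OF ring_mor_mul_self(2)[of ?T]] reassoc[OF ring_mor_mul_self(3)[of ?T]] by simp_all
  have "r_mul ?T \<cdot> e = (r_mul ?T \<cdot> prd K ?U f1 g1) \<cdot> s" by (simp add: e_def)
  also have "\<dots> = in1 K A B \<cdot> r_mul A \<cdot> s"
    by (simp add: ring_mor_prd[OF ring_mor_mul_self(1)] mT ring_mor_mul[OF ring_mor_in1, symmetric])
  finally have me: "r_mul ?T \<cdot> e = r_unit ?T" by (simp add: s(4) ring_morD(4)[OF ring_mor_in1])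
  have "r_mul ?T \<cdot> d = (r_mul ?T \<cdot> prd K ?U f2 g2) \<cdot> t" by (simp add: d_def)
  also have "\<dots> = in2 K A B \<cdot> r_mul B \<cdot> t"
    by (simp add: ring_mor_prd[OF ring_mor_mul_self(1)] mT ring_mor_mul[OF ring_mor_in2, symmetric])
  finally have md: "r_mul ?T \<cdot> d = r_unit ?T" by (simp add: t(4) ring_morD(4)[OF ring_mor_in2])
  have 1: "r_mul ?T \<cdot> scl K ?U e d = r_unit ?T"
    by (subst ring_mor_scl[OF ring_mor_mul_self(1)]) (simp_all add: me md)
  show ?thesis by (rule separableI[OF _ _ _ _ 1 2]) simp_all
qed

text \<open>Each axiom is tested after precomposition with a tensor product of copies of
  \<open>p\<close> and identities, which is again split epimorphic; there it becomes the axiom for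
  \<open>T\<close> followed by \<open>p\<close>.\<close>

lemma quotient_ring:
  assumes T: "is_ring K T" and p: "p \<in> arrs K" "src K p = r_ob T" "tgt K p = c"
    and j: "j \<in> arrs K" "src K j = c" "tgt K j = r_ob T" "p \<cdot> j = idt K c"
    and M: "M \<in> arrs K" "src K M = c \<boxtimes> c" "tgt K M = c" "M \<cdot> (p \<odot> p) = p \<cdot> r_mul T"
    and C: "C = \<lparr>r_ob = c, r_mul = M, r_unit = p \<cdot> r_unit T\<rparr>"
  shows "is_ring K C" "ring_mor K T C p"
proof -
  let ?t = "r_ob T" and ?i = "idt K"
  have [simp]: "c \<in> objs K" using p by auto
  note [simp] = T p j M(1-3)
  have Mx: "M \<cdot> ((p \<cdot> f) \<odot> (p \<cdot> g)) = p \<cdot> prd K T f g" if "f \<in> arrs K" "g \<in> arrs K" "tgt K f = ?t" "tgt K g = ?t" for f g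
    using that reassoc[OF M(4), of "f \<odot> g"] by (simp add: prd_def tarr_cmp_tarr)
  have s2: "(p \<odot> p) \<cdot> (j \<odot> j) = ?i (c \<boxtimes> c)" by (simp add: tarr_cmp_tarr)
  have s3: "((p \<odot> p) \<odot> p) \<cdot> ((j \<odot> j) \<odot> j) = ?i ((c \<boxtimes> c) \<boxtimes> c)" by (simp add: tarr_cmp_tarr)
  have s1: "(?i (unt K) \<odot> p) \<cdot> (?i (unt K) \<odot> j) = ?i (unt K \<boxtimes> c)" by (simp add: tarr_cmp_tarr)
  have 1: "M \<cdot> (M \<odot> ?i c) = M \<cdot> (?i c \<odot> M) \<cdot> asc K c c c"
  proof (rule sect_cancel_right[OF s3])
    have "(M \<cdot> (M \<odot> ?i c)) \<cdot> ((p \<odot> p) \<odot> p) = M \<cdot> ((p \<cdot> r_mul T) \<odot> (p \<cdot> ?i ?t))"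
      by (simp add: tarr_cmp_tarr M(4))
    also have "\<dots> = p \<cdot> prd K T (r_mul T) (?i ?t)" by (rule Mx) simp_all
    also have "\<dots> = p \<cdot> prd K T (?i ?t) (r_mul T) \<cdot> asc K ?t ?t ?t"
      by (simp add: prd_def ring_mul_assoc)
    also have "\<dots> = M \<cdot> ((p \<cdot> ?i ?t) \<odot> (p \<cdot> r_mul T)) \<cdot> asc K ?t ?t ?t"
      using reassoc[OF Mx[of "?i ?t" "r_mul T"], of "asc K ?t ?t ?t"] by simp
    also have "\<dots> = (M \<cdot> (?i c \<odot> M) \<cdot> asc K c c c) \<cdot> ((p \<odot> p) \<odot> p)"
      by (simp add: asc_nat tarr_cmp_tarr_assoc M(4))
    finally show "(M \<cdot> (M \<odot> ?i c)) \<cdot> ((p \<odot> p) \<odot> p) = (M \<cdot> (?i c \<odot> M) \<cdot> asc K c c c) \<cdot> ((p \<odot> p) \<odot> p)" .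
  qed simp_all
  have 2: "M \<cdot> ((p \<cdot> r_unit T) \<odot> ?i c) = lun K c"
  proof (rule sect_cancel_right[OF s1])
    have "(M \<cdot> ((p \<cdot> r_unit T) \<odot> ?i c)) \<cdot> (?i (unt K) \<odot> p) = M \<cdot> ((p \<cdot> r_unit T) \<odot> (p \<cdot> ?i ?t))"
      by (simp add: tarr_cmp_tarr)
    also have "\<dots> = p \<cdot> prd K T (r_unit T) (?i ?t)" by (rule Mx) simp_all
    also have "\<dots> = lun K c \<cdot> (?i (unt K) \<odot> p)" by (simp add: prd_unit_left lun_nat)
    finally show "(M \<cdot> ((p \<cdot> r_unit T) \<odot> ?i c)) \<cdot> (?i (unt K) \<odot> p) = lun K c \<cdot> (?i (unt K) \<odot> p)" .
  qed simp_all
  have 3: "M \<cdot> brd K c c = M"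
  proof (rule sect_cancel_right[OF s2])
    show "(M \<cdot> brd K c c) \<cdot> (p \<odot> p) = M \<cdot> (p \<odot> p)"
      using reassoc[OF M(4), of "brd K ?t ?t"] by (simp add: brd_nat M(4) ring_mul_comm)
  qed simp_all
  show R: "is_ring K C" by (rule is_ringI) (simp_all add: C 1 2 3)
  show "ring_mor K T C p"
    by (simp add: ring_mor_def C M(4))
qed

text \<open>Multiplicativity is an equation out of the tensor square of \<open>C\<close>, and
  \<open>p \<odot> p\<close> onto it is split because \<open>p\<close> is.\<close>

lemma ring_mor_cancel_epi:
  assumes "is_ring K X" "is_ring K C" "is_ring K R" and p: "ring_mor K X C p"
    and j: "j \<in> arrs K" "src K j = r_ob C" "tgt K j = r_ob X" "p \<cdot> j = idt K (r_ob C)"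
    and v: "v \<in> arrs K" "src K v = r_ob C" "tgt K v = r_ob R" and vp: "ring_mor K X R (v \<cdot> p)"
  shows "ring_mor K C R v"
proof (rule ring_morI)
  note [simp] = assms(1-3) ring_morD[OF p] j v
  have s: "(p \<odot> p) \<cdot> (j \<odot> j) = idt K (r_ob C \<boxtimes> r_ob C)" by (simp add: tarr_cmp_tarr)
  have "(v \<cdot> r_mul C) \<cdot> (p \<odot> p) = v \<cdot> p \<cdot> r_mul X"
    using ring_mor_mul[OF p] by (simp add: prd_def)
  also have "\<dots> = prd K R v v \<cdot> (p \<odot> p)"
    using ring_mor_mul[OF vp] by (simp add: prd_cmp)
  finally show "v \<cdot> r_mul C = prd K R v v"
    by (rule sect_cancel_right[OF s]) simp_all
  show "v \<cdot> r_unit C = r_unit R"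
    using ring_morD(4)[OF vp] by simp
qed (use assms in simp_all)

end

section \<open>Localisation at idempotent elements and products\<close>

text \<open>One separability idempotent is fixed per ring, so that \<open>eql\<close> is a function
  of the two morphisms and its naturality is an equation.\<close>

definition sep_elt :: "('o, 'm) smc \<Rightarrow> ('o, 'm) ring_obj \<Rightarrow> 'm" where
  "sep_elt K A = (SOME s. s \<in> Hom K (unt K) (r_ob A \<boxtimes>\<^bsub>K\<^esub> r_ob A) \<and> r_mul A \<cdot>\<^bsub>K\<^esub> s = r_unit A \<and>
     scl K (tensor_ring K A A) s (in1 K A A) = scl K (tensor_ring K A A) s (in2 K A A) \<and>
     scl K (tensor_ring K A A) s s = s)"

text \<open>The idempotent element of \<open>R\<close> that cuts out the locus where \<open>f, g : A \<rightarrow> R\<close> agree.\<close>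

definition eql :: "('o, 'm) smc \<Rightarrow> ('o, 'm) ring_obj \<Rightarrow> ('o, 'm) ring_obj \<Rightarrow> 'm \<Rightarrow> 'm \<Rightarrow> 'm" where
  "eql K A R f g = prd K R f g \<cdot>\<^bsub>K\<^esub> sep_elt K A"

context idempotent_complete_symmetric_monoidal_category
begin

lemma add_tarr:
  "\<lbrakk>f \<in> arrs K; f' \<in> arrs K; g \<in> arrs K; src K f' = src K f; tgt K f' = tgt K f\<rbrakk> \<Longrightarrow>
    (f \<boxplus> f') \<odot> g = (f \<odot> g) \<boxplus> (f' \<odot> g)"
  using tarr_add_left[of f "src K f" "tgt K f" f' g "src K g" "tgt K g"] by simp

lemma tarr_add:
  "\<lbrakk>f \<in> arrs K; g \<in> arrs K; g' \<in> arrs K; src K g' = src K g; tgt K g' = tgt K g\<rbrakk> \<Longrightarrow>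
    f \<odot> (g \<boxplus> g') = (f \<odot> g) \<boxplus> (f \<odot> g')"
  using tarr_add_right[of f "src K f" "tgt K f" g "src K g" "tgt K g" g'] by simp

lemma zro_tarr [simp]:
  assumes "f \<in> arrs K" "x \<in> objs K" "y \<in> objs K"
  shows "zro K x y \<odot> f = zro K (x \<boxtimes> src K f) (y \<boxtimes> tgt K f)"
proof -
  let ?z = "zro K x y \<odot> f"
  have "?z \<boxplus> ?z = ?z \<boxplus> zro K (x \<boxtimes> src K f) (y \<boxtimes> tgt K f)"
    using assms add_tarr[of "zro K x y" "zro K x y" f] by simp
  then show ?thesis by (rule add_left_cancel) (use assms in simp_all)
qed

lemma tarr_zro [simp]:
  assumes "f \<in> arrs K" "x \<in> objs K" "y \<in> objs K"
  shows "f \<odot> zro K x y = zro K (src K f \<boxtimes> x) (tgt K f \<boxtimes> y)"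
proof -
  let ?z = "f \<odot> zro K x y"
  have "?z \<boxplus> ?z = ?z \<boxplus> zro K (src K f \<boxtimes> x) (tgt K f \<boxtimes> y)"
    using assms tarr_add[of f "zro K x y" "zro K x y"] by simp
  then show ?thesis by (rule add_left_cancel) (use assms in simp_all)
qed

lemma prd_add_left:
  assumes "is_ring K A" "f \<in> arrs K" "f' \<in> arrs K" "g \<in> arrs K" "src K f' = src K f" "tgt K f = r_ob A" "tgt K f' = r_ob A" "tgt K g = r_ob A"
  shows "prd K A (f \<boxplus> f') g = prd K A f g \<boxplus> prd K A f' g"
  using assms by (simp add: prd_def add_tarr cmp_add)

lemma prd_add_right:
  assumes "is_ring K A" "f \<in> arrs K" "g' \<in> arrs K" "g \<in> arrs K" "src K g' = src K g" "tgt K f = r_ob A" "tgt K g' = r_ob A" "tgt K g = r_ob A"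
  shows "prd K A f (g \<boxplus> g') = prd K A f g \<boxplus> prd K A f g'"
  using assms by (simp add: prd_def tarr_add cmp_add)

lemma scl_add_left:
  assumes "is_ring K A" "e \<in> arrs K" "e' \<in> arrs K" "f \<in> arrs K" "src K e = unt K" "src K e' = unt K" "tgt K e = r_ob A" "tgt K e' = r_ob A" "tgt K f = r_ob A"
  shows "scl K A (e \<boxplus> e') f = scl K A e f \<boxplus> scl K A e' f"
  using assms by (simp add: scl_def prd_add_left add_cmp)

lemma scl_add_right:
  assumes "is_ring K A" "e \<in> arrs K" "f \<in> arrs K" "f' \<in> arrs K" "src K e = unt K" "src K f' = src K f" "tgt K e = r_ob A" "tgt K f' = r_ob A" "tgt K f = r_ob A"
  shows "scl K A e (f \<boxplus> f') = scl K A e f \<boxplus> scl K A e f'"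
  using assms by (simp add: scl_def prd_add_right add_cmp)

lemma scl_zro_left [simp]:
  assumes "is_ring K A" "f \<in> arrs K" "tgt K f = r_ob A"
  shows "scl K A (zro K (unt K) (r_ob A)) f = zro K (src K f) (r_ob A)"
  using assms by (simp add: scl_def prd_def)

lemma scl_zro_right [simp]:
  assumes "is_ring K A" "e \<in> arrs K" "src K e = unt K" "tgt K e = r_ob A" "x \<in> objs K"
  shows "scl K A e (zro K x (r_ob A)) = zro K x (r_ob A)"
  using assms by (simp add: scl_def prd_def)

text \<open>The identity arrow is the scaling by the unit, so a ring vanishes exactly when 1 = 0.
  Vanishing thus becomes an equation between elements, which ring morphisms preserve.\<close>

lemma nonzero_ring_iff: "is_ring K A \<Longrightarrow> nonzero_ring K A \<longleftrightarrow> r_unit A \<noteq> zro K (unt K) (r_ob A)"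
proof -
  assume [simp]: "is_ring K A"
  have "r_unit A = zro K (unt K) (r_ob A)" if "idt K (r_ob A) = zro K (r_ob A) (r_ob A)"
    using arg_cong[OF that, of "\<lambda>x. x \<cdot> r_unit A"] by simp
  moreover have "idt K (r_ob A) = zro K (r_ob A) (r_ob A)" if "r_unit A = zro K (unt K) (r_ob A)"
    using arg_cong[OF that, of "\<lambda>x. scl K A x (idt K (r_ob A))"] by simp
  ultimately show ?thesis by (auto simp: nonzero_ring_def zero_object_def)
qed

lemma nonzero_ring_mor:
  assumes "is_ring K A" "is_ring K B" "ring_mor K A B f" "nonzero_ring K B"
  shows "nonzero_ring K A"
  using assms ring_morD[OF assms(3)] by (auto simp: nonzero_ring_iff)

lemma is_locD:
  assumes "is_loc K X e C p"
  shows "is_ring K X" "is_ring K C" "e \<in> arrs K" "src K e = unt K" "tgt K e = r_ob X" "ring_mor K X C p"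
    "p \<in> arrs K" "src K p = r_ob X" "tgt K p = r_ob C"
  using assms unfolding is_loc_def by (auto dest: ring_morD)

text \<open>The element is recovered as e = j(1). Hence \<open>p\<close> sends \<open>e\<close> to
  the unit, and \<open>e\<close> is idempotent.\<close>

lemma is_locE:
  assumes "is_loc K X e C p"
  obtains j where "j \<in> arrs K" "src K j = r_ob C" "tgt K j = r_ob X" "p \<cdot> j = idt K (r_ob C)"
    "j \<cdot> p = scl K X e (idt K (r_ob X))" "p \<cdot> e = r_unit C" "scl K X e e = e"
proof -
  note [simp] = is_locD[OF assms]
  obtain j where "j \<in> Hom K (r_ob C) (r_ob X)" and j: "p \<cdot> j = idt K (r_ob C)" "j \<cdot> p = scl K X e (idt K (r_ob X))"
    using assms unfolding is_loc_def by blast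
  then have [simp]: "j \<in> arrs K" "src K j = r_ob C" "tgt K j = r_ob X" by auto
  have e: "j \<cdot> r_unit C = e"
    using arg_cong[OF j(2), of "\<lambda>x. x \<cdot> r_unit X"] ring_morD(4)[of X C p] by (simp add: scl_cmp)
  then have pe: "p \<cdot> e = r_unit C"
    using reassoc[OF j(1), of "r_unit C"] by simp
  have "scl K X e e = (j \<cdot> p) \<cdot> e" unfolding j(2) by (simp add: scl_cmp)
  also have "\<dots> = e" using pe e by simp
  finally have ee: "scl K X e e = e" .
  show ?thesis by (rule that[OF _ _ _ j pe ee]) simp_all
qed

text \<open>Multiplication by an idempotent element is an idempotent endomorphism of the object, so
  it splits in \<open>K\<close>. The image inherits the multiplication of \<open>X\<close> because
  the product of e x and e y is e (x y).\<close>

lemma ex_loc: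
  assumes X: "is_ring K X" and e: "e \<in> arrs K" "src K e = unt K" "tgt K e = r_ob X" and ee: "scl K X e e = e"
  obtains C p where "is_loc K X e C p"
proof -
  note [simp] = X e
  let ?i = "idt K (r_ob X)"
  let ?E = "scl K X e ?i"
  have EE: "?E \<cdot> f = scl K X e f" if "f \<in> arrs K" "tgt K f = r_ob X" for f
    using that by (simp add: scl_cmp)
  have "?E \<cdot> ?E = ?E" by (simp add: scl_cmp scl_scl ee)
  moreover have "?E \<in> Hom K (r_ob X) (r_ob X)" by simp
  ultimately obtain c c' i i' p p' where b: "biproduct K c c' (r_ob X) i i' p p'" "?E = i \<cdot> p"
    using idempotent_splits[of "r_ob X" ?E] by auto
  have [simp]: "i \<in> arrs K" "src K i = c" "tgt K i = r_ob X" "p \<in> arrs K" "src K p = r_ob X" "tgt K p = c"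
    and pi: "p \<cdot> i = idt K c"
    using b(1) unfolding biproduct_def by auto
  have [simp]: "c \<in> objs K" using src_in_objs[of i] by simp
  have piX: "p \<cdot> i \<cdot> f = f" if "f \<in> arrs K" "tgt K f = c" for f
    using that reassoc[OF pi] by simp
  have pE: "p \<cdot> scl K X e f = p \<cdot> f" if "f \<in> arrs K" "tgt K f = r_ob X" for f
    using that piX[of "p \<cdot> f"] by (simp add: EE[symmetric] b(2))
  let ?M = "p \<cdot> r_mul X \<cdot> (i \<odot> i)"
  have M: "?M \<cdot> (p \<odot> p) = p \<cdot> r_mul X"
  proof -
    have "?M \<cdot> (p \<odot> p) = p \<cdot> prd K X ?E ?E"
      unfolding b(2) by (simp add: prd_def tarr_cmp_tarr)
    also have "\<dots> = p \<cdot> scl K X e (scl K X e (r_mul X))"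
      by (simp add: scl_prd_left[symmetric] scl_prd_right[symmetric] prd_idt)
    also have "\<dots> = p \<cdot> r_mul X" by (simp add: pE)
    finally show ?thesis .
  qed
  let ?C = "\<lparr>r_ob = c, r_mul = ?M, r_unit = p \<cdot> r_unit X\<rparr>"
  have "is_ring K ?C" "ring_mor K X ?C p"
    by (rule quotient_ring[OF X _ _ _ _ _ _ pi _ _ _ M refl]; simp)+
  then have "is_loc K X e ?C p"
    unfolding is_loc_def using pi b(2) by auto
  then show ?thesis by (rule that)
qed

lemma is_loc_sect_cancel:
  assumes "is_loc K X e C p" "f \<cdot> p = g \<cdot> p" "f \<in> arrs K" "g \<in> arrs K" "src K f = r_ob C" "src K g = r_ob C"
  shows "f = g"
proof -
  note [simp] = is_locD[OF assms(1)]
  obtain j where j: "j \<in> arrs K" "src K j = r_ob C" "tgt K j = r_ob X" "p \<cdot> j = idt K (r_ob C)"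
    by (rule is_locE[OF assms(1)]) blast
  show ?thesis by (rule sect_cancel_right[OF j(4) assms(2)]) (use assms j in simp_all)
qed

text \<open>A ring morphism that sends \<open>e\<close> to 1 does not notice multiplication by
  \<open>e\<close>, hence it is unchanged by passing through \<open>j \<cdot> p\<close>.\<close>

lemma loc_factor:
  assumes l: "is_loc K X e C p" and R: "is_ring K R" and u: "ring_mor K X R u" and ue: "u \<cdot> e = r_unit R"
  obtains v where "ring_mor K C R v" "v \<cdot> p = u"
proof -
  note [simp] = is_locD[OF l] R ring_morD[OF u]
  obtain j where j: "j \<in> arrs K" "src K j = r_ob C" "tgt K j = r_ob X" "p \<cdot> j = idt K (r_ob C)" "j \<cdot> p = scl K X e (idt K (r_ob X))"
    by (rule is_locE[OF l]) blast
  note [simp] = j(1-3)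
  have 1: "(u \<cdot> j) \<cdot> p = u"
    by (simp add: j(5) ring_mor_scl[OF u] ue)
  have "ring_mor K C R (u \<cdot> j)"
    by (rule ring_mor_cancel_epi[of X C R p j]) (use 1 u j in \<open>simp_all\<close>)
  then show ?thesis using 1 that by blast
qed

text \<open>The idempotent \<open>d\<close> of \<open>C\<close> is lifted back to \<open>X\<close>
  along \<open>j\<close> and scaled by \<open>e\<close>; the composite of the two sections then
  splits multiplication by the result.\<close>

lemma loc_cmp:
  assumes l: "is_loc K X e C p" and m: "is_loc K C d D q"
  shows "\<exists>f. is_loc K X f D (q \<cdot> p)"
proof -
  note [simp] = is_locD[OF l] is_locD[OF m]
  obtain j where j: "j \<in> arrs K" "src K j = r_ob C" "tgt K j = r_ob X" "p \<cdot> j = idt K (r_ob C)" "j \<cdot> p = scl K X e (idt K (r_ob X))"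
    by (rule is_locE[OF l]) blast
  obtain i where i: "i \<in> arrs K" "src K i = r_ob D" "tgt K i = r_ob C" "q \<cdot> i = idt K (r_ob D)" "i \<cdot> q = scl K C d (idt K (r_ob C))"
    by (rule is_locE[OF m]) blast
  note [simp] = i(1-3) j(1-3)
  let ?f = "scl K X e (j \<cdot> d)"
  have "(q \<cdot> p) \<cdot> (j \<cdot> i) = q \<cdot> ((p \<cdot> j) \<cdot> i)" by simp
  then have 1: "(q \<cdot> p) \<cdot> (j \<cdot> i) = idt K (r_ob D)" unfolding j(4) by (simp add: i(4))
  have "(j \<cdot> i) \<cdot> (q \<cdot> p) = j \<cdot> scl K C ((p \<cdot> j) \<cdot> d) p"
    using reassoc[OF i(5), of p] by (simp add: scl_cmp j(4))
  also have "\<dots> = (j \<cdot> p) \<cdot> scl K X (j \<cdot> d) (idt K (r_ob X))"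
    by (simp add: ring_mor_scl[of X C p])
  also have "\<dots> = scl K X ?f (idt K (r_ob X))"
    unfolding j(5) by (simp add: scl_cmp scl_scl)
  finally have 2: "(j \<cdot> i) \<cdot> (q \<cdot> p) = scl K X ?f (idt K (r_ob X))" .
  have "is_loc K X ?f D (q \<cdot> p)"
    unfolding is_loc_def using 1 2 by (auto intro!: bexI[of _ "j \<cdot> i"] intro: ring_mor_cmp[of X C p D q])
  then show ?thesis ..
qed

lemma idempotent_complement:
  assumes X: "is_ring K X" and e: "e \<in> arrs K" "src K e = unt K" "tgt K e = r_ob X" and ee: "scl K X e e = e"
  obtains e' where "e' \<in> arrs K" "src K e' = unt K" "tgt K e' = r_ob X" "e \<boxplus> e' = r_unit X"
    "scl K X e e' = zro K (unt K) (r_ob X)" "scl K X e' e' = e'"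
proof -
  note [simp] = X e
  obtain e' where e': "e' \<in> arrs K" "src K e' = unt K" "tgt K e' = r_ob X" "e \<boxplus> e' = r_unit X"
    by (rule ex_complement[of e "r_unit X"]) auto
  note [simp] = e'(1-3)
  have "e \<boxplus> scl K X e e' = scl K X e (e \<boxplus> e')" by (simp add: scl_add_right ee)
  also have "\<dots> = e \<boxplus> zro K (unt K) (r_ob X)" unfolding e'(4) by simp
  finally have 1: "scl K X e e' = zro K (unt K) (r_ob X)"
    by (rule add_left_cancel) simp_all
  have "e' = scl K X (e \<boxplus> e') e'" unfolding e'(4) by simp
  also have "\<dots> = scl K X e' e'" by (simp add: scl_add_left 1)
  finally have 2: "e' = scl K X e' e'" .
  show ?thesis by (rule that[OF e' 1 2[symmetric]])
qed

lemma biproductD: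
  assumes "biproduct K x y s i j p q"
  shows "i \<in> arrs K" "src K i = x" "tgt K i = s" "j \<in> arrs K" "src K j = y" "tgt K j = s"
    "p \<in> arrs K" "src K p = s" "tgt K p = x" "q \<in> arrs K" "src K q = s" "tgt K q = y"
    "x \<in> objs K" "y \<in> objs K" "s \<in> objs K"
    "p \<cdot> i = idt K x" "q \<cdot> j = idt K y" "p \<cdot> j = zro K y x" "q \<cdot> i = zro K x y"
    "(i \<cdot> p) \<boxplus> (j \<cdot> q) = idt K s"
  using assms unfolding biproduct_def by (auto dest: src_in_objs tgt_in_objs)

lemma biproduct_cmp:
  assumes "biproduct K x y s i j p q" "f \<in> arrs K"
  shows "tgt K f = x \<Longrightarrow> p \<cdot> i \<cdot> f = f" "tgt K f = y \<Longrightarrow> q \<cdot> j \<cdot> f = f"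
    "tgt K f = y \<Longrightarrow> p \<cdot> j \<cdot> f = zro K (src K f) x" "tgt K f = x \<Longrightarrow> q \<cdot> i \<cdot> f = zro K (src K f) y"
  using biproductD[OF assms(1)] assms(2) by (simp_all add: reassoc)

lemma biproduct_joint:
  assumes b: "biproduct K x y s i j p q" and "p \<cdot> f = p \<cdot> g" "q \<cdot> f = q \<cdot> g" "f \<in> arrs K" "g \<in> arrs K" "tgt K f = s" "tgt K g = s"
  shows "f = g"
proof -
  note [simp] = biproductD(1-15)[OF b]
  have "h = (i \<cdot> (p \<cdot> h)) \<boxplus> (j \<cdot> (q \<cdot> h))" if "h \<in> arrs K" "tgt K h = s" for h
    using that arg_cong[OF biproductD(20)[OF b], of "\<lambda>x. x \<cdot> h"] by (simp add: add_cmp)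
  from this[of f] this[of g] show ?thesis using assms by simp
qed

text \<open>Equations into a biproduct may be compared after both projections, where the ring axioms
  become those of \<open>A\<close> and \<open>B\<close>. The lemma hides the chosen direct sum
  behind the biproduct property.\<close>

lemma prod_ring_biproduct:
  assumes A: "is_ring K A" and B: "is_ring K B"
  obtains i j where "biproduct K (r_ob A) (r_ob B) (r_ob (prod_ring K A B)) i j (prod_pr1 K A B) (prod_pr2 K A B)"
    "is_ring K (prod_ring K A B)" "ring_mor K (prod_ring K A B) A (prod_pr1 K A B)"
    "ring_mor K (prod_ring K A B) B (prod_pr2 K A B)"
proof -
  note [simp] = A B
  have "\<exists>t. case t of (s, i, j, p, q) \<Rightarrow> biproduct K (r_ob A) (r_ob B) s i j p q"
    using ex_biproduct[of "r_ob A" "r_ob B"] by auto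
  then have "case chosen_sum K (r_ob A) (r_ob B) of (s, i, j, p, q) \<Rightarrow> biproduct K (r_ob A) (r_ob B) s i j p q"
    unfolding chosen_sum_def by (rule someI_ex)
  then obtain s i j p q where c: "chosen_sum K (r_ob A) (r_ob B) = (s, i, j, p, q)" and b: "biproduct K (r_ob A) (r_ob B) s i j p q"
    by (cases "chosen_sum K (r_ob A) (r_ob B)") auto
  let ?P = "prod_ring K A B"
  define M where "M = r_mul ?P"
  define H where "H = r_unit ?P"
  have P: "r_ob ?P = s" "prod_pr1 K A B = p" "prod_pr2 K A B = q"
    by (simp_all add: prod_ring_def prod_pr1_def prod_pr2_def c)
  have M: "M = (i \<cdot> r_mul A \<cdot> (p \<odot> p)) \<boxplus> (j \<cdot> r_mul B \<cdot> (q \<odot> q))" and H: "H = (i \<cdot> r_unit A) \<boxplus> (j \<cdot> r_unit B)"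
    by (simp_all add: M_def H_def prod_ring_def c)
  note [simp] = biproductD(1-15)[OF b]
  have [simp]: "M \<in> arrs K" "src K M = s \<boxtimes> s" "tgt K M = s" "H \<in> arrs K" "src K H = unt K" "tgt K H = s"
    by (simp_all add: M H)
  have pM: "p \<cdot> M = prd K A p p" "q \<cdot> M = prd K B q q" "p \<cdot> H = r_unit A" "q \<cdot> H = r_unit B"
    by (simp_all add: M H cmp_add biproduct_cmp[OF b] prd_def)
  have pMf: "p \<cdot> M \<cdot> f = prd K A p p \<cdot> f" "q \<cdot> M \<cdot> f = prd K B q q \<cdot> f" if "f \<in> arrs K" "tgt K f = s \<boxtimes> s" for f
    using that by (simp_all add: reassoc[OF pM(1)] reassoc[OF pM(2)])
  have R: "is_ring K ?P"
  proof (rule is_ringI; (unfold M_def[symmetric] H_def[symmetric] P)?)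
    show "M \<cdot> (M \<odot> idt K s) = M \<cdot> (idt K s \<odot> M) \<cdot> asc K s s s"
      by (rule biproduct_joint[OF b]) (simp_all add: pMf reassoc[OF prd_cmp] prd_cmp pM prd_assoc)
    show "M \<cdot> (H \<odot> idt K s) = lun K s"
      by (rule biproduct_joint[OF b]) (simp_all add: pMf prd_cmp pM prd_unit_left)
    show "M \<cdot> brd K s s = M"
      by (rule biproduct_joint[OF b])
        (simp_all add: pMf pM prd_comm[of A p p, symmetric, simplified] prd_comm[of B q q, symmetric, simplified])
  qed simp_all
  show ?thesis
  proof (rule that[of i j])
    show "ring_mor K ?P A (prod_pr1 K A B)" "ring_mor K ?P B (prod_pr2 K A B)"
      by (rule ring_morI; simp add: R P pM M_def[symmetric] H_def[symmetric])+
  qed (use b P R in simp_all)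
qed

lemma is_ring_prod [simp]: "\<lbrakk>is_ring K A; is_ring K B\<rbrakk> \<Longrightarrow> is_ring K (prod_ring K A B)"
  by (metis prod_ring_biproduct)

lemma loc_prod_fst:
  assumes A: "is_ring K A" and B: "is_ring K B"
  shows "\<exists>e d. is_loc K (prod_ring K A B) e A (prod_pr1 K A B) \<and> is_loc K (prod_ring K A B) d B (prod_pr2 K A B) \<and>
     e \<boxplus> d = r_unit (prod_ring K A B)"
proof -
  let ?P = "prod_ring K A B" and ?p = "prod_pr1 K A B" and ?q = "prod_pr2 K A B"
  obtain i j where b: "biproduct K (r_ob A) (r_ob B) (r_ob ?P) i j ?p ?q"
    and m: "is_ring K ?P" "ring_mor K ?P A ?p" "ring_mor K ?P B ?q"
    by (rule prod_ring_biproduct[OF A B])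
  note [simp] = A B m biproductD(1-15)[OF b]
  let ?e = "i \<cdot> r_unit A" and ?d = "j \<cdot> r_unit B"
  have 1: "i \<cdot> ?p = scl K ?P ?e (idt K (r_ob ?P))"
    by (rule biproduct_joint[OF b])
     (simp_all add: biproduct_cmp[OF b] ring_mor_scl[OF m(2)] ring_mor_scl[OF m(3)])
  have 2: "j \<cdot> ?q = scl K ?P ?d (idt K (r_ob ?P))"
    by (rule biproduct_joint[OF b])
     (simp_all add: biproduct_cmp[OF b] ring_mor_scl[OF m(2)] ring_mor_scl[OF m(3)])
  have "?e \<boxplus> ?d = r_unit ?P"
    by (rule biproduct_joint[OF b])
     (simp_all add: biproduct_cmp[OF b] cmp_add ring_morD(4)[OF m(2)] ring_morD(4)[OF m(3)])
  moreover have "is_loc K ?P ?e A ?p"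
    unfolding is_loc_def using 1 biproductD(16)[OF b] by (auto intro!: bexI[of _ i])
  moreover have "is_loc K ?P ?d B ?q"
    unfolding is_loc_def using 2 biproductD(17)[OF b] by (auto intro!: bexI[of _ j])
  ultimately show ?thesis by blast
qed

text \<open>Chinese remainder theorem for idempotents: orthogonality kills the cross terms
  \<open>p \<cdot> k\<close> and \<open>q \<cdot> j\<close>, so both projections together split
  multiplication by \<open>e \<boxplus> d\<close>.\<close>

lemma loc_pair:
  assumes l: "is_loc K X e C p" and m: "is_loc K X d D q" and ed: "scl K X e d = zro K (unt K) (r_ob X)"
  obtains h where "is_loc K X (e \<boxplus> d) (prod_ring K C D) h" "prod_pr1 K C D \<cdot> h = p" "prod_pr2 K C D \<cdot> h = q"
proof -
  note [simp] = is_locD[OF l] is_locD[OF m]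
  obtain j where j: "j \<in> arrs K" "src K j = r_ob C" "tgt K j = r_ob X" "p \<cdot> j = idt K (r_ob C)" "j \<cdot> p = scl K X e (idt K (r_ob X))"
     "p \<cdot> e = r_unit C"
    by (rule is_locE[OF l]) blast
  obtain k where k: "k \<in> arrs K" "src K k = r_ob D" "tgt K k = r_ob X" "q \<cdot> k = idt K (r_ob D)" "k \<cdot> q = scl K X d (idt K (r_ob X))"
     "q \<cdot> d = r_unit D"
    by (rule is_locE[OF m]) blast
  note [simp] = j(1-3) k(1-3)
  let ?P = "prod_ring K C D" and ?p = "prod_pr1 K C D" and ?q = "prod_pr2 K C D"
  obtain u v where b: "biproduct K (r_ob C) (r_ob D) (r_ob ?P) u v ?p ?q"
    and r: "is_ring K ?P" "ring_mor K ?P C ?p" "ring_mor K ?P D ?q"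
    by (rule prod_ring_biproduct[of C D]) auto
  note [simp] = r biproductD(1-15)[OF b]
  have pd: "p \<cdot> d = zro K (unt K) (r_ob C)"
    using arg_cong[OF ed, of "\<lambda>x. p \<cdot> x"] ring_mor_scl[of X C p e d] by (simp add: j)
  have qe: "q \<cdot> e = zro K (unt K) (r_ob D)"
    using arg_cong[OF ed, of "\<lambda>x. q \<cdot> x"] ring_mor_scl[of X D q e d] by (simp add: k)
  have pk: "p \<cdot> k = zro K (r_ob D) (r_ob C)"
  proof (rule is_loc_sect_cancel[OF m])
    show "(p \<cdot> k) \<cdot> q = zro K (r_ob D) (r_ob C) \<cdot> q"
      by (simp add: k ring_mor_scl[of X C p] pd)
  qed simp_all
  have qj: "q \<cdot> j = zro K (r_ob C) (r_ob D)"
  proof (rule is_loc_sect_cancel[OF l])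
    show "(q \<cdot> j) \<cdot> p = zro K (r_ob C) (r_ob D) \<cdot> p"
      by (simp add: j ring_mor_scl[of X D q] qe)
  qed simp_all
  let ?h = "(u \<cdot> p) \<boxplus> (v \<cdot> q)"
  let ?k = "(j \<cdot> ?p) \<boxplus> (k \<cdot> ?q)"
  have h1: "?p \<cdot> ?h = p" and h2: "?q \<cdot> ?h = q"
    by (simp_all add: cmp_add biproduct_cmp[OF b])
  have h1f: "?p \<cdot> ?h \<cdot> f = p \<cdot> f" and h2f: "?q \<cdot> ?h \<cdot> f = q \<cdot> f" if "f \<in> arrs K" "tgt K f = r_ob X" for f
    using that by (simp_all add: reassoc[OF h1] reassoc[OF h2])
  have pf: "p \<cdot> j \<cdot> f = f" "q \<cdot> j \<cdot> f = zro K (src K f) (r_ob D)" if "f \<in> arrs K" "tgt K f = r_ob C" for f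
    using that by (simp_all add: reassoc[OF j(4)] reassoc[OF qj])
  have qf: "q \<cdot> k \<cdot> f = f" "p \<cdot> k \<cdot> f = zro K (src K f) (r_ob C)" if "f \<in> arrs K" "tgt K f = r_ob D" for f
    using that by (simp_all add: reassoc[OF k(4)] reassoc[OF pk])
  have hk: "?h \<cdot> ?k = idt K (r_ob ?P)"
    by (rule biproduct_joint[OF b]) (simp_all add: h1f h2f, simp_all add: cmp_add pf qf)
  have "?k \<cdot> ?h = (j \<cdot> (?p \<cdot> ?h)) \<boxplus> (k \<cdot> (?q \<cdot> ?h))" by (simp add: add_cmp)
  then have kh: "?k \<cdot> ?h = scl K X (e \<boxplus> d) (idt K (r_ob X))"
    unfolding h1 h2 by (simp add: j(5) k(5) scl_add_left)
  have "?h \<cdot> r_mul X = prd K ?P ?h ?h"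
  proof (rule biproduct_joint[OF b])
    show "?p \<cdot> (?h \<cdot> r_mul X) = ?p \<cdot> prd K ?P ?h ?h"
      using ring_mor_mul[of X C p] by (simp add: ring_mor_prd[OF r(2)] h1f h1)
    show "?q \<cdot> (?h \<cdot> r_mul X) = ?q \<cdot> prd K ?P ?h ?h"
      using ring_mor_mul[of X D q] by (simp add: ring_mor_prd[OF r(3)] h2f h2)
  qed simp_all
  moreover have "?h \<cdot> r_unit X = r_unit ?P"
    by (rule biproduct_joint[OF b])
      (simp_all add: h1f h2f ring_morD(4)[of X C p] ring_morD(4)[of X D q] ring_morD(4)[OF r(2)] ring_morD(4)[OF r(3)])
  ultimately have "ring_mor K X ?P ?h"
    by (intro ring_morI) simp_all
  then have "is_loc K X (e \<boxplus> d) ?P ?h"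
    unfolding is_loc_def using hk kh by (auto intro!: bexI[of _ ?k])
  then show ?thesis using that h1 h2 by blast
qed

lemma is_ring_zero [simp]: "is_ring K (zero_ring K)"
  and zero_ring_ob: "zero_object K (r_ob (zero_ring K))"
proof -
  let ?z = "SOME z. zero_object K z"
  have z: "zero_object K ?z" using ex_zero_object by (rule someI_ex)
  then have [simp]: "?z \<in> objs K" and i: "idt K ?z = zro K ?z ?z" by (auto simp: zero_object_def)
  show "zero_object K (r_ob (zero_ring K))" using z by (simp add: zero_ring_def Let_def)
  have "f = g" if "f \<in> arrs K" "g \<in> arrs K" "src K f = src K g" "tgt K f = ?z" "tgt K g = ?z" for f g
  proof -
    have "f = idt K ?z \<cdot> f" "g = idt K ?z \<cdot> g" using that by simp_all
    then show ?thesis using that unfolding i by simp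
  qed
  then show "is_ring K (zero_ring K)"
    by (intro is_ringI) (simp_all add: zero_ring_def Let_def)
qed

lemma is_ring_prod_list [simp]: "\<forall>A \<in> set As. is_ring K A \<Longrightarrow> is_ring K (prod_ring_list K As)"
  unfolding prod_ring_list_def by (induction As) auto

text \<open>Base case for finite products: the empty product is cut out by the zero
  idempotent.\<close>

lemma loc_zero:
  assumes X: "is_ring K X"
  shows "is_loc K X (zro K (unt K) (r_ob X)) (zero_ring K) (zro K (r_ob X) (r_ob (zero_ring K)))"
proof -
  let ?Z = "zero_ring K"
  have i: "idt K (r_ob ?Z) = zro K (r_ob ?Z) (r_ob ?Z)" using zero_ring_ob by (simp add: zero_object_def)
  have "r_unit ?Z = zro K (unt K) (r_ob ?Z)"
    using arg_cong[OF i, of "\<lambda>x. x \<cdot> r_unit ?Z"] by simp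
  then have "ring_mor K X ?Z (zro K (r_ob X) (r_ob ?Z))"
    using X by (intro ring_morI) (simp_all add: prd_def)
  moreover have "zro K (r_ob X) (r_ob ?Z) \<cdot> zro K (r_ob ?Z) (r_ob X) = idt K (r_ob ?Z)"
    using X i by simp
  moreover have "zro K (r_ob ?Z) (r_ob X) \<cdot> zro K (r_ob X) (r_ob ?Z) = scl K X (zro K (unt K) (r_ob X)) (idt K (r_ob X))"
    using X by simp
  ultimately show ?thesis unfolding is_loc_def using X
    by (auto simp del: zro_cmp cmp_zro scl_zro_left intro!: bexI[of _ "zro K (r_ob ?Z) (r_ob X)"])
qed

lemma loc_unit_iso:
  assumes "is_loc K X (r_unit X) C p"
  shows "ring_iso K X C p"
proof -
  note [simp] = is_locD[OF assms]
  obtain j where j: "j \<in> arrs K" "src K j = r_ob C" "tgt K j = r_ob X" "p \<cdot> j = idt K (r_ob C)" "j \<cdot> p = scl K X (r_unit X) (idt K (r_ob X))"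
    by (rule is_locE[OF assms]) blast
  have "iso_arrow K p" by (rule iso_arrowI[of p j]) (use j in simp_all)
  then show ?thesis by (simp add: ring_iso_def)
qed

lemma ring_iso_loc:
  assumes "ring_iso K X C p" "is_ring K X" "is_ring K C"
  shows "is_loc K X (r_unit X) C p"
  unfolding is_loc_def using assms ring_morD[of X C p] iso_inv[of p]
  by (auto simp: ring_iso_def intro!: bexI[of _ "inv_arrow K p"])

lemma ring_iso_inverse:
  assumes "ring_iso K X C p" "is_ring K X" "is_ring K C"
  shows "ring_iso K C X (inv_arrow K p)"
proof -
  have i: "iso_arrow K p" and m: "ring_mor K X C p" using assms by (auto simp: ring_iso_def)
  note [simp] = iso_inv[OF i] ring_morD[OF m] assms(2,3)
  have "ring_mor K C X (inv_arrow K p)"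
    by (rule ring_mor_cancel_epi[of X C X p "inv_arrow K p"]) (simp_all add: m ring_mor_idt)
  moreover have "iso_arrow K (inv_arrow K p)" by (rule iso_arrowI[where g = p]) simp_all
  ultimately show ?thesis by (simp add: ring_iso_def)
qed

lemma rings_isomorphic_sym: "\<lbrakk>rings_isomorphic K X C; is_ring K X; is_ring K C\<rbrakk> \<Longrightarrow> rings_isomorphic K C X"
  unfolding rings_isomorphic_def using ring_iso_inverse by blast

text \<open>The complementary factor is recovered as the localisation at 1 - e. Describing a factor
  by one idempotent and one projection makes transitivity and transport along isomorphisms direct
  consequences of \<open>loc_cmp\<close>.\<close>

lemma ring_factor_iff:
  assumes A: "is_ring K A" and B: "is_ring K B"
  shows "ring_factor K B A \<longleftrightarrow> (\<exists>e p. is_loc K A e B p)"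
proof
  assume "ring_factor K B A"
  then obtain C f where C: "is_ring K C" and f: "ring_iso K A (prod_ring K B C) f"
    unfolding ring_factor_def rings_isomorphic_def by blast
  show "\<exists>e p. is_loc K A e B p"
    using loc_cmp[OF ring_iso_loc[OF f A]] loc_prod_fst[OF B C] C B by (metis is_ring_prod)
next
  assume "\<exists>e p. is_loc K A e B p"
  then obtain e p where l: "is_loc K A e B p" by blast
  note [simp] = is_locD[OF l]
  have ee: "scl K A e e = e" by (rule is_locE[OF l]) blast
  obtain d where d: "d \<in> arrs K" "src K d = unt K" "tgt K d = r_ob A" "e \<boxplus> d = r_unit A"
    "scl K A e d = zro K (unt K) (r_ob A)" "scl K A d d = d"
    by (rule idempotent_complement[OF A _ _ _ ee]) simp_all
  obtain C q where m: "is_loc K A d C q" by (rule ex_loc[OF A d(1-3,6)])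
  obtain h where "is_loc K A (e \<boxplus> d) (prod_ring K B C) h" by (rule loc_pair[OF l m d(5)])
  then have "ring_iso K A (prod_ring K B C) h" unfolding d(4) by (rule loc_unit_iso)
  then show "ring_factor K B A" using is_locD(2)[OF m] unfolding ring_factor_def rings_isomorphic_def by blast
qed

text \<open>An idempotent element acts by an idempotent linear endomorphism of the regular module,
  and it is recovered as the image of the unit.\<close>

lemma indecomposable_idempotent:
  assumes B: "indecomposable K B" and e: "e \<in> arrs K" "src K e = unt K" "tgt K e = r_ob B" and ee: "scl K B e e = e"
  shows "e = r_unit B \<or> e = zro K (unt K) (r_ob B)"
proof -
  have R [simp]: "is_ring K B" using B by (simp add: indecomposable_def)
  note [simp] = e
  let ?E = "scl K B e (idt K (r_ob B))"
  have "linear K B (regular_module B) (regular_module B) ?E"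
  proof -
    have "scl K B e (prd K B (idt K (r_ob B)) (idt K (r_ob B))) = prd K B (idt K (r_ob B)) ?E"
      by (simp add: scl_prd_right)
    then show ?thesis by (simp add: linear_def regular_module_def scl_cmp prd_idt) (simp add: prd_def)
  qed
  moreover have "?E \<cdot> ?E = ?E" by (simp add: scl_cmp scl_scl ee)
  ultimately have "?E = idt K (r_ob B) \<or> ?E = zro K (r_ob B) (r_ob B)"
    using B unfolding indecomposable_def by blast
  moreover have "e = ?E \<cdot> r_unit B" by (simp add: scl_cmp)
  ultimately show ?thesis by (metis R idt_cmp zro_cmp ring_unit_arr ring_unit_src ring_unit_tgt ring_ob)
qed

section \<open>Agreement idempotents and the universal property of the derived algebra\<close>

lemma sep_elt:
  assumes A: "is_ring K A" "separable K A"
  shows "sep_elt K A \<in> arrs K" "src K (sep_elt K A) = unt K" "tgt K (sep_elt K A) = r_ob A \<boxtimes> r_ob A"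
    "r_mul A \<cdot> sep_elt K A = r_unit A"
    "scl K (tensor_ring K A A) (sep_elt K A) (in1 K A A) = scl K (tensor_ring K A A) (sep_elt K A) (in2 K A A)"
    "scl K (tensor_ring K A A) (sep_elt K A) (sep_elt K A) = sep_elt K A"
proof -
  have "\<exists>s. s \<in> Hom K (unt K) (r_ob A \<boxtimes> r_ob A) \<and> r_mul A \<cdot> s = r_unit A \<and>
     scl K (tensor_ring K A A) s (in1 K A A) = scl K (tensor_ring K A A) s (in2 K A A) \<and>
     scl K (tensor_ring K A A) s s = s"
    by (rule separableE[OF A]) auto
  note s = someI_ex[OF this, folded sep_elt_def]
  show "sep_elt K A \<in> arrs K" "src K (sep_elt K A) = unt K" "tgt K (sep_elt K A) = r_ob A \<boxtimes> r_ob A"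
    "r_mul A \<cdot> sep_elt K A = r_unit A"
    "scl K (tensor_ring K A A) (sep_elt K A) (in1 K A A) = scl K (tensor_ring K A A) (sep_elt K A) (in2 K A A)"
    "scl K (tensor_ring K A A) (sep_elt K A) (sep_elt K A) = sep_elt K A"
    using s by auto
qed

text \<open>Write t for the agreement idempotent and s for the separability element. The sixth fact
  is maximality: an element over which \<open>f\<close> and \<open>g\<close> agree is absorbed by t,
  because there the value of the product of \<open>f\<close> and \<open>g\<close> at s becomes
  f(\<mu>(s)) = f(1) = 1. The seventh is stability under change of ring.\<close>

lemma eql:
  assumes A: "is_ring K A" "separable K A" and R: "is_ring K R" and f: "ring_mor K A R f" and g: "ring_mor K A R g"
  shows "eql K A R f g \<in> arrs K" "src K (eql K A R f g) = unt K" "tgt K (eql K A R f g) = r_ob R"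
    "scl K R (eql K A R f g) (eql K A R f g) = eql K A R f g"
    "scl K R (eql K A R f g) f = scl K R (eql K A R f g) g"
    "\<lbrakk>e \<in> arrs K; src K e = unt K; tgt K e = r_ob R; scl K R e f = scl K R e g\<rbrakk> \<Longrightarrow> scl K R e (eql K A R f g) = e"
    "\<lbrakk>is_ring K S; ring_mor K R S u\<rbrakk> \<Longrightarrow> u \<cdot> eql K A R f g = eql K A S (u \<cdot> f) (u \<cdot> g)"
proof -
  note s = sep_elt[OF A]
  note [simp] = A(1) R ring_morD(1-3)[OF f] ring_morD(1-3)[OF g] s(1-3)
  note w = prd_ring_mor[OF A(1) A(1) R f g]
  let ?t = "eql K A R f g"
  show [simp]: "?t \<in> arrs K" "src K ?t = unt K" "tgt K ?t = r_ob R" by (simp_all add: eql_def)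
  show "scl K R ?t ?t = ?t"
    using arg_cong[OF s(6), of "\<lambda>x. prd K R f g \<cdot> x"] by (simp add: ring_mor_scl[OF w(1)] eql_def)
  show "scl K R ?t f = scl K R ?t g"
    using arg_cong[OF s(5), of "\<lambda>x. prd K R f g \<cdot> x"] by (simp add: ring_mor_scl[OF w(1)] w(2,3) eql_def)
  { assume e: "e \<in> arrs K" "src K e = unt K" "tgt K e = r_ob R" "scl K R e f = scl K R e g"
    have "scl K R e ?t = prd K R f (scl K R e f) \<cdot> sep_elt K A"
      using e by (simp add: eql_def scl_cmp[symmetric] scl_prd_right)
    also have "\<dots> = scl K R e (f \<cdot> r_mul A) \<cdot> sep_elt K A"
      using e by (simp add: ring_mor_mul[OF f] scl_prd_right)
    also have "\<dots> = scl K R e (f \<cdot> r_mul A \<cdot> sep_elt K A)"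
      using e by (simp add: scl_cmp)
    also have "\<dots> = e" using e by (simp add: s(4) ring_morD(4)[OF f])
    finally show "scl K R e ?t = e" . }
  { assume u: "is_ring K S" "ring_mor K R S u"
    note [simp] = u(1) ring_morD(1-3)[OF u(2)]
    show "u \<cdot> ?t = eql K A S (u \<cdot> f) (u \<cdot> g)"
      by (simp add: eql_def reassoc[OF ring_mor_prd[OF u(2)]]) }
qed

lemma disjoint_iff_eql:
  assumes A: "is_ring K A" "separable K A" and R: "is_ring K R" and f: "ring_mor K A R f" and g: "ring_mor K A R g"
  shows "disjoint_mors K R f g \<longleftrightarrow> eql K A R f g = zro K (unt K) (r_ob R)"
  unfolding disjoint_mors_def
  using eql[OF A R f g] scl_zro_right[OF R] by (metis R ring_ob unt_in_objs in_Hom_iff)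

text \<open>Disjointness is the vanishing of an idempotent that is natural in the target ring. In
  this way a condition quantified over all elements of \<open>S\<close> is inherited from
  \<open>R\<close>.\<close>

lemma disjoint_cmp:
  assumes A: "is_ring K A" "separable K A" and R: "is_ring K R" "is_ring K S" and f: "ring_mor K A R f" and g: "ring_mor K A R g"
    and u: "ring_mor K R S u" and d: "disjoint_mors K R f g"
  shows "disjoint_mors K S (u \<cdot> f) (u \<cdot> g)"
proof -
  have "eql K A S (u \<cdot> f) (u \<cdot> g) = zro K (unt K) (r_ob S)"
    using d eql(7)[OF A R(1) f g R(2) u] ring_morD[OF u] R
    by (simp add: disjoint_iff_eql[OF A R(1) f g])
  then show ?thesis
    using disjoint_iff_eql[OF A R(2) ring_mor_cmp[OF f u A(1) R] ring_mor_cmp[OF g u A(1) R]] by simp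
qed

lemma disjoint_sym: "disjoint_mors K R f g \<Longrightarrow> disjoint_mors K R g f"
  unfolding disjoint_mors_def by metis

lemma disjoint_self_zero:
  assumes "is_ring K R" "disjoint_mors K R f f"
  shows "\<not> nonzero_ring K R"
  using assms unfolding disjoint_mors_def nonzero_ring_iff[OF assms(1)]
  by (metis in_Hom_iff ring_unit_arr ring_unit_src ring_unit_tgt)

text \<open>The agreement idempotent is 0 or 1. This dichotomy is the point where indecomposability
  turns disjointness back into plain difference.\<close>

lemma indecomposable_eq_or_disjoint:
  assumes A: "is_ring K A" "separable K A" and R: "indecomposable K R" and f: "ring_mor K A R f" and g: "ring_mor K A R g"
  shows "f = g \<or> disjoint_mors K R f g"
proof -
  have Rr: "is_ring K R" using R by (simp add: indecomposable_def)
  note e = eql[OF A Rr f g]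
  consider "eql K A R f g = r_unit R" | "eql K A R f g = zro K (unt K) (r_ob R)"
    using indecomposable_idempotent[OF R e(1-4)] by blast
  then show ?thesis
  proof cases
    case 1
    then have "f = g" using e(5) Rr ring_morD[OF f] ring_morD[OF g] by simp
    then show ?thesis ..
  next
    case 2
    then show ?thesis using disjoint_iff_eql[OF A Rr f g] by simp
  qed
qed

text \<open>The multiplication is the localisation of A \<otimes> A at the separability idempotent
  s: the diagonal is open and closed. A' is taken to be the localisation at the complement 1 - s,
  with structure map a -> a \<otimes> 1.\<close>

lemma derived_algebra_exists:
  assumes A: "is_ring K A" "separable K A"
  shows "\<exists>A' \<iota>. is_derived_algebra K A A' \<iota>"
proof -
  note [simp] = A(1)
  let ?T = "tensor_ring K A A"
  obtain s where s: "s \<in> arrs K" "src K s = unt K" "tgt K s = r_ob A \<boxtimes> r_ob A" "r_mul A \<cdot> s = r_unit A"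
     "scl K ?T s (idt K (r_ob A \<boxtimes> r_ob A)) = scl K ?T s (in1 K A A) \<cdot> r_mul A"
     "scl K ?T s s = s"
    by (rule separableE[OF A]) blast
  note [simp] = s(1-3)
  have l: "is_loc K ?T s A (r_mul A)"
    unfolding is_loc_def using s(5)
    by (auto simp: ring_mor_mul_self(1) ring_mor_mul_self(2) ring_mor_scl[OF ring_mor_mul_self(1)] s(4) intro!: bexI[of _ "scl K ?T s (in1 K A A)"])
  obtain d where d: "d \<in> arrs K" "src K d = unt K" "tgt K d = r_ob ?T" "s \<boxplus> d = r_unit ?T"
    "scl K ?T s d = zro K (unt K) (r_ob ?T)" "scl K ?T d d = d"
    by (rule idempotent_complement[of ?T s]) (simp_all add: s)
  obtain C q where m: "is_loc K ?T d C q" by (rule ex_loc[OF _ d(1-3,6)]) simp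
  obtain h where h: "is_loc K ?T (s \<boxplus> d) (prod_ring K A C) h" "prod_pr1 K A C \<cdot> h = r_mul A" "prod_pr2 K A C \<cdot> h = q"
    by (rule loc_pair[OF l m d(5)])
  have iso: "ring_iso K ?T (prod_ring K A C) h" using h(1) unfolding d(4) by (rule loc_unit_iso)
  note [simp] = is_locD[OF m]
  obtain j where j: "j \<in> arrs K" "src K j = r_ob C" "tgt K j = r_ob ?T" "q \<cdot> j = idt K (r_ob C)"
    by (rule is_locE[OF m]) blast
  have "separable K C"
    by (rule separable_quotient[OF _ separable_tensor[OF A A] _ _ j]) simp_all
  moreover have "ring_mor K A C (q \<cdot> in1 K A A)"
    by (rule ring_mor_cmp[OF ring_mor_in1]) simp_all
  moreover have "q \<cdot> in1 K A A = prod_pr2 K A C \<cdot> h \<cdot> (idt K (r_ob A) \<odot> r_unit A) \<cdot> run' (r_ob A)"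
    unfolding h(3)[symmetric] in1_def[symmetric]
    using is_locD[OF h(1)] loc_prod_fst[of A C] is_locD[of "prod_ring K A C" _ C "prod_pr2 K A C"] by auto
  ultimately have "is_derived_algebra K A C (q \<cdot> in1 K A A)"
    unfolding is_derived_algebra_def using iso h(2) by auto
  then show ?thesis by blast
qed

lemma derived_algebra_is: "\<lbrakk>is_ring K A; separable K A\<rbrakk> \<Longrightarrow>
   is_derived_algebra K A (fst (derived_algebra K A)) (snd (derived_algebra K A))"
proof -
  assume "is_ring K A" "separable K A"
  then have "\<exists>t. case t of (A', \<iota>) \<Rightarrow> is_derived_algebra K A A' \<iota>"
    using derived_algebra_exists[of A] by auto
  then have "case derived_algebra K A of (A', \<iota>) \<Rightarrow> is_derived_algebra K A A' \<iota>"
    unfolding derived_algebra_def by (rule someI_ex)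
  then show ?thesis by (simp add: case_prod_beta)
qed

text \<open>A' classifies pairs of disjoint morphisms out of \<open>A\<close>: a pair is a morphism
  out of A \<otimes> A, and disjointness says that it kills the diagonal factor. The argument starts
  from an arbitrary \<open>h\<close>, as A' is known only by its defining property. The section
  \<open>k\<close> records that A \<otimes> A -> A' is split epimorphic; uniqueness statements rest
  on it later.\<close>

lemma derived_algebra_spec:
  assumes A: "is_ring K A" and d: "is_derived_algebra K A A' \<iota>"
  shows "\<exists>q. ring_mor K A A' q \<and> disjoint_mors K A' \<iota> q \<and>
    (\<exists>k \<in> Hom K (r_ob A') (r_ob A \<boxtimes> r_ob A). prd K A' \<iota> q \<cdot> k = idt K (r_ob A')) \<and>
    (\<forall>S f g. is_ring K S \<and> ring_mor K A S f \<and> ring_mor K A S g \<and> disjoint_mors K S f g \<longrightarrow>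
      (\<exists>u. ring_mor K A' S u \<and> u \<cdot> \<iota> = f \<and> u \<cdot> q = g))"
proof -
  let ?T = "tensor_ring K A A" and ?P = "prod_ring K A A'" and ?p1 = "prod_pr1 K A A'" and ?p2 = "prod_pr2 K A A'"
  let ?i = "idt K"
  obtain h where A': "is_ring K A'" and \<iota>: "ring_mor K A A' \<iota>" and h: "ring_iso K ?T ?P h" "?p1 \<cdot> h = r_mul A"
    "\<iota> = ?p2 \<cdot> h \<cdot> in1 K A A"
    using d unfolding is_derived_algebra_def in1_def by blast
  note [simp] = A A'
  obtain i j where b: "biproduct K (r_ob A) (r_ob A') (r_ob ?P) i j ?p1 ?p2"
    and r: "is_ring K ?P" "ring_mor K ?P A ?p1" "ring_mor K ?P A' ?p2"
    by (rule prod_ring_biproduct[OF A A'])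
  have hm: "ring_mor K ?T ?P h" and hi: "iso_arrow K h" using h by (auto simp: ring_iso_def)
  note [simp] = r(1) biproductD(1-15)[OF b] ring_morD(1-3)[OF hm] iso_inv(2-4)[OF hi]
  define h' where "h' = inv_arrow K h"
  have hh: "h' \<cdot> h = ?i (r_ob A \<boxtimes> r_ob A)" "h \<cdot> h' = ?i (r_ob ?P)" and [simp]: "h' \<in> arrs K" "src K h' = r_ob ?P" "tgt K h' = r_ob A \<boxtimes> r_ob A"
    using iso_inv[OF hi] by (simp_all add: h'_def)
  have hhf: "h \<cdot> h' \<cdot> f = f" if "f \<in> arrs K" "tgt K f = r_ob ?P" for f
    using that reassoc[OF hh(2), of f] by simp
  define p where "p = ?p2 \<cdot> h"
  have pm: "ring_mor K ?T A' p" unfolding p_def by (rule ring_mor_cmp[OF hm r(3)]) simp_all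
  note [simp] = ring_morD(1-3)[OF pm]
  define q where "q = p \<cdot> in2 K A A"
  have \<iota>': "\<iota> = p \<cdot> in1 K A A" by (simp add: p_def h(3))
  have qm: "ring_mor K A A' q" unfolding q_def by (rule ring_mor_cmp[OF ring_mor_in2 pm]) simp_all
  note [simp] = ring_morD(1-3)[OF qm] ring_morD(1-3)[OF \<iota>]
  have pq: "prd K A' \<iota> q = p"
    unfolding \<iota>' q_def by (rule prd_in1_in2_expand[symmetric]) (simp_all add: pm)
  define k where "k = h' \<cdot> j"
  have [simp]: "k \<in> arrs K" "src K k = r_ob A'" "tgt K k = r_ob A \<boxtimes> r_ob A" by (simp_all add: k_def)
  have pk: "p \<cdot> k = ?i (r_ob A')"
    by (simp add: p_def k_def hhf biproductD[OF b])
  \<comment> \<open>\<open>e\<close> is the idempotent of the tensor ring that \<open>h\<close> maps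
    to (1, 0).\<close>
  define e where "e = h' \<cdot> i \<cdot> r_unit A"
  have [simp]: "e \<in> arrs K" "src K e = unt K" "tgt K e = r_ob A \<boxtimes> r_ob A" by (simp_all add: e_def)
  have he: "h \<cdot> e = i \<cdot> r_unit A" by (simp add: e_def hhf)
  have pe: "p \<cdot> e = zro K (unt K) (r_ob A')"
    by (simp add: p_def he biproduct_cmp[OF b])
  have "r_mul A \<cdot> e = (?p1 \<cdot> h) \<cdot> e" unfolding h(2) ..
  also have "\<dots> = r_unit A" by (simp add: he biproduct_cmp[OF b])
  finally have me: "r_mul A \<cdot> e = r_unit A" .
  have mf: "?p1 \<cdot> h \<cdot> f = r_mul A \<cdot> f" if "f \<in> arrs K" "tgt K f = r_ob A \<boxtimes> r_ob A" for f
    using that by (simp add: reassoc[OF h(2)])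
  \<comment> \<open>Scaled by \<open>e\<close>, any section of the multiplication becomes the
    inclusion of the factor \<open>A\<close>. Applied to \<open>in1\<close> and to
    \<open>in2\<close>, this shows that they agree where \<open>e\<close> lives.\<close>
  have ei: "scl K ?T e x = h' \<cdot> i" if x: "x \<in> arrs K" "src K x = r_ob A" "tgt K x = r_ob A \<boxtimes> r_ob A" "r_mul A \<cdot> x = ?i (r_ob A)" for x
  proof -
    have "h \<cdot> scl K ?T e x = h \<cdot> h' \<cdot> i"
      by (rule biproduct_joint[OF b])
        (simp_all add: x hhf ring_mor_scl[OF hm] he ring_mor_scl[OF r(2)] ring_mor_scl[OF r(3)] biproduct_cmp[OF b] mf biproductD[OF b])
    then show ?thesis by (rule iso_cancel_left[OF hi]) (simp_all add: x)
  qed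
  have e1: "scl K ?T e (in1 K A A) = h' \<cdot> i" and e2: "scl K ?T e (in2 K A A) = h' \<cdot> i"
    by (rule ei; simp add: ring_mor_mul_self(2,3))+
  have dis: "disjoint_mors K A' \<iota> q"
    unfolding disjoint_mors_def
  proof (intro ballI impI)
    fix \<epsilon> assume e0: "\<epsilon> \<in> Hom K (unt K) (r_ob A')" and eq: "scl K A' \<epsilon> \<iota> = scl K A' \<epsilon> q"
    then have [simp]: "\<epsilon> \<in> arrs K" "src K \<epsilon> = unt K" "tgt K \<epsilon> = r_ob A'" by auto
    have "scl K A' \<epsilon> p = prd K A' \<iota> (scl K A' \<epsilon> \<iota>)"
      unfolding pq[symmetric] by (simp add: scl_prd_right eq)
    also have "\<dots> = scl K A' \<epsilon> (\<iota> \<cdot> r_mul A)" by (simp add: scl_prd_right ring_mor_mul[OF \<iota>])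
    finally have "scl K A' \<epsilon> p \<cdot> e = scl K A' \<epsilon> (\<iota> \<cdot> r_mul A) \<cdot> e" by simp
    then show "\<epsilon> = zro K (unt K) (r_ob A')"
      by (simp add: scl_cmp pe me ring_morD(4)[OF \<iota>])
  qed
  have univ: "\<exists>u. ring_mor K A' S u \<and> u \<cdot> \<iota> = f \<and> u \<cdot> q = g"
    if S: "is_ring K S" and f: "ring_mor K A S f" and g: "ring_mor K A S g" and fg: "disjoint_mors K S f g" for S f g
  proof -
    note [simp] = S ring_morD(1-3)[OF f] ring_morD(1-3)[OF g]
    let ?w = "prd K S f g"
    note w = prd_ring_mor[OF A A S f g]
    have "scl K S (?w \<cdot> e) f = ?w \<cdot> scl K ?T e (in1 K A A)"
      by (simp add: ring_mor_scl[OF w(1)] w(2))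
    also have "\<dots> = scl K S (?w \<cdot> e) g"
      unfolding e1 e2[symmetric] by (simp add: ring_mor_scl[OF w(1)] w(3))
    finally have we: "?w \<cdot> e = zro K (unt K) (r_ob S)"
      using fg unfolding disjoint_mors_def by simp
    have wi: "?w \<cdot> (h' \<cdot> i) = zro K (r_ob A) (r_ob S)"
      unfolding e1[symmetric] by (simp add: ring_mor_scl[OF w(1)] we w(2))
    let ?u = "?w \<cdot> k"
    \<comment> \<open>The identity of the product ring is decomposed into its two summands; the one
      through \<open>A\<close> vanishes by \<open>wi\<close>, so \<open>?w\<close> factors through
      \<open>p\<close>.\<close>
    have "?w = ?w \<cdot> h' \<cdot> (((i \<cdot> ?p1) \<boxplus> (j \<cdot> ?p2)) \<cdot> h)"
      using biproductD(20)[OF b] hh by simp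
    also have "\<dots> = ((?w \<cdot> (h' \<cdot> i)) \<cdot> ?p1 \<cdot> h) \<boxplus> (?w \<cdot> h' \<cdot> j \<cdot> ?p2 \<cdot> h)"
      by (simp add: add_cmp cmp_add)
    also have "\<dots> = ?u \<cdot> p"
      unfolding wi by (simp add: k_def p_def)
    finally have up: "?u \<cdot> p = ?w" ..
    have um: "ring_mor K A' S ?u"
      by (rule ring_mor_cancel_epi[of ?T A' S p k]) (use up w in \<open>simp_all add: pm pk\<close>)
    have "?u \<cdot> \<iota> = (?u \<cdot> p) \<cdot> in1 K A A" "?u \<cdot> q = (?u \<cdot> p) \<cdot> in2 K A A"
      by (simp_all add: \<iota>' q_def)
    then have "?u \<cdot> \<iota> = f" "?u \<cdot> q = g" unfolding up w(2,3) by simp_all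
    then show ?thesis using um by blast
  qed
  show ?thesis
    using qm dis univ pk unfolding pq[symmetric] by (intro exI[of _ q]) (auto intro!: bexI[of _ k])
qed

end

section \<open>The category of modules over a separable ring\<close>

locale sep_ring = idempotent_complete_symmetric_monoidal_category K
  for K :: "('o, 'm) smc" (structure) +
  fixes R :: "('o, 'm) ring_obj"
  assumes R_ring [simp]: "is_ring K R" and R_sep: "separable K R"
begin

abbreviation r :: 'o where "r \<equiv> r_ob R"
abbreviation pj :: "('o, 'm) module_obj \<Rightarrow> ('o, 'm) module_obj \<Rightarrow> 'm" where "pj \<equiv> tens_proj K R"
abbreviation tn :: "('o, 'm) module_obj \<Rightarrow> ('o, 'm) module_obj \<Rightarrow> ('o, 'm) module_obj" where "tn \<equiv> tens_obj K R"
abbreviation md :: "('o, 'm) module_obj \<Rightarrow> bool" where "md \<equiv> is_module K R"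
abbreviation ln :: "('o, 'm) module_obj \<Rightarrow> ('o, 'm) module_obj \<Rightarrow> 'm \<Rightarrow> bool" where "ln \<equiv> linear K R"
abbreviation RR :: "('o, 'm) module_obj" where "RR \<equiv> regular_module R"

lemma mod_iff: "md M \<longleftrightarrow> fst M \<in> objs K \<and> snd M \<in> arrs K \<and> src K (snd M) = r \<boxtimes> fst M \<and> tgt K (snd M) = fst M \<and>
    snd M \<cdot> (r_mul R \<odot> idt K (fst M)) = snd M \<cdot> (idt K r \<odot> snd M) \<cdot> asc K r r (fst M) \<and>
    snd M \<cdot> (r_unit R \<odot> idt K (fst M)) = lun K (fst M)"
  unfolding is_module_def by (cases M) (simp add: conj_assoc)

lemma mod_ob [simp]: "md M \<Longrightarrow> fst M \<in> objs K"
  and mod_act [simp]: "md M \<Longrightarrow> snd M \<in> arrs K" "md M \<Longrightarrow> src K (snd M) = r \<boxtimes> fst M" "md M \<Longrightarrow> tgt K (snd M) = fst M"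
  and mod_assoc: "md M \<Longrightarrow> snd M \<cdot> (r_mul R \<odot> idt K (fst M)) = snd M \<cdot> (idt K r \<odot> snd M) \<cdot> asc K r r (fst M)"
  and mod_unit: "md M \<Longrightarrow> snd M \<cdot> (r_unit R \<odot> idt K (fst M)) = lun K (fst M)"
  unfolding mod_iff by blast+

lemma lin_iff: "ln M N f \<longleftrightarrow> f \<in> arrs K \<and> src K f = fst M \<and> tgt K f = fst N \<and> f \<cdot> snd M = snd N \<cdot> (idt K r \<odot> f)"
  unfolding linear_def by (simp add: conj_assoc)

lemma linD: "ln M N f \<Longrightarrow> f \<in> arrs K" "ln M N f \<Longrightarrow> src K f = fst M" "ln M N f \<Longrightarrow> tgt K f = fst N"
  and lin_act: "ln M N f \<Longrightarrow> f \<cdot> snd M = snd N \<cdot> (idt K r \<odot> f)"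
  unfolding lin_iff by blast+

text \<open>The right action obtained from the left one by the braiding. With it a module is a
  bimodule, and the pair of arrows defining the relative tensor product consists of
  \<open>rac M\<close> on the left factor and \<open>snd N\<close> on the right one.\<close>

definition rac :: "('o, 'm) module_obj \<Rightarrow> 'm" where
  "rac M = snd M \<cdot> brd K (fst M) r"

lemma rac_arr [simp]: "md M \<Longrightarrow> rac M \<in> arrs K" "md M \<Longrightarrow> src K (rac M) = fst M \<boxtimes> r" "md M \<Longrightarrow> tgt K (rac M) = fst M"
  by (simp_all add: rac_def)

text \<open>Commutativity of \<open>R\<close> lets two successive actions be interchanged;
  \<open>rac_rac\<close> and \<open>rac_act\<close> both reduce to this.\<close>

lemma act_sw:
  assumes [simp]: "md M"
  shows "snd M \<cdot> (idt K r \<odot> snd M) \<cdot> sw r r (fst M) = snd M \<cdot> (idt K r \<odot> snd M)"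
proof -
  have *: "snd M \<cdot> (r_mul R \<odot> idt K (fst M)) \<cdot> asc' r r (fst M) = snd M \<cdot> (idt K r \<odot> snd M)"
    using reassoc[OF mod_assoc[OF assms], of "asc' r r (fst M)"] by simp
  have "snd M \<cdot> (idt K r \<odot> snd M) \<cdot> sw r r (fst M) = (snd M \<cdot> (r_mul R \<odot> idt K (fst M)) \<cdot> asc' r r (fst M)) \<cdot> sw r r (fst M)"
    unfolding * by simp
  also have "\<dots> = snd M \<cdot> (r_mul R \<odot> idt K (fst M)) \<cdot> (brd K r r \<odot> idt K (fst M)) \<cdot> asc' r r (fst M)"
    by (simp add: sw_def)
  also have "\<dots> = snd M \<cdot> (r_mul R \<odot> idt K (fst M)) \<cdot> asc' r r (fst M)"
    by (simp add: tarr_cmp_tarr_assoc ring_mul_comm)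
  finally show ?thesis unfolding * .
qed

lemma rac_rac:
  assumes [simp]: "md M"
  shows "rac M \<cdot> (rac M \<odot> idt K r) = rac M \<cdot> (idt K (fst M) \<odot> r_mul R) \<cdot> asc K (fst M) r r"
proof -
  let ?x = "fst M" and ?\<rho> = "snd M" and ?i = "idt K"
  have "rac M \<cdot> (?i ?x \<odot> r_mul R) \<cdot> asc K ?x r r = (?\<rho> \<cdot> (r_mul R \<odot> ?i ?x)) \<cdot> brd K ?x (r \<boxtimes> r) \<cdot> asc K ?x r r"
    by (simp add: rac_def brd_nat_assoc)
  also have "\<dots> = ?\<rho> \<cdot> (?i r \<odot> ?\<rho>) \<cdot> ((?i r \<odot> brd K ?x r) \<cdot> asc K r ?x r) \<cdot> (brd K ?x r \<odot> ?i r)"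
    by (simp add: mod_assoc hexagon)
  also have "\<dots> = (?\<rho> \<cdot> (?i r \<odot> ?\<rho>) \<cdot> sw r r ?x) \<cdot> brd K (r \<boxtimes> ?x) r \<cdot> (brd K ?x r \<odot> ?i r)"
    by (simp add: sw_brd[symmetric])
  also have "\<dots> = ?\<rho> \<cdot> (?i r \<odot> ?\<rho>) \<cdot> (?i r \<odot> brd K ?x r) \<cdot> brd K (?x \<boxtimes> r) r"
    unfolding act_sw[OF assms] by (simp add: brd_nat)
  also have "\<dots> = rac M \<cdot> (rac M \<odot> ?i r)"
    by (simp add: rac_def brd_nat whisker_left)
  finally show ?thesis by simp
qed

lemma rac_act:
  assumes [simp]: "md M"
  shows "rac M \<cdot> (snd M \<odot> idt K r) = snd M \<cdot> (idt K r \<odot> rac M) \<cdot> asc K r (fst M) r"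
proof -
  let ?x = "fst M" and ?\<rho> = "snd M" and ?i = "idt K"
  have "?\<rho> \<cdot> (?i r \<odot> rac M) \<cdot> asc K r ?x r = ?\<rho> \<cdot> (?i r \<odot> ?\<rho>) \<cdot> ((?i r \<odot> brd K ?x r) \<cdot> asc K r ?x r)"
    by (simp add: rac_def whisker_left)
  also have "\<dots> = (?\<rho> \<cdot> (?i r \<odot> ?\<rho>) \<cdot> sw r r ?x) \<cdot> brd K (r \<boxtimes> ?x) r"
    by (simp add: sw_brd[symmetric])
  also have "\<dots> = rac M \<cdot> (?\<rho> \<odot> ?i r)"
    unfolding act_sw[OF assms] by (simp add: rac_def brd_nat)
  finally show ?thesis by simp
qed

lemma rac_unit: "md M \<Longrightarrow> rac M \<cdot> (idt K (fst M) \<odot> r_unit R) = run K (fst M)"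
  by (simp add: rac_def brd_nat reassoc[OF mod_unit] lun_brd)

lemma rac_lin:
  assumes "ln M N f" and [simp]: "md M" "md N"
  shows "f \<cdot> rac M = rac N \<cdot> (f \<odot> idt K r)"
  using linD[OF assms(1)] reassoc[OF lin_act[OF assms(1)], of "brd K (fst M) r"] by (simp add: rac_def brd_nat)

text \<open>Separability of \<open>R\<close> makes the right action split by a map which is itself right linear.\<close>

lemma rac_section:
  assumes [simp]: "md M"
  obtains u where "u \<in> arrs K" "src K u = fst M" "tgt K u = fst M \<boxtimes> r" "rac M \<cdot> u = idt K (fst M)"
    "u \<cdot> rac M = (idt K (fst M) \<odot> r_mul R) \<cdot> asc K (fst M) r r \<cdot> (u \<odot> idt K r)"
proof -
  let ?x = "fst M" and ?\<rho> = "snd M" and ?i = "idt K" and ?\<mu> = "r_mul R" and ?\<eta> = "r_unit R"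
  obtain \<sigma> where s0: "\<sigma> \<in> Hom K r (r \<boxtimes> r)" and s: "?\<mu> \<cdot> \<sigma> = ?i r"
      "(?i r \<odot> ?\<mu>) \<cdot> asc K r r r \<cdot> (\<sigma> \<odot> ?i r) = \<sigma> \<cdot> ?\<mu>"
      "(?\<mu> \<odot> ?i r) \<cdot> asc' r r r \<cdot> (?i r \<odot> \<sigma>) = \<sigma> \<cdot> ?\<mu>"
    using R_sep unfolding separable_def Let_def by blast
  have [simp]: "\<sigma> \<in> arrs K" "src K \<sigma> = r" "tgt K \<sigma> = r \<boxtimes> r" using s0 by auto
  \<comment> \<open>\<open>e\<close> is the separability element \<sigma>(1). Multiplying it by
    \<open>R\<close> from either side gives back \<sigma>, as \<open>e1\<close> and
    \<open>e2\<close> record.\<close>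
  define e where "e = \<sigma> \<cdot> ?\<eta>"
  have [simp]: "e \<in> arrs K" "src K e = unt K" "tgt K e = r \<boxtimes> r" by (simp_all add: e_def)
  have me: "?\<mu> \<cdot> e = ?\<eta>" using reassoc[OF s(1), of ?\<eta>] by (simp add: e_def)
  have e1: "(?i r \<odot> ?\<mu>) \<cdot> asc K r r r \<cdot> (e \<odot> ?i r) = \<sigma> \<cdot> lun K r"
  proof -
    have "(?i r \<odot> ?\<mu>) \<cdot> asc K r r r \<cdot> (e \<odot> ?i r) = ((?i r \<odot> ?\<mu>) \<cdot> asc K r r r \<cdot> (\<sigma> \<odot> ?i r)) \<cdot> (?\<eta> \<odot> ?i r)"
      by (simp add: e_def tarr_cmp_tarr)
    then show ?thesis unfolding s by (simp add: ring_mul_unit_left)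
  qed
  have e2: "(?\<mu> \<odot> ?i r) \<cdot> asc' r r r \<cdot> (?i r \<odot> e) = \<sigma> \<cdot> run K r"
  proof -
    have "(?\<mu> \<odot> ?i r) \<cdot> asc' r r r \<cdot> (?i r \<odot> e) = ((?\<mu> \<odot> ?i r) \<cdot> asc' r r r \<cdot> (?i r \<odot> \<sigma>)) \<cdot> (?i r \<odot> ?\<eta>)"
      by (simp add: e_def tarr_cmp_tarr)
    then show ?thesis unfolding s by (simp add: ring_mul_unit_right)
  qed
  \<comment> \<open>\<open>u\<close> multiplies x by the first tensor component of \<open>e\<close>
    and keeps the second.\<close>
  define u where "u = (rac M \<odot> ?i r) \<cdot> asc' ?x r r \<cdot> (?i ?x \<odot> e) \<cdot> run' ?x"
  have [simp]: "u \<in> arrs K" "src K u = ?x" "tgt K u = ?x \<boxtimes> r" by (simp_all add: u_def)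
  have "rac M \<cdot> u = (rac M \<cdot> (rac M \<odot> ?i r)) \<cdot> asc' ?x r r \<cdot> (?i ?x \<odot> e) \<cdot> run' ?x"
    by (simp add: u_def)
  also have "\<dots> = rac M \<cdot> (?i ?x \<odot> ?\<eta>) \<cdot> run' ?x"
    unfolding rac_rac[OF assms] by (simp add: tarr_cmp_tarr_assoc me)
  also have "\<dots> = ?i ?x" by (simp add: reassoc[OF rac_unit])
  finally have 1: "rac M \<cdot> u = ?i ?x" .
  have "(?i ?x \<odot> ?\<mu>) \<cdot> asc K ?x r r \<cdot> (u \<odot> ?i r) =
     (?i ?x \<odot> ?\<mu>) \<cdot> asc K ?x r r \<cdot> ((rac M \<odot> ?i r) \<odot> ?i r) \<cdot> (asc' ?x r r \<odot> ?i r) \<cdot> ((?i ?x \<odot> e) \<odot> ?i r) \<cdot> (run' ?x \<odot> ?i r)"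
    by (simp add: u_def whisker_right)
  also have "\<dots> = (?i ?x \<odot> ?\<mu>) \<cdot> ((rac M \<odot> (?i r \<odot> ?i r)) \<cdot> (asc K (?x \<boxtimes> r) r r \<cdot> (asc' ?x r r \<odot> ?i r) \<cdot> ((?i ?x \<odot> e) \<odot> ?i r) \<cdot> (run' ?x \<odot> ?i r)))"
    by (simp add: asc_nat_assoc)
  also have "\<dots> = (rac M \<odot> ?i r) \<cdot> ((?i (?x \<boxtimes> r) \<odot> ?\<mu>) \<cdot> (asc K (?x \<boxtimes> r) r r \<cdot> (asc' ?x r r \<odot> ?i r) \<cdot> ((?i ?x \<odot> e) \<odot> ?i r) \<cdot> (run' ?x \<odot> ?i r)))"
    by (simp add: tarr_cmp_tarr_assoc)
  also have "\<dots> = (rac M \<odot> ?i r) \<cdot> ((?i (?x \<boxtimes> r) \<odot> ?\<mu>) \<cdot> ((asc K (?x \<boxtimes> r) r r \<cdot> (asc' ?x r r \<odot> ?i r) \<cdot> asc' ?x (r \<boxtimes> r) r) \<cdot> asc K ?x (r \<boxtimes> r) r \<cdot> ((?i ?x \<odot> e) \<odot> ?i r) \<cdot> (run' ?x \<odot> ?i r)))"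
    by simp
  also have "\<dots> = (rac M \<odot> ?i r) \<cdot> (?i (?x \<boxtimes> r) \<odot> ?\<mu>) \<cdot> asc' ?x r (r \<boxtimes> r) \<cdot> (?i ?x \<odot> asc K r r r) \<cdot> (?i ?x \<odot> (e \<odot> ?i r)) \<cdot> asc K ?x (unt K) r \<cdot> (run' ?x \<odot> ?i r)"
    by (subst pentagon_2[symmetric]) (simp_all add: asc_nat_assoc)
  also have "\<dots> = (rac M \<odot> ?i r) \<cdot> (((?i ?x \<odot> ?i r) \<odot> ?\<mu>) \<cdot> (asc' ?x r (r \<boxtimes> r) \<cdot> (?i ?x \<odot> (asc K r r r \<cdot> (e \<odot> ?i r))) \<cdot> asc K ?x (unt K) r \<cdot> (run' ?x \<odot> ?i r)))"
    by (simp add: whisker_left)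
  also have "\<dots> = (rac M \<odot> ?i r) \<cdot> asc' ?x r r \<cdot> (?i ?x \<odot> ((?i r \<odot> ?\<mu>) \<cdot> asc K r r r \<cdot> (e \<odot> ?i r))) \<cdot> asc K ?x (unt K) r \<cdot> (run' ?x \<odot> ?i r)"
    by (simp add: whisker_left asc'_nat_assoc)
  also have "\<dots> = (rac M \<odot> ?i r) \<cdot> asc' ?x r r \<cdot> (?i ?x \<odot> \<sigma>) \<cdot> (?i ?x \<odot> lun K r) \<cdot> asc K ?x (unt K) r \<cdot> (run' ?x \<odot> ?i r)"
    unfolding e1 by (simp add: whisker_left)
  also have "\<dots> = (rac M \<odot> ?i r) \<cdot> asc' ?x r r \<cdot> (?i ?x \<odot> \<sigma>)"
    by (simp add: reassoc[OF triangle] whisker_inv)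
  \<comment> \<open>Both composites to be compared turn out to be x \<otimes> a -> x \<sigma>(a),
    which is the right linearity of \<open>u\<close>.\<close>
  finally have L: "(?i ?x \<odot> ?\<mu>) \<cdot> asc K ?x r r \<cdot> (u \<odot> ?i r) = (rac M \<odot> ?i r) \<cdot> asc' ?x r r \<cdot> (?i ?x \<odot> \<sigma>)" .
  have rr: "asc K ?x r (unt K) \<cdot> run' (?x \<boxtimes> r) = ?i ?x \<odot> run' r"
  proof (rule iso_cancel_left[OF tarr_iso[OF idt_iso run_iso]])
    have "(?i ?x \<odot> run K r) \<cdot> asc K ?x r (unt K) \<cdot> run' (?x \<boxtimes> r) = ?i (?x \<boxtimes> r)"
      by (simp add: reassoc[OF run_tobj[symmetric]])
    then show "(?i ?x \<odot> run K r) \<cdot> asc K ?x r (unt K) \<cdot> run' (?x \<boxtimes> r) = (?i ?x \<odot> run K r) \<cdot> (?i ?x \<odot> run' r)"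
      by (simp add: whisker_inv)
  qed simp_all
  have "u \<cdot> rac M = (rac M \<odot> ?i r) \<cdot> asc' ?x r r \<cdot> ((rac M \<odot> e) \<cdot> run' (?x \<boxtimes> r))"
    by (simp add: u_def run'_nat tarr_cmp_tarr_assoc)
  also have "\<dots> = (rac M \<odot> ?i r) \<cdot> asc' ?x r r \<cdot> ((rac M \<odot> (?i r \<odot> ?i r)) \<cdot> ((?i (?x \<boxtimes> r) \<odot> e) \<cdot> run' (?x \<boxtimes> r)))"
    by (simp add: tarr_cmp_tarr_assoc)
  also have "\<dots> = ((rac M \<cdot> (rac M \<odot> ?i r)) \<odot> ?i r) \<cdot> asc' (?x \<boxtimes> r) r r \<cdot> (?i (?x \<boxtimes> r) \<odot> e) \<cdot> run' (?x \<boxtimes> r)"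
    by (subst asc'_nat_assoc) (simp_all add: whisker_right)
  also have "\<dots> = (rac M \<odot> ?i r) \<cdot> ((?i ?x \<odot> ?\<mu>) \<odot> ?i r) \<cdot> (asc K ?x r r \<odot> ?i r) \<cdot> asc' (?x \<boxtimes> r) r r \<cdot> ((?i ?x \<odot> ?i r) \<odot> e) \<cdot> run' (?x \<boxtimes> r)"
    unfolding rac_rac[OF assms] by (simp add: whisker_right)
  also have "\<dots> = (rac M \<odot> ?i r) \<cdot> ((?i ?x \<odot> ?\<mu>) \<odot> ?i r) \<cdot> (asc' ?x (r \<boxtimes> r) r \<cdot> asc K ?x (r \<boxtimes> r) r \<cdot> (asc K ?x r r \<odot> ?i r) \<cdot> asc' (?x \<boxtimes> r) r r) \<cdot> ((?i ?x \<odot> ?i r) \<odot> e) \<cdot> run' (?x \<boxtimes> r)"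
    by simp
  also have "\<dots> = (rac M \<odot> ?i r) \<cdot> ((?i ?x \<odot> ?\<mu>) \<odot> ?i r) \<cdot> asc' ?x (r \<boxtimes> r) r \<cdot> (?i ?x \<odot> asc' r r r) \<cdot> asc K ?x r (r \<boxtimes> r) \<cdot> ((?i ?x \<odot> ?i r) \<odot> e) \<cdot> run' (?x \<boxtimes> r)"
    by (subst pentagon_3[symmetric]) (simp_all del: tarr_idt_idt)
  also have "\<dots> = (rac M \<odot> ?i r) \<cdot> ((?i ?x \<odot> ?\<mu>) \<odot> ?i r) \<cdot> asc' ?x (r \<boxtimes> r) r \<cdot> (?i ?x \<odot> asc' r r r) \<cdot> (?i ?x \<odot> (?i r \<odot> e)) \<cdot> asc K ?x r (unt K) \<cdot> run' (?x \<boxtimes> r)"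
    by (subst asc_nat_assoc) simp_all
  also have "\<dots> = (rac M \<odot> ?i r) \<cdot> asc' ?x r r \<cdot> (?i ?x \<odot> ((?\<mu> \<odot> ?i r) \<cdot> asc' r r r \<cdot> (?i r \<odot> e))) \<cdot> (?i ?x \<odot> run' r)"
    unfolding rr by (simp add: whisker_left asc'_nat_assoc)
  also have "\<dots> = (rac M \<odot> ?i r) \<cdot> asc' ?x r r \<cdot> (?i ?x \<odot> \<sigma>)"
    unfolding e2 by (simp add: tarr_cmp_tarr)
  finally have 2: "u \<cdot> rac M = (?i ?x \<odot> ?\<mu>) \<cdot> asc K ?x r r \<cdot> (u \<odot> ?i r)" unfolding L .
  show ?thesis by (rule that[OF _ _ _ 1 2]) simp_all
qed

text \<open>Besides a section of the projection, the choice records that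
  \<open>tsec M N \<cdot> pj M N\<close> is the second action after a section \<open>t\<close> of
  the first. These are the data of a split coequaliser, which survive tensoring with further
  objects; descent on iterated tensor products depends on that.\<close>

definition tsec :: "('o, 'm) module_obj \<Rightarrow> ('o, 'm) module_obj \<Rightarrow> 'm" where
  "tsec M N = (SOME k. k \<in> Hom K (tgt K (pj M N)) (fst M \<boxtimes> fst N) \<and> pj M N \<cdot> k = idt K (tgt K (pj M N)) \<and>
     (\<exists>t \<in> Hom K (fst M \<boxtimes> fst N) ((fst M \<boxtimes> r) \<boxtimes> fst N). (rac M \<odot> idt K (fst N)) \<cdot> t = idt K (fst M \<boxtimes> fst N) \<and>
       k \<cdot> pj M N = ((idt K (fst M) \<odot> snd N) \<cdot> asc K (fst M) r (fst N)) \<cdot> t))"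

text \<open>The right linear section \<open>u\<close> makes the two actions \<alpha>, \<beta> a
  split coequaliser: with t = u \<otimes> 1, the arrow E = \<beta> t is idempotent and coequalises
  them, while every balanced h satisfies h E = h. Splitting E gives a coequaliser, so the choice in
  \<open>tens_proj\<close> is one.\<close>

lemma pj_aux:
  assumes [simp]: "md M" "md N"
  shows "pj M N \<in> arrs K" "src K (pj M N) = fst M \<boxtimes> fst N"
    "pj M N \<cdot> (rac M \<odot> idt K (fst N)) = pj M N \<cdot> (idt K (fst M) \<odot> snd N) \<cdot> asc K (fst M) r (fst N)"
    "\<exists>k. k \<in> Hom K (tgt K (pj M N)) (fst M \<boxtimes> fst N) \<and> pj M N \<cdot> k = idt K (tgt K (pj M N)) \<and>
     (\<exists>t \<in> Hom K (fst M \<boxtimes> fst N) ((fst M \<boxtimes> r) \<boxtimes> fst N). (rac M \<odot> idt K (fst N)) \<cdot> t = idt K (fst M \<boxtimes> fst N) \<and>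
       k \<cdot> pj M N = ((idt K (fst M) \<odot> snd N) \<cdot> asc K (fst M) r (fst N)) \<cdot> t)"
proof -
  let ?x = "fst M" and ?y = "fst N" and ?i = "idt K" and ?\<mu> = "r_mul R"
  let ?\<alpha> = "rac M \<odot> ?i ?y" and ?\<beta> = "(?i ?x \<odot> snd N) \<cdot> asc K ?x r ?y"
  obtain u where u: "u \<in> arrs K" "src K u = ?x" "tgt K u = ?x \<boxtimes> r" "rac M \<cdot> u = ?i ?x"
    "u \<cdot> rac M = (?i ?x \<odot> ?\<mu>) \<cdot> asc K ?x r r \<cdot> (u \<odot> ?i r)"
    by (rule rac_section[OF assms(1)])
  note [simp] = u(1-3)
  define t where "t = u \<odot> ?i ?y"
  have [simp]: "t \<in> arrs K" "src K t = ?x \<boxtimes> ?y" "tgt K t = (?x \<boxtimes> r) \<boxtimes> ?y" by (simp_all add: t_def)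
  have at: "?\<alpha> \<cdot> t = ?i (?x \<boxtimes> ?y)" by (simp add: t_def tarr_cmp_tarr u(4))
  define E where "E = ?\<beta> \<cdot> t"
  have [simp]: "E \<in> arrs K" "src K E = ?x \<boxtimes> ?y" "tgt K E = ?x \<boxtimes> ?y" by (simp_all add: E_def)
  \<comment> \<open>Right linearity of \<open>u\<close> enters here, together with associativity of
    the action on \<open>N\<close> and the pentagon.\<close>
  have Eab: "E \<cdot> ?\<alpha> = E \<cdot> ?\<beta>"
  proof -
    have "E \<cdot> ?\<alpha> = (?i ?x \<odot> snd N) \<cdot> asc K ?x r ?y \<cdot> ((?i ?x \<odot> ?\<mu>) \<odot> ?i ?y) \<cdot> (asc K ?x r r \<odot> ?i ?y) \<cdot> ((u \<odot> ?i r) \<odot> ?i ?y)"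
      by (simp add: E_def t_def tarr_cmp_tarr u(5))
    also have "\<dots> = (?i ?x \<odot> (snd N \<cdot> (?\<mu> \<odot> ?i ?y))) \<cdot> asc K ?x (r \<boxtimes> r) ?y \<cdot> (asc K ?x r r \<odot> ?i ?y) \<cdot> ((u \<odot> ?i r) \<odot> ?i ?y)"
      by (simp add: asc_nat_assoc whisker_left)
    also have "\<dots> = (?i ?x \<odot> snd N) \<cdot> (?i ?x \<odot> (?i r \<odot> snd N)) \<cdot> ((?i ?x \<odot> asc K r r ?y) \<cdot> asc K ?x (r \<boxtimes> r) ?y \<cdot> (asc K ?x r r \<odot> ?i ?y)) \<cdot> ((u \<odot> ?i r) \<odot> ?i ?y)"
      unfolding mod_assoc[OF assms(2)] by (simp add: whisker_left)
    also have "\<dots> = (?i ?x \<odot> snd N) \<cdot> (?i ?x \<odot> (?i r \<odot> snd N)) \<cdot> asc K ?x r (r \<boxtimes> ?y) \<cdot> (u \<odot> (?i r \<odot> ?i ?y)) \<cdot> asc K ?x r ?y"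
      by (simp add: pentagon[symmetric] asc_nat del: tarr_idt_idt)
    also have "\<dots> = (?i ?x \<odot> snd N) \<cdot> asc K ?x r ?y \<cdot> ((?i (?x \<boxtimes> r) \<odot> snd N) \<cdot> ((u \<odot> ?i (r \<boxtimes> ?y)) \<cdot> asc K ?x r ?y))"
      using asc_nat_assoc[of "?i ?x" "?i r" "snd N" ?x r ?y "(u \<odot> ?i (r \<boxtimes> ?y)) \<cdot> asc K ?x r ?y"] by simp
    also have "\<dots> = E \<cdot> ?\<beta>"
      by (simp add: E_def t_def tarr_cmp_tarr_assoc)
    finally show ?thesis .
  qed
  have EE: "E \<cdot> E = E"
  proof -
    have "E \<cdot> E = (E \<cdot> ?\<beta>) \<cdot> t" by (simp add: E_def)
    also have "\<dots> = (E \<cdot> ?\<alpha>) \<cdot> t" unfolding Eab ..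
    also have "\<dots> = E" using at by simp
    finally show ?thesis .
  qed
  have hE: "h \<cdot> E = h" if "h \<in> arrs K" "src K h = ?x \<boxtimes> ?y" "h \<cdot> ?\<alpha> = h \<cdot> ?\<beta>" for h
  proof -
    have "h \<cdot> E = (h \<cdot> ?\<beta>) \<cdot> t" using that(1,2) by (simp add: E_def)
    also have "\<dots> = (h \<cdot> ?\<alpha>) \<cdot> t" unfolding that(3) ..
    also have "\<dots> = h" using at that(1,2) by simp
    finally show ?thesis .
  qed
  have "E \<in> Hom K (?x \<boxtimes> ?y) (?x \<boxtimes> ?y)" by simp
  then obtain z z' i i' p p' where b: "biproduct K z z' (?x \<boxtimes> ?y) i i' p p'" "E = i \<cdot> p"
    using idempotent_splits[of "?x \<boxtimes> ?y" E] EE by (auto simp del: in_Hom_iff)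
  note [simp] = biproductD(1-15)[OF b(1)]
  note pi = biproductD(16)[OF b(1)]
  have "coequaliser K ?\<alpha> ?\<beta> p"
    unfolding coequaliser_def
  proof (intro conjI ballI impI)
    have "p \<cdot> i \<cdot> p \<cdot> ?\<alpha> = p \<cdot> i \<cdot> p \<cdot> ?\<beta>"
      using arg_cong[OF Eab, of "\<lambda>f. p \<cdot> f"] unfolding b(2) by simp
    then show "p \<cdot> ?\<alpha> = p \<cdot> ?\<beta>" by (simp add: reassoc[OF pi])
    fix h assume h: "h \<in> arrs K" "src K h = tgt K ?\<alpha> \<and> h \<cdot> ?\<alpha> = h \<cdot> ?\<beta>"
    then have 1: "(h \<cdot> i) \<cdot> p = h" using hE[of h] unfolding b(2) by simp
    show "\<exists>!k. k \<in> Hom K (tgt K p) (tgt K h) \<and> k \<cdot> p = h"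
    proof (rule ex1I[of _ "h \<cdot> i"])
      show "h \<cdot> i \<in> Hom K (tgt K p) (tgt K h) \<and> (h \<cdot> i) \<cdot> p = h" using h 1 by simp
      fix k assume k: "k \<in> Hom K (tgt K p) (tgt K h) \<and> k \<cdot> p = h"
      then show "k = h \<cdot> i" using reassoc[of k p h i] pi by simp
    qed
  qed simp_all
  moreover have "pj M N = (SOME q. coequaliser K ?\<alpha> ?\<beta> q)"
    by (simp add: tens_proj_def rac_def case_prod_beta)
  ultimately have c: "coequaliser K ?\<alpha> ?\<beta> (pj M N)" using someI_ex[of "coequaliser K ?\<alpha> ?\<beta>"] by auto
  show q [simp]: "pj M N \<in> arrs K" "src K (pj M N) = fst M \<boxtimes> fst N"
    and qab: "pj M N \<cdot> ?\<alpha> = pj M N \<cdot> ?\<beta>"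
    using c unfolding coequaliser_def by auto
  let ?q = "pj M N"
  have un: "\<exists>!k. k \<in> Hom K (tgt K ?q) (tgt K h) \<and> k \<cdot> ?q = h" if "h \<in> arrs K" "src K h = ?x \<boxtimes> ?y" "h \<cdot> ?\<alpha> = h \<cdot> ?\<beta>" for h
    using c that unfolding coequaliser_def by simp
  \<comment> \<open>The chosen coequaliser may differ from the one just constructed, so its section
    is obtained from its own universal property, applied to \<open>E\<close>.\<close>
  obtain k where k: "k \<in> Hom K (tgt K ?q) (?x \<boxtimes> ?y)" "k \<cdot> ?q = E"
    using un[of E] Eab by auto
  then have [simp]: "k \<in> arrs K" "src K k = tgt K ?q" "tgt K k = ?x \<boxtimes> ?y" by auto
  have "(?q \<cdot> k) \<cdot> ?q = ?q" using hE[of ?q] qab by (simp add: k(2))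
  then have "?q \<cdot> k = ?i (tgt K ?q)"
    using un[of ?q] qab by (metis cmp_arr cmp_src cmp_tgt idt_arr idt_cmp idt_src idt_tgt in_Hom_iff k(1) q(1) q(2) tgt_in_objs)
  then show "\<exists>k. k \<in> Hom K (tgt K ?q) (?x \<boxtimes> ?y) \<and> ?q \<cdot> k = ?i (tgt K ?q) \<and>
     (\<exists>t \<in> Hom K (?x \<boxtimes> ?y) ((?x \<boxtimes> r) \<boxtimes> ?y). ?\<alpha> \<cdot> t = ?i (?x \<boxtimes> ?y) \<and> k \<cdot> ?q = ?\<beta> \<cdot> t)"
    using k at by (intro exI[of _ k]) (auto simp: E_def intro!: bexI[of _ t])
qed

end

section \<open>Descent along split epimorphisms\<close>

context category
begin

definition split_epi :: "'m \<Rightarrow> bool" where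
  "split_epi q \<longleftrightarrow> q \<in> arrs K \<and> (\<exists>k \<in> arrs K. src K k = tgt K q \<and> tgt K k = src K q \<and> q \<cdot> k = idt K (tgt K q))"

lemma split_epi_idt: "x \<in> objs K \<Longrightarrow> split_epi (idt K x)"
  unfolding split_epi_def by (auto intro!: bexI[of _ "idt K x"])

lemma split_epi_cmp:
  assumes "split_epi f" "split_epi g" "src K g = tgt K f"
  shows "split_epi (g \<cdot> f)"
proof -
  obtain k where k: "f \<in> arrs K" "k \<in> arrs K" "src K k = tgt K f" "tgt K k = src K f" "f \<cdot> k = idt K (tgt K f)"
    using assms(1) unfolding split_epi_def by blast
  obtain l where l: "g \<in> arrs K" "l \<in> arrs K" "src K l = tgt K g" "tgt K l = src K g" "g \<cdot> l = idt K (tgt K g)"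
    using assms(2) unfolding split_epi_def by blast
  have "(g \<cdot> f) \<cdot> (k \<cdot> l) = idt K (tgt K g)"
    using k l assms(3) reassoc[OF k(5), of l] by simp
  then show ?thesis unfolding split_epi_def using k l assms(3) by (auto intro!: bexI[of _ "k \<cdot> l"])
qed

lemma split_epi_cancel:
  assumes "split_epi h" "f \<cdot> h = g \<cdot> h" "f \<in> arrs K" "g \<in> arrs K" "src K f = tgt K h" "src K g = tgt K h"
  shows "f = g"
proof -
  obtain k where k: "h \<in> arrs K" "k \<in> arrs K" "src K k = tgt K h" "tgt K k = src K h" "h \<cdot> k = idt K (tgt K h)"
    using assms(1) unfolding split_epi_def by blast
  show ?thesis by (rule sect_cancel_right[OF k(5) assms(2)]) (use assms k in simp_all)
qed

text \<open>\<open>descend\<close> is a definite description. With a section \<open>k\<close> at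
  hand the only candidate is \<open>f \<cdot> k\<close>, and the condition on \<open>f\<close> says
  that it works.\<close>

lemma descend_sect:
  assumes "q \<in> arrs K" "k \<in> arrs K" "src K k = tgt K q" "tgt K k = src K q" "q \<cdot> k = idt K (tgt K q)"
    and f: "f \<in> arrs K" "src K f = src K q" "f \<cdot> k \<cdot> q = f"
  shows "descend K q f \<in> arrs K" "src K (descend K q f) = tgt K q" "tgt K (descend K q f) = tgt K f"
    "descend K q f \<cdot> q = f"
proof -
  have "descend K q f = f \<cdot> k"
    unfolding descend_def
  proof (rule the_equality)
    show "f \<cdot> k \<in> Hom K (tgt K q) (tgt K f) \<and> (f \<cdot> k) \<cdot> q = f" using assms by simp
    fix g assume g: "g \<in> Hom K (tgt K q) (tgt K f) \<and> g \<cdot> q = f"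
    then show "g = f \<cdot> k" using reassoc[of g q f k] assms by simp
  qed
  then show "descend K q f \<in> arrs K" "src K (descend K q f) = tgt K q" "tgt K (descend K q f) = tgt K f"
    "descend K q f \<cdot> q = f" using assms by simp_all
qed

end

lemma (in symmetric_monoidal_category) split_epi_tarr:
  assumes "split_epi f" "split_epi g"
  shows "split_epi (f \<odot> g)"
proof -
  obtain k where k: "f \<in> arrs K" "k \<in> arrs K" "src K k = tgt K f" "tgt K k = src K f" "f \<cdot> k = idt K (tgt K f)"
    using assms(1) unfolding split_epi_def by blast
  obtain l where l: "g \<in> arrs K" "l \<in> arrs K" "src K l = tgt K g" "tgt K l = src K g" "g \<cdot> l = idt K (tgt K g)"
    using assms(2) unfolding split_epi_def by blast
  show ?thesis unfolding split_epi_def using k l by (auto simp: tarr_cmp_tarr intro!: bexI[of _ "k \<odot> l"])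
qed

text \<open>Reversing three factors, reassociating and reversing again inverts the associator. The
  inverse is thereby expressed through arrows already known to descend to modules.\<close>

lemma (in symmetric_monoidal_category) asc'_brd:
  assumes [simp]: "x \<in> objs K" "y \<in> objs K" "z \<in> objs K"
  shows "(brd K y x \<odot> idt K z) \<cdot> brd K z (y \<boxtimes> x) \<cdot> asc K z y x \<cdot> (brd K y z \<odot> idt K x) \<cdot> brd K x (y \<boxtimes> z) = asc' x y z"
  by (simp add: hexagon_brd[of x y z] hexagon_brd[of z y x] whisker_inv)

section \<open>The relative tensor product and its structure arrows\<close>

context sep_ring
begin

lemma fst_tn: "fst (tn M N) = tgt K (pj M N)"
  by (simp add: tens_obj_def Let_def)

lemma pj_arr [simp]: "\<lbrakk>md M; md N\<rbrakk> \<Longrightarrow> pj M N \<in> arrs K"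
  and pj_src [simp]: "\<lbrakk>md M; md N\<rbrakk> \<Longrightarrow> src K (pj M N) = fst M \<boxtimes> fst N"
  and pj_tgt [simp]: "tgt K (pj M N) = fst (tn M N)"
  and pj_bal: "\<lbrakk>md M; md N\<rbrakk> \<Longrightarrow> pj M N \<cdot> (rac M \<odot> idt K (fst N)) = pj M N \<cdot> (idt K (fst M) \<odot> snd N) \<cdot> asc K (fst M) r (fst N)"
  by (simp_all add: pj_aux fst_tn)

lemma tn_ob [simp]: "\<lbrakk>md M; md N\<rbrakk> \<Longrightarrow> fst (tn M N) \<in> objs K"
  using tgt_in_objs[of "pj M N"] by simp

lemma pj_bal_assoc:
  "\<lbrakk>md M; md N; h \<in> arrs K; tgt K h = (fst M \<boxtimes> r) \<boxtimes> fst N\<rbrakk> \<Longrightarrow>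
   pj M N \<cdot> (rac M \<odot> idt K (fst N)) \<cdot> h = pj M N \<cdot> (idt K (fst M) \<odot> snd N) \<cdot> asc K (fst M) r (fst N) \<cdot> h"
  using reassoc[OF pj_bal, of M N h] by simp

lemma tsec:
  assumes "md M" "md N"
  shows "tsec M N \<in> arrs K" "src K (tsec M N) = fst (tn M N)" "tgt K (tsec M N) = fst M \<boxtimes> fst N"
    "pj M N \<cdot> tsec M N = idt K (fst (tn M N))"
    "\<exists>t \<in> Hom K (fst M \<boxtimes> fst N) ((fst M \<boxtimes> r) \<boxtimes> fst N). (rac M \<odot> idt K (fst N)) \<cdot> t = idt K (fst M \<boxtimes> fst N) \<and>
       tsec M N \<cdot> pj M N = ((idt K (fst M) \<odot> snd N) \<cdot> asc K (fst M) r (fst N)) \<cdot> t"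
  using someI_ex[OF pj_aux(4)[OF assms], folded tsec_def] by simp_all

lemma pj_split_epi [simp]: "\<lbrakk>md M; md N\<rbrakk> \<Longrightarrow> split_epi (pj M N)"
  unfolding split_epi_def using tsec[of M N] by (auto intro!: bexI[of _ "tsec M N"])

text \<open>A balanced arrow may trade the second action for the first, whose section
  \<open>t\<close> then cancels. The two variants that follow perform the same exchange next to a
  spectator factor \<open>w\<close>.\<close>

lemma tsec_absorb:
  assumes [simp]: "md M" "md N" and h: "h \<in> arrs K" "src K h = fst M \<boxtimes> fst N"
    "h \<cdot> (rac M \<odot> idt K (fst N)) = h \<cdot> (idt K (fst M) \<odot> snd N) \<cdot> asc K (fst M) r (fst N)"
  shows "h \<cdot> tsec M N \<cdot> pj M N = h"
proof -
  obtain t where t: "t \<in> arrs K" "src K t = fst M \<boxtimes> fst N" "tgt K t = (fst M \<boxtimes> r) \<boxtimes> fst N"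
    "(rac M \<odot> idt K (fst N)) \<cdot> t = idt K (fst M \<boxtimes> fst N)"
    "tsec M N \<cdot> pj M N = ((idt K (fst M) \<odot> snd N) \<cdot> asc K (fst M) r (fst N)) \<cdot> t"
    using tsec(5)[OF assms(1,2)] by auto
  have "h \<cdot> tsec M N \<cdot> pj M N = (h \<cdot> (idt K (fst M) \<odot> snd N) \<cdot> asc K (fst M) r (fst N)) \<cdot> t"
    unfolding t(5) using h(1,2) t(1-4) by simp
  also have "\<dots> = h" unfolding h(3)[symmetric] using h(1,2) t(1-4) by simp
  finally show ?thesis .
qed

lemma tsec_absorb_left:
  assumes [simp]: "md M" "md N" "w \<in> objs K" and h: "h \<in> arrs K" "src K h = w \<boxtimes> (fst M \<boxtimes> fst N)"
    "h \<cdot> (idt K w \<odot> (rac M \<odot> idt K (fst N))) = h \<cdot> (idt K w \<odot> ((idt K (fst M) \<odot> snd N) \<cdot> asc K (fst M) r (fst N)))"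
  shows "h \<cdot> (idt K w \<odot> tsec M N) \<cdot> (idt K w \<odot> pj M N) = h"
proof -
  obtain t where t: "t \<in> arrs K" "src K t = fst M \<boxtimes> fst N" "tgt K t = (fst M \<boxtimes> r) \<boxtimes> fst N"
    "(rac M \<odot> idt K (fst N)) \<cdot> t = idt K (fst M \<boxtimes> fst N)"
    "tsec M N \<cdot> pj M N = ((idt K (fst M) \<odot> snd N) \<cdot> asc K (fst M) r (fst N)) \<cdot> t"
    using tsec(5)[OF assms(1,2)] by auto
  have "h \<cdot> (idt K w \<odot> tsec M N) \<cdot> (idt K w \<odot> pj M N) = (h \<cdot> (idt K w \<odot> ((idt K (fst M) \<odot> snd N) \<cdot> asc K (fst M) r (fst N)))) \<cdot> (idt K w \<odot> t)"
    using h(1,2) t(1-4) tsec(1-3)[of M N] by (simp add: tarr_cmp_tarr t(5))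
  also have "\<dots> = h" unfolding h(3)[symmetric] using h(1,2) t(1-4) by (simp add: tarr_cmp_tarr)
  finally show ?thesis .
qed

lemma tsec_absorb_right:
  assumes [simp]: "md M" "md N" "w \<in> objs K" and h: "h \<in> arrs K" "src K h = (fst M \<boxtimes> fst N) \<boxtimes> w"
    "h \<cdot> ((rac M \<odot> idt K (fst N)) \<odot> idt K w) = h \<cdot> (((idt K (fst M) \<odot> snd N) \<cdot> asc K (fst M) r (fst N)) \<odot> idt K w)"
  shows "h \<cdot> (tsec M N \<odot> idt K w) \<cdot> (pj M N \<odot> idt K w) = h"
proof -
  obtain t where t: "t \<in> arrs K" "src K t = fst M \<boxtimes> fst N" "tgt K t = (fst M \<boxtimes> r) \<boxtimes> fst N"
    "(rac M \<odot> idt K (fst N)) \<cdot> t = idt K (fst M \<boxtimes> fst N)"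
    "tsec M N \<cdot> pj M N = ((idt K (fst M) \<odot> snd N) \<cdot> asc K (fst M) r (fst N)) \<cdot> t"
    using tsec(5)[OF assms(1,2)] by auto
  have "h \<cdot> (tsec M N \<odot> idt K w) \<cdot> (pj M N \<odot> idt K w) = (h \<cdot> (((idt K (fst M) \<odot> snd N) \<cdot> asc K (fst M) r (fst N)) \<odot> idt K w)) \<cdot> (t \<odot> idt K w)"
    using h(1,2) t(1-4) tsec(1-3)[of M N] by (simp add: tarr_cmp_tarr t(5))
  also have "\<dots> = h" unfolding h(3)[symmetric] using h(1,2) t(1-4) by (simp add: tarr_cmp_tarr)
  finally show ?thesis .
qed

lemma descend_pj:
  assumes "md M" "md N" "h \<in> arrs K" "src K h = fst M \<boxtimes> fst N"
    "h \<cdot> (rac M \<odot> idt K (fst N)) = h \<cdot> (idt K (fst M) \<odot> snd N) \<cdot> asc K (fst M) r (fst N)"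
  shows "descend K (pj M N) h \<in> arrs K" "src K (descend K (pj M N) h) = fst (tn M N)"
    "tgt K (descend K (pj M N) h) = tgt K h" "descend K (pj M N) h \<cdot> pj M N = h"
  using descend_sect[of "pj M N" "tsec M N" h] tsec(1-4)[OF assms(1,2)] assms(1-4) tsec_absorb[OF assms] by simp_all

text \<open>\<open>R\<close> acts through the left factor. This respects the balancing because left
  and right action on \<open>M\<close> commute, by \<open>rac_act\<close>.\<close>

lemma tn_act_aux:
  assumes [simp]: "md M" "md N"
  shows "snd (tn M N) \<in> arrs K" "src K (snd (tn M N)) = r \<boxtimes> fst (tn M N)" "tgt K (snd (tn M N)) = fst (tn M N)"
    "snd (tn M N) \<cdot> (idt K r \<odot> pj M N) = pj M N \<cdot> (snd M \<odot> idt K (fst N)) \<cdot> asc' r (fst M) (fst N)"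
proof -
  let ?x = "fst M" and ?y = "fst N" and ?i = "idt K"
  let ?h = "pj M N \<cdot> (snd M \<odot> ?i ?y) \<cdot> asc' r ?x ?y"
  have "?h \<cdot> (?i r \<odot> (rac M \<odot> ?i ?y)) = pj M N \<cdot> ((snd M \<cdot> (?i r \<odot> rac M)) \<odot> ?i ?y) \<cdot> asc' r (?x \<boxtimes> r) ?y"
    by (simp add: asc'_nat whisker_right)
  also have "snd M \<cdot> (?i r \<odot> rac M) = rac M \<cdot> (snd M \<odot> ?i r) \<cdot> asc' r ?x r"
    using reassoc[OF rac_act[of M], of "asc' r ?x r"] by simp
  also have "pj M N \<cdot> ((rac M \<cdot> (snd M \<odot> ?i r) \<cdot> asc' r ?x r) \<odot> ?i ?y) \<cdot> asc' r (?x \<boxtimes> r) ?y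
      = pj M N \<cdot> (?i ?x \<odot> snd N) \<cdot> asc K ?x r ?y \<cdot> ((snd M \<odot> ?i r) \<odot> ?i ?y) \<cdot> (asc' r ?x r \<odot> ?i ?y) \<cdot> asc' r (?x \<boxtimes> r) ?y"
    by (simp add: whisker_right pj_bal_assoc)
  also have "\<dots> = pj M N \<cdot> ((?i ?x \<odot> snd N) \<cdot> ((snd M \<odot> ?i (r \<boxtimes> ?y)) \<cdot> (asc K (r \<boxtimes> ?x) r ?y \<cdot> (asc' r ?x r \<odot> ?i ?y) \<cdot> asc' r (?x \<boxtimes> r) ?y)))"
    by (simp add: asc_nat_assoc)
  also have "\<dots> = pj M N \<cdot> ((snd M \<odot> ?i ?y) \<cdot> ((?i (r \<boxtimes> ?x) \<odot> snd N) \<cdot> (asc K (r \<boxtimes> ?x) r ?y \<cdot> (asc' r ?x r \<odot> ?i ?y) \<cdot> asc' r (?x \<boxtimes> r) ?y)))"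
    by (simp add: tarr_cmp_tarr_assoc)
  also have "\<dots> = ?h \<cdot> (?i r \<odot> ((?i ?x \<odot> snd N) \<cdot> asc K ?x r ?y))"
    by (simp add: pentagon_2[symmetric] whisker_left asc'_nat_assoc)
  finally have b: "?h \<cdot> (?i r \<odot> (rac M \<odot> ?i ?y)) = ?h \<cdot> (?i r \<odot> ((?i ?x \<odot> snd N) \<cdot> asc K ?x r ?y))" .
  have a: "?h \<cdot> (?i r \<odot> tsec M N) \<cdot> (?i r \<odot> pj M N) = ?h"
    by (rule tsec_absorb_left[OF _ _ _ _ _ b]) simp_all
  have s: "snd (tn M N) = descend K (?i r \<odot> pj M N) ?h" by (simp only: tens_obj_def Let_def snd_conv)
  show "snd (tn M N) \<in> arrs K" "src K (snd (tn M N)) = r \<boxtimes> fst (tn M N)" "tgt K (snd (tn M N)) = fst (tn M N)"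
    "snd (tn M N) \<cdot> (?i r \<odot> pj M N) = ?h"
    unfolding s using descend_sect[OF _ _ _ _ _ _ _ a] tsec[of M N] by (simp_all add: tarr_cmp_tarr)
qed

lemma tn_act:
  assumes [simp]: "md M" "md N" and "f \<in> arrs K" "tgt K f = r" "h \<in> arrs K" "tgt K h = fst M \<boxtimes> fst N"
  shows "snd (tn M N) \<cdot> (f \<odot> (pj M N \<cdot> h)) = pj M N \<cdot> (snd M \<odot> idt K (fst N)) \<cdot> asc' r (fst M) (fst N) \<cdot> (f \<odot> h)"
proof -
  have "snd (tn M N) \<cdot> (f \<odot> (pj M N \<cdot> h)) = (snd (tn M N) \<cdot> (idt K r \<odot> pj M N)) \<cdot> (f \<odot> h)"
    using assms tn_act_aux(1-3)[of M N] by (simp add: tarr_cmp_tarr)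
  then show ?thesis using assms by (simp add: tn_act_aux)
qed

lemma tn_act_assoc:
  assumes "md M" "md N" "f \<in> arrs K" "tgt K f = r" "h \<in> arrs K" "tgt K h = fst M \<boxtimes> fst N"
    "k \<in> arrs K" "tgt K k = src K f \<boxtimes> src K h"
  shows "snd (tn M N) \<cdot> ((f \<odot> (pj M N \<cdot> h)) \<cdot> k) = pj M N \<cdot> (snd M \<odot> idt K (fst N)) \<cdot> asc' r (fst M) (fst N) \<cdot> ((f \<odot> h) \<cdot> k)"
  using assms tn_act_aux(1-3)[OF assms(1,2)] reassoc[OF tn_act[OF assms(1-6)], of k] by simp

lemma md_tn [simp]:
  assumes [simp]: "md M" "md N"
  shows "md (tn M N)"
proof -
  let ?x = "fst M" and ?y = "fst N" and ?i = "idt K" and ?\<mu> = "r_mul R" and ?k = "snd (tn M N)" and ?q = "pj M N"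
  note [simp] = tn_act_aux(1-3)[OF assms]
  have ka: "?k \<cdot> (f \<odot> ?q) = ?q \<cdot> (snd M \<odot> ?i ?y) \<cdot> asc' r ?x ?y \<cdot> (f \<odot> ?i (?x \<boxtimes> ?y))"
    if "f \<in> arrs K" "tgt K f = r" for f
    using that tn_act[of M N f "?i (?x \<boxtimes> ?y)"] by simp
  have 1: "?k \<cdot> (?\<mu> \<odot> ?i (fst (tn M N))) = ?k \<cdot> (?i r \<odot> ?k) \<cdot> asc K r r (fst (tn M N))"
  proof (rule split_epi_cancel[of "?i (r \<boxtimes> r) \<odot> ?q"])
    have "(?k \<cdot> (?\<mu> \<odot> ?i (fst (tn M N)))) \<cdot> (?i (r \<boxtimes> r) \<odot> ?q) = ?q \<cdot> (snd M \<odot> ?i ?y) \<cdot> asc' r ?x ?y \<cdot> (?\<mu> \<odot> (?i ?x \<odot> ?i ?y))"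
      by (simp add: tarr_cmp_tarr ka)
    also have "\<dots> = ?q \<cdot> ((snd M \<cdot> (?\<mu> \<odot> ?i ?x)) \<odot> ?i ?y) \<cdot> asc' (r \<boxtimes> r) ?x ?y"
      by (simp add: asc'_nat whisker_right del: tarr_idt_idt)
    also have "\<dots> = ?q \<cdot> (snd M \<odot> ?i ?y) \<cdot> ((?i r \<odot> snd M) \<odot> ?i ?y) \<cdot> (asc K r r ?x \<odot> ?i ?y) \<cdot> asc' (r \<boxtimes> r) ?x ?y"
      unfolding mod_assoc[OF assms(1)] by (simp add: whisker_right)
    also have "\<dots> = ?q \<cdot> (snd M \<odot> ?i ?y) \<cdot> ((?i r \<odot> snd M) \<odot> ?i ?y) \<cdot> asc' r (r \<boxtimes> ?x) ?y \<cdot> (asc K r (r \<boxtimes> ?x) ?y \<cdot> (asc K r r ?x \<odot> ?i ?y) \<cdot> asc' (r \<boxtimes> r) ?x ?y)"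
      by simp
    also have "\<dots> = ?q \<cdot> (snd M \<odot> ?i ?y) \<cdot> asc' r ?x ?y \<cdot> (?i r \<odot> (snd M \<odot> ?i ?y)) \<cdot> (?i r \<odot> asc' r ?x ?y) \<cdot> asc K r r (?x \<boxtimes> ?y)"
      unfolding pentagon_3[symmetric, OF ring_ob[OF R_ring] ring_ob[OF R_ring] mod_ob[OF assms(1)] mod_ob[OF assms(2)]]
      by (simp add: asc'_nat_assoc)
    also have "\<dots> = ?k \<cdot> (?i r \<odot> (?q \<cdot> (snd M \<odot> ?i ?y) \<cdot> asc' r ?x ?y)) \<cdot> asc K r r (?x \<boxtimes> ?y)"
      by (subst tn_act_assoc) (simp_all add: whisker_left)
    also have "\<dots> = ?k \<cdot> (?i r \<odot> (?k \<cdot> (?i r \<odot> ?q))) \<cdot> asc K r r (?x \<boxtimes> ?y)"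
      by (simp add: ka)
    also have "\<dots> = (?k \<cdot> (?i r \<odot> ?k) \<cdot> asc K r r (fst (tn M N))) \<cdot> ((?i r \<odot> ?i r) \<odot> ?q)"
      by (simp add: asc_nat whisker_left del: tarr_idt_idt)
    finally show "(?k \<cdot> (?\<mu> \<odot> ?i (fst (tn M N)))) \<cdot> (?i (r \<boxtimes> r) \<odot> ?q) =
       (?k \<cdot> (?i r \<odot> ?k) \<cdot> asc K r r (fst (tn M N))) \<cdot> (?i (r \<boxtimes> r) \<odot> ?q)" by simp
  qed (simp_all add: split_epi_tarr split_epi_idt)
  have 2: "?k \<cdot> (r_unit R \<odot> ?i (fst (tn M N))) = lun K (fst (tn M N))"
  proof (rule split_epi_cancel[of "?i (unt K) \<odot> ?q"])
    have "(?k \<cdot> (r_unit R \<odot> ?i (fst (tn M N)))) \<cdot> (?i (unt K) \<odot> ?q) = ?q \<cdot> (snd M \<odot> ?i ?y) \<cdot> asc' r ?x ?y \<cdot> (r_unit R \<odot> (?i ?x \<odot> ?i ?y))"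
      by (simp add: tarr_cmp_tarr ka)
    also have "\<dots> = ?q \<cdot> ((snd M \<cdot> (r_unit R \<odot> ?i ?x)) \<odot> ?i ?y) \<cdot> asc' (unt K) ?x ?y"
      by (simp add: asc'_nat whisker_right del: tarr_idt_idt)
    also have "\<dots> = ?q \<cdot> lun K (?x \<boxtimes> ?y)"
      unfolding mod_unit[OF assms(1)] by (simp add: lun_tobj[symmetric])
    finally show "(?k \<cdot> (r_unit R \<odot> ?i (fst (tn M N)))) \<cdot> (?i (unt K) \<odot> ?q) = lun K (fst (tn M N)) \<cdot> (?i (unt K) \<odot> ?q)"
      by (simp add: lun_nat)
  qed (simp_all add: split_epi_tarr split_epi_idt)
  show ?thesis unfolding mod_iff using 1 2 by simp
qed

text \<open>Balancing moves the scalar from \<open>M\<close> to \<open>N\<close>. In this form the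
  right action of a tensor product meets the third factor in the construction of the
  associator.\<close>

lemma rac_tn:
  assumes [simp]: "md M" "md N"
  shows "rac (tn M N) \<cdot> (pj M N \<odot> idt K r) = pj M N \<cdot> (idt K (fst M) \<odot> rac N) \<cdot> asc K (fst M) (fst N) r"
proof -
  let ?x = "fst M" and ?y = "fst N" and ?i = "idt K" and ?q = "pj M N"
  have "rac (tn M N) \<cdot> (?q \<odot> ?i r) = (snd (tn M N) \<cdot> (?i r \<odot> (?q \<cdot> ?i (?x \<boxtimes> ?y)))) \<cdot> brd K (?x \<boxtimes> ?y) r"
    by (simp add: rac_def brd_nat)
  also have "\<dots> = ?q \<cdot> (snd M \<odot> ?i ?y) \<cdot> asc' r ?x ?y \<cdot> brd K (?x \<boxtimes> ?y) r"
    by (subst tn_act) simp_all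
  also have "\<dots> = ?q \<cdot> (rac M \<odot> ?i ?y) \<cdot> asc' ?x r ?y \<cdot> (?i ?x \<odot> brd K ?y r) \<cdot> asc K ?x ?y r"
    by (simp add: hexagon_brd_2[of ?x ?y r] rac_def whisker_right)
  also have "\<dots> = ?q \<cdot> (?i ?x \<odot> rac N) \<cdot> asc K ?x ?y r"
    by (simp add: pj_bal_assoc) (simp add: rac_def whisker_left)
  finally show ?thesis .
qed

lemma lin_idt [simp]: "md M \<Longrightarrow> ln M M (idt K (fst M))"
  by (simp add: lin_iff)

lemma lin_cmp:
  assumes "ln M N f" "ln N P g" and [simp]: "md M" "md N" "md P"
  shows "ln M P (g \<cdot> f)"
proof -
  note [simp] = linD[OF assms(1)] linD[OF assms(2)]
  have "g \<cdot> f \<cdot> snd M = snd P \<cdot> (idt K r \<odot> g) \<cdot> (idt K r \<odot> f)"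
    by (simp add: lin_act[OF assms(1)] reassoc[OF lin_act[OF assms(2)]])
  then show ?thesis unfolding lin_iff by (simp add: whisker_left)
qed

lemma lin_tnI:
  assumes [simp]: "md M" "md N" "md P" and h: "h \<in> arrs K" "src K h = fst (tn M N)" "tgt K h = fst P"
    and e: "h \<cdot> pj M N \<cdot> (snd M \<odot> idt K (fst N)) \<cdot> asc' r (fst M) (fst N) = snd P \<cdot> (idt K r \<odot> (h \<cdot> pj M N))"
  shows "ln (tn M N) P h"
proof -
  have "h \<cdot> snd (tn M N) = snd P \<cdot> (idt K r \<odot> h)"
  proof (rule split_epi_cancel[of "idt K r \<odot> pj M N"])
    show "(h \<cdot> snd (tn M N)) \<cdot> (idt K r \<odot> pj M N) = (snd P \<cdot> (idt K r \<odot> h)) \<cdot> (idt K r \<odot> pj M N)"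
      using h e by (simp add: tn_act_aux tarr_cmp_tarr)
  qed (use h in \<open>simp_all add: split_epi_tarr split_epi_idt\<close>)
  then show ?thesis unfolding lin_iff using h by simp
qed

lemma lin_inverse:
  assumes f: "ln M N f" and g: "g \<in> arrs K" "src K g = fst N" "tgt K g = fst M" "g \<cdot> f = idt K (fst M)" "f \<cdot> g = idt K (fst N)"
    and [simp]: "md M" "md N"
  shows "ln N M g"
proof -
  note [simp] = linD[OF f]
  have "g \<cdot> snd N = g \<cdot> snd N \<cdot> (idt K r \<odot> f) \<cdot> (idt K r \<odot> g)"
    using g by (simp add: tarr_cmp_tarr)
  also have "\<dots> = g \<cdot> (f \<cdot> snd M) \<cdot> (idt K r \<odot> g)"
    unfolding lin_act[OF f] using g by simp
  also have "\<dots> = snd M \<cdot> (idt K r \<odot> g)"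
    using g reassoc[OF g(4)] by simp
  finally show ?thesis unfolding lin_iff using g by simp
qed

text \<open>Together with \<open>am\<close>, \<open>lm\<close>, \<open>rm\<close> and
  \<open>cm\<close>, the underlying arrow of the corresponding structure of \<open>Mod K R\<close>.
  Working with plain arrows allows the monoidal axioms for modules to be proved in \<open>K\<close>,
  by cancelling projections.\<close>

definition tm :: "('o, 'm) module_obj \<Rightarrow> ('o, 'm) module_obj \<Rightarrow> ('o, 'm) module_obj \<Rightarrow> ('o, 'm) module_obj \<Rightarrow> 'm \<Rightarrow> 'm \<Rightarrow> 'm" where
  "tm M N M' N' f g = descend K (pj M N) (pj M' N' \<cdot> (f \<odot> g))"

definition am :: "('o, 'm) module_obj \<Rightarrow> ('o, 'm) module_obj \<Rightarrow> ('o, 'm) module_obj \<Rightarrow> 'm" where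
  "am M N P = descend K (pj (tn M N) P \<cdot> (pj M N \<odot> idt K (fst P)))
     (pj M (tn N P) \<cdot> (idt K (fst M) \<odot> pj N P) \<cdot> asc K (fst M) (fst N) (fst P))"

definition lm :: "('o, 'm) module_obj \<Rightarrow> 'm" where "lm M = descend K (pj RR M) (snd M)"
definition rm :: "('o, 'm) module_obj \<Rightarrow> 'm" where "rm M = descend K (pj M RR) (rac M)"
definition cm :: "('o, 'm) module_obj \<Rightarrow> ('o, 'm) module_obj \<Rightarrow> 'm" where
  "cm M N = descend K (pj M N) (pj N M \<cdot> brd K (fst M) (fst N))"

lemma tm:
  assumes f: "ln M M' f" and g: "ln N N' g" and [simp]: "md M" "md M'" "md N" "md N'"
  shows "tm M N M' N' f g \<in> arrs K" "src K (tm M N M' N' f g) = fst (tn M N)" "tgt K (tm M N M' N' f g) = fst (tn M' N')"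
    "tm M N M' N' f g \<cdot> pj M N = pj M' N' \<cdot> (f \<odot> g)" "ln (tn M N) (tn M' N') (tm M N M' N' f g)"
proof -
  note [simp] = linD[OF f] linD[OF g]
  let ?i = "idt K"
  let ?h = "pj M' N' \<cdot> (f \<odot> g)"
  have "?h \<cdot> (rac M \<odot> ?i (fst N)) = pj M' N' \<cdot> (rac M' \<odot> ?i (fst N')) \<cdot> ((f \<odot> ?i r) \<odot> g)"
    by (simp add: tarr_cmp_tarr rac_lin[OF f])
  also have "\<dots> = pj M' N' \<cdot> (?i (fst M') \<odot> snd N') \<cdot> (f \<odot> (?i r \<odot> g)) \<cdot> asc K (fst M) r (fst N)"
    by (simp add: pj_bal_assoc asc_nat)
  also have "\<dots> = ?h \<cdot> (?i (fst M) \<odot> snd N) \<cdot> asc K (fst M) r (fst N)"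
    by (simp add: tarr_cmp_tarr_assoc lin_act[OF g])
  finally have b: "?h \<cdot> (rac M \<odot> ?i (fst N)) = ?h \<cdot> (?i (fst M) \<odot> snd N) \<cdot> asc K (fst M) r (fst N)" .
  note d = descend_pj[OF _ _ _ _ b, folded tm_def]
  show 1: "tm M N M' N' f g \<in> arrs K" "src K (tm M N M' N' f g) = fst (tn M N)" "tgt K (tm M N M' N' f g) = fst (tn M' N')"
    "tm M N M' N' f g \<cdot> pj M N = pj M' N' \<cdot> (f \<odot> g)"
    using d by simp_all
  show "ln (tn M N) (tn M' N') (tm M N M' N' f g)"
  proof (rule lin_tnI)
    have "tm M N M' N' f g \<cdot> pj M N \<cdot> (snd M \<odot> ?i (fst N)) \<cdot> asc' r (fst M) (fst N) = pj M' N' \<cdot> ((f \<cdot> snd M) \<odot> g) \<cdot> asc' r (fst M) (fst N)"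
      by (simp add: reassoc[OF 1(4)] 1 tarr_cmp_tarr_assoc)
    also have "\<dots> = pj M' N' \<cdot> (snd M' \<odot> ?i (fst N')) \<cdot> ((?i r \<odot> f) \<odot> g) \<cdot> asc' r (fst M) (fst N)"
      by (simp add: lin_act[OF f] tarr_cmp_tarr_assoc)
    also have "\<dots> = snd (tn M' N') \<cdot> (?i r \<odot> (tm M N M' N' f g \<cdot> pj M N))"
      by (simp add: 1 tn_act asc'_nat)
    finally show "tm M N M' N' f g \<cdot> pj M N \<cdot> (snd M \<odot> ?i (fst N)) \<cdot> asc' r (fst M) (fst N)
       = snd (tn M' N') \<cdot> (?i r \<odot> (tm M N M' N' f g \<cdot> pj M N))" .
  qed (simp_all add: 1)
qed

lemma pj2_split_epi:
  assumes "md M" "md N" "md P"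
  shows "split_epi (pj (tn M N) P \<cdot> (pj M N \<odot> idt K (fst P)))" "split_epi (pj M (tn N P) \<cdot> (idt K (fst M) \<odot> pj N P))"
  using assms by (auto intro!: split_epi_cmp split_epi_tarr split_epi_idt)

text \<open>The source is an iterated quotient, so descent takes two stages: balancing over the
  inner tensor product and balancing over the outer one. The latter becomes visible only after
  composing with the inner projection, which is why the splitting must survive tensoring.\<close>

lemma am:
  assumes [simp]: "md M" "md N" "md P"
  shows "am M N P \<in> arrs K" "src K (am M N P) = fst (tn (tn M N) P)" "tgt K (am M N P) = fst (tn M (tn N P))"
    "am M N P \<cdot> pj (tn M N) P \<cdot> (pj M N \<odot> idt K (fst P)) = pj M (tn N P) \<cdot> (idt K (fst M) \<odot> pj N P) \<cdot> asc K (fst M) (fst N) (fst P)"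
    "ln (tn (tn M N) P) (tn M (tn N P)) (am M N P)"
proof -
  let ?i = "idt K" and ?x = "fst M" and ?y = "fst N" and ?z = "fst P"
  let ?T = "tn M N" and ?U = "tn N P"
  let ?f = "pj M ?U \<cdot> (?i ?x \<odot> pj N P) \<cdot> asc K ?x ?y ?z"
  have "?f \<cdot> ((rac M \<odot> ?i ?y) \<odot> ?i ?z) = pj M ?U \<cdot> ((?i ?x \<odot> pj N P) \<cdot> ((rac M \<odot> ?i (?y \<boxtimes> ?z)) \<cdot> asc K (?x \<boxtimes> r) ?y ?z))"
    by (simp add: asc_nat)
  also have "\<dots> = pj M ?U \<cdot> ((rac M \<odot> ?i (fst ?U)) \<cdot> ((?i (?x \<boxtimes> r) \<odot> pj N P) \<cdot> asc K (?x \<boxtimes> r) ?y ?z))"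
    by (simp add: tarr_cmp_tarr_assoc)
  also have "\<dots> = pj M ?U \<cdot> (?i ?x \<odot> snd ?U) \<cdot> asc K ?x r (fst ?U) \<cdot> ((?i ?x \<odot> ?i r) \<odot> pj N P) \<cdot> asc K (?x \<boxtimes> r) ?y ?z"
    by (simp add: pj_bal_assoc)
  also have "\<dots> = pj M ?U \<cdot> (?i ?x \<odot> (snd ?U \<cdot> (?i r \<odot> (pj N P \<cdot> ?i (?y \<boxtimes> ?z))))) \<cdot> asc K ?x r (?y \<boxtimes> ?z) \<cdot> asc K (?x \<boxtimes> r) ?y ?z"
    by (simp add: asc_nat_assoc whisker_left del: tarr_idt_idt)
  also have "\<dots> = pj M ?U \<cdot> (?i ?x \<odot> pj N P) \<cdot> (?i ?x \<odot> (snd N \<odot> ?i ?z)) \<cdot> (?i ?x \<odot> asc' r ?y ?z) \<cdot> asc K ?x r (?y \<boxtimes> ?z) \<cdot> asc K (?x \<boxtimes> r) ?y ?z"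
    by (subst tn_act) (simp_all add: whisker_left)
  also have "\<dots> = pj M ?U \<cdot> (?i ?x \<odot> pj N P) \<cdot> (?i ?x \<odot> (snd N \<odot> ?i ?z)) \<cdot> asc K ?x (r \<boxtimes> ?y) ?z \<cdot> (asc K ?x r ?y \<odot> ?i ?z)"
    by (simp add: pentagon_3_assoc)
  also have "\<dots> = ?f \<cdot> (((?i ?x \<odot> snd N) \<cdot> asc K ?x r ?y) \<odot> ?i ?z)"
    by (simp add: whisker_right asc_nat_assoc)
  finally have A: "?f \<cdot> ((rac M \<odot> ?i ?y) \<odot> ?i ?z) = ?f \<cdot> (((?i ?x \<odot> snd N) \<cdot> asc K ?x r ?y) \<odot> ?i ?z)" .
  have a: "?f \<cdot> (tsec M N \<odot> ?i ?z) \<cdot> (pj M N \<odot> ?i ?z) = ?f"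
    by (rule tsec_absorb_right[OF _ _ _ _ _ A]) simp_all
  note [simp] = tsec(1-3)[of M N] tsec(1-3)[of ?T P]
  \<comment> \<open>\<open>?g\<close> is the arrow induced on the inner quotient, written with the
    chosen section.\<close>
  let ?g = "?f \<cdot> (tsec M N \<odot> ?i ?z)"
  have gp: "?g \<cdot> ((pj M N \<cdot> h) \<odot> k) = ?f \<cdot> (h \<odot> k)"
    if "h \<in> arrs K" "tgt K h = ?x \<boxtimes> ?y" "k \<in> arrs K" "tgt K k = ?z" for h k
    using that reassoc[OF a, of "h \<odot> k"] arg_cong[OF a, of "\<lambda>u. u \<cdot> (h \<odot> k)"] by (simp add: tarr_cmp_tarr tarr_cmp_tarr_assoc)
  have B: "?g \<cdot> (rac ?T \<odot> ?i ?z) = ?g \<cdot> (?i (fst ?T) \<odot> snd P) \<cdot> asc K (fst ?T) r ?z"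
  proof (rule split_epi_cancel[of "(pj M N \<odot> ?i r) \<odot> ?i ?z"])
    have "(?g \<cdot> (rac ?T \<odot> ?i ?z)) \<cdot> ((pj M N \<odot> ?i r) \<odot> ?i ?z) = ?g \<cdot> ((pj M N \<cdot> ((?i ?x \<odot> rac N) \<cdot> asc K ?x ?y r)) \<odot> ?i ?z)"
      by (simp add: tarr_cmp_tarr rac_tn)
    also have "\<dots> = ?f \<cdot> (((?i ?x \<odot> rac N) \<cdot> asc K ?x ?y r) \<odot> ?i ?z)"
      by (rule gp) simp_all
    also have "\<dots> = pj M ?U \<cdot> (?i ?x \<odot> (pj N P \<cdot> (rac N \<odot> ?i ?z))) \<cdot> asc K ?x (?y \<boxtimes> r) ?z \<cdot> (asc K ?x ?y r \<odot> ?i ?z)"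
      by (simp add: whisker_right asc_nat_assoc whisker_left)
    also have "\<dots> = pj M ?U \<cdot> (?i ?x \<odot> pj N P) \<cdot> (?i ?x \<odot> (?i ?y \<odot> snd P)) \<cdot> ((?i ?x \<odot> asc K ?y r ?z) \<cdot> asc K ?x (?y \<boxtimes> r) ?z \<cdot> (asc K ?x ?y r \<odot> ?i ?z))"
      by (simp add: pj_bal whisker_left)
    also have "\<dots> = ?f \<cdot> (?i (?x \<boxtimes> ?y) \<odot> snd P) \<cdot> asc K (?x \<boxtimes> ?y) r ?z"
      by (simp add: pentagon[symmetric] asc_nat_assoc tarr_idt_idt[symmetric] del: tarr_idt_idt)
    also have "\<dots> = (?g \<cdot> ((pj M N \<cdot> ?i (?x \<boxtimes> ?y)) \<odot> snd P)) \<cdot> asc K (?x \<boxtimes> ?y) r ?z"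
      by (subst gp) simp_all
    also have "\<dots> = ?g \<cdot> ((?i (fst ?T) \<odot> snd P) \<cdot> ((pj M N \<odot> (?i r \<odot> ?i ?z)) \<cdot> asc K (?x \<boxtimes> ?y) r ?z))"
      by (simp add: tarr_cmp_tarr_assoc)
    also have "\<dots> = (?g \<cdot> (?i (fst ?T) \<odot> snd P) \<cdot> asc K (fst ?T) r ?z) \<cdot> ((pj M N \<odot> ?i r) \<odot> ?i ?z)"
      by (simp add: asc_nat del: tarr_idt_idt)
    finally show "(?g \<cdot> (rac ?T \<odot> ?i ?z)) \<cdot> ((pj M N \<odot> ?i r) \<odot> ?i ?z) =
       (?g \<cdot> (?i (fst ?T) \<odot> snd P) \<cdot> asc K (fst ?T) r ?z) \<cdot> ((pj M N \<odot> ?i r) \<odot> ?i ?z)" .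
  qed (simp_all add: split_epi_tarr split_epi_idt)
  have b: "?g \<cdot> tsec ?T P \<cdot> pj ?T P = ?g"
    by (rule tsec_absorb[OF _ _ _ _ B]) simp_all
  let ?q = "pj ?T P \<cdot> (pj M N \<odot> ?i ?z)" and ?k = "(tsec M N \<odot> ?i ?z) \<cdot> tsec ?T P"
  have "?f \<cdot> ?k \<cdot> ?q = (?g \<cdot> tsec ?T P \<cdot> pj ?T P) \<cdot> (pj M N \<odot> ?i ?z)" by simp
  then have fk: "?f \<cdot> ?k \<cdot> ?q = ?f" unfolding b using a by simp
  have "?q \<cdot> ?k = pj ?T P \<cdot> ((pj M N \<cdot> tsec M N) \<odot> ?i ?z) \<cdot> tsec ?T P" by (simp add: tarr_cmp_tarr_assoc)
  then have qk: "?q \<cdot> ?k = ?i (tgt K ?q)" using tsec(4)[of M N] tsec(4)[of ?T P] by simp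
  note d = descend_sect[OF _ _ _ _ qk _ _ fk, folded am_def]
  show 1: "am M N P \<in> arrs K" "src K (am M N P) = fst (tn ?T P)" "tgt K (am M N P) = fst (tn M ?U)"
    "am M N P \<cdot> pj ?T P \<cdot> (pj M N \<odot> ?i ?z) = ?f"
    using d by simp_all
  note [simp] = 1(1-3)
  have am1: "am M N P \<cdot> pj ?T P \<cdot> ((pj M N \<odot> ?i ?z) \<cdot> h) = ?f \<cdot> h" if "h \<in> arrs K" "tgt K h = (?x \<boxtimes> ?y) \<boxtimes> ?z" for h
    using that arg_cong[OF 1(4), of "\<lambda>u. u \<cdot> h"] by simp
  show "ln (tn ?T P) (tn M ?U) (am M N P)"
  proof (rule lin_tnI)
    show "am M N P \<cdot> pj ?T P \<cdot> (snd ?T \<odot> ?i ?z) \<cdot> asc' r (fst ?T) ?z = snd (tn M ?U) \<cdot> (?i r \<odot> (am M N P \<cdot> pj ?T P))"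
    proof (rule split_epi_cancel[of "?i r \<odot> (pj M N \<odot> ?i ?z)"])
      have "(am M N P \<cdot> pj ?T P \<cdot> (snd ?T \<odot> ?i ?z) \<cdot> asc' r (fst ?T) ?z) \<cdot> (?i r \<odot> (pj M N \<odot> ?i ?z)) =
        am M N P \<cdot> pj ?T P \<cdot> ((snd ?T \<cdot> (?i r \<odot> (pj M N \<cdot> ?i (?x \<boxtimes> ?y)))) \<odot> ?i ?z) \<cdot> asc' r (?x \<boxtimes> ?y) ?z"
        by (simp add: asc'_nat whisker_right)
      also have "\<dots> = am M N P \<cdot> pj ?T P \<cdot> ((pj M N \<odot> ?i ?z) \<cdot> ((snd M \<odot> ?i ?y) \<odot> ?i ?z) \<cdot> (asc' r ?x ?y \<odot> ?i ?z) \<cdot> asc' r (?x \<boxtimes> ?y) ?z)"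
        by (subst tn_act) (simp_all add: whisker_right)
      also have "\<dots> = pj M ?U \<cdot> ((?i ?x \<odot> pj N P) \<cdot> ((snd M \<odot> ?i (?y \<boxtimes> ?z)) \<cdot> (asc K (r \<boxtimes> ?x) ?y ?z \<cdot> (asc' r ?x ?y \<odot> ?i ?z) \<cdot> asc' r (?x \<boxtimes> ?y) ?z)))"
        by (subst am1) (simp_all add: asc_nat_assoc)
      also have "\<dots> = pj M ?U \<cdot> ((?i ?x \<odot> pj N P) \<cdot> ((snd M \<odot> ?i (?y \<boxtimes> ?z)) \<cdot> (asc' r ?x (?y \<boxtimes> ?z) \<cdot> (?i r \<odot> asc K ?x ?y ?z))))"
        by (simp add: pentagon_2)
      also have "\<dots> = pj M ?U \<cdot> ((snd M \<odot> ?i (fst ?U)) \<cdot> (((?i r \<odot> ?i ?x) \<odot> pj N P) \<cdot> (asc' r ?x (?y \<boxtimes> ?z) \<cdot> (?i r \<odot> asc K ?x ?y ?z))))"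
        by (simp add: tarr_cmp_tarr_assoc)
      also have "\<dots> = pj M ?U \<cdot> (snd M \<odot> ?i (fst ?U)) \<cdot> asc' r ?x (fst ?U) \<cdot> (?i r \<odot> ((?i ?x \<odot> pj N P) \<cdot> asc K ?x ?y ?z))"
        by (simp add: asc'_nat_assoc whisker_left del: tarr_idt_idt)
      also have "\<dots> = snd (tn M ?U) \<cdot> (?i r \<odot> (am M N P \<cdot> pj ?T P \<cdot> (pj M N \<odot> ?i ?z)))"
        unfolding 1(4) by (simp add: tn_act)
      also have "\<dots> = (snd (tn M ?U) \<cdot> (?i r \<odot> (am M N P \<cdot> pj ?T P))) \<cdot> (?i r \<odot> (pj M N \<odot> ?i ?z))"
        by (simp add: whisker_left)
      finally show "(am M N P \<cdot> pj ?T P \<cdot> (snd ?T \<odot> ?i ?z) \<cdot> asc' r (fst ?T) ?z) \<cdot> (?i r \<odot> (pj M N \<odot> ?i ?z)) =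
         (snd (tn M ?U) \<cdot> (?i r \<odot> (am M N P \<cdot> pj ?T P))) \<cdot> (?i r \<odot> (pj M N \<odot> ?i ?z))" .
    qed (simp_all add: split_epi_tarr split_epi_idt)
  qed simp_all
qed

lemma md_RR [simp]: "md RR"
  unfolding mod_iff by (simp add: regular_module_def ring_mul_assoc ring_mul_unit_left)

lemma RR_simps [simp]: "fst RR = r" "snd RR = r_mul R" "rac RR = r_mul R"
  by (simp_all add: regular_module_def rac_def ring_mul_comm)

lemma lm:
  assumes [simp]: "md M"
  shows "lm M \<in> arrs K" "src K (lm M) = fst (tn RR M)" "tgt K (lm M) = fst M" "lm M \<cdot> pj RR M = snd M"
    "ln (tn RR M) M (lm M)" "iso_arrow K (lm M)"
proof -
  let ?i = "idt K" and ?x = "fst M"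
  have b: "snd M \<cdot> (rac RR \<odot> ?i ?x) = snd M \<cdot> (?i (fst RR) \<odot> snd M) \<cdot> asc K (fst RR) r ?x"
    by (simp add: mod_assoc)
  note d = descend_pj[OF _ _ _ _ b, folded lm_def]
  show 1: "lm M \<in> arrs K" "src K (lm M) = fst (tn RR M)" "tgt K (lm M) = fst M" "lm M \<cdot> pj RR M = snd M"
    using d by simp_all
  show "ln (tn RR M) M (lm M)"
  proof (rule lin_tnI)
    show "lm M \<cdot> pj RR M \<cdot> (snd RR \<odot> ?i ?x) \<cdot> asc' r (fst RR) ?x = snd M \<cdot> (?i r \<odot> (lm M \<cdot> pj RR M))"
      using 1 reassoc[OF mod_assoc[of M], of "asc' r r ?x"] by (simp add: reassoc[OF 1(4)])
  qed (simp_all add: 1)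
  \<comment> \<open>The inverse of the left unitor sends x to 1 \<otimes> x.\<close>
  let ?g = "pj RR M \<cdot> (r_unit R \<odot> ?i ?x) \<cdot> lun' ?x"
  have "lm M \<cdot> ?g = ?i ?x" by (simp add: reassoc[OF 1(4)] 1 reassoc[OF mod_unit])
  moreover have "?g \<cdot> lm M = ?i (fst (tn RR M))"
  proof (rule split_epi_cancel[of "pj RR M"])
    have "(?g \<cdot> lm M) \<cdot> pj RR M = pj RR M \<cdot> ((r_unit R \<odot> snd M) \<cdot> lun' (r \<boxtimes> ?x))"
      by (simp add: 1 lun'_nat tarr_cmp_tarr_assoc)
    also have "\<dots> = pj RR M \<cdot> (?i (fst RR) \<odot> snd M) \<cdot> (asc K (fst RR) r ?x \<cdot> asc' (fst RR) r ?x) \<cdot> (r_unit R \<odot> (?i r \<odot> ?i ?x)) \<cdot> lun' (r \<boxtimes> ?x)"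
      by (simp add: tarr_cmp_tarr_assoc)
    also have "\<dots> = pj RR M \<cdot> (rac RR \<odot> ?i ?x) \<cdot> (asc' (fst RR) r ?x \<cdot> (r_unit R \<odot> (?i r \<odot> ?i ?x)) \<cdot> lun' (r \<boxtimes> ?x))"
      using pj_bal_assoc[of RR M "asc' (fst RR) r ?x \<cdot> (r_unit R \<odot> (?i r \<odot> ?i ?x)) \<cdot> lun' (r \<boxtimes> ?x)"] by simp
    also have "\<dots> = pj RR M \<cdot> ((r_mul R \<cdot> (r_unit R \<odot> ?i r)) \<odot> ?i ?x) \<cdot> asc' (unt K) r ?x \<cdot> lun' (r \<boxtimes> ?x)"
      by (simp add: asc'_nat_assoc whisker_right del: tarr_idt_idt)
    also have "\<dots> = pj RR M"
      by (simp add: ring_mul_unit_left lun_tobj[symmetric])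
    finally show "(?g \<cdot> lm M) \<cdot> pj RR M = ?i (fst (tn RR M)) \<cdot> pj RR M" by simp
  qed (simp_all add: 1)
  ultimately show "iso_arrow K (lm M)"
    by (intro iso_arrowI[of _ ?g]) (simp_all add: 1)
qed

lemma cm:
  assumes [simp]: "md M" "md N"
  shows "cm M N \<in> arrs K" "src K (cm M N) = fst (tn M N)" "tgt K (cm M N) = fst (tn N M)"
    "cm M N \<cdot> pj M N = pj N M \<cdot> brd K (fst M) (fst N)" "ln (tn M N) (tn N M) (cm M N)"
proof -
  let ?i = "idt K" and ?x = "fst M" and ?y = "fst N"
  let ?h = "pj N M \<cdot> brd K ?x ?y"
  have p: "pj N M \<cdot> (?i ?y \<odot> snd M) \<cdot> h = pj N M \<cdot> (rac N \<odot> ?i ?x) \<cdot> asc' ?y r ?x \<cdot> h" if "h \<in> arrs K" "tgt K h = ?y \<boxtimes> (r \<boxtimes> ?x)" for h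
    using that pj_bal_assoc[of N M "asc' ?y r ?x \<cdot> h"] by simp
  have "?h \<cdot> (rac M \<odot> ?i ?y) = pj N M \<cdot> (?i ?y \<odot> snd M) \<cdot> (?i ?y \<odot> brd K ?x r) \<cdot> brd K (?x \<boxtimes> r) ?y"
    by (simp add: rac_def brd_nat whisker_left)
  also have "\<dots> = pj N M \<cdot> (rac N \<odot> ?i ?x) \<cdot> asc' ?y r ?x \<cdot> brd K (r \<boxtimes> ?x) ?y \<cdot> (brd K ?x r \<odot> ?i ?y)"
    by (simp add: p brd_nat)
  also have "\<dots> = pj N M \<cdot> (snd N \<odot> ?i ?x) \<cdot> (asc' r ?y ?x \<cdot> (?i r \<odot> brd K ?x ?y) \<cdot> asc K r ?x ?y \<cdot> (brd K ?x r \<odot> ?i ?y))"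
    by (simp add: hexagon_brd_2[of r ?x ?y] rac_def whisker_right whisker_inv)
  also have "\<dots> = pj N M \<cdot> (snd N \<odot> ?i ?x) \<cdot> brd K ?x (r \<boxtimes> ?y) \<cdot> asc K ?x r ?y"
    by (simp add: hexagon_brd)
  also have "\<dots> = ?h \<cdot> (?i ?x \<odot> snd N) \<cdot> asc K ?x r ?y"
    by (simp add: brd_nat_assoc)
  finally have b: "?h \<cdot> (rac M \<odot> ?i ?y) = ?h \<cdot> (?i ?x \<odot> snd N) \<cdot> asc K ?x r ?y" .
  note d = descend_pj[OF _ _ _ _ b, folded cm_def]
  show 1: "cm M N \<in> arrs K" "src K (cm M N) = fst (tn M N)" "tgt K (cm M N) = fst (tn N M)"
    "cm M N \<cdot> pj M N = pj N M \<cdot> brd K ?x ?y"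
    using d by simp_all
  show "ln (tn M N) (tn N M) (cm M N)"
  proof (rule lin_tnI)
    have "cm M N \<cdot> pj M N \<cdot> (snd M \<odot> ?i ?y) \<cdot> asc' r ?x ?y = pj N M \<cdot> (?i ?y \<odot> snd M) \<cdot> brd K (r \<boxtimes> ?x) ?y \<cdot> asc' r ?x ?y"
      by (simp add: reassoc[OF 1(4)] 1 brd_nat_assoc)
    also have "\<dots> = pj N M \<cdot> (snd N \<odot> ?i ?x) \<cdot> asc' r ?y ?x \<cdot> (?i r \<odot> brd K ?x ?y)"
      by (simp add: p hexagon_brd_2[of r ?x ?y] rac_def whisker_right whisker_inv)
    also have "\<dots> = snd (tn N M) \<cdot> (?i r \<odot> (cm M N \<cdot> pj M N))"
      by (simp add: 1 tn_act)
    finally show "cm M N \<cdot> pj M N \<cdot> (snd M \<odot> ?i ?y) \<cdot> asc' r ?x ?y = snd (tn N M) \<cdot> (?i r \<odot> (cm M N \<cdot> pj M N))" .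
  qed (simp_all add: 1)
qed

text \<open>Invertibility is inherited from \<open>lm\<close>, because \<open>rm M\<close> is
  \<open>lm M\<close> after the symmetry \<open>cm\<close>.\<close>

lemma rm:
  assumes [simp]: "md M"
  shows "rm M \<in> arrs K" "src K (rm M) = fst (tn M RR)" "tgt K (rm M) = fst M" "rm M \<cdot> pj M RR = rac M"
    "ln (tn M RR) M (rm M)" "iso_arrow K (rm M)"
proof -
  let ?i = "idt K" and ?x = "fst M"
  have b: "rac M \<cdot> (rac M \<odot> ?i (fst RR)) = rac M \<cdot> (?i ?x \<odot> snd RR) \<cdot> asc K ?x r (fst RR)"
    by (simp add: rac_rac)
  note d = descend_pj[OF _ _ _ _ b, folded rm_def]
  show 1: "rm M \<in> arrs K" "src K (rm M) = fst (tn M RR)" "tgt K (rm M) = fst M" "rm M \<cdot> pj M RR = rac M"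
    using d by simp_all
  show "ln (tn M RR) M (rm M)"
  proof (rule lin_tnI)
    show "rm M \<cdot> pj M RR \<cdot> (snd M \<odot> ?i (fst RR)) \<cdot> asc' r ?x (fst RR) = snd M \<cdot> (?i r \<odot> (rm M \<cdot> pj M RR))"
      using 1 reassoc[OF rac_act[of M], of "asc' r ?x r"] by (simp add: reassoc[OF 1(4)])
  qed (simp_all add: 1)
  note c = cm(1-4)[of M RR, simplified] and c' = cm(1-4)[of RR M, simplified] and l = lm[of M]
  have "rm M = lm M \<cdot> cm M RR"
    by (rule split_epi_cancel[of "pj M RR"])
      (simp_all add: 1 c l reassoc[OF l(4)] rac_def)
  moreover have "cm RR M \<cdot> cm M RR = ?i (fst (tn M RR))"
    by (rule split_epi_cancel[of "pj M RR"])
      (simp_all add: c c' reassoc[OF c'(4)])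
  moreover have "cm M RR \<cdot> cm RR M = ?i (fst (tn RR M))"
    by (rule split_epi_cancel[of "pj RR M"])
      (simp_all add: c c' reassoc[OF c(4)])
  ultimately show "iso_arrow K (rm M)"
    by (simp add: cmp_iso l c iso_arrowI[of "cm M RR" "cm RR M"] c')
qed

end

section \<open>Monoidal and additive axioms for the category of modules\<close>

context sep_ring
begin

text \<open>The push rules move structure arrows of modules past the projections \<open>pj\<close>,
  until an identity between module arrows has become an identity in \<open>K\<close> followed by
  projections.\<close>

lemma tm_push:
  assumes "ln M M' f" "ln N N' g" and [simp]: "md M" "md M'" "md N" "md N'" and "c \<in> arrs K" "tgt K c = fst M \<boxtimes> fst N"
  shows "tm M N M' N' f g \<cdot> (pj M N \<cdot> c) = pj M' N' \<cdot> ((f \<odot> g) \<cdot> c)"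
  using tm[OF assms(1-6)] linD[OF assms(1)] linD[OF assms(2)] assms(7,8) reassoc[OF tm(4)[OF assms(1-6)], of c] by simp

lemma cm_push:
  assumes "md M" "md N" and "c \<in> arrs K" "tgt K c = fst M \<boxtimes> fst N"
  shows "cm M N \<cdot> (pj M N \<cdot> c) = pj N M \<cdot> (brd K (fst M) (fst N) \<cdot> c)"
  using cm[OF assms(1,2)] assms reassoc[OF cm(4)[OF assms(1,2)], of c] by simp

lemma am_push:
  assumes [simp]: "md M" "md N" "md P" and "h \<in> arrs K" "tgt K h = fst M \<boxtimes> fst N" "k \<in> arrs K" "tgt K k = fst P"
  shows "am M N P \<cdot> (pj (tn M N) P \<cdot> ((pj M N \<cdot> h) \<odot> k)) = pj M (tn N P) \<cdot> (idt K (fst M) \<odot> pj N P) \<cdot> asc K (fst M) (fst N) (fst P) \<cdot> (h \<odot> k)"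
    "\<lbrakk>c \<in> arrs K; tgt K c = src K h \<boxtimes> src K k\<rbrakk> \<Longrightarrow>
      am M N P \<cdot> (pj (tn M N) P \<cdot> (((pj M N \<cdot> h) \<odot> k) \<cdot> c)) = pj M (tn N P) \<cdot> (idt K (fst M) \<odot> pj N P) \<cdot> asc K (fst M) (fst N) (fst P) \<cdot> (h \<odot> k) \<cdot> c"
proof -
  note a = am[OF assms(1-3)]
  have "am M N P \<cdot> (pj (tn M N) P \<cdot> ((pj M N \<cdot> h) \<odot> k)) = (am M N P \<cdot> pj (tn M N) P \<cdot> (pj M N \<odot> idt K (fst P))) \<cdot> (h \<odot> k)"
    using a(1-3) assms by (simp add: tarr_cmp_tarr)
  also have "\<dots> = pj M (tn N P) \<cdot> (idt K (fst M) \<odot> pj N P) \<cdot> asc K (fst M) (fst N) (fst P) \<cdot> (h \<odot> k)"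
    unfolding a(4) using assms by simp
  finally show 1: "am M N P \<cdot> (pj (tn M N) P \<cdot> ((pj M N \<cdot> h) \<odot> k)) = pj M (tn N P) \<cdot> (idt K (fst M) \<odot> pj N P) \<cdot> asc K (fst M) (fst N) (fst P) \<cdot> (h \<odot> k)" .
  show "am M N P \<cdot> (pj (tn M N) P \<cdot> (((pj M N \<cdot> h) \<odot> k) \<cdot> c)) = pj M (tn N P) \<cdot> (idt K (fst M) \<odot> pj N P) \<cdot> asc K (fst M) (fst N) (fst P) \<cdot> (h \<odot> k) \<cdot> c"
    if "c \<in> arrs K" "tgt K c = src K h \<boxtimes> src K k"
    using arg_cong[OF 1, of "\<lambda>u. u \<cdot> c"] that a(1-3) assms(4-7) by simp
qed

lemma am_push_id:
  assumes "md M" "md N" "md P" "k \<in> arrs K" "tgt K k = fst P"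
  shows "am M N P \<cdot> (pj (tn M N) P \<cdot> (pj M N \<odot> k)) = pj M (tn N P) \<cdot> (idt K (fst M) \<odot> pj N P) \<cdot> asc K (fst M) (fst N) (fst P) \<cdot> (idt K (fst M \<boxtimes> fst N) \<odot> k)"
    "\<lbrakk>c \<in> arrs K; tgt K c = (fst M \<boxtimes> fst N) \<boxtimes> src K k\<rbrakk> \<Longrightarrow>
      am M N P \<cdot> (pj (tn M N) P \<cdot> ((pj M N \<odot> k) \<cdot> c)) = pj M (tn N P) \<cdot> (idt K (fst M) \<odot> pj N P) \<cdot> asc K (fst M) (fst N) (fst P) \<cdot> (idt K (fst M \<boxtimes> fst N) \<odot> k) \<cdot> c"
  using am_push[OF assms(1-3), of "idt K (fst M \<boxtimes> fst N)" k] assms by simp_all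

lemma pj_epi: "\<lbrakk>f \<cdot> pj M N = g \<cdot> pj M N; md M; md N; f \<in> arrs K; g \<in> arrs K; src K f = fst (tn M N); src K g = fst (tn M N)\<rbrakk> \<Longrightarrow> f = g"
  by (rule split_epi_cancel[of "pj M N"]) simp_all

lemma pj_epi_3: "\<lbrakk>f \<cdot> pj (tn M N) P \<cdot> (pj M N \<odot> idt K (fst P)) = g \<cdot> pj (tn M N) P \<cdot> (pj M N \<odot> idt K (fst P));
   md M; md N; md P; f \<in> arrs K; g \<in> arrs K; src K f = fst (tn (tn M N) P); src K g = fst (tn (tn M N) P)\<rbrakk> \<Longrightarrow> f = g"
  by (rule split_epi_cancel[OF pj2_split_epi(1)[of M N P]]) simp_all

lemma tm_idt: "\<lbrakk>md M; md N\<rbrakk> \<Longrightarrow> tm M N M N (idt K (fst M)) (idt K (fst N)) = idt K (fst (tn M N))"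
  by (rule pj_epi[of _ M N]) (simp_all add: tm)

lemma tm_cmp:
  assumes "ln M M' f" "ln M' M'' f'" "ln N N' g" "ln N' N'' g'" "md M" "md M'" "md M''" "md N" "md N'" "md N''"
  shows "tm M N M'' N'' (f' \<cdot> f) (g' \<cdot> g) = tm M' N' M'' N'' f' g' \<cdot> tm M N M' N' f g"
proof (rule pj_epi[of _ M N])
  note [simp] = assms(5-10) linD[OF assms(1)] linD[OF assms(2)] linD[OF assms(3)] linD[OF assms(4)]
  note c = lin_cmp[OF assms(1,2)] lin_cmp[OF assms(3,4)]
  show "tm M N M'' N'' (f' \<cdot> f) (g' \<cdot> g) \<cdot> pj M N = (tm M' N' M'' N'' f' g' \<cdot> tm M N M' N' f g) \<cdot> pj M N"
    using assms c by (simp add: tm tm_push tarr_cmp_tarr)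
qed (use assms lin_cmp[OF assms(1,2)] lin_cmp[OF assms(3,4)] in \<open>simp_all add: tm\<close>)

lemma am_natural:
  assumes f: "ln M M' f" and g: "ln N N' g" and h: "ln P P' h" and [simp]: "md M" "md M'" "md N" "md N'" "md P" "md P'"
  shows "am M' N' P' \<cdot> tm (tn M N) P (tn M' N') P' (tm M N M' N' f g) h =
     tm M (tn N P) M' (tn N' P') f (tm N P N' P' g h) \<cdot> am M N P"
proof (rule pj_epi_3[of _ M N P])
  note [simp] = linD[OF f] linD[OF g] linD[OF h] f g h tm[OF f g] tm[OF g h] am(1-3)[of M N P] am(1-3)[of M' N' P']
  have 1: "(am M' N' P' \<cdot> tm (tn M N) P (tn M' N') P' (tm M N M' N' f g) h) \<cdot> pj (tn M N) P \<cdot> (pj M N \<odot> idt K (fst P))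
    = pj M' (tn N' P') \<cdot> (idt K (fst M') \<odot> pj N' P') \<cdot> (f \<odot> (g \<odot> h)) \<cdot> asc K (fst M) (fst N) (fst P)"
    by (simp add: tm tm_push tarr_cmp_tarr am_push asc_nat)
  have 2: "(tm M (tn N P) M' (tn N' P') f (tm N P N' P' g h) \<cdot> am M N P) \<cdot> pj (tn M N) P \<cdot> (pj M N \<odot> idt K (fst P))
    = pj M' (tn N' P') \<cdot> (idt K (fst M') \<odot> pj N' P') \<cdot> (f \<odot> (g \<odot> h)) \<cdot> asc K (fst M) (fst N) (fst P)"
    by (simp add: tm am tm_push tarr_cmp_tarr_assoc)
  show "(am M' N' P' \<cdot> tm (tn M N) P (tn M' N') P' (tm M N M' N' f g) h) \<cdot> pj (tn M N) P \<cdot> (pj M N \<odot> idt K (fst P))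
    = (tm M (tn N P) M' (tn N' P') f (tm N P N' P' g h) \<cdot> am M N P) \<cdot> pj (tn M N) P \<cdot> (pj M N \<odot> idt K (fst P))"
    unfolding 1 2 ..
qed (use assms in \<open>simp_all add: tm am\<close>)

lemma lm_natural:
  assumes f: "ln M N f" and [simp]: "md M" "md N"
  shows "lm N \<cdot> tm RR M RR N (idt K r) f = f \<cdot> lm M"
proof (rule pj_epi[of _ RR M])
  have r: "ln RR RR (idt K r)" using lin_idt[of RR] by simp
  note [simp] = linD[OF f] f r lm(1-4)[of M] lm(1-4)[of N] tm[OF r f]
  show "(lm N \<cdot> tm RR M RR N (idt K r) f) \<cdot> pj RR M = (f \<cdot> lm M) \<cdot> pj RR M"
    by (simp add: lin_act[OF f] reassoc[OF lm(4)])
qed (use assms lin_idt[of RR] in \<open>simp_all add: tm lm linD\<close>)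

lemma rm_natural:
  assumes f: "ln M N f" and [simp]: "md M" "md N"
  shows "rm N \<cdot> tm M RR N RR f (idt K r) = f \<cdot> rm M"
proof (rule pj_epi[of _ M RR])
  have r: "ln RR RR (idt K r)" using lin_idt[of RR] by simp
  note [simp] = linD[OF f] f r rm(1-4)[of M] rm(1-4)[of N] tm[OF f r]
  show "(rm N \<cdot> tm M RR N RR f (idt K r)) \<cdot> pj M RR = (f \<cdot> rm M) \<cdot> pj M RR"
    by (simp add: rac_lin[OF f] reassoc[OF rm(4)])
qed (use assms lin_idt[of RR] in \<open>simp_all add: tm rm linD\<close>)

lemma cm_natural:
  assumes f: "ln M M' f" and g: "ln N N' g" and [simp]: "md M" "md M'" "md N" "md N'"
  shows "cm M' N' \<cdot> tm M N M' N' f g = tm N M N' M' g f \<cdot> cm M N"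
proof (rule pj_epi[of _ M N])
  note [simp] = linD[OF f] linD[OF g] f g tm[OF f g] tm[OF g f] cm(1-4)[of M N] cm(1-4)[of M' N']
  show "(cm M' N' \<cdot> tm M N M' N' f g) \<cdot> pj M N = (tm N M N' M' g f \<cdot> cm M N) \<cdot> pj M N"
    by (simp add: cm_push tm_push brd_nat)
qed (use assms in \<open>simp_all add: tm cm\<close>)

lemma cm_cm: "\<lbrakk>md M; md N\<rbrakk> \<Longrightarrow> cm N M \<cdot> cm M N = idt K (fst (tn M N))"
  by (rule pj_epi[of _ M N]) (simp_all add: cm cm_push)

lemma lin_am [simp]: "\<lbrakk>md M; md N; md P\<rbrakk> \<Longrightarrow> ln (tn (tn M N) P) (tn M (tn N P)) (am M N P)"
  and lin_cm [simp]: "\<lbrakk>md M; md N\<rbrakk> \<Longrightarrow> ln (tn M N) (tn N M) (cm M N)"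
  and lin_lm [simp]: "md M \<Longrightarrow> ln (tn RR M) M (lm M)"
  and lin_rm [simp]: "md M \<Longrightarrow> ln (tn M RR) M (rm M)"
  and lin_tm [simp]: "\<lbrakk>ln M M' f; ln N N' g; md M; md N; md M'; md N'\<rbrakk> \<Longrightarrow> ln (tn M N) (tn M' N') (tm M N M' N' f g)"
  by (simp_all add: am cm lm rm tm)

text \<open>Both sides are precomposed with the split epimorphism from the plain tensor product of
  the four objects. After pushing, what remains is the pentagon of \<open>K\<close>.\<close>

lemma Mod_pentagon:
  assumes [simp]: "md W" "md X" "md Y" "md Z"
  shows "am W X (tn Y Z) \<cdot> am (tn W X) Y Z =
       tm W (tn (tn X Y) Z) W (tn X (tn Y Z)) (idt K (fst W)) (am X Y Z) \<cdot> am W (tn X Y) Z \<cdot>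
       tm (tn (tn W X) Y) Z (tn W (tn X Y)) Z (am W X Y) (idt K (fst Z))"
proof -
  let ?i = "idt K" and ?w = "fst W" and ?x = "fst X" and ?y = "fst Y" and ?z = "fst Z"
  let ?q = "pj (tn (tn W X) Y) Z \<cdot> ((pj (tn W X) Y \<cdot> (pj W X \<odot> ?i ?y)) \<odot> ?i ?z)"
  note [simp] = am(1-3) tm(1-3)
  have q: "split_epi ?q" by (intro split_epi_cmp split_epi_tarr split_epi_idt) simp_all
  have "(am W X (tn Y Z) \<cdot> am (tn W X) Y Z) \<cdot> ?q =
     am W X (tn Y Z) \<cdot> (pj (tn W X) (tn Y Z) \<cdot> ((pj W X \<odot> pj Y Z) \<cdot> asc K (?w \<boxtimes> ?x) ?y ?z))"
    by (simp add: am_push asc_nat tarr_cmp_tarr_assoc)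
  also have "\<dots> = pj W (tn X (tn Y Z)) \<cdot> (?i ?w \<odot> pj X (tn Y Z)) \<cdot> (asc K ?w ?x (fst (tn Y Z)) \<cdot> (((?i ?w \<odot> ?i ?x) \<odot> pj Y Z) \<cdot> asc K (?w \<boxtimes> ?x) ?y ?z))"
    by (simp add: am_push_id)
  also have "\<dots> = pj W (tn X (tn Y Z)) \<cdot> (?i ?w \<odot> pj X (tn Y Z)) \<cdot> (?i ?w \<odot> (?i ?x \<odot> pj Y Z)) \<cdot> asc K ?w ?x (?y \<boxtimes> ?z) \<cdot> asc K (?w \<boxtimes> ?x) ?y ?z"
    by (simp add: asc_nat_assoc del: tarr_idt_idt)
  finally have L: "(am W X (tn Y Z) \<cdot> am (tn W X) Y Z) \<cdot> ?q =
    pj W (tn X (tn Y Z)) \<cdot> (?i ?w \<odot> pj X (tn Y Z)) \<cdot> (?i ?w \<odot> (?i ?x \<odot> pj Y Z)) \<cdot> asc K ?w ?x (?y \<boxtimes> ?z) \<cdot> asc K (?w \<boxtimes> ?x) ?y ?z" .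
  have "(tm W (tn (tn X Y) Z) W (tn X (tn Y Z)) (?i ?w) (am X Y Z) \<cdot> am W (tn X Y) Z \<cdot>
       tm (tn (tn W X) Y) Z (tn W (tn X Y)) Z (am W X Y) (?i ?z)) \<cdot> ?q =
     tm W (tn (tn X Y) Z) W (tn X (tn Y Z)) (?i ?w) (am X Y Z) \<cdot> am W (tn X Y) Z \<cdot>
       (pj (tn W (tn X Y)) Z \<cdot> ((am W X Y \<cdot> (pj (tn W X) Y \<cdot> (pj W X \<odot> ?i ?y))) \<odot> ?i ?z))"
    by (simp add: tm_push tarr_cmp_tarr)
  also have "\<dots> = tm W (tn (tn X Y) Z) W (tn X (tn Y Z)) (?i ?w) (am X Y Z) \<cdot> (am W (tn X Y) Z \<cdot>
       (pj (tn W (tn X Y)) Z \<cdot> ((pj W (tn X Y) \<cdot> ((?i ?w \<odot> pj X Y) \<cdot> asc K ?w ?x ?y)) \<odot> ?i ?z)))"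
    by (simp add: am(4))
  also have "\<dots> = tm W (tn (tn X Y) Z) W (tn X (tn Y Z)) (?i ?w) (am X Y Z) \<cdot> (pj W (tn (tn X Y) Z) \<cdot> ((?i ?w \<odot> pj (tn X Y) Z) \<cdot> (asc K ?w (fst (tn X Y)) ?z \<cdot>
       (((?i ?w \<odot> pj X Y) \<cdot> asc K ?w ?x ?y) \<odot> ?i ?z))))"
    by (simp add: am_push)
  also have "\<dots> = pj W (tn X (tn Y Z)) \<cdot> (?i ?w \<odot> (am X Y Z \<cdot> pj (tn X Y) Z \<cdot> (pj X Y \<odot> ?i ?z))) \<cdot> asc K ?w (?x \<boxtimes> ?y) ?z \<cdot> (asc K ?w ?x ?y \<odot> ?i ?z)"
    by (simp add: tm_push whisker_right asc_nat_assoc tarr_cmp_tarr_assoc)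
  also have "\<dots> = pj W (tn X (tn Y Z)) \<cdot> (?i ?w \<odot> pj X (tn Y Z)) \<cdot> (?i ?w \<odot> (?i ?x \<odot> pj Y Z)) \<cdot> asc K ?w ?x (?y \<boxtimes> ?z) \<cdot> asc K (?w \<boxtimes> ?x) ?y ?z"
    by (simp add: am(4) whisker_left pentagon)
  finally show ?thesis
    by (intro split_epi_cancel[OF q trans[OF L sym]]) simp_all
qed

text \<open>Once projections are cancelled, the two sides differ by the balancing relation itself:
  the middle scalar acts on \<open>N\<close> on one side and on \<open>M\<close> on the
  other.\<close>

lemma Mod_triangle:
  assumes [simp]: "md M" "md N"
  shows "tm M (tn RR N) M N (idt K (fst M)) (lm N) \<cdot> am M RR N = tm (tn M RR) N M N (rm M) (idt K (fst N))"
proof (rule pj_epi_3[of _ M RR N])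
  note [simp] = am(1-3) tm(1-3) lm(1-3) rm(1-3)
  let ?i = "idt K"
  have "(tm M (tn RR N) M N (?i (fst M)) (lm N) \<cdot> am M RR N) \<cdot> pj (tn M RR) N \<cdot> (pj M RR \<odot> ?i (fst N)) =
     pj M N \<cdot> (?i (fst M) \<odot> snd N) \<cdot> asc K (fst M) r (fst N)"
    by (simp add: am(4) tm_push tarr_cmp_tarr_assoc lm(4))
  also have "\<dots> = tm (tn M RR) N M N (rm M) (?i (fst N)) \<cdot> pj (tn M RR) N \<cdot> (pj M RR \<odot> ?i (fst N))"
    by (simp add: tm_push tarr_cmp_tarr rm(4) pj_bal)
  finally show "(tm M (tn RR N) M N (?i (fst M)) (lm N) \<cdot> am M RR N) \<cdot> pj (tn M RR) N \<cdot> (pj M RR \<odot> ?i (fst N)) =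
     tm (tn M RR) N M N (rm M) (?i (fst N)) \<cdot> pj (tn M RR) N \<cdot> (pj M RR \<odot> ?i (fst N))" .
qed (simp_all add: am tm rm)

lemma Mod_hexagon:
  assumes [simp]: "md X" "md Y" "md Z"
  shows "am Y Z X \<cdot> cm X (tn Y Z) \<cdot> am X Y Z =
    tm Y (tn X Z) Y (tn Z X) (idt K (fst Y)) (cm X Z) \<cdot> am Y X Z \<cdot> tm (tn X Y) Z (tn Y X) Z (cm X Y) (idt K (fst Z))"
proof (rule pj_epi_3[of _ X Y Z])
  note [simp] = am(1-3) tm(1-3) cm(1-3)
  let ?i = "idt K" and ?x = "fst X" and ?y = "fst Y" and ?z = "fst Z"
  have "(am Y Z X \<cdot> cm X (tn Y Z) \<cdot> am X Y Z) \<cdot> pj (tn X Y) Z \<cdot> (pj X Y \<odot> ?i ?z) =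
     pj Y (tn Z X) \<cdot> (?i ?y \<odot> pj Z X) \<cdot> asc K ?y ?z ?x \<cdot> brd K ?x (?y \<boxtimes> ?z) \<cdot> asc K ?x ?y ?z"
    by (simp add: am(4) cm_push brd_nat_assoc am_push_id)
  also have "\<dots> = pj Y (tn Z X) \<cdot> (?i ?y \<odot> (pj Z X \<cdot> brd K ?x ?z)) \<cdot> asc K ?y ?x ?z \<cdot> (brd K ?x ?y \<odot> ?i ?z)"
    by (simp add: hexagon whisker_left)
  also have "\<dots> = pj Y (tn Z X) \<cdot> (?i ?y \<odot> (cm X Z \<cdot> pj X Z)) \<cdot> asc K ?y ?x ?z \<cdot> (brd K ?x ?y \<odot> ?i ?z)"
    by (simp add: cm(4))
  also have "\<dots> = (tm Y (tn X Z) Y (tn Z X) (?i ?y) (cm X Z) \<cdot> am Y X Z \<cdot> tm (tn X Y) Z (tn Y X) Z (cm X Y) (?i ?z)) \<cdot> pj (tn X Y) Z \<cdot> (pj X Y \<odot> ?i ?z)"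
    by (simp add: tm_push tarr_cmp_tarr tarr_cmp_tarr_assoc cm(4) am_push)
  finally show "(am Y Z X \<cdot> cm X (tn Y Z) \<cdot> am X Y Z) \<cdot> pj (tn X Y) Z \<cdot> (pj X Y \<odot> ?i ?z) =
   (tm Y (tn X Z) Y (tn Z X) (?i ?y) (cm X Z) \<cdot> am Y X Z \<cdot> tm (tn X Y) Z (tn Y X) Z (cm X Y) (?i ?z)) \<cdot> pj (tn X Y) Z \<cdot> (pj X Y \<odot> ?i ?z)" .
qed (simp_all add: am tm cm)

text \<open>In the presence of the braiding the inverse of the associator is again built from the associator.\<close>

lemma am_iso:
  assumes [simp]: "md X" "md Y" "md Z"
  obtains j where "ln (tn X (tn Y Z)) (tn (tn X Y) Z) j" "j \<cdot> am X Y Z = idt K (fst (tn (tn X Y) Z))"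
     "am X Y Z \<cdot> j = idt K (fst (tn X (tn Y Z)))"
proof -
  note [simp] = am(1-3) tm(1-3) cm(1-3)
  let ?i = "idt K" and ?x = "fst X" and ?y = "fst Y" and ?z = "fst Z"
  \<comment> \<open>Read from right to left: the three factors are reversed, reassociated, and
    reversed back.\<close>
  define j where "j = tm (tn Y X) Z (tn X Y) Z (cm Y X) (?i ?z) \<cdot> cm Z (tn Y X) \<cdot> am Z Y X \<cdot> tm (tn Y Z) X (tn Z Y) X (cm Y Z) (?i ?x) \<cdot> cm X (tn Y Z)"
  have l: "ln (tn X (tn Y Z)) (tn (tn X Y) Z) j"
    unfolding j_def by (intro lin_cmp) (auto intro: lin_cm lin_tm lin_am lin_idt)
  note [simp] = linD[OF l]
  have jp: "j \<cdot> pj X (tn Y Z) \<cdot> (?i ?x \<odot> pj Y Z) \<cdot> c = pj (tn X Y) Z \<cdot> (pj X Y \<odot> ?i ?z) \<cdot> asc' ?x ?y ?z \<cdot> c"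
    if c: "c \<in> arrs K" "tgt K c = ?x \<boxtimes> (?y \<boxtimes> ?z)" for c
  proof -
    have "j \<cdot> pj X (tn Y Z) \<cdot> (?i ?x \<odot> pj Y Z) = tm (tn Y X) Z (tn X Y) Z (cm Y X) (?i ?z) \<cdot> cm Z (tn Y X) \<cdot> am Z Y X \<cdot>
        (tm (tn Y Z) X (tn Z Y) X (cm Y Z) (?i ?x) \<cdot> (pj (tn Y Z) X \<cdot> ((pj Y Z \<odot> ?i ?x) \<cdot> brd K ?x (?y \<boxtimes> ?z))))"
      unfolding j_def by (simp add: cm_push brd_nat)
    also have "\<dots> = tm (tn Y X) Z (tn X Y) Z (cm Y X) (?i ?z) \<cdot> cm Z (tn Y X) \<cdot> am Z Y X \<cdot>
        (pj (tn Z Y) X \<cdot> (((pj Z Y \<cdot> brd K ?y ?z) \<odot> ?i ?x) \<cdot> brd K ?x (?y \<boxtimes> ?z)))"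
      by (simp add: tm_push tarr_cmp_tarr_assoc cm(4))
    also have "\<dots> = tm (tn Y X) Z (tn X Y) Z (cm Y X) (?i ?z) \<cdot> (cm Z (tn Y X) \<cdot> (pj Z (tn Y X) \<cdot>
        ((?i ?z \<odot> pj Y X) \<cdot> asc K ?z ?y ?x \<cdot> (brd K ?y ?z \<odot> ?i ?x) \<cdot> brd K ?x (?y \<boxtimes> ?z))))"
      by (simp add: am_push)
    also have "\<dots> = tm (tn Y X) Z (tn X Y) Z (cm Y X) (?i ?z) \<cdot> (pj (tn Y X) Z \<cdot>
        ((pj Y X \<odot> ?i ?z) \<cdot> brd K ?z (?y \<boxtimes> ?x) \<cdot> asc K ?z ?y ?x \<cdot> (brd K ?y ?z \<odot> ?i ?x) \<cdot> brd K ?x (?y \<boxtimes> ?z)))"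
      by (simp add: cm_push brd_nat_assoc)
    also have "\<dots> = pj (tn X Y) Z \<cdot> (pj X Y \<odot> ?i ?z) \<cdot> ((brd K ?y ?x \<odot> ?i ?z) \<cdot> brd K ?z (?y \<boxtimes> ?x) \<cdot> asc K ?z ?y ?x \<cdot> (brd K ?y ?z \<odot> ?i ?x) \<cdot> brd K ?x (?y \<boxtimes> ?z))"
      by (simp add: tm_push tarr_cmp_tarr_assoc cm(4))
    also have "\<dots> = pj (tn X Y) Z \<cdot> (pj X Y \<odot> ?i ?z) \<cdot> asc' ?x ?y ?z"
      by (subst asc'_brd) simp_all
    finally have e: "j \<cdot> pj X (tn Y Z) \<cdot> (?i ?x \<odot> pj Y Z) = pj (tn X Y) Z \<cdot> (pj X Y \<odot> ?i ?z) \<cdot> asc' ?x ?y ?z" .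
    show ?thesis using arg_cong[OF e, of "\<lambda>u. u \<cdot> c"] c by simp
  qed
  have 1: "j \<cdot> am X Y Z = ?i (fst (tn (tn X Y) Z))"
    by (rule pj_epi_3[of _ X Y Z]) (simp_all add: am(4) jp)
  have 2: "am X Y Z \<cdot> j = ?i (fst (tn X (tn Y Z)))"
  proof (rule split_epi_cancel[OF pj2_split_epi(2)[of X Y Z]])
    have "(am X Y Z \<cdot> j) \<cdot> pj X (tn Y Z) \<cdot> (?i ?x \<odot> pj Y Z) = am X Y Z \<cdot> (j \<cdot> pj X (tn Y Z) \<cdot> (?i ?x \<odot> pj Y Z) \<cdot> ?i (?x \<boxtimes> (?y \<boxtimes> ?z)))"
      by simp
    also have "\<dots> = am X Y Z \<cdot> pj (tn X Y) Z \<cdot> (pj X Y \<odot> ?i ?z) \<cdot> asc' ?x ?y ?z"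
      by (subst jp) simp_all
    also have "\<dots> = pj X (tn Y Z) \<cdot> (?i ?x \<odot> pj Y Z)"
      by (simp add: am_push_id)
    finally show "(am X Y Z \<cdot> j) \<cdot> pj X (tn Y Z) \<cdot> (?i ?x \<odot> pj Y Z) = ?i (fst (tn X (tn Y Z))) \<cdot> pj X (tn Y Z) \<cdot> (?i ?x \<odot> pj Y Z)"
      by simp
  qed simp_all
  show ?thesis by (rule that[OF l 1 2])
qed

lemma lin_add:
  assumes "ln M N f" "ln M N g" and [simp]: "md M" "md N"
  shows "ln M N (f \<boxplus> g)"
proof -
  note [simp] = linD[OF assms(1)] linD[OF assms(2)]
  show ?thesis unfolding lin_iff by (simp add: add_cmp tarr_add cmp_add lin_act[OF assms(1)] lin_act[OF assms(2)])
qed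

lemma lin_zro: "\<lbrakk>md M; md N\<rbrakk> \<Longrightarrow> ln M N (zro K (fst M) (fst N))"
  unfolding lin_iff by simp

lemma tm_add:
  assumes "ln M M' f" "ln M M' f'" "ln N N' g" and [simp]: "md M" "md M'" "md N" "md N'"
  shows "tm M N M' N' (f \<boxplus> f') g = tm M N M' N' f g \<boxplus> tm M N M' N' f' g"
    and "tm N M N' M' g (f \<boxplus> f') = tm N M N' M' g f \<boxplus> tm N M N' M' g f'"
proof -
  note l = lin_add[OF assms(1,2,4,5)]
  note [simp] = linD[OF assms(1)] linD[OF assms(2)] linD[OF assms(3)] tm(1-4)[OF l assms(3)] tm(1-4)[OF assms(1,3)] tm(1-4)[OF assms(2,3)]
    tm(1-4)[OF assms(3) l] tm(1-4)[OF assms(3,1)] tm(1-4)[OF assms(3,2)]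
  show "tm M N M' N' (f \<boxplus> f') g = tm M N M' N' f g \<boxplus> tm M N M' N' f' g"
    by (rule pj_epi[of _ M N]) (simp_all add: add_cmp add_tarr cmp_add)
  show "tm N M N' M' g (f \<boxplus> f') = tm N M N' M' g f \<boxplus> tm N M N' M' g f'"
    by (rule pj_epi[of _ N M]) (simp_all add: add_cmp tarr_add cmp_add)
qed

text \<open>A linear idempotent commutes with the action, so its image carries the action obtained
  by including, acting and projecting.\<close>

lemma mod_retract:
  assumes [simp]: "md M" and a: "i \<in> arrs K" "src K i = x" "tgt K i = fst M" "p \<in> arrs K" "src K p = fst M" "tgt K p = x"
    "p \<cdot> i = idt K x" and l: "ln M M (i \<cdot> p)"
  shows "md (x, p \<cdot> snd M \<cdot> (idt K r \<odot> i))" "ln (x, p \<cdot> snd M \<cdot> (idt K r \<odot> i)) M i" "ln M (x, p \<cdot> snd M \<cdot> (idt K r \<odot> i)) p"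
proof -
  note [simp] = a(1-6)
  have [simp]: "x \<in> objs K" using src_in_objs[OF a(1)] by simp
  let ?i = "idt K" and ?\<rho> = "snd M"
  have c: "i \<cdot> p \<cdot> ?\<rho> = ?\<rho> \<cdot> (?i r \<odot> (i \<cdot> p))" using lin_act[OF l] by simp
  have cf: "i \<cdot> p \<cdot> ?\<rho> \<cdot> f = ?\<rho> \<cdot> (?i r \<odot> (i \<cdot> p)) \<cdot> f" if "f \<in> arrs K" "tgt K f = r \<boxtimes> fst M" for f
    using that arg_cong[OF c, of "\<lambda>u. u \<cdot> f"] by simp
  have pif: "p \<cdot> i \<cdot> f = f" if "f \<in> arrs K" "tgt K f = x" for f
    using that reassoc[OF a(7), of f] by simp
  have ip: "i \<cdot> (p \<cdot> ?\<rho> \<cdot> (?i r \<odot> i)) = ?\<rho> \<cdot> (?i r \<odot> i)"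
    by (simp add: cf tarr_cmp_tarr a(7) pif)
  let ?\<tau> = "p \<cdot> ?\<rho> \<cdot> (?i r \<odot> i)"
  have "?\<tau> \<cdot> (r_mul R \<odot> ?i x) = p \<cdot> (?\<rho> \<cdot> (r_mul R \<odot> ?i (fst M))) \<cdot> (?i (r \<boxtimes> r) \<odot> i)"
    by (simp add: tarr_cmp_tarr)
  also have "\<dots> = p \<cdot> ?\<rho> \<cdot> (?i r \<odot> (?\<rho> \<cdot> (?i r \<odot> i))) \<cdot> asc K r r x"
    unfolding mod_assoc[OF assms(1)] by (simp add: asc_nat whisker_left tarr_idt_idt[symmetric] del: tarr_idt_idt)
  also have "\<dots> = p \<cdot> ?\<rho> \<cdot> (?i r \<odot> (i \<cdot> ?\<tau>)) \<cdot> asc K r r x"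
    unfolding ip ..
  also have "\<dots> = ?\<tau> \<cdot> (?i r \<odot> ?\<tau>) \<cdot> asc K r r x"
    by (simp add: tarr_cmp_tarr_assoc)
  finally have 1: "?\<tau> \<cdot> (r_mul R \<odot> ?i x) = ?\<tau> \<cdot> (?i r \<odot> ?\<tau>) \<cdot> asc K r r x" .
  have "?\<tau> \<cdot> (r_unit R \<odot> ?i x) = p \<cdot> (?\<rho> \<cdot> (r_unit R \<odot> ?i (fst M))) \<cdot> (?i (unt K) \<odot> i)"
    by (simp add: tarr_cmp_tarr)
  also have "\<dots> = lun K x"
    unfolding mod_unit[OF assms(1)] by (simp add: lun_nat pif)
  finally have 2: "?\<tau> \<cdot> (r_unit R \<odot> ?i x) = lun K x" .
  show "md (x, ?\<tau>)" unfolding mod_iff using 1 2 by simp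
  show "ln (x, ?\<tau>) M i" unfolding lin_iff using ip by simp
  have "?\<tau> \<cdot> (?i r \<odot> p) = p \<cdot> (i \<cdot> p \<cdot> ?\<rho>)"
    unfolding c by (simp add: tarr_cmp_tarr)
  also have "\<dots> = p \<cdot> ?\<rho>" by (simp add: pif)
  finally show "ln M (x, ?\<tau>) p" unfolding lin_iff by simp
qed

lemma mod_biproduct:
  assumes M [simp]: "md M" and N [simp]: "md N"
  obtains S i j p q where "biproduct K (fst M) (fst N) (fst S) i j p q" "md S" "ln M S i" "ln N S j" "ln S M p" "ln S N q"
proof -
  obtain s i j p q where b: "biproduct K (fst M) (fst N) s i j p q" using ex_biproduct[of "fst M" "fst N"] by auto
  note [simp] = biproductD(1-15)[OF b]
  let ?i = "idt K"
  define \<tau> where "\<tau> = (i \<cdot> snd M \<cdot> (?i r \<odot> p)) \<boxplus> (j \<cdot> snd N \<cdot> (?i r \<odot> q))"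
  have [simp]: "\<tau> \<in> arrs K" "src K \<tau> = r \<boxtimes> s" "tgt K \<tau> = s" by (simp_all add: \<tau>_def)
  have t: "p \<cdot> \<tau> = snd M \<cdot> (?i r \<odot> p)" "q \<cdot> \<tau> = snd N \<cdot> (?i r \<odot> q)"
    by (simp_all add: \<tau>_def cmp_add biproduct_cmp[OF b])
  have tf: "p \<cdot> \<tau> \<cdot> f = snd M \<cdot> (?i r \<odot> p) \<cdot> f" "q \<cdot> \<tau> \<cdot> f = snd N \<cdot> (?i r \<odot> q) \<cdot> f" if "f \<in> arrs K" "tgt K f = r \<boxtimes> s" for f
    using that by (simp_all add: reassoc[OF t(1)] reassoc[OF t(2)])
  have as: "snd P \<cdot> (?i r \<odot> u) \<cdot> (r_mul R \<odot> ?i s) = snd P \<cdot> (?i r \<odot> (snd P \<cdot> (?i r \<odot> u))) \<cdot> asc K r r s"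
    "snd P \<cdot> (?i r \<odot> u) \<cdot> (r_unit R \<odot> ?i s) = u \<cdot> lun K s"
    if [simp]: "md P" "u \<in> arrs K" "src K u = s" "tgt K u = fst P" for P u
  proof -
    have "snd P \<cdot> (?i r \<odot> u) \<cdot> (r_mul R \<odot> ?i s) = (snd P \<cdot> (r_mul R \<odot> ?i (fst P))) \<cdot> ((?i r \<odot> ?i r) \<odot> u)"
      by (simp add: tarr_cmp_tarr)
    also have "\<dots> = snd P \<cdot> (?i r \<odot> (snd P \<cdot> (?i r \<odot> u))) \<cdot> asc K r r s"
      unfolding mod_assoc[OF that(1)] by (simp add: asc_nat whisker_left del: tarr_idt_idt)
    finally show "snd P \<cdot> (?i r \<odot> u) \<cdot> (r_mul R \<odot> ?i s) = snd P \<cdot> (?i r \<odot> (snd P \<cdot> (?i r \<odot> u))) \<cdot> asc K r r s" .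
    have "snd P \<cdot> (?i r \<odot> u) \<cdot> (r_unit R \<odot> ?i s) = (snd P \<cdot> (r_unit R \<odot> ?i (fst P))) \<cdot> (?i (unt K) \<odot> u)"
      by (simp add: tarr_cmp_tarr)
    then show "snd P \<cdot> (?i r \<odot> u) \<cdot> (r_unit R \<odot> ?i s) = u \<cdot> lun K s"
      unfolding mod_unit[OF that(1)] by (simp add: lun_nat)
  qed
  have 1: "\<tau> \<cdot> (r_mul R \<odot> ?i s) = \<tau> \<cdot> (?i r \<odot> \<tau>) \<cdot> asc K r r s"
    by (rule biproduct_joint[OF b]) (simp_all add: tf as tarr_cmp_tarr_assoc t)
  have 2: "\<tau> \<cdot> (r_unit R \<odot> ?i s) = lun K s"
    by (rule biproduct_joint[OF b]) (simp_all add: tf as)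
  have S: "md (s, \<tau>)" unfolding mod_iff using 1 2 by simp
  have p: "ln (s, \<tau>) M p" "ln (s, \<tau>) N q" unfolding lin_iff using t by simp_all
  have i: "ln M (s, \<tau>) i" unfolding lin_iff
    by simp (rule biproduct_joint[OF b], simp_all add: tf biproduct_cmp[OF b] tarr_cmp_tarr biproductD[OF b])
  have j: "ln N (s, \<tau>) j" unfolding lin_iff
    by simp (rule biproduct_joint[OF b], simp_all add: tf biproduct_cmp[OF b] tarr_cmp_tarr biproductD[OF b])
  show ?thesis by (rule that[of "(s, \<tau>)" i j p q]) (use b S i j p in simp_all)
qed

abbreviation L :: "(('o, 'm) module_obj, ('o, 'm) module_arr) smc" where "L \<equiv> Mod K R"

lemma Mod_simps [simp]:
  "objs L = {M. md M}" "src L t = fst t" "tgt L t = snd (snd t)" "idt L M = (M, idt K (fst M), M)"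
  "cmp L t u = (fst u, under t \<cdot> under u, snd (snd t))"
  "add L t u = (fst t, under t \<boxplus> under u, snd (snd t))"
  "zro L M N = (M, zro K (fst M) (fst N), N)"
  "tobj L = tn" "unt L = RR"
  "tarr L (M, f, M') (N, g, N') = (tn M N, tm M N M' N' f g, tn M' N')"
  "asc L M N P = (tn (tn M N) P, am M N P, tn M (tn N P))"
  "lun L M = (tn RR M, lm M, M)" "run L M = (tn M RR, rm M, M)" "brd L M N = (tn M N, cm M N, tn N M)"
  by (simp_all add: Mod_def tm_def am_def lm_def rm_def cm_def rac_def)

lemma Mod_arrs [simp]: "(M, f, N) \<in> arrs L \<longleftrightarrow> md M \<and> md N \<and> ln M N f"
  by (auto simp: Mod_def)

lemma Mod_Hom: "t \<in> Hom L M N \<longleftrightarrow> (\<exists>f. t = (M, f, N) \<and> md M \<and> md N \<and> ln M N f)"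
  unfolding Hom_def by (cases t) auto

lemma Mod_arrs_iff: "t \<in> arrs L \<longleftrightarrow> (\<exists>M f N. t = (M, f, N) \<and> md M \<and> md N \<and> ln M N f)"
  by (cases t) auto

lemma Mod_category: "category L"
proof
  fix t assume "t \<in> arrs L"
  then show "src L t \<in> objs L" "tgt L t \<in> objs L" by (auto simp: Mod_arrs_iff)
qed (auto simp: Mod_Hom linD lin_cmp)

lemma Mod_iso_arrowI:
  assumes "ln M N f" "md M" "md N" "g \<in> arrs K" "src K g = fst N" "tgt K g = fst M" "g \<cdot> f = idt K (fst M)" "f \<cdot> g = idt K (fst N)"
  shows "iso_arrow L (M, f, N)"
  using lin_inverse[of M N f g] assms unfolding iso_arrow_def inverse_arrows_def Mod_Hom by auto

lemma Mod_additive: "additive_category L"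
proof (rule additive_category.intro[OF Mod_category], rule additive_category_axioms.intro)
  fix M N assume "M \<in> objs L" "N \<in> objs L"
  then have [simp]: "md M" "md N" by auto
  show "comm_group (hom_group L M N)"
  proof (rule comm_groupI)
    fix t assume "t \<in> carrier (hom_group L M N)"
    then obtain f where t: "t = (M, f, N)" and f: "ln M N f" by (auto simp: hom_group_def Mod_Hom)
    note [simp] = linD[OF f]
    obtain g where g: "g \<in> arrs K" "src K g = fst M" "tgt K g = fst N" "f \<boxplus> g = zro K (fst M) (fst N)"
      by (rule ex_complement[of f "zro K (fst M) (fst N)"]) auto
    note [simp] = g(1-3)
    \<comment> \<open>The negative of a linear arrow is linear: add \<open>f\<close> on both sides,
      where the sum vanishes, and cancel.\<close>
    have "(f \<cdot> snd M) \<boxplus> (g \<cdot> snd M) = (f \<boxplus> g) \<cdot> snd M" by (simp add: add_cmp)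
    also have "\<dots> = snd N \<cdot> (idt K r \<odot> (f \<boxplus> g))" unfolding g(4) by simp
    also have "\<dots> = (f \<cdot> snd M) \<boxplus> (snd N \<cdot> (idt K r \<odot> g))" by (simp add: tarr_add cmp_add lin_act[OF f])
    finally have "g \<cdot> snd M = snd N \<cdot> (idt K r \<odot> g)" by (rule add_left_cancel) simp_all
    then have "ln M N g" unfolding lin_iff by simp
    moreover have "g \<boxplus> f = zro K (fst M) (fst N)" using g(4) add_comm[of f g] by simp
    ultimately show "\<exists>y\<in>carrier (hom_group L M N). y \<otimes>\<^bsub>hom_group L M N\<^esub> t = \<one>\<^bsub>hom_group L M N\<^esub>"
      by (intro bexI[of _ "(M, g, N)"]) (simp_all add: hom_group_def Mod_Hom t)
  next
    fix t u assume "t \<in> carrier (hom_group L M N)" "u \<in> carrier (hom_group L M N)"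
    then obtain f g where tu: "t = (M, f, N)" "u = (M, g, N)" and l: "ln M N f" "ln M N g" by (auto simp: hom_group_def Mod_Hom)
    show "t \<otimes>\<^bsub>hom_group L M N\<^esub> u \<in> carrier (hom_group L M N)"
      using lin_add[OF l] by (simp add: tu hom_group_def Mod_Hom)
    show "t \<otimes>\<^bsub>hom_group L M N\<^esub> u = u \<otimes>\<^bsub>hom_group L M N\<^esub> t"
      using linD[OF l(1)] linD[OF l(2)] by (simp add: tu hom_group_def add_comm)
  next
    fix t u v assume "t \<in> carrier (hom_group L M N)" "u \<in> carrier (hom_group L M N)" "v \<in> carrier (hom_group L M N)"
    then obtain f g h where tu: "t = (M, f, N)" "u = (M, g, N)" "v = (M, h, N)" and l: "ln M N f" "ln M N g" "ln M N h" by (auto simp: hom_group_def Mod_Hom)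
    show "t \<otimes>\<^bsub>hom_group L M N\<^esub> u \<otimes>\<^bsub>hom_group L M N\<^esub> v = t \<otimes>\<^bsub>hom_group L M N\<^esub> (u \<otimes>\<^bsub>hom_group L M N\<^esub> v)"
      using linD[OF l(1)] linD[OF l(2)] linD[OF l(3)] by (simp add: tu hom_group_def add_assoc)
  qed (auto simp: hom_group_def Mod_Hom lin_zro linD)
  obtain S i j p q where b: "biproduct K (fst M) (fst N) (fst S) i j p q" and "md S" "ln M S i" "ln N S j" "ln S M p" "ln S N q"
    by (rule mod_biproduct[of M N]) auto
  then have "biproduct L M N S (M, i, S) (N, j, S) (S, p, M) (S, q, N)"
    using biproductD[OF b] unfolding biproduct_def by (auto simp: Mod_Hom)
  then show "\<exists>s i j p q. biproduct L M N s i j p q" by blast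
next
  obtain z where z: "z \<in> objs K" "idt K z = zro K z z" using ex_zero_object by (auto simp: zero_object_def)
  \<comment> \<open>Every arrow into a zero object is zero, so the module laws on it hold
    automatically.\<close>
  have zz: "f = zro K (src K f) z" if "f \<in> arrs K" "tgt K f = z" for f
    using idt_cmp[of f z] zro_cmp[of f z z] that z by metis
  have "md (z, zro K (r \<boxtimes> z) z)"
    unfolding mod_iff using z zz[of "lun K z"] by simp
  then show "\<exists>z. zero_object L z" using z by (auto simp: zero_object_def)
qed (auto simp: Mod_Hom linD add_cmp cmp_add)

lemma Mod_smc: "symmetric_monoidal_category L"
proof (rule symmetric_monoidal_category.intro[OF Mod_category], unfold_locales)
  fix M N P assume "M \<in> objs L" "N \<in> objs L" "P \<in> objs L"
  then have [simp]: "md M" "md N" "md P" by auto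
  obtain j where j: "ln (tn M (tn N P)) (tn (tn M N) P) j" "j \<cdot> am M N P = idt K (fst (tn (tn M N) P))"
     "am M N P \<cdot> j = idt K (fst (tn M (tn N P)))" by (rule am_iso[of M N P]) auto
  show "iso_arrow L (asc L M N P)"
    using Mod_iso_arrowI[OF lin_am, of M N P j] j by (simp add: linD)
next
  fix M assume "M \<in> objs L"
  then have [simp]: "md M" by auto
  show "iso_arrow L (lun L M)" "iso_arrow L (run L M)"
    using Mod_iso_arrowI[OF lin_lm, of M "lun' _"] iso_inv[OF lm(6)[of M]] lm[of M] Mod_iso_arrowI[OF lin_lm, of M "inv_arrow K (lm M)"]
     iso_inv[OF rm(6)[of M]] rm[of M] Mod_iso_arrowI[OF lin_rm, of M "inv_arrow K (rm M)"] by simp_all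
qed (auto simp: Mod_Hom tm_idt tm_cmp am_natural lm_natural rm_natural cm_natural cm_cm Mod_pentagon Mod_triangle Mod_hexagon)

text \<open>With this, every result proved for an abstract category of this kind holds for modules
  as well, in particular the existence and the universal property of the derived algebra.\<close>

lemma Mod_icsmc: "idempotent_complete_symmetric_monoidal_category L"
proof (rule idempotent_complete_symmetric_monoidal_category.intro[OF Mod_additive Mod_smc], unfold_locales)
  fix M e assume "M \<in> objs L" "e \<in> Hom L M M" "cmp L e e = e"
  then obtain f where [simp]: "md M" and e: "e = (M, f, M)" and l: "ln M M f" and ff: "f \<cdot> f = f"
    by (auto simp: Mod_Hom)
  note [simp] = linD[OF l]
  obtain x y i j p q where b: "biproduct K x y (fst M) i j p q" and f: "f = i \<cdot> p"
    using idempotent_splits[of "fst M" f] ff by auto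
  note [simp] = biproductD(1-15)[OF b]
  have l1: "ln M M (i \<cdot> p)" using l f by simp
  \<comment> \<open>Linearity is known for the first idempotent; the complementary one inherits it
    because the two add up to the identity.\<close>
  have "(i \<cdot> p \<cdot> snd M) \<boxplus> (j \<cdot> q \<cdot> snd M) = ((i \<cdot> p) \<boxplus> (j \<cdot> q)) \<cdot> snd M"
    by (simp add: add_cmp)
  also have "\<dots> = snd M \<cdot> (idt K r \<odot> ((i \<cdot> p) \<boxplus> (j \<cdot> q)))"
    unfolding biproductD(20)[OF b] by simp
  also have "\<dots> = (i \<cdot> p \<cdot> snd M) \<boxplus> (snd M \<cdot> (idt K r \<odot> (j \<cdot> q)))"
    using lin_act[OF l1] by (simp add: tarr_add cmp_add)
  finally have "j \<cdot> q \<cdot> snd M = snd M \<cdot> (idt K r \<odot> (j \<cdot> q))"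
    by (rule add_left_cancel) simp_all
  then have l2: "ln M M (j \<cdot> q)" unfolding lin_iff by simp
  let ?X = "(x, p \<cdot> snd M \<cdot> (idt K r \<odot> i))" and ?Y = "(y, q \<cdot> snd M \<cdot> (idt K r \<odot> j))"
  note X = mod_retract[of M i x p, OF _ _ _ _ _ _ _ _ l1]
  note Y = mod_retract[of M j y q, OF _ _ _ _ _ _ _ _ l2]
  have "biproduct L ?X ?Y M (?X, i, M) (?Y, j, M) (M, p, ?X) (M, q, ?Y)"
    using X Y biproductD[OF b] unfolding biproduct_def by (simp add: Mod_Hom)
  moreover have "e = cmp L (?X, i, M) (M, p, ?X)" by (simp add: e f)
  ultimately show "\<exists>x\<^sub>1 x\<^sub>2 i j p q. biproduct L x\<^sub>1 x\<^sub>2 M i j p q \<and> e = cmp L i p" by blast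
qed (auto simp: Mod_Hom tm_add)

end

section \<open>Algebras and rings of modules\<close>

context sep_ring
begin

abbreviation roa :: "('o, 'm) ring_obj \<Rightarrow> 'm \<Rightarrow> (('o, 'm) module_obj, ('o, 'm) module_arr) ring_obj" where
  "roa \<equiv> ring_of_algebra K R"
abbreviation alg :: "('o, 'm) ring_obj \<Rightarrow> 'm \<Rightarrow> bool" where
  "alg B \<phi> \<equiv> is_ring K B \<and> ring_mor K R B \<phi>"

text \<open>\<open>B\<close> as a module through \<phi>; \<open>bm\<close> is its multiplication on
  the relative tensor square. They are the ingredients of \<open>ring_of_algebra\<close>, named so
  that the module lemmas apply to them.\<close>

definition AM :: "('o, 'm) ring_obj \<Rightarrow> 'm \<Rightarrow> ('o, 'm) module_obj" where
  "AM B \<phi> = (r_ob B, prd K B \<phi> (idt K (r_ob B)))"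
definition bm :: "('o, 'm) ring_obj \<Rightarrow> 'm \<Rightarrow> 'm" where
  "bm B \<phi> = descend K (pj (AM B \<phi>) (AM B \<phi>)) (r_mul B)"

lemma roa_simps [simp]: "r_ob (roa B \<phi>) = AM B \<phi>" "r_mul (roa B \<phi>) = (tn (AM B \<phi>) (AM B \<phi>), bm B \<phi>, AM B \<phi>)"
  "r_unit (roa B \<phi>) = (RR, \<phi>, AM B \<phi>)" "fst (AM B \<phi>) = r_ob B" "snd (AM B \<phi>) = prd K B \<phi> (idt K (r_ob B))"
  by (simp_all add: ring_of_algebra_def Let_def AM_def prd_def bm_def)

lemma algD: "alg B \<phi> \<Longrightarrow> is_ring K B" "alg B \<phi> \<Longrightarrow> \<phi> \<in> arrs K" "alg B \<phi> \<Longrightarrow> src K \<phi> = r" "alg B \<phi> \<Longrightarrow> tgt K \<phi> = r_ob B"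
  "alg B \<phi> \<Longrightarrow> \<phi> \<cdot> r_unit R = r_unit B" "alg B \<phi> \<Longrightarrow> \<phi> \<cdot> r_mul R = prd K B \<phi> \<phi>"
  by (auto dest: ring_morD ring_mor_mul)

lemma md_AM:
  assumes a: "alg B \<phi>"
  shows "md (AM B \<phi>)" "rac (AM B \<phi>) = prd K B (idt K (r_ob B)) \<phi>"
    "bm B \<phi> \<in> arrs K" "src K (bm B \<phi>) = fst (tn (AM B \<phi>) (AM B \<phi>))" "tgt K (bm B \<phi>) = r_ob B"
    "bm B \<phi> \<cdot> pj (AM B \<phi>) (AM B \<phi>) = r_mul B" "ln (tn (AM B \<phi>) (AM B \<phi>)) (AM B \<phi>) (bm B \<phi>)" "ln RR (AM B \<phi>) \<phi>"
proof -
  note [simp] = algD(1-4)[OF a]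
  let ?b = "r_ob B" and ?i = "idt K (r_ob B)" and ?M = "AM B \<phi>"
  have "prd K B \<phi> ?i \<cdot> (r_mul R \<odot> ?i) = prd K B \<phi> ?i \<cdot> (idt K r \<odot> prd K B \<phi> ?i) \<cdot> asc K r r ?b"
    by (simp add: prd_cmp reassoc[OF prd_cmp] algD(6)[OF a] prd_assoc)
  moreover have "prd K B \<phi> ?i \<cdot> (r_unit R \<odot> ?i) = lun K ?b"
    by (simp add: prd_cmp algD(5)[OF a] prd_unit_left)
  ultimately show [simp]: "md ?M" unfolding mod_iff by simp
  show rc: "rac ?M = prd K B ?i \<phi>"
    by (simp add: rac_def prd_comm[of B ?i \<phi>])
  have b: "r_mul B \<cdot> (rac ?M \<odot> idt K (fst ?M)) = r_mul B \<cdot> (idt K (fst ?M) \<odot> snd ?M) \<cdot> asc K (fst ?M) r (fst ?M)"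
    using prd_assoc[of B ?i \<phi> ?i] by (simp add: rc prd_def)
  show d: "bm B \<phi> \<in> arrs K" "src K (bm B \<phi>) = fst (tn ?M ?M)" "tgt K (bm B \<phi>) = ?b" "bm B \<phi> \<cdot> pj ?M ?M = r_mul B"
    using descend_pj[OF _ _ _ _ b, folded bm_def] by simp_all
  show "ln (tn ?M ?M) ?M (bm B \<phi>)"
  proof (rule lin_tnI)
    have "r_mul B \<cdot> (prd K B \<phi> ?i \<odot> ?i) \<cdot> asc' r ?b ?b = prd K B \<phi> (prd K B ?i ?i)"
      using prd_assoc[of B \<phi> ?i ?i] by (simp add: prd_def[of K B "prd K B \<phi> ?i"] reassoc)
    then show "bm B \<phi> \<cdot> pj ?M ?M \<cdot> (snd ?M \<odot> idt K (fst ?M)) \<cdot> asc' r (fst ?M) (fst ?M) = snd ?M \<cdot> (idt K r \<odot> (bm B \<phi> \<cdot> pj ?M ?M))"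
      by (simp add: d reassoc[OF d(4)] prd_cmp prd_idt)
  qed (simp_all add: d)
  show "ln RR ?M \<phi>" unfolding lin_iff by (simp add: algD(6)[OF a] prd_cmp)
qed

lemma bm_push: "\<lbrakk>alg B \<phi>; c \<in> arrs K; tgt K c = r_ob B \<boxtimes> r_ob B\<rbrakk> \<Longrightarrow> bm B \<phi> \<cdot> (pj (AM B \<phi>) (AM B \<phi>) \<cdot> c) = r_mul B \<cdot> c"
  using reassoc[OF md_AM(6), of B \<phi> c] md_AM[of B \<phi>] by simp

lemma is_ring_roa:
  assumes a: "alg B \<phi>"
  shows "is_ring L (roa B \<phi>)"
proof -
  note [simp] = algD(1-4)[OF a] md_AM(1)[OF a] md_AM(3-5,7,8)[OF a]
  let ?M = "AM B \<phi>" and ?i = "idt K (r_ob B)"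
  have li: "ln ?M ?M ?i" using lin_idt[of ?M] by simp
  have lr: "ln RR RR (idt K r)" using lin_idt[of RR] by simp
  have lmu: "ln (tn ?M ?M) ?M (bm B \<phi>)" by simp
  note [simp] = li lr tm(1-3)[OF lmu li] tm(1-3)[OF li lmu] tm(1-3)[OF md_AM(8)[OF a] li] tm(1-3)[OF li md_AM(8)[OF a]] am(1-3) cm(1-3) lm(1-3) rm(1-3)
  have 1: "bm B \<phi> \<cdot> tm (tn ?M ?M) ?M ?M ?M (bm B \<phi>) ?i = bm B \<phi> \<cdot> tm ?M (tn ?M ?M) ?M ?M ?i (bm B \<phi>) \<cdot> am ?M ?M ?M"
  proof (rule pj_epi_3[of _ ?M ?M ?M])
    show "(bm B \<phi> \<cdot> tm (tn ?M ?M) ?M ?M ?M (bm B \<phi>) ?i) \<cdot> pj (tn ?M ?M) ?M \<cdot> (pj ?M ?M \<odot> idt K (fst ?M)) =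
      (bm B \<phi> \<cdot> tm ?M (tn ?M ?M) ?M ?M ?i (bm B \<phi>) \<cdot> am ?M ?M ?M) \<cdot> pj (tn ?M ?M) ?M \<cdot> (pj ?M ?M \<odot> idt K (fst ?M))"
      using am(4)[of ?M ?M ?M]
      by (simp add: tm_push tarr_cmp_tarr tarr_cmp_tarr_assoc md_AM(6)[OF a] bm_push[OF a] ring_mul_assoc)
  qed simp_all
  have 2: "bm B \<phi> \<cdot> tm RR ?M ?M ?M \<phi> ?i = lm ?M"
    by (rule pj_epi[of _ RR ?M]) (simp_all add: tm(4)[OF md_AM(8)[OF a] li] bm_push[OF a] lm(4), simp add: prd_def)
  have 3: "bm B \<phi> \<cdot> tm ?M RR ?M ?M ?i \<phi> = rm ?M"
    by (rule pj_epi[of _ ?M RR]) (simp_all add: tm(4)[OF li md_AM(8)[OF a]] bm_push[OF a] rm(4) md_AM(2)[OF a], simp add: prd_def)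
  have 4: "bm B \<phi> \<cdot> cm ?M ?M = bm B \<phi>"
    by (rule pj_epi[of _ ?M ?M]) (simp_all add: cm(4) bm_push[OF a] md_AM(6)[OF a] ring_mul_comm)
  show ?thesis
    unfolding is_ring_def Let_def Mod_Hom using 1 2 3 4 by simp
qed

lemma roa_ring_mor:
  assumes a: "alg B \<phi>" and b: "alg C \<psi>" and f: "ring_mor K B C f" "f \<cdot> \<phi> = \<psi>"
  shows "ring_mor L (roa B \<phi>) (roa C \<psi>) (AM B \<phi>, f, AM C \<psi>)" "ln (AM B \<phi>) (AM C \<psi>) f"
proof -
  note [simp] = algD(1-4)[OF a] md_AM(1)[OF a] md_AM(3-5,7,8)[OF a] algD(1-4)[OF b] md_AM(1)[OF b] md_AM(3-5,7,8)[OF b] ring_morD(1-3)[OF f(1)]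
  let ?M = "AM B \<phi>" and ?N = "AM C \<psi>"
  show l: "ln ?M ?N f"
    unfolding lin_iff by (simp add: ring_mor_prd[OF f(1)] f(2) prd_cmp)
  have "f \<cdot> bm B \<phi> = bm C \<psi> \<cdot> tm ?M ?M ?N ?N f f"
    by (rule pj_epi[of _ ?M ?M])
      (simp_all add: tm[OF l l] md_AM(6)[OF a] bm_push[OF b] ring_mor_mul[OF f(1)], simp add: prd_def)
  then show "ring_mor L (roa B \<phi>) (roa C \<psi>) (?M, f, ?N)"
    unfolding ring_mor_def Mod_Hom using l f(2) by simp
qed

lemma ring_mor_roa:
  assumes a: "alg B \<phi>" and b: "alg C \<psi>" and t: "ring_mor L (roa B \<phi>) (roa C \<psi>) t"
  obtains f where "t = (AM B \<phi>, f, AM C \<psi>)" "ring_mor K B C f" "f \<cdot> \<phi> = \<psi>" "ln (AM B \<phi>) (AM C \<psi>) f"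
proof -
  note [simp] = algD(1-4)[OF a] md_AM(1)[OF a] md_AM(3-5,7,8)[OF a] algD(1-4)[OF b] md_AM(1)[OF b] md_AM(3-5,7,8)[OF b]
  let ?M = "AM B \<phi>" and ?N = "AM C \<psi>"
  obtain f where tf: "t = (?M, f, ?N)" and l: "ln ?M ?N f" using t unfolding ring_mor_def Mod_Hom by auto
  note [simp] = linD[OF l]
  have m: "f \<cdot> bm B \<phi> = bm C \<psi> \<cdot> tm ?M ?M ?N ?N f f" and p: "f \<cdot> \<phi> = \<psi>"
    using t unfolding ring_mor_def by (simp_all add: tf)
  have "f \<cdot> r_mul B = (f \<cdot> bm B \<phi>) \<cdot> pj ?M ?M" by (simp add: md_AM(6)[OF a])
  also have "\<dots> = prd K C f f" unfolding m by (simp add: tm[OF l l] bm_push[OF b] prd_def)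
  finally have "ring_mor K B C f"
    using reassoc[OF p, of "r_unit R"] algD(5)[OF a] algD(5)[OF b] by (intro ring_morI) simp_all
  then show ?thesis using that tf p l by simp
qed

text \<open>Passing to the underlying ring loses nothing once the unit is remembered: a scalar acts
  as multiplication by its image under the unit. The outcome is an equality of records rather than
  an isomorphism, so a ring chosen in the module category can be rewritten in place as an
  algebra.\<close>

lemma ring_is_roa:
  assumes C: "is_ring L C"
  shows "C = roa (underlying_ring K R C) (under (r_unit C))" "alg (underlying_ring K R C) (under (r_unit C))"
proof -
  define M where "M = r_ob C"
  obtain m e where m: "r_mul C = (tn M M, m, M)" and e: "r_unit C = (RR, e, M)" and [simp]: "md M" and lm': "ln (tn M M) M m" and le: "ln RR M e"
    using C unfolding is_ring_def Let_def Mod_Hom M_def[symmetric] by auto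
  note [simp] = linD[OF lm'] linD[OF le]
  have li: "ln M M (idt K (fst M))" by simp
  note [simp] = tm(1-3)[OF lm' li] tm(1-3)[OF li lm'] tm(1-3)[OF le li] tm(1-3)[OF li le] am(1-3) cm(1-3) lm(1-3) rm(1-3) lm' le
  have 1: "m \<cdot> tm (tn M M) M M M m (idt K (fst M)) = m \<cdot> tm M (tn M M) M M (idt K (fst M)) m \<cdot> am M M M"
    and 2: "m \<cdot> tm RR M M M e (idt K (fst M)) = lm M"
    and 4: "m \<cdot> cm M M = m"
    using C unfolding is_ring_def Let_def by (simp_all add: m e M_def[symmetric])
  let ?U = "underlying_ring K R C"
  have U: "?U = \<lparr>r_ob = fst M, r_mul = m \<cdot> pj M M, r_unit = e \<cdot> r_unit R\<rparr>"
    by (simp add: underlying_ring_def m e M_def)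
  have a1: "m \<cdot> pj M M \<cdot> ((m \<cdot> pj M M) \<odot> idt K (fst M)) = m \<cdot> pj M M \<cdot> (idt K (fst M) \<odot> (m \<cdot> pj M M)) \<cdot> asc K (fst M) (fst M) (fst M)"
  proof -
    have "m \<cdot> pj M M \<cdot> ((m \<cdot> pj M M) \<odot> idt K (fst M)) = (m \<cdot> tm (tn M M) M M M m (idt K (fst M))) \<cdot> pj (tn M M) M \<cdot> (pj M M \<odot> idt K (fst M))"
      by (simp add: tm_push tarr_cmp_tarr)
    also have "\<dots> = m \<cdot> pj M M \<cdot> (idt K (fst M) \<odot> (m \<cdot> pj M M)) \<cdot> asc K (fst M) (fst M) (fst M)"
      unfolding 1 by (simp add: am(4) tm_push tarr_cmp_tarr_assoc)
    finally show ?thesis .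
  qed
  have re: "m \<cdot> pj M M \<cdot> (e \<odot> idt K (fst M)) = snd M"
  proof -
    have "m \<cdot> pj M M \<cdot> (e \<odot> idt K (fst M)) = (m \<cdot> tm RR M M M e (idt K (fst M))) \<cdot> pj RR M"
      by (simp add: tm(4)[OF le li])
    then show ?thesis unfolding 2 by (simp add: lm)
  qed
  have a2: "m \<cdot> pj M M \<cdot> ((e \<cdot> r_unit R) \<odot> idt K (fst M)) = lun K (fst M)"
  proof -
    have "m \<cdot> pj M M \<cdot> ((e \<cdot> r_unit R) \<odot> idt K (fst M)) = (m \<cdot> pj M M \<cdot> (e \<odot> idt K (fst M))) \<cdot> (r_unit R \<odot> idt K (fst M))"
      by (simp add: tarr_cmp_tarr)
    then show ?thesis unfolding re by (simp add: mod_unit)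
  qed
  have a3: "m \<cdot> pj M M \<cdot> brd K (fst M) (fst M) = m \<cdot> pj M M"
  proof -
    have "m \<cdot> pj M M \<cdot> brd K (fst M) (fst M) = (m \<cdot> cm M M) \<cdot> pj M M" by (simp add: cm(4))
    then show ?thesis unfolding 4 by simp
  qed
  have r [simp]: "is_ring K ?U" by (rule is_ringI) (simp_all add: U a1 a2 a3)
  have "e \<cdot> r_mul R = snd M \<cdot> (idt K r \<odot> e)" using lin_act[OF le] by simp
  also have "\<dots> = m \<cdot> pj M M \<cdot> (e \<odot> e)" unfolding re[symmetric] by (simp add: tarr_cmp_tarr)
  finally have rm': "ring_mor K R ?U e" by (intro ring_morI) (use r in \<open>simp_all add: U prd_def\<close>)
  then show a: "alg ?U (under (r_unit C))" by (simp add: e)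
  have AMU: "AM ?U e = M"
    unfolding AM_def prd_def using re by (simp add: U)
  have "bm ?U e = m"
  proof (rule pj_epi[of _ M M])
    show "bm ?U e \<cdot> pj M M = m \<cdot> pj M M" using md_AM(6)[of ?U e] a by (simp add: AMU e) (simp add: U)
  qed (use md_AM(3,4)[of ?U e] a in \<open>simp_all add: AMU e\<close>)
  then have "roa ?U e = \<lparr>r_ob = M, r_mul = (tn M M, m, M), r_unit = (RR, e, M)\<rparr>"
    by (intro ring_obj.equality) (simp_all add: AMU)
  also have "\<dots> = C" by (intro ring_obj.equality) (simp_all add: M_def[symmetric] m e)
  finally show "C = roa ?U (under (r_unit C))" by (simp add: e)
qed

text \<open>\<open>R\<close> is the free module on one generator, so linear arrows out of it
  correspond to elements of the underlying object. Since \<open>R\<close> is the unit object of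
  modules, elements of a ring there match elements in \<open>K\<close>.\<close>

lemma mod_element:
  assumes [simp]: "md M" and a: "a \<in> arrs K" "src K a = unt K" "tgt K a = fst M"
  obtains e where "ln RR M e" "e \<cdot> r_unit R = a"
proof -
  note [simp] = a
  let ?e = "snd M \<cdot> (idt K r \<odot> a) \<cdot> run' r"
  have "?e \<cdot> r_unit R = (snd M \<cdot> (r_unit R \<odot> idt K (fst M))) \<cdot> (idt K (unt K) \<odot> a) \<cdot> run' (unt K)"
    by (simp add: run'_nat tarr_cmp_tarr_assoc)
  also have "\<dots> = a" unfolding mod_unit[OF assms(1)] by (simp add: lun_nat_assoc) (simp add: lun_unt)
  finally have 1: "?e \<cdot> r_unit R = a" .
  have rr: "asc K r r (unt K) \<cdot> run' (r \<boxtimes> r) = idt K r \<odot> run' r"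
  proof (rule iso_cancel_left[OF tarr_iso[OF idt_iso run_iso]])
    have "(idt K r \<odot> run K r) \<cdot> asc K r r (unt K) \<cdot> run' (r \<boxtimes> r) = idt K (r \<boxtimes> r)"
      by (simp add: reassoc[OF run_tobj[symmetric]])
    then show "(idt K r \<odot> run K r) \<cdot> asc K r r (unt K) \<cdot> run' (r \<boxtimes> r) = (idt K r \<odot> run K r) \<cdot> (idt K r \<odot> run' r)"
      by (simp add: whisker_inv)
  qed simp_all
  have "?e \<cdot> r_mul R = (snd M \<cdot> (r_mul R \<odot> idt K (fst M))) \<cdot> ((idt K r \<odot> idt K r) \<odot> a) \<cdot> run' (r \<boxtimes> r)"
    by (simp add: run'_nat tarr_cmp_tarr_assoc)
  also have "\<dots> = snd M \<cdot> (idt K r \<odot> snd M) \<cdot> (idt K r \<odot> (idt K r \<odot> a)) \<cdot> (asc K r r (unt K) \<cdot> run' (r \<boxtimes> r))"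
    unfolding mod_assoc[OF assms(1)] by (simp add: asc_nat_assoc del: tarr_idt_idt)
  also have "\<dots> = snd M \<cdot> (idt K r \<odot> ?e)"
    unfolding rr by (simp add: whisker_left)
  finally have "ln RR M ?e" unfolding lin_iff by simp
  then show ?thesis using 1 that by blast
qed

lemma mod_element_eq:
  assumes [simp]: "md M" and e: "ln RR M e" "ln RR M d" "e \<cdot> r_unit R = d \<cdot> r_unit R"
  shows "e = d"
proof -
  have "f = snd M \<cdot> (idt K r \<odot> (f \<cdot> r_unit R)) \<cdot> run' r" if f: "ln RR M f" for f
  proof -
    note [simp] = linD[OF f]
    have "f = f \<cdot> (r_mul R \<cdot> (idt K r \<odot> r_unit R)) \<cdot> run' r" by (simp add: ring_mul_unit_right)
    also have "\<dots> = (f \<cdot> r_mul R) \<cdot> (idt K r \<odot> r_unit R) \<cdot> run' r" by simp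
    also have "f \<cdot> r_mul R = snd M \<cdot> (idt K r \<odot> f)" using lin_act[OF f] by simp
    finally show ?thesis by (simp add: whisker_left)
  qed
  from this[OF e(1)] this[OF e(2)] e(3) show ?thesis by simp
qed

lemma inv_lun_Mod:
  assumes [simp]: "md M"
  shows "inv_arrow L (lun L M) = (M, pj RR M \<cdot> (r_unit R \<odot> idt K (fst M)) \<cdot> lun' (fst M), tn RR M)"
proof (rule category.inv_arrow_eqI[OF Mod_category])
  note l = lm[OF assms]
  let ?g = "pj RR M \<cdot> (r_unit R \<odot> idt K (fst M)) \<cdot> lun' (fst M)"
  have 1: "lm M \<cdot> ?g = idt K (fst M)"
    using l by (simp add: reassoc[OF l(4)] reassoc[OF mod_unit])
  have "lm M \<cdot> (?g \<cdot> lm M) = lm M \<cdot> idt K (fst (tn RR M))"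
    using arg_cong[OF 1, of "\<lambda>u. u \<cdot> lm M"] l by simp
  then have 2: "?g \<cdot> lm M = idt K (fst (tn RR M))"
    by (rule iso_cancel_left[OF l(6)]) (use l in simp_all)
  have "ln M (tn RR M) ?g"
    by (rule lin_inverse[OF l(5)]) (use l 1 2 in simp_all)
  then show "inverse_arrows L (lun L M) (M, ?g, tn RR M)"
    unfolding inverse_arrows_def using 1 2 by (simp add: Mod_Hom)
qed

lemma prd_L:
  assumes a: "alg B \<phi>" and f: "ln N (AM B \<phi>) f" and g: "ln P (AM B \<phi>) g" and [simp]: "md N" "md P"
  obtains h where "prd L (roa B \<phi>) (N, f, AM B \<phi>) (P, g, AM B \<phi>) = (tn N P, h, AM B \<phi>)" "h \<cdot> pj N P = prd K B f g"
    "h \<in> arrs K" "src K h = fst (tn N P)" "tgt K h = r_ob B"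
proof -
  note [simp] = algD(1-4)[OF a] md_AM(1)[OF a] md_AM(3-5,7,8)[OF a] linD[OF f] linD[OF g] tm(1-3)[OF f g]
  show ?thesis
    by (rule that[of "bm B \<phi> \<cdot> tm N P (AM B \<phi>) (AM B \<phi>) f g"])
      (simp_all add: prd_def[of L] tm(4)[OF f g] bm_push[OF a], simp add: prd_def)
qed

text \<open>Under the correspondence of elements, scaling in the module category is scaling in
  \<open>K\<close>. Disjointness and idempotents can thus be moved between the two
  categories.\<close>

lemma scl_L:
  assumes a: "alg B \<phi>" and e: "ln RR (AM B \<phi>) e" and f: "ln N (AM B \<phi>) f" and [simp]: "md N"
  shows "scl L (roa B \<phi>) (RR, e, AM B \<phi>) (N, f, AM B \<phi>) = (N, scl K B (e \<cdot> r_unit R) f, AM B \<phi>)"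
proof -
  note [simp] = algD(1-4)[OF a] md_AM(1)[OF a] linD[OF e] linD[OF f]
  obtain h where h: "prd L (roa B \<phi>) (RR, e, AM B \<phi>) (N, f, AM B \<phi>) = (tn RR N, h, AM B \<phi>)" "h \<cdot> pj RR N = prd K B e f"
    "h \<in> arrs K" "src K h = fst (tn RR N)" "tgt K h = r_ob B"
    by (rule prd_L[OF a e f]) auto
  have "h \<cdot> pj RR N \<cdot> (r_unit R \<odot> idt K (fst N)) \<cdot> lun' (fst N) = scl K B (e \<cdot> r_unit R) f"
    using h(3-5) by (simp add: reassoc[OF h(2)] reassoc[OF prd_cmp] scl_def)
  moreover have "scl L (roa B \<phi>) (RR, e, AM B \<phi>) (N, f, AM B \<phi>) =
      cmp L (tn RR N, h, AM B \<phi>) (inv_arrow L (lun L N))"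
    unfolding scl_def h(1) by simp
  ultimately show ?thesis unfolding inv_lun_Mod[OF assms(4)] by simp
qed

lemma Mod_Ball: "\<lbrakk>md M; md N\<rbrakk> \<Longrightarrow> (\<forall>t \<in> Hom L M N. P t) \<longleftrightarrow> (\<forall>f. ln M N f \<longrightarrow> P (M, f, N))"
  unfolding Ball_def Mod_Hom by blast

lemma disjoint_L:
  assumes a: "alg B \<phi>" and f: "ln N (AM B \<phi>) f" and g: "ln N (AM B \<phi>) g" and [simp]: "md N"
  shows "disjoint_mors L (roa B \<phi>) (N, f, AM B \<phi>) (N, g, AM B \<phi>) \<longleftrightarrow> disjoint_mors K B f g"
proof -
  note [simp] = algD(1-4)[OF a] md_AM(1)[OF a] linD[OF f] linD[OF g]
  let ?M = "AM B \<phi>"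
  have z: "ln RR ?M (zro K r (r_ob B))" using lin_zro[of RR ?M] by simp
  have 1: "disjoint_mors L (roa B \<phi>) (N, f, ?M) (N, g, ?M) \<longleftrightarrow>
     (\<forall>e. ln RR ?M e \<longrightarrow> scl K B (e \<cdot> r_unit R) f = scl K B (e \<cdot> r_unit R) g \<longrightarrow> e = zro K r (r_ob B))"
    by (simp add: disjoint_mors_def Mod_Ball scl_L[OF a _ f] scl_L[OF a _ g])
  show ?thesis
  proof
    assume L: "disjoint_mors L (roa B \<phi>) (N, f, ?M) (N, g, ?M)"
    show "disjoint_mors K B f g"
      unfolding disjoint_mors_def
    proof (intro ballI impI)
      fix d assume d: "d \<in> Hom K (unt K) (r_ob B)" "scl K B d f = scl K B d g"
      obtain e where e: "ln RR ?M e" "e \<cdot> r_unit R = d" by (rule mod_element[of ?M d]) (use d in auto)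
      then have "e = zro K r (r_ob B)" using L d(2) unfolding 1 by blast
      then show "d = zro K (unt K) (r_ob B)" using e(2) by simp
    qed
  next
    assume D: "disjoint_mors K B f g"
    show "disjoint_mors L (roa B \<phi>) (N, f, ?M) (N, g, ?M)"
      unfolding 1
    proof (intro allI impI)
      fix e assume e: "ln RR ?M e" "scl K B (e \<cdot> r_unit R) f = scl K B (e \<cdot> r_unit R) g"
      then have "e \<cdot> r_unit R = zro K (unt K) (r_ob B)"
        using D linD[OF e(1)] unfolding disjoint_mors_def by simp
      then show "e = zro K r (r_ob B)" by (intro mod_element_eq[OF _ e(1) z]) simp_all
    qed
  qed
qed

text \<open>The separability element of \<open>B\<close> is projected from the tensor square in
  \<open>K\<close> to the tensor square over \<open>R\<close> and extended linearly; the defining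
  identities survive because the projection is a ring morphism.\<close>

lemma separable_roa:
  assumes a: "alg B \<phi>" and s: "separable K B"
  shows "separable L (roa B \<phi>)"
proof -
  note [simp] = algD(1-4)[OF a] md_AM(1)[OF a] md_AM(3-5,7,8)[OF a]
  let ?M = "AM B \<phi>" and ?C = "roa B \<phi>"
  let ?T = "tensor_ring L ?C ?C"
  have smc: "symmetric_monoidal_category L" by (rule Mod_smc)
  have C: "is_ring L ?C" by (rule is_ring_roa[OF a])
  note aux = symmetric_monoidal_category.is_ring_tensor_aux[OF smc C C]
  define U \<psi> where "U = underlying_ring K R ?T" and "\<psi> = under (r_unit ?T)"
  have T: "?T = roa U \<psi>" and b: "alg U \<psi>"
    unfolding U_def \<psi>_def using ring_is_roa[OF aux(1)] by simp_all
  have AMU: "AM U \<psi> = tn ?M ?M" using T tensor_ring_ob[of L ?C ?C] by simp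
  have Uob: "r_ob U = fst (tn ?M ?M)" using AMU roa_simps(4)[of U \<psi>] by simp
  note [simp] = algD(1-4)[OF b] md_AM(1)[OF b]
  obtain f where f: "in1 L ?C ?C = (?M, f, AM U \<psi>)" "ring_mor K B U f" "f \<cdot> \<phi> = \<psi>" "ln ?M (AM U \<psi>) f"
    by (rule ring_mor_roa[OF a b aux(3)[unfolded T]])
  obtain g where g: "in2 L ?C ?C = (?M, g, AM U \<psi>)" "ring_mor K B U g" "g \<cdot> \<phi> = \<psi>" "ln ?M (AM U \<psi>) g"
    by (rule ring_mor_roa[OF a b aux(4)[unfolded T]])
  note [simp] = ring_morD(1-3)[OF f(2)] ring_morD(1-3)[OF g(2)]
  obtain h where h: "prd L (roa U \<psi>) (?M, f, AM U \<psi>) (?M, g, AM U \<psi>) = (tn ?M ?M, h, AM U \<psi>)" "h \<cdot> pj ?M ?M = prd K U f g"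
    by (rule prd_L[OF b f(4) g(4)]) auto
  have "h = idt K (fst (tn ?M ?M))"
    using aux(2)[unfolded f(1) g(1) T h(1)] by (simp add: AMU)
  \<comment> \<open>The copairing of the two inclusions of \<open>B\<close> into its relative tensor
    square is the projection itself, so the latter is a ring morphism.\<close>
  then have w: "prd K U f g = pj ?M ?M" using h(2) by simp
  note wm = prd_ring_mor[OF _ _ _ f(2) g(2)]
  obtain t where t: "t \<in> arrs K" "src K t = unt K" "tgt K t = r_ob B \<boxtimes> r_ob B" "r_mul B \<cdot> t = r_unit B"
     "scl K (tensor_ring K B B) t (in1 K B B) = scl K (tensor_ring K B B) t (in2 K B B)"
    by (rule separableE[OF _ s]) auto
  note [simp] = t(1-3)
  let ?t = "pj ?M ?M \<cdot> t"
  obtain e where e: "ln RR (tn ?M ?M) e" "e \<cdot> r_unit R = ?t"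
    by (rule mod_element[of "tn ?M ?M" ?t]) simp_all
  note [simp] = linD[OF e(1)]
  have eq: "scl K U ?t f = scl K U ?t g"
    using arg_cong[OF t(5), of "\<lambda>x. prd K U f g \<cdot> x"] ring_mor_scl[OF wm(1), of t "in1 K B B"] ring_mor_scl[OF wm(1), of t "in2 K B B"] wm(2,3)
    by (simp add: w)
  have "bm B \<phi> \<cdot> e = \<phi>"
  proof (rule mod_element_eq[of ?M])
    show "ln RR ?M (bm B \<phi> \<cdot> e)" by (rule lin_cmp[OF e(1)]) simp_all
    show "(bm B \<phi> \<cdot> e) \<cdot> r_unit R = \<phi> \<cdot> r_unit R"
      by (simp add: e(2) bm_push[OF a] t(4) algD(5)[OF a])
  qed simp_all
  then show ?thesis
    using scl_L[OF b, of e ?M f] scl_L[OF b, of e ?M g] e f(4) g(4) eq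
    by (intro symmetric_monoidal_category.separableI[OF smc C, of "(RR, e, tn ?M ?M)"])
      (simp_all add: T f(1) g(1) AMU)
qed

text \<open>The universal property of the derived algebra in \<open>Mod K R\<close>, translated to
  \<open>K\<close>. Morphisms of algebras are ring morphisms compatible with the structure maps, so
  a pair must have a common restriction along \<phi>. Separability of B' in \<open>K\<close> comes
  from the split surjection of B \<otimes> B onto it.\<close>

lemma tower_step_spec:
  assumes a: "alg B \<phi>" and s: "separable K B"
  obtains B' \<iota> q where "tower_step K (R, B, \<phi>) = (B, B', \<iota>)" "is_ring K B'" "separable K B'" "ring_mor K B B' \<iota>" "ring_mor K B B' q"
    "\<iota> \<cdot> \<phi> = q \<cdot> \<phi>" "disjoint_mors K B' \<iota> q"
    "\<exists>k \<in> Hom K (r_ob B') (r_ob B \<boxtimes> r_ob B). prd K B' \<iota> q \<cdot> k = idt K (r_ob B')"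
    "\<And>S f g. \<lbrakk>is_ring K S; ring_mor K B S f; ring_mor K B S g; f \<cdot> \<phi> = g \<cdot> \<phi>; disjoint_mors K S f g\<rbrakk> \<Longrightarrow>
      \<exists>u. ring_mor K B' S u \<and> u \<cdot> \<iota> = f \<and> u \<cdot> q = g"
proof -
  note [simp] = algD(1-4)[OF a] md_AM(1)[OF a]
  let ?M = "AM B \<phi>" and ?C = "roa B \<phi>"
  have C: "is_ring L ?C" by (rule is_ring_roa[OF a])
  define D where "D = fst (derived_algebra L ?C)"
  define j where "j = snd (derived_algebra L ?C)"
  have d: "is_derived_algebra L ?C D j"
    unfolding D_def j_def by (rule idempotent_complete_symmetric_monoidal_category.derived_algebra_is[OF Mod_icsmc C separable_roa[OF a s]])
  have Dr: "is_ring L D" and jm: "ring_mor L ?C D j" using d unfolding is_derived_algebra_def by auto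
  define B' \<psi> where "B' = underlying_ring K R D" and "\<psi> = under (r_unit D)"
  have T: "D = roa B' \<psi>" and b: "alg B' \<psi>"
    unfolding B'_def \<psi>_def using ring_is_roa[OF Dr] by simp_all
  let ?N = "AM B' \<psi>"
  note [simp] = algD(1-4)[OF b] md_AM(1)[OF b]
  obtain \<iota> where i: "j = (?M, \<iota>, ?N)" "ring_mor K B B' \<iota>" "\<iota> \<cdot> \<phi> = \<psi>" "ln ?M ?N \<iota>"
    by (rule ring_mor_roa[OF a b jm[unfolded T]])
  obtain qq where qq: "ring_mor L ?C D qq" "disjoint_mors L D j qq"
    "\<exists>k \<in> Hom L (r_ob D) (tobj L (r_ob ?C) (r_ob ?C)). cmp L (prd L D j qq) k = idt L (r_ob D)"
    "\<And>S f g. \<lbrakk>is_ring L S; ring_mor L ?C S f; ring_mor L ?C S g; disjoint_mors L S f g\<rbrakk> \<Longrightarrow>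
      (\<exists>u. ring_mor L D S u \<and> cmp L u j = f \<and> cmp L u qq = g)"
    using idempotent_complete_symmetric_monoidal_category.derived_algebra_spec[OF Mod_icsmc C d] by blast
  obtain q where q: "qq = (?M, q, ?N)" "ring_mor K B B' q" "q \<cdot> \<phi> = \<psi>" "ln ?M ?N q"
    by (rule ring_mor_roa[OF a b qq(1)[unfolded T]])
  note [simp] = ring_morD(1-3)[OF i(2)] ring_morD(1-3)[OF q(2)]
  have step: "tower_step K (R, B, \<phi>) = (B, B', \<iota>)"
    unfolding tower_step_def using i(1) by (simp add: case_prod_beta D_def[symmetric] j_def[symmetric] B'_def)
  have dis: "disjoint_mors K B' \<iota> q"
    using qq(2) disjoint_L[OF b i(4) q(4)] unfolding T i(1) q(1) by simp
  obtain h where h: "prd L (roa B' \<psi>) (?M, \<iota>, ?N) (?M, q, ?N) = (tn ?M ?M, h, ?N)" "h \<cdot> pj ?M ?M = prd K B' \<iota> q"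
     "h \<in> arrs K" "src K h = fst (tn ?M ?M)" "tgt K h = r_ob B'"
    by (rule prd_L[OF b i(4) q(4)]) auto
  obtain k where k: "ln ?N (tn ?M ?M) k" "h \<cdot> k = idt K (r_ob B')"
    using qq(3) unfolding T i(1) q(1) h(1) by (auto simp: Mod_Hom)
  note [simp] = linD[OF k(1)] h(3-5) tsec(1-3)[of ?M ?M]
  let ?k = "tsec ?M ?M \<cdot> k"
  have "pj ?M ?M \<cdot> ?k = k" using reassoc[OF tsec(4)[of ?M ?M], of k] by simp
  then have pk: "prd K B' \<iota> q \<cdot> ?k = idt K (r_ob B')"
    unfolding h(2)[symmetric] using k(2) by simp
  have sep: "separable K B'"
    by (rule separable_quotient[of "tensor_ring K B B" B' "prd K B' \<iota> q" ?k])
      (use pk prd_ring_mor(1)[OF _ _ _ i(2) q(2)] in \<open>simp_all add: separable_tensor s\<close>)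
  have univ: "\<exists>u. ring_mor K B' S u \<and> u \<cdot> \<iota> = f \<and> u \<cdot> q = g"
    if S: "is_ring K S" and f: "ring_mor K B S f" and g: "ring_mor K B S g" and fg: "f \<cdot> \<phi> = g \<cdot> \<phi>" "disjoint_mors K S f g" for S f g
  proof -
    \<comment> \<open>\<open>S\<close> becomes an \<open>R\<close>-algebra through the common
      restriction of \<open>f\<close> and \<open>g\<close>.\<close>
    let ?\<sigma> = "f \<cdot> \<phi>"
    have c: "alg S ?\<sigma>" using S f a by (auto intro: ring_mor_cmp)
    note fL = roa_ring_mor[OF a c f refl] and gL = roa_ring_mor[OF a c g fg(1)[symmetric]]
    have "disjoint_mors L (roa S ?\<sigma>) (?M, f, AM S ?\<sigma>) (?M, g, AM S ?\<sigma>)"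
      using disjoint_L[OF c fL(2) gL(2)] fg(2) by simp
    then obtain uu where uu: "ring_mor L D (roa S ?\<sigma>) uu" "cmp L uu j = (?M, f, AM S ?\<sigma>)" "cmp L uu qq = (?M, g, AM S ?\<sigma>)"
      using qq(4)[OF is_ring_roa[OF c] fL(1) gL(1)] by blast
    obtain u where u: "uu = (?N, u, AM S ?\<sigma>)" "ring_mor K B' S u"
      by (rule ring_mor_roa[OF b c uu(1)[unfolded T]])
    show ?thesis using uu(2,3) u by (auto simp: i(1) q(1))
  qed
  have kk: "\<exists>k \<in> Hom K (r_ob B') (r_ob B \<boxtimes> r_ob B). prd K B' \<iota> q \<cdot> k = idt K (r_ob B')"
    using pk by (intro bexI[of _ ?k]) simp_all
  show ?thesis
    by (rule that[OF step _ sep i(2) q(2) _ dis kk univ]) (simp_all add: i(3) q(3))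
qed

end

section \<open>Points of the splitting tower\<close>

definition points :: "('o, 'm) smc \<Rightarrow> ('o, 'm) ring_obj \<Rightarrow> ('o, 'm) ring_obj \<Rightarrow> (nat \<Rightarrow> 'm) \<Rightarrow> nat \<Rightarrow> bool" where
  "points K A R x n \<longleftrightarrow> (\<forall>i<n. ring_mor K A R (x i)) \<and> (\<forall>i<n. \<forall>j<i. disjoint_mors K R (x i) (x j))"

text \<open>\<open>B\<close> with \<open>c\<close> is the universal ring with \<open>n\<close> pairwise disjoint ring morphisms from \<open>A\<close>; the last
  clause strengthens uniqueness of the induced morphism to uniqueness after scaling by an element.\<close>

definition represents :: "('o, 'm) smc \<Rightarrow> ('o, 'm) ring_obj \<Rightarrow> nat \<Rightarrow> ('o, 'm) ring_obj \<Rightarrow> (nat \<Rightarrow> 'm) \<Rightarrow> bool" where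
  "represents K A n B c \<longleftrightarrow> is_ring K B \<and> separable K B \<and> points K A B c n \<and>
     (\<forall>R x. is_ring K R \<and> points K A R x n \<longrightarrow> (\<exists>u. ring_mor K B R u \<and> (\<forall>i<n. u \<cdot>\<^bsub>K\<^esub> c i = x i))) \<and>
     (\<forall>R f g e. is_ring K R \<and> ring_mor K B R f \<and> ring_mor K B R g \<and> e \<in> Hom K (unt K) (r_ob R) \<and>
        (\<forall>i<n. scl K R e (f \<cdot>\<^bsub>K\<^esub> c i) = scl K R e (g \<cdot>\<^bsub>K\<^esub> c i)) \<longrightarrow> scl K R e f = scl K R e g)"

context idempotent_complete_symmetric_monoidal_category
begin

lemma unit_ring_simps [simp]: "r_ob (unit_ring K) = unt K" "r_mul (unit_ring K) = lun K (unt K)" "r_unit (unit_ring K) = idt K (unt K)"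
  by (simp_all add: unit_ring_def)

lemma is_ring_unit [simp]: "is_ring K (unit_ring K)"
proof (rule is_ringI)
  have "run K (unt K) \<odot> idt K (unt K) = (idt K (unt K) \<odot> lun K (unt K)) \<cdot> asc K (unt K) (unt K) (unt K)"
    by (simp add: triangle)
  then show "r_mul (unit_ring K) \<cdot> (r_mul (unit_ring K) \<odot> idt K (r_ob (unit_ring K))) = r_mul (unit_ring K) \<cdot> (idt K (r_ob (unit_ring K)) \<odot> r_mul (unit_ring K)) \<cdot>
      asc K (r_ob (unit_ring K)) (r_ob (unit_ring K)) (r_ob (unit_ring K))"
    using lun_unt by simp
  show "r_mul (unit_ring K) \<cdot> brd K (r_ob (unit_ring K)) (r_ob (unit_ring K)) = r_mul (unit_ring K)"
    using lun_unt lun_brd[of "unt K"] by simp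
qed simp_all

lemma separable_unit: "separable K (unit_ring K)"
proof (rule separableI[of _ "lun' (unt K)"])
  have "in1 K (unit_ring K) (unit_ring K) = in2 K (unit_ring K) (unit_ring K)"
    by (simp add: in1_def in2_def lun_unt)
  then show "scl K (tensor_ring K (unit_ring K) (unit_ring K)) (lun' (unt K)) (in1 K (unit_ring K) (unit_ring K)) =
    scl K (tensor_ring K (unit_ring K) (unit_ring K)) (lun' (unt K)) (in2 K (unit_ring K) (unit_ring K))" by simp
qed simp_all

lemma ring_mor_unit: "is_ring K R \<Longrightarrow> ring_mor K (unit_ring K) R (r_unit R)"
  by (intro ring_morI) (simp_all add: prd_unit_left)

lemma ring_mor_unit_eq: "ring_mor K (unit_ring K) R f \<Longrightarrow> f = r_unit R"
  using ring_morD[of "unit_ring K" R f] by simp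

lemma points_cmp:
  assumes A: "is_ring K A" "separable K A" and R: "is_ring K R" "is_ring K S" and x: "points K A R x n" and u: "ring_mor K R S u"
  shows "points K A S (\<lambda>i. u \<cdot> x i) n"
  using x unfolding points_def
  by (auto intro!: ring_mor_cmp[OF _ u A(1) R] disjoint_cmp[OF A R _ _ u])

lemma pointsD: "points K A R x n \<Longrightarrow> i < n \<Longrightarrow> ring_mor K A R (x i)"
  "points K A R x n \<Longrightarrow> i < n \<Longrightarrow> j < n \<Longrightarrow> i \<noteq> j \<Longrightarrow> disjoint_mors K R (x i) (x j)"
  unfolding points_def by (auto intro: disjoint_sym elim!: linorder_neqE_nat)

lemma points_Suc: "points K A R x (Suc n) \<longleftrightarrow> points K A R x n \<and> ring_mor K A R (x n) \<and> (\<forall>j<n. disjoint_mors K R (x n) (x j))"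
  unfolding points_def by (auto simp: less_Suc_eq)

lemma representsD:
  assumes "represents K A n B c"
  shows "is_ring K B" "separable K B" "points K A B c n"
    "\<lbrakk>is_ring K R; points K A R x n\<rbrakk> \<Longrightarrow> \<exists>u. ring_mor K B R u \<and> (\<forall>i<n. u \<cdot> c i = x i)"
    "\<lbrakk>is_ring K R; ring_mor K B R f; ring_mor K B R g; e \<in> arrs K; src K e = unt K; tgt K e = r_ob R;
        \<And>i. i<n \<Longrightarrow> scl K R e (f \<cdot> c i) = scl K R e (g \<cdot> c i)\<rbrakk> \<Longrightarrow> scl K R e f = scl K R e g"
proof -
  show "is_ring K B" "separable K B" "points K A B c n"
    "\<lbrakk>is_ring K R; points K A R x n\<rbrakk> \<Longrightarrow> \<exists>u. ring_mor K B R u \<and> (\<forall>i<n. u \<cdot> c i = x i)"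
    using assms unfolding represents_def by blast+
  assume "is_ring K R" "ring_mor K B R f" "ring_mor K B R g" "e \<in> arrs K" "src K e = unt K" "tgt K e = r_ob R"
        "\<And>i. i<n \<Longrightarrow> scl K R e (f \<cdot> c i) = scl K R e (g \<cdot> c i)"
  moreover have "e \<in> Hom K (unt K) (r_ob R)" using calculation by simp
  ultimately show "scl K R e f = scl K R e g"
    using assms unfolding represents_def by blast
qed

lemma represents_unique:
  assumes "represents K A n B c" "is_ring K R" "ring_mor K B R f" "ring_mor K B R g" "\<And>i. i<n \<Longrightarrow> f \<cdot> c i = g \<cdot> c i"
  shows "f = g"
proof -
  have "scl K R (r_unit R) f = scl K R (r_unit R) g"
    by (rule representsD(5)[OF assms(1-4)]) (use assms(2,5) in simp_all)
  then show ?thesis using assms(2) ring_morD[OF assms(3)] ring_morD[OF assms(4)] by simp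
qed

text \<open>A tuple of n + 2 disjoint morphisms is a pair of tuples of length n + 1 that share their
  first n entries and have disjoint last entries. Such pairs are classified by B': sharing n entries
  is agreement after \<phi>, and disjointness of the last entries matches disjointness of the two
  morphisms out of \<open>B\<close>.\<close>

lemma represents_step:
  assumes A: "is_ring K A" "separable K A"
    and c: "represents K A n B0 c" and d: "represents K A (Suc n) B d" and \<phi>: "ring_mor K B0 B \<phi>"
    and dc: "\<And>i. i < n \<Longrightarrow> d i = \<phi> \<cdot> c i"
    and B': "is_ring K B'" "separable K B'" and \<iota>: "ring_mor K B B' \<iota>" and q: "ring_mor K B B' q"
    and \<iota>q: "\<iota> \<cdot> \<phi> = q \<cdot> \<phi>" and dis: "disjoint_mors K B' \<iota> q"
    and k: "k \<in> Hom K (r_ob B') (r_ob B \<boxtimes> r_ob B)" "prd K B' \<iota> q \<cdot> k = idt K (r_ob B')"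
    and univ: "\<And>S f g. \<lbrakk>is_ring K S; ring_mor K B S f; ring_mor K B S g; f \<cdot> \<phi> = g \<cdot> \<phi>; disjoint_mors K S f g\<rbrakk> \<Longrightarrow>
      \<exists>u. ring_mor K B' S u \<and> u \<cdot> \<iota> = f \<and> u \<cdot> q = g"
  shows "represents K A (Suc (Suc n)) B' (\<lambda>i. if i < Suc n then \<iota> \<cdot> d i else q \<cdot> d n)"
proof -
  note Br = representsD(1)[OF d] and B0r = representsD(1)[OF c]
  note dm = pointsD(1)[OF representsD(3)[OF d]] and cm' = pointsD(1)[OF representsD(3)[OF c]]
  note [simp] = A(1) Br B0r B'(1) ring_morD(1-3)[OF \<iota>] ring_morD(1-3)[OF q] ring_morD(1-3)[OF \<phi>]
  have [simp]: "d i \<in> arrs K" "src K (d i) = r_ob A" "tgt K (d i) = r_ob B" if "i < Suc n" for i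
    using ring_morD[OF dm[OF that]] by auto
  have [simp]: "c i \<in> arrs K" "src K (c i) = r_ob A" "tgt K (c i) = r_ob B0" if "i < n" for i
    using ring_morD[OF cm'[OF that]] by auto
  have [simp]: "k \<in> arrs K" "src K k = r_ob B'" "tgt K k = r_ob B \<boxtimes> r_ob B" using k(1) by auto
  have qd: "q \<cdot> d i = \<iota> \<cdot> d i" if "i < n" for i
    using that reassoc[OF \<iota>q, of "c i"] by (simp add: dc)
  let ?d = "\<lambda>i. if i < Suc n then \<iota> \<cdot> d i else q \<cdot> d n"
  have P1: "points K A B' (\<lambda>i. \<iota> \<cdot> d i) (Suc n)"
    by (rule points_cmp[OF A Br B'(1) representsD(3)[OF d] \<iota>])
  have P2: "points K A B' (\<lambda>i. q \<cdot> d i) (Suc n)"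
    by (rule points_cmp[OF A Br B'(1) representsD(3)[OF d] q])
  \<comment> \<open>Where the last entries agree, all entries do, since the first n are shared.
    Uniqueness after scaling then makes \<iota> and \<open>q\<close> agree there.\<close>
  have last: "disjoint_mors K B' (q \<cdot> d n) (\<iota> \<cdot> d n)"
    unfolding disjoint_mors_def
  proof (intro ballI impI)
    fix e assume e: "e \<in> Hom K (unt K) (r_ob B')" "scl K B' e (q \<cdot> d n) = scl K B' e (\<iota> \<cdot> d n)"
    have "scl K B' e \<iota> = scl K B' e q"
    proof (rule representsD(5)[OF d B'(1) \<iota> q])
      fix i assume "i < Suc n"
      then show "scl K B' e (\<iota> \<cdot> d i) = scl K B' e (q \<cdot> d i)"
        using e(2) qd[of i] by (cases "i = n") auto
    qed (use e(1) in simp_all)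
    then show "e = zro K (unt K) (r_ob B')" using dis e(1) unfolding disjoint_mors_def by blast
  qed
  have pts: "points K A B' ?d (Suc (Suc n))"
    unfolding points_Suc[of A B' ?d "Suc n"]
  proof (intro conjI allI impI)
    show "points K A B' ?d (Suc n)" using P1 unfolding points_def by auto
    show "ring_mor K A B' (?d (Suc n))" using pointsD(1)[OF P2, of n] by simp
    fix j assume "j < Suc n"
    then show "disjoint_mors K B' (?d (Suc n)) (?d j)"
      using last pointsD(2)[OF P2, of n j] qd[of j] by (cases "j = n") auto
  qed
  have un: "\<exists>u. ring_mor K B' R u \<and> (\<forall>i<Suc (Suc n). u \<cdot> ?d i = x i)" if R: "is_ring K R" and x: "points K A R x (Suc (Suc n))" for R x
  proof -
    have x1: "points K A R x (Suc n)" using x unfolding points_Suc[of A R x "Suc n"] by blast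
    obtain f where f: "ring_mor K B R f" "\<And>i. i < Suc n \<Longrightarrow> f \<cdot> d i = x i"
      using representsD(4)[OF d R x1] by blast
    \<comment> \<open>The second tuple keeps the first n entries and takes the entry at index n + 1
      in place of the one at index n.\<close>
    let ?y = "\<lambda>i. if i < n then x i else x (Suc n)"
    have x2: "points K A R ?y (Suc n)"
      using pointsD[OF x] unfolding points_def by auto
    obtain g where g: "ring_mor K B R g" "\<And>i. i < Suc n \<Longrightarrow> g \<cdot> d i = ?y i"
      using representsD(4)[OF d R x2] by blast
    note [simp] = ring_morD(1-3)[OF f(1)] ring_morD(1-3)[OF g(1)]
    have fg: "f \<cdot> \<phi> = g \<cdot> \<phi>"
    proof (rule represents_unique[OF c R])
      show "ring_mor K B0 R (f \<cdot> \<phi>)" "ring_mor K B0 R (g \<cdot> \<phi>)"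
        using f(1) g(1) \<phi> R by (auto intro: ring_mor_cmp)
      fix i assume i: "i < n"
      then show "(f \<cdot> \<phi>) \<cdot> c i = (g \<cdot> \<phi>) \<cdot> c i" using f(2)[of i] g(2)[of i] by (simp add: dc)
    qed
    have "disjoint_mors K R f g"
      unfolding disjoint_mors_def
    proof (intro ballI impI)
      fix e assume e: "e \<in> Hom K (unt K) (r_ob R)" "scl K R e f = scl K R e g"
      have "scl K R e (x n) = scl K R e f \<cdot> d n" using e(1) R f(2)[of n] by (simp add: scl_cmp)
      also have "\<dots> = scl K R e (x (Suc n))" unfolding e(2) using e(1) R g(2)[of n] by (simp add: scl_cmp)
      finally have "scl K R e (x n) = scl K R e (x (Suc n))" .
      moreover have "disjoint_mors K R (x n) (x (Suc n))" by (rule pointsD(2)[OF x]) auto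
      ultimately show "e = zro K (unt K) (r_ob R)"
        using e(1) unfolding disjoint_mors_def by blast
    qed
    then obtain u where u: "ring_mor K B' R u" "u \<cdot> \<iota> = f" "u \<cdot> q = g" using univ[OF R f(1) g(1) fg] by blast
    note [simp] = ring_morD(1-3)[OF u(1)]
    have "u \<cdot> ?d i = x i" if "i < Suc (Suc n)" for i
    proof (cases "i < Suc n")
      case True
      then show ?thesis using reassoc[OF u(2), of "d i"] f(2)[of i] by simp
    next
      case False
      then have "i = Suc n" using that by simp
      then show ?thesis using reassoc[OF u(3), of "d n"] g(2)[of n] by simp
    qed
    then show ?thesis using u(1) by blast
  qed
  have uq: "scl K R e f = scl K R e g" if R: "is_ring K R" and f: "ring_mor K B' R f" and g: "ring_mor K B' R g"
    and e: "e \<in> Hom K (unt K) (r_ob R)" and eq: "\<And>i. i < Suc (Suc n) \<Longrightarrow> scl K R e (f \<cdot> ?d i) = scl K R e (g \<cdot> ?d i)" for R f g e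
  proof -
    have [simp]: "e \<in> arrs K" "src K e = unt K" "tgt K e = r_ob R" using e by auto
    note [simp] = R ring_morD(1-3)[OF f] ring_morD(1-3)[OF g]
    have 1: "scl K R e (f \<cdot> \<iota>) = scl K R e (g \<cdot> \<iota>)"
    proof (rule representsD(5)[OF d R])
      show "ring_mor K B R (f \<cdot> \<iota>)" "ring_mor K B R (g \<cdot> \<iota>)"
        using f g \<iota> by (auto intro: ring_mor_cmp)
      fix i assume "i < Suc n"
      then show "scl K R e ((f \<cdot> \<iota>) \<cdot> d i) = scl K R e ((g \<cdot> \<iota>) \<cdot> d i)" using eq[of i] by simp
    qed simp_all
    have 2: "scl K R e (f \<cdot> q) = scl K R e (g \<cdot> q)"
    proof (rule representsD(5)[OF d R])
      show "ring_mor K B R (f \<cdot> q)" "ring_mor K B R (g \<cdot> q)"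
        using f g q by (auto intro: ring_mor_cmp)
      fix i assume "i < Suc n"
      then show "scl K R e ((f \<cdot> q) \<cdot> d i) = scl K R e ((g \<cdot> q) \<cdot> d i)" using eq[of i] eq[of "Suc n"] qd[of i]
        by (cases "i = n") auto
    qed simp_all
    \<comment> \<open>The split epimorphism from B \<otimes> B onto B' reduces equality on B' to
      equality on its two copies of \<open>B\<close>.\<close>
    have "scl K R e f = scl K R e (f \<cdot> prd K B' \<iota> q) \<cdot> k"
      by (simp add: scl_cmp k(2))
    also have "\<dots> = prd K R (scl K R e (f \<cdot> \<iota>)) (f \<cdot> q) \<cdot> k"
      by (simp add: ring_mor_prd[OF f] scl_prd_left)
    also have "\<dots> = prd K R (g \<cdot> \<iota>) (scl K R e (f \<cdot> q)) \<cdot> k"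
      unfolding 1 by (simp add: scl_prd_left[symmetric] scl_prd_right)
    also have "\<dots> = scl K R e (g \<cdot> prd K B' \<iota> q) \<cdot> k"
      unfolding 2 by (simp add: ring_mor_prd[OF g] scl_prd_right)
    also have "\<dots> = scl K R e g"
      by (simp add: scl_cmp k(2))
    finally show ?thesis .
  qed
  show ?thesis unfolding represents_def using B' pts un uq by blast
qed

text \<open>The induction carries two consecutive stages with the map between them, because the next
  stage is formed relative to the previous one. At the start, the initial ring represents the empty
  tuple and \<open>A\<close> represents a single morphism.\<close>

lemma tower_represents:
  assumes A: "is_ring K A" "separable K A"
  shows "\<exists>c d. represents K A n (fst (tower K A n)) c \<and> represents K A (Suc n) (fst (snd (tower K A n))) d \<and>
     ring_mor K (fst (tower K A n)) (fst (snd (tower K A n))) (snd (snd (tower K A n))) \<and>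
     (\<forall>i<n. d i = snd (snd (tower K A n)) \<cdot> c i) \<and> fst (snd (tower K A n)) = fst (tower K A (Suc n))"
proof (induction n)
  case 0
  have "represents K A 0 (unit_ring K) (\<lambda>i. undefined)"
    unfolding represents_def
    using separable_unit ring_mor_unit by (auto simp: points_def simp del: unit_ring_simps dest!: ring_mor_unit_eq)
  moreover have "f \<cdot> idt K (r_ob A) = f" if "ring_mor K A R f" for R f
    using ring_morD[OF that] by simp
  then have "represents K A (Suc 0) A (\<lambda>i. idt K (r_ob A))"
    unfolding represents_def using A by (auto simp: points_def ring_mor_idt)
  ultimately show ?case
    using ring_mor_unit[OF A(1)] by (auto simp: tower_step_def case_prod_beta)
next
  case (Suc n)
  obtain B0 B \<phi> where t: "tower K A n = (B0, B, \<phi>)" by (cases "tower K A n") auto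
  obtain c d where c: "represents K A n B0 c" and d: "represents K A (Suc n) B d" and \<phi>: "ring_mor K B0 B \<phi>" and dc: "\<forall>i<n. d i = \<phi> \<cdot> c i"
    using Suc.IH unfolding t by auto
  interpret B0: sep_ring K B0
    using representsD(1,2)[OF c] by unfold_locales
  have a: "is_ring K B \<and> ring_mor K B0 B \<phi>" using \<phi> representsD(1)[OF d] by blast
  obtain B' \<iota> q where s: "tower_step K (B0, B, \<phi>) = (B, B', \<iota>)" "is_ring K B'" "separable K B'" "ring_mor K B B' \<iota>" "ring_mor K B B' q"
    "\<iota> \<cdot> \<phi> = q \<cdot> \<phi>" "disjoint_mors K B' \<iota> q"
    "\<exists>k \<in> Hom K (r_ob B') (r_ob B \<boxtimes> r_ob B). prd K B' \<iota> q \<cdot> k = idt K (r_ob B')"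
    "\<And>S f g. \<lbrakk>is_ring K S; ring_mor K B S f; ring_mor K B S g; f \<cdot> \<phi> = g \<cdot> \<phi>; disjoint_mors K S f g\<rbrakk> \<Longrightarrow>
      \<exists>u. ring_mor K B' S u \<and> u \<cdot> \<iota> = f \<and> u \<cdot> q = g"
    by (rule B0.tower_step_spec[OF a representsD(2)[OF d]]) blast
  obtain k where k: "k \<in> Hom K (r_ob B') (r_ob B \<boxtimes> r_ob B)" "prd K B' \<iota> q \<cdot> k = idt K (r_ob B')" using s(8) by blast
  have dc': "\<And>i. i < n \<Longrightarrow> d i = \<phi> \<cdot> c i" using dc by blast
  note st = represents_step[OF A c d \<phi> dc' s(2-7) k s(9)]
  have t': "tower K A (Suc n) = (B, B', \<iota>)" using s(1) by (simp add: t)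
  have t'': "fst (tower K A (Suc (Suc n))) = B'"
    using t' by (simp only: tower.simps(2)[of K A "Suc n"]) (simp add: tower_step_def case_prod_beta)
  show ?case
    unfolding t' t'' fst_conv snd_conv
    by (intro exI[of _ d] exI[of _ "\<lambda>i. if i < Suc n then \<iota> \<cdot> d i else q \<cdot> d n"] conjI d st s(4) allI impI) simp_all
qed

section \<open>Degree and the number of disjoint morphisms\<close>

lemma tower_ring_represents:
  assumes "is_ring K A" "separable K A"
  obtains c where "represents K A n (tower_ring K A n) c"
  using tower_represents[OF assms, of n] unfolding tower_ring_def by blast

lemma tower_ring_mor:
  assumes "is_ring K A" "separable K A"
  obtains f where "ring_mor K (tower_ring K A n) (tower_ring K A (Suc n)) f"
proof -
  obtain f where "ring_mor K (fst (tower K A n)) (fst (snd (tower K A n))) f" "fst (snd (tower K A n)) = fst (tower K A (Suc n))"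
    using tower_represents[OF assms, of n] by blast
  then show ?thesis using that unfolding tower_ring_def by simp
qed

lemma is_ring_tower: "\<lbrakk>is_ring K A; separable K A\<rbrakk> \<Longrightarrow> is_ring K (tower_ring K A n)"
  and separable_tower: "\<lbrakk>is_ring K A; separable K A\<rbrakk> \<Longrightarrow> separable K (tower_ring K A n)"
  using tower_ring_represents[of A n] representsD(1,2)[of A n "tower_ring K A n"] by blast+

text \<open>Each stage maps to the next, and a ring with a morphism to a nonzero ring is nonzero.
  Uniqueness of the degree follows.\<close>

lemma tower_zero_mono:
  assumes A: "is_ring K A" "separable K A" and "nonzero_ring K (tower_ring K A n)" "m \<le> n"
  shows "nonzero_ring K (tower_ring K A m)"
  using assms(4,3)
proof (induction n rule: dec_induct)
  case (step n)
  obtain f where "ring_mor K (tower_ring K A n) (tower_ring K A (Suc n)) f" by (rule tower_ring_mor[OF A])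
  then have "nonzero_ring K (tower_ring K A n)"
    using nonzero_ring_mor[OF is_ring_tower[OF A] is_ring_tower[OF A]] step.prems by blast
  then show ?case by (rule step.IH)
qed

lemma has_degree_unique:
  assumes A: "is_ring K A" "separable K A" and "has_degree K A m" "has_degree K A n"
  shows "m = n"
proof (rule ccontr)
  assume "m \<noteq> n"
  then consider "Suc m \<le> n" | "Suc n \<le> m" by linarith
  then show False
    using assms(3,4) tower_zero_mono[OF A] unfolding has_degree_def by cases blast+
qed

lemma has_degree_degree: "\<lbrakk>is_ring K A; separable K A; finite_degree K A\<rbrakk> \<Longrightarrow> has_degree K A (degree K A)"
  unfolding finite_degree_def degree_def using has_degree_unique by (metis theI)

lemma points_zero:
  assumes A: "is_ring K A" "separable K A" and d: "has_degree K A d" and R: "is_ring K R" and x: "points K A R x (Suc d)"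
  shows "\<not> nonzero_ring K R"
proof -
  obtain c where c: "represents K A (Suc d) (tower_ring K A (Suc d)) c" by (rule tower_ring_represents[OF A])
  obtain u where "ring_mor K (tower_ring K A (Suc d)) R u" using representsD(4)[OF c R x] by blast
  then show ?thesis using nonzero_ring_mor[OF is_ring_tower[OF A] R] d unfolding has_degree_def by blast
qed

text \<open>The degree is the index of the last nonzero stage, so a vanishing stage must be
  accompanied by a nonzero stage at the bottom; the nonzero unit ring is that stage.\<close>

lemma finite_degreeI:
  assumes A: "is_ring K A" "separable K A" and u: "nonzero_ring K (unit_ring K)"
    and z: "\<And>R x. \<lbrakk>is_ring K R; points K A R x n\<rbrakk> \<Longrightarrow> \<not> nonzero_ring K R"
  shows "finite_degree K A"
proof -
  obtain c where c: "represents K A n (tower_ring K A n) c" by (rule tower_ring_represents[OF A])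
  have "\<not> nonzero_ring K (tower_ring K A n)" by (rule z[OF representsD(1,3)[OF c]])
  moreover have "nonzero_ring K (tower_ring K A 0)" using u by (simp add: tower_ring_def)
  ultimately have "\<exists>k<n. nonzero_ring K (tower_ring K A k) \<and> \<not> nonzero_ring K (tower_ring K A (Suc k))"
    using ex_least_nat_less[of "\<lambda>k. \<not> nonzero_ring K (tower_ring K A k)" n] by (metis le_refl)
  then show ?thesis unfolding finite_degree_def has_degree_def by blast
qed

lemma eql_self:
  assumes "is_ring K A" "separable K A" "is_ring K R" "ring_mor K A R f"
  shows "eql K A R f f = r_unit R"
  using eql(6)[OF assms(1-4) assms(4), of "r_unit R"] eql(1-3)[OF assms(1-4) assms(4)] assms(3) by simp

lemma loc_nonzero:
  assumes l: "is_loc K X e C p" and "e \<noteq> zro K (unt K) (r_ob X)"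
  shows "nonzero_ring K C"
proof (rule ccontr)
  note [simp] = is_locD[OF l]
  assume "\<not> nonzero_ring K C"
  then have z: "r_unit C = zro K (unt K) (r_ob C)" by (simp add: nonzero_ring_iff)
  obtain j where j: "j \<in> arrs K" "src K j = r_ob C" "tgt K j = r_ob X" "j \<cdot> p = scl K X e (idt K (r_ob X))" "p \<cdot> e = r_unit C" "scl K X e e = e"
    by (rule is_locE[OF l]) blast
  have "e = (j \<cdot> p) \<cdot> e" unfolding j(4) using j(6) by (simp add: scl_cmp)
  also have "\<dots> = zro K (unt K) (r_ob X)" using j(1-3,5) by (simp add: z)
  finally show False using assms(2) by simp
qed

text \<open>A nonzero ring does not admit d + 1 pairwise disjoint morphisms from a ring of degree d,
  so a further morphism must meet one of the d given ones.\<close>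

lemma points_exhaust:
  assumes A: "is_ring K A" "separable K A" and d: "has_degree K A d" and R: "is_ring K R" "nonzero_ring K R"
    and x: "points K A R x d" and h: "ring_mor K A R h"
  obtains k where "k < d" "eql K A R (x k) h \<noteq> zro K (unt K) (r_ob R)"
proof -
  let ?y = "x(d := h)"
  have "points K A R ?y d" using x unfolding points_def by auto
  moreover have "\<not> points K A R ?y (Suc d)" using points_zero[OF A d R(1)] R(2) by blast
  ultimately obtain k where k: "k < d" "\<not> disjoint_mors K R h (x k)" using h unfolding points_Suc by auto
  then have "\<not> disjoint_mors K R (x k) h" using disjoint_sym by blast
  then show ?thesis using that k(1) disjoint_iff_eql[OF A R(1) pointsD(1)[OF x k(1)] h] by blast
qed

text \<open>Over a decomposable ring a morphism may agree with different \<open>x k\<close> on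
  different pieces. Localising at nonzero agreement idempotents, one for each morphism of the list,
  makes every one of them coincide with some \<open>x k\<close> over a ring that is still
  nonzero.\<close>

lemma points_refine:
  assumes A: "is_ring K A" "separable K A" and d: "has_degree K A d" and R: "is_ring K R" "nonzero_ring K R"
    and x: "points K A R x d" and hs: "\<forall>h \<in> set hs. ring_mor K A R h"
  shows "\<exists>S p. is_ring K S \<and> nonzero_ring K S \<and> ring_mor K R S p \<and> (\<forall>h \<in> set hs. \<exists>k<d. p \<cdot> h = p \<cdot> x k)"
  using hs
proof (induction hs)
  case Nil
  show ?case using R ring_mor_idt[OF R(1)] by (intro exI[of _ R] exI[of _ "idt K (r_ob R)"]) simp
next
  case (Cons h hs)
  obtain S p where S: "is_ring K S" "nonzero_ring K S" and p: "ring_mor K R S p" and ph: "\<And>h. h \<in> set hs \<Longrightarrow> \<exists>k<d. p \<cdot> h = p \<cdot> x k"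
    using Cons by auto
  have h: "ring_mor K A S (p \<cdot> h)" using Cons.prems p A R S by (auto intro: ring_mor_cmp)
  have px: "points K A S (\<lambda>i. p \<cdot> x i) d" by (rule points_cmp[OF A R(1) S(1) x p])
  obtain k where k: "k < d" "eql K A S (p \<cdot> x k) (p \<cdot> h) \<noteq> zro K (unt K) (r_ob S)"
    using points_exhaust[OF A d S px h] by blast
  note e = eql[OF A S(1) pointsD(1)[OF px k(1)] h]
  obtain C q where l: "is_loc K S (eql K A S (p \<cdot> x k) (p \<cdot> h)) C q" by (rule ex_loc[OF S(1) e(1-4)])
  note [simp] = A(1) R(1) S(1) is_locD[OF l] ring_morD(1-3)[OF p] ring_morD(1-3)[OF h] ring_morD(1-3)[OF pointsD(1)[OF px]]
  have hx: "ring_mor K A R h'" if "h' \<in> set (h # hs)" for h' using Cons.prems that by blast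
  have qe: "q \<cdot> eql K A S (p \<cdot> x k) (p \<cdot> h) = r_unit C" by (rule is_locE[OF l]) blast
  have "scl K C (q \<cdot> eql K A S (p \<cdot> x k) (p \<cdot> h)) (q \<cdot> p \<cdot> x k) = scl K C (q \<cdot> eql K A S (p \<cdot> x k) (p \<cdot> h)) (q \<cdot> p \<cdot> h)"
    using arg_cong[OF e(5), of "\<lambda>u. q \<cdot> u"] k(1) by (simp add: ring_mor_scl[of S C q])
  then have qk: "q \<cdot> p \<cdot> h = q \<cdot> p \<cdot> x k" unfolding qe using k(1) by simp
  have xm: "x i \<in> arrs K" "src K (x i) = r_ob A" "tgt K (x i) = r_ob R" if "i < d" for i
    using ring_morD[OF pointsD(1)[OF x that]] by auto
  have "\<exists>k<d. (q \<cdot> p) \<cdot> h' = (q \<cdot> p) \<cdot> x k" if "h' \<in> set (h # hs)" for h'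
  proof (cases "h' = h")
    case True
    then show ?thesis using qk k(1) xm[OF k(1)] ring_morD[OF hx[OF that]] by (intro exI[of _ k]) simp
  next
    case False
    then have "h' \<in> set hs" using that by simp
    then obtain i where "i < d" "p \<cdot> h' = p \<cdot> x i" using ph by blast
    then show ?thesis using xm[of i] ring_morD[OF hx[OF that]] by (intro exI[of _ i]) simp
  qed
  moreover have "ring_mor K R C (q \<cdot> p)" using p by (auto intro: ring_mor_cmp)
  moreover have "nonzero_ring K C" by (rule loc_nonzero[OF l k(2)])
  ultimately show ?case using is_locD(2)[OF l] by blast
qed

lemma nonzero_unit_ring: "\<lbrakk>is_ring K A; nonzero_ring K A\<rbrakk> \<Longrightarrow> nonzero_ring K (unit_ring K)"
  using nonzero_ring_mor[OF is_ring_unit _ ring_mor_unit] by blast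

text \<open>This makes \<open>nice\<close> applicable to A^[d]. A morphism out of A^[d] is a tuple
  of d morphisms out of \<open>A\<close>. Over a suitable nonzero ring, every entry of finitely many
  such tuples is one of d fixed morphisms, so at most d^d of the tuples differ.\<close>

lemma finite_degree_tower:
  assumes A: "is_ring K A" "separable K A" and d: "has_degree K A d"
  shows "finite_degree K (tower_ring K A d)"
proof -
  let ?T = "tower_ring K A d"
  note T = is_ring_tower[OF A, of d] separable_tower[OF A, of d]
  obtain c where c: "represents K A d ?T c" by (rule tower_ring_represents[OF A])
  note cm' = pointsD(1)[OF representsD(3)[OF c]]
  have "nonzero_ring K ?T" using d by (simp add: has_degree_def)
  then have u: "nonzero_ring K (unit_ring K)" by (rule nonzero_unit_ring[OF T(1)])
  show ?thesis
  proof (rule finite_degreeI[OF T u, where n = "Suc (d ^ d)"])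
    fix R g assume R: "is_ring K R" and g: "points K ?T R g (Suc (d ^ d))"
    let ?n = "Suc (d ^ d)"
    show "\<not> nonzero_ring K R"
    proof
      assume nz: "nonzero_ring K R"
      have gm: "ring_mor K ?T R (g a)" if "a < ?n" for a using pointsD(1)[OF g that] .
      have gc: "ring_mor K A R (g a \<cdot> c i)" if "a < ?n" "i < d" for a i
        using gm[OF that(1)] cm'[OF that(2)] A T R by (auto intro: ring_mor_cmp)
      have x: "points K A R (\<lambda>i. g 0 \<cdot> c i) d"
        by (rule points_cmp[OF A T(1) R representsD(3)[OF c] gm]) simp
      \<comment> \<open>The entries of all d^d + 1 tuples are collected, so that a single refinement
        serves them simultaneously.\<close>
      have "finite (\<Union>a\<in>{..<?n}. (\<lambda>i. g a \<cdot> c i) ` {..<d})" by simp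
      from finite_list[OF this] obtain hs where hs0: "set hs = (\<Union>a\<in>{..<?n}. (\<lambda>i. g a \<cdot> c i) ` {..<d})" by (elim exE)
      have hs: "\<And>a i. \<lbrakk>a < ?n; i < d\<rbrakk> \<Longrightarrow> g a \<cdot> c i \<in> set hs" "\<And>h. h \<in> set hs \<Longrightarrow> \<exists>a<?n. \<exists>i<d. h = g a \<cdot> c i"
      proof -
        show "g a \<cdot> c i \<in> set hs" if "a < ?n" "i < d" for a i
          unfolding hs0 by (rule UN_I[of a], use that in simp, rule imageI, use that in simp)
        fix h assume "h \<in> set hs"
        then obtain a i where "a \<in> {..<?n}" "i \<in> {..<d}" "h = g a \<cdot> c i" unfolding hs0 by (elim UN_E imageE)
        then show "\<exists>a<?n. \<exists>i<d. h = g a \<cdot> c i" by (intro exI[of _ a] conjI exI[of _ i]) simp_all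
      qed
      have "\<forall>h \<in> set hs. ring_mor K A R h"
      proof
        fix h assume h: "h \<in> set hs"
        obtain a i where "a < ?n" "i < d" "h = g a \<cdot> c i" using hs(2)[OF h] by (elim exE conjE)
        then show "ring_mor K A R h" using gc[of a i] by simp
      qed
      from points_refine[OF A d R nz x this] obtain S p where S: "is_ring K S" "nonzero_ring K S" and p: "ring_mor K R S p"
        and ph: "\<forall>h \<in> set hs. \<exists>k<d. p \<cdot> h = p \<cdot> (g 0 \<cdot> c k)" by blast
      have "\<exists>k. a < ?n \<and> i < d \<longrightarrow> k < d \<and> p \<cdot> (g a \<cdot> c i) = p \<cdot> (g 0 \<cdot> c k)" for a i
        using bspec[OF ph hs(1), of a i] by (cases "a < ?n \<and> i < d") auto
      then have "\<forall>a i. \<exists>k. a < ?n \<and> i < d \<longrightarrow> k < d \<and> p \<cdot> (g a \<cdot> c i) = p \<cdot> (g 0 \<cdot> c k)" by blast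
      then obtain \<kappa> where \<kappa>: "\<And>a i. \<lbrakk>a < ?n; i < d\<rbrakk> \<Longrightarrow> \<kappa> a i < d \<and> p \<cdot> (g a \<cdot> c i) = p \<cdot> (g 0 \<cdot> c (\<kappa> a i))"
        by metis
      \<comment> \<open>\<open>restrict\<close> makes the index functions extensional, so that they
        lie in a finite function space of cardinality d^d.\<close>
      let ?F = "\<lambda>a. restrict (\<kappa> a) {..<d}"
      have "?F ` {..<?n} \<subseteq> PiE {..<d} (\<lambda>_. {..<d})" using \<kappa> by (auto simp: PiE_iff split: if_splits)
      then have "card (?F ` {..<?n}) \<le> card (PiE {..<d} (\<lambda>_. {..<d}))" by (intro card_mono finite_PiE) auto
      also have "\<dots> = d ^ d" by (simp add: card_PiE)
      finally have "card (?F ` {..<?n}) < card {..<?n}" by simp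
      then have "\<not> inj_on ?F {..<?n}" by (rule pigeonhole)
      then obtain a b where ab: "a < ?n" "b < ?n" "a \<noteq> b" "?F a = ?F b" unfolding inj_on_def by auto
      have \<kappa>ab: "\<kappa> a i = \<kappa> b i" if "i < d" for i using fun_cong[OF ab(4), of i] that by simp
      note [simp] = ring_morD(1-3)[OF p] ring_morD(1-3)[OF gm[OF ab(1)]] ring_morD(1-3)[OF gm[OF ab(2)]]
      have pm: "ring_mor K ?T S (p \<cdot> g a)" "ring_mor K ?T S (p \<cdot> g b)"
        using gm[OF ab(1)] gm[OF ab(2)] p T R S by (auto intro: ring_mor_cmp)
      have "p \<cdot> g a = p \<cdot> g b"
      proof (rule represents_unique[OF c S(1) pm])
        fix i assume i: "i < d"
        show "(p \<cdot> g a) \<cdot> c i = (p \<cdot> g b) \<cdot> c i"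
          using ring_morD[OF cm'[OF i]] \<kappa>[OF ab(1) i] \<kappa>[OF ab(2) i] \<kappa>ab[OF i] by simp
      qed
      \<comment> \<open>The two morphisms remain disjoint over \<open>S\<close> but have become
        equal, which a nonzero ring forbids.\<close>
      moreover have "disjoint_mors K S (p \<cdot> g a) (p \<cdot> g b)"
        using disjoint_cmp[OF T R S(1) _ _ p] pointsD(2)[OF g ab(1,2,3)] gm ab by blast
      ultimately show False using disjoint_self_zero[OF S(1)] S(2) by simp
    qed
  qed
qed

text \<open>Precomposition with the split epimorphism \<open>p\<close> can be cancelled even after
  scaling, so disjoint morphisms out of \<open>B\<close> give disjoint morphisms out of
  \<open>T\<close>, and the bound for \<open>T\<close> applies.\<close>

lemma finite_degree_loc:
  assumes T: "is_ring K T" "separable K T" "finite_degree K T" and l: "is_loc K T e B p"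
  shows "separable K B" "nonzero_ring K B \<Longrightarrow> finite_degree K B"
proof -
  note [simp] = is_locD[OF l]
  obtain j where j: "j \<in> arrs K" "src K j = r_ob B" "tgt K j = r_ob T" "p \<cdot> j = idt K (r_ob B)"
    by (rule is_locE[OF l]) blast
  show B: "separable K B" by (rule separable_quotient[OF T(1,2) _ _ j]) simp_all
  assume nz: "nonzero_ring K B"
  have d: "has_degree K T (degree K T)" by (rule has_degree_degree[OF T])
  show "finite_degree K B"
  proof (rule finite_degreeI[OF _ B nonzero_unit_ring[OF _ nz], of "Suc (degree K T)"])
    fix R g assume R: "is_ring K R" and g: "points K B R g (Suc (degree K T))"
    have "points K T R (\<lambda>i. g i \<cdot> p) (Suc (degree K T))"
      unfolding points_def
    proof (intro conjI allI impI)
      fix i assume i: "i < Suc (degree K T)"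
      show "ring_mor K T R (g i \<cdot> p)" by (rule ring_mor_cmp[OF is_locD(6)[OF l] pointsD(1)[OF g i]]) (simp_all add: R)
      fix i' assume i': "i' < i"
      note m = ring_morD(1-3)[OF pointsD(1)[OF g i]] ring_morD(1-3)[OF pointsD(1)[OF g], of i']
      show "disjoint_mors K R (g i \<cdot> p) (g i' \<cdot> p)"
        unfolding disjoint_mors_def
      proof (intro ballI impI)
        fix e assume e: "e \<in> Hom K (unt K) (r_ob R)" "scl K R e (g i \<cdot> p) = scl K R e (g i' \<cdot> p)"
        have "scl K R e (g i) \<cdot> p = scl K R e (g i') \<cdot> p" using e R m i i' by (simp add: scl_cmp)
        then have "scl K R e (g i) = scl K R e (g i')"
          by (rule is_loc_sect_cancel[OF l]) (use e(1) R m i i' in simp_all)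
        then show "e = zro K (unt K) (r_ob R)"
          using e(1) pointsD(2)[OF g i, of i'] i i' unfolding disjoint_mors_def by auto
      qed
    qed
    then show "\<not> nonzero_ring K R" by (rule points_zero[OF T(1,2) d R])
  qed simp_all
qed

section \<open>Finite products of rings and orthogonal idempotents\<close>

lemma prod_ring_list_Cons: "prod_ring_list K (C # Cs) = prod_ring K C (prod_ring_list K Cs)"
  by (simp add: prod_ring_list_def)

text \<open>The coordinate projections come with the standard idempotents dual to them. These
  elements later prove different projections of a split algebra to be disjoint.\<close>

lemma prod_ring_list_points:
  assumes "\<forall>C \<in> set Cs. is_ring K C"
  shows "\<exists>\<pi> e. \<forall>i<length Cs. ring_mor K (prod_ring_list K Cs) (Cs ! i) (\<pi> i) \<and> e i \<in> Hom K (unt K) (r_ob (prod_ring_list K Cs)) \<and>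
     (\<forall>j<length Cs. \<pi> i \<cdot> e j = (if i = j then r_unit (Cs ! i) else zro K (unt K) (r_ob (Cs ! i))))"
  using assms
proof (induction Cs)
  case (Cons C Cs)
  let ?Q = "prod_ring_list K Cs"
  let ?P = "prod_ring K C ?Q"
  have r: "is_ring K C" "is_ring K ?Q" using Cons.prems by auto
  obtain \<pi> e where IH: "\<And>i. i<length Cs \<Longrightarrow> ring_mor K ?Q (Cs ! i) (\<pi> i)" "\<And>i. i<length Cs \<Longrightarrow> e i \<in> Hom K (unt K) (r_ob ?Q)"
     "\<And>i j. \<lbrakk>i<length Cs; j<length Cs\<rbrakk> \<Longrightarrow> \<pi> i \<cdot> e j = (if i = j then r_unit (Cs ! i) else zro K (unt K) (r_ob (Cs ! i)))"
    using Cons.IH Cons.prems by auto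
  obtain i j where b: "biproduct K (r_ob C) (r_ob ?Q) (r_ob ?P) i j (prod_pr1 K C ?Q) (prod_pr2 K C ?Q)"
    and m: "is_ring K ?P" "ring_mor K ?P C (prod_pr1 K C ?Q)" "ring_mor K ?P ?Q (prod_pr2 K C ?Q)"
    by (rule prod_ring_biproduct[OF r])
  note [simp] = r biproductD(1-15)[OF b] m(1)
  have [simp]: "e k \<in> arrs K" "src K (e k) = unt K" "tgt K (e k) = r_ob ?Q" if "k < length Cs" for k using IH(2)[OF that] by auto
  have [simp]: "\<pi> k \<in> arrs K" "src K (\<pi> k) = r_ob ?Q" "tgt K (\<pi> k) = r_ob (Cs ! k)" if "k < length Cs" for k using ring_morD[OF IH(1)[OF that]] by auto
  have [simp]: "is_ring K (Cs ! k)" if "k < length Cs" for k using Cons.prems that by simp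
  let ?\<pi> = "\<lambda>k. case k of 0 \<Rightarrow> prod_pr1 K C ?Q | Suc k \<Rightarrow> \<pi> k \<cdot> prod_pr2 K C ?Q"
  let ?e = "\<lambda>k. case k of 0 \<Rightarrow> i \<cdot> r_unit C | Suc k \<Rightarrow> j \<cdot> e k"
  have "ring_mor K ?P ((C # Cs) ! k) (?\<pi> k)" if "k < Suc (length Cs)" for k
    using that m IH(1) by (cases k) (auto intro: ring_mor_cmp)
  moreover have "?e k \<in> Hom K (unt K) (r_ob ?P)" if "k < Suc (length Cs)" for k
    using that by (cases k) auto
  moreover have "?\<pi> k \<cdot> ?e l = (if k = l then r_unit ((C # Cs) ! k) else zro K (unt K) (r_ob ((C # Cs) ! k)))"
    if "k < Suc (length Cs)" "l < Suc (length Cs)" for k l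
    using that IH(3) by (cases k; cases l) (auto simp: biproduct_cmp[OF b])
  ultimately show ?case
    unfolding prod_ring_list_Cons by (intro exI[of _ ?\<pi>] exI[of _ ?e]) simp
qed simp

text \<open>Iterates \<open>loc_pair\<close>, with \<open>d\<close> built as the sum of the
  \<open>e i\<close>. The last conjunct, that whatever is orthogonal to every \<open>e i\<close> is
  orthogonal to \<open>d\<close>, is what the induction uses to adjoin the next idempotent.\<close>

lemma prod_ring_list_loc:
  assumes X: "is_ring K X" and "\<And>i. i < length Cs \<Longrightarrow> is_loc K X (e i) (Cs ! i) (\<pi> i)"
    and "\<And>i j. \<lbrakk>i < length Cs; j < length Cs; i \<noteq> j\<rbrakk> \<Longrightarrow> scl K X (e i) (e j) = zro K (unt K) (r_ob X)"
  shows "\<exists>d p. is_loc K X d (prod_ring_list K Cs) p \<and> (\<forall>i<length Cs. scl K X d (e i) = e i) \<and>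
     (\<forall>t \<in> Hom K (unt K) (r_ob X). (\<forall>i<length Cs. scl K X t (e i) = zro K (unt K) (r_ob X)) \<longrightarrow> scl K X t d = zro K (unt K) (r_ob X))"
  using assms(2,3)
proof (induction Cs arbitrary: e \<pi>)
  case Nil
  show ?case using loc_zero[OF X] X by (auto simp: prod_ring_list_def)
next
  case (Cons C Cs)
  have l0: "is_loc K X (e 0) C (\<pi> 0)" using Cons.prems(1)[of 0] by simp
  have orth: "scl K X (e (Suc i)) (e (Suc j)) = zro K (unt K) (r_ob X)" if "i < length Cs" "j < length Cs" "i \<noteq> j" for i j
    using Cons.prems(2)[of "Suc i" "Suc j"] that by simp
  have ls: "is_loc K X (e (Suc i)) (Cs ! i) (\<pi> (Suc i))" if "i < length Cs" for i
    using Cons.prems(1)[of "Suc i"] that by simp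
  obtain d p where d: "is_loc K X d (prod_ring_list K Cs) p" "\<And>i. i<length Cs \<Longrightarrow> scl K X d (e (Suc i)) = e (Suc i)"
    "\<And>t. t \<in> Hom K (unt K) (r_ob X) \<Longrightarrow> (\<forall>i<length Cs. scl K X t (e (Suc i)) = zro K (unt K) (r_ob X)) \<Longrightarrow> scl K X t d = zro K (unt K) (r_ob X)"
    using Cons.IH[of "\<lambda>i. e (Suc i)" "\<lambda>i. \<pi> (Suc i)", OF ls orth] by blast
  note [simp] = X is_locD(3-5)[OF l0] is_locD(3-5)[OF d(1)] is_locD(3-5)[OF ls]
  have e0: "scl K X (e 0) (e (Suc i)) = zro K (unt K) (r_ob X)" if "i < length Cs" for i
    using Cons.prems(2)[of 0 "Suc i"] that by simp
  have ed: "scl K X (e 0) d = zro K (unt K) (r_ob X)" by (rule d(3)) (use e0 in simp_all)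
  have ee: "scl K X (e 0) (e 0) = e 0" by (rule is_locE[OF l0]) blast
  obtain h where h: "is_loc K X (e 0 \<boxplus> d) (prod_ring K C (prod_ring_list K Cs)) h"
    by (rule loc_pair[OF l0 d(1) ed])
  have "scl K X (e 0 \<boxplus> d) (e i) = e i" if "i < Suc (length Cs)" for i
    using that ed e0 d(2) ee scl_comm[of X d "e 0"] by (cases i) (auto simp: scl_add_left)
  moreover have "scl K X t (e 0 \<boxplus> d) = zro K (unt K) (r_ob X)"
    if t: "t \<in> Hom K (unt K) (r_ob X)" and z: "\<forall>i<Suc (length Cs). scl K X t (e i) = zro K (unt K) (r_ob X)" for t
  proof -
    have "scl K X t d = zro K (unt K) (r_ob X)" by (rule d(3)[OF t]) (use z in auto)
    then show ?thesis using t z by (auto simp: scl_add_right)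
  qed
  ultimately show ?case unfolding prod_ring_list_Cons using h by (intro exI[of _ "e 0 \<boxplus> d"] exI[of _ h]) simp
qed

end

section \<open>Splitting rings as points of the splitting tower\<close>

lemma (in idempotent_complete_symmetric_monoidal_category) iso_prod_ring_list_points:
  assumes "\<forall>C \<in> set Cs. is_ring K C" and X: "is_ring K X" and "rings_isomorphic K X (prod_ring_list K Cs)"
  shows "\<exists>\<pi> e. \<forall>i<length Cs. ring_mor K X (Cs ! i) (\<pi> i) \<and> e i \<in> Hom K (unt K) (r_ob X) \<and>
     (\<forall>j<length Cs. \<pi> i \<cdot> e j = (if i = j then r_unit (Cs ! i) else zro K (unt K) (r_ob (Cs ! i))))"
proof -
  let ?P = "prod_ring_list K Cs"
  have P [simp]: "is_ring K ?P" by (rule is_ring_prod_list[OF assms(1)])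
  obtain g where g: "ring_mor K X ?P g" "iso_arrow K g" using assms(3) unfolding rings_isomorphic_def ring_iso_def by blast
  obtain \<pi> e where IH: "\<And>i. i<length Cs \<Longrightarrow> ring_mor K ?P (Cs ! i) (\<pi> i)" "\<And>i. i<length Cs \<Longrightarrow> e i \<in> Hom K (unt K) (r_ob ?P)"
     "\<And>i j. \<lbrakk>i<length Cs; j<length Cs\<rbrakk> \<Longrightarrow> \<pi> i \<cdot> e j = (if i = j then r_unit (Cs ! i) else zro K (unt K) (r_ob (Cs ! i)))"
    using prod_ring_list_points[OF assms(1)] by blast
  note [simp] = X ring_morD(1-3)[OF g(1)] iso_inv(2-4)[OF g(2)]
  have [simp]: "e k \<in> arrs K" "src K (e k) = unt K" "tgt K (e k) = r_ob ?P" if "k < length Cs" for k using IH(2)[OF that] by auto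
  have [simp]: "\<pi> k \<in> arrs K" "src K (\<pi> k) = r_ob ?P" "tgt K (\<pi> k) = r_ob (Cs ! k)" if "k < length Cs" for k using ring_morD[OF IH(1)[OF that]] by auto
  have [simp]: "is_ring K (Cs ! k)" if "k < length Cs" for k using assms(1) that by simp
  have gg: "g \<cdot> inv_arrow K g \<cdot> h = h" if "h \<in> arrs K" "tgt K h = r_ob ?P" for h
    using that reassoc[OF iso_inv(6)[OF g(2)], of h] by simp
  have m: "ring_mor K X (Cs ! i) (\<pi> i \<cdot> g)" if "i < length Cs" for i
    by (rule ring_mor_cmp[OF g(1) IH(1)[OF that]]) (use that in simp_all)
  have h: "inv_arrow K g \<cdot> e i \<in> Hom K (unt K) (r_ob X)" if "i < length Cs" for i
    using that by simp
  have z: "(\<pi> i \<cdot> g) \<cdot> (inv_arrow K g \<cdot> e j) = (if i = j then r_unit (Cs ! i) else zro K (unt K) (r_ob (Cs ! i)))"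
    if "i < length Cs" "j < length Cs" for i j
  proof -
    have "(\<pi> i \<cdot> g) \<cdot> (inv_arrow K g \<cdot> e j) = \<pi> i \<cdot> e j" using that by (simp add: gg)
    then show ?thesis using IH(3)[OF that] by (simp only:)
  qed
  show ?thesis
  proof (rule exI[of _ "\<lambda>i. \<pi> i \<cdot> g"], rule exI[of _ "\<lambda>i. inv_arrow K g \<cdot> e i"], intro allI impI conjI)
    fix i assume "i < length Cs"
    then show "ring_mor K X (Cs ! i) (\<pi> i \<cdot> g)" "inv_arrow K g \<cdot> e i \<in> Hom K (unt K) (r_ob X)"
      by (rule m, rule h)
    fix j assume "j < length Cs"
    with \<open>i < length Cs\<close> show "(\<pi> i \<cdot> g) \<cdot> (inv_arrow K g \<cdot> e j) = (if i = j then r_unit (Cs ! i) else zro K (unt K) (r_ob (Cs ! i)))"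
      by (rule z)
  qed
qed

section \<open>Extension of scalars and the splitting criterion\<close>

context sep_ring
begin

lemma ext_obj_simps [simp]: "fst (ext_obj K R x) = r \<boxtimes> x" "snd (ext_obj K R x) = (r_mul R \<odot> idt K x) \<cdot> asc' r r x"
  unfolding ext_obj_def by (rule fst_conv, rule snd_conv)

lemma md_ext [simp]:
  assumes [simp]: "x \<in> objs K"
  shows "md (ext_obj K R x)"
proof -
  let ?i = "idt K" and ?\<mu> = "r_mul R" and ?\<eta> = "r_unit R"
  let ?\<rho> = "(?\<mu> \<odot> ?i x) \<cdot> asc' r r x"
  have "?\<rho> \<cdot> (?\<mu> \<odot> (?i r \<odot> ?i x)) = ((?\<mu> \<cdot> (?\<mu> \<odot> ?i r)) \<odot> ?i x) \<cdot> asc' (r \<boxtimes> r) r x"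
    by (simp add: asc'_nat tarr_cmp_tarr_assoc del: tarr_idt_idt)
  also have "\<dots> = ((?\<mu> \<cdot> (?i r \<odot> ?\<mu>)) \<odot> ?i x) \<cdot> (asc K r r r \<odot> ?i x) \<cdot> asc' (r \<boxtimes> r) r x"
    by (simp add: ring_mul_assoc tarr_cmp_tarr_assoc)
  also have "\<dots> = ((?\<mu> \<cdot> (?i r \<odot> ?\<mu>)) \<odot> ?i x) \<cdot> (asc' r (r \<boxtimes> r) x \<cdot> (?i r \<odot> asc' r r x) \<cdot> asc K r r (r \<boxtimes> x))"
    by (simp add: pentagon_3)
  also have "\<dots> = ?\<rho> \<cdot> (?i r \<odot> ?\<rho>) \<cdot> asc K r r (r \<boxtimes> x)"
    by (simp add: whisker_left whisker_right asc'_nat_assoc)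
  finally have 1: "?\<rho> \<cdot> (?\<mu> \<odot> ?i (r \<boxtimes> x)) = ?\<rho> \<cdot> (?i r \<odot> ?\<rho>) \<cdot> asc K r r (r \<boxtimes> x)" by simp
  have "?\<rho> \<cdot> (?\<eta> \<odot> (?i r \<odot> ?i x)) = ((?\<mu> \<cdot> (?\<eta> \<odot> ?i r)) \<odot> ?i x) \<cdot> asc' (unt K) r x"
    by (simp add: asc'_nat tarr_cmp_tarr_assoc del: tarr_idt_idt)
  also have "\<dots> = lun K (r \<boxtimes> x)"
    by (simp add: ring_mul_unit_left lun_tobj[symmetric])
  finally have 2: "?\<rho> \<cdot> (?\<eta> \<odot> ?i (r \<boxtimes> x)) = lun K (r \<boxtimes> x)" by simp
  show ?thesis unfolding mod_iff using 1 2 by simp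
qed

text \<open>\<open>ext_tensor\<close> multiplies the scalars of the two factors. It descends because
  a scalar in the middle may be absorbed from either side: \<open>h1\<close> and \<open>h2\<close>
  rewrite both ways as the same action on the target.\<close>

lemma ext_tensor_eq:
  assumes [simp]: "x \<in> objs K" "y \<in> objs K"
  obtains t where "ext_tensor K R x y = (tn (ext_obj K R x) (ext_obj K R y), t, ext_obj K R (x \<boxtimes> y))"
    "t \<in> arrs K" "src K t = fst (tn (ext_obj K R x) (ext_obj K R y))" "tgt K t = r \<boxtimes> (x \<boxtimes> y)"
    "t \<cdot> pj (ext_obj K R x) (ext_obj K R y) = (r_mul R \<odot> idt K (x \<boxtimes> y)) \<cdot> middle_swap K r x r y"
proof -
  let ?i = "idt K" and ?\<mu> = "r_mul R"
  let ?X = "ext_obj K R x" and ?Y = "ext_obj K R y" and ?Z = "ext_obj K R (x \<boxtimes> y)"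
  define act where "act z = (?\<mu> \<odot> ?i z) \<cdot> asc' r r z" for z
  have [simp]: "act z \<in> arrs K" "src K (act z) = r \<boxtimes> (r \<boxtimes> z)" "tgt K (act z) = r \<boxtimes> z" if "z \<in> objs K" for z
    using that by (simp_all add: act_def)
  define h where "h = (?\<mu> \<odot> ?i (x \<boxtimes> y)) \<cdot> middle_swap K r x r y"
  have [simp]: "h \<in> arrs K" "src K h = (r \<boxtimes> x) \<boxtimes> (r \<boxtimes> y)" "tgt K h = r \<boxtimes> (x \<boxtimes> y)"
    by (simp_all add: h_def)
  have h0: "h = act (x \<boxtimes> y) \<cdot> (?i r \<odot> sw x r y) \<cdot> asc K r x (r \<boxtimes> y)"
    by (simp add: h_def act_def middle_swap_sw)
  let ?a = "act (x \<boxtimes> y)"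
  have aa: "?a \<cdot> (?\<mu> \<odot> ?i (r \<boxtimes> (x \<boxtimes> y))) = ?a \<cdot> (?i r \<odot> ?a) \<cdot> asc K r r (r \<boxtimes> (x \<boxtimes> y))"
    using mod_assoc[of ?Z] by (simp add: act_def)
  have h1: "h \<cdot> (act x \<odot> ?i (r \<boxtimes> y)) = ?a \<cdot> (?i r \<odot> h) \<cdot> asc K r (r \<boxtimes> x) (r \<boxtimes> y)"
  proof -
    have "h \<cdot> (act x \<odot> ?i (r \<boxtimes> y)) = ?a \<cdot> ((?i r \<odot> sw x r y) \<cdot> ((?\<mu> \<odot> ?i (x \<boxtimes> (r \<boxtimes> y))) \<cdot> (asc K (r \<boxtimes> r) x (r \<boxtimes> y) \<cdot> (asc' r r x \<odot> ?i (r \<boxtimes> y)))))"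
      by (simp add: h0 act_def[of x] whisker_right asc_nat_assoc)
    also have "\<dots> = ?a \<cdot> ((?\<mu> \<odot> ?i (r \<boxtimes> (x \<boxtimes> y))) \<cdot> ((?i (r \<boxtimes> r) \<odot> sw x r y) \<cdot> (asc K (r \<boxtimes> r) x (r \<boxtimes> y) \<cdot> (asc' r r x \<odot> ?i (r \<boxtimes> y)))))"
      by (simp add: tarr_cmp_tarr_assoc)
    also have "\<dots> = (?a \<cdot> (?i r \<odot> ?a) \<cdot> asc K r r (r \<boxtimes> (x \<boxtimes> y))) \<cdot> (((?i r \<odot> ?i r) \<odot> sw x r y) \<cdot> (asc K (r \<boxtimes> r) x (r \<boxtimes> y) \<cdot> (asc' r r x \<odot> ?i (r \<boxtimes> y))))"
      unfolding aa[symmetric] by simp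
    also have "\<dots> = ?a \<cdot> (?i r \<odot> ?a) \<cdot> (?i r \<odot> (?i r \<odot> sw x r y)) \<cdot> (asc K r r (x \<boxtimes> (r \<boxtimes> y)) \<cdot> (asc K (r \<boxtimes> r) x (r \<boxtimes> y) \<cdot> (asc' r r x \<odot> ?i (r \<boxtimes> y))))"
      by (simp add: asc_nat_assoc del: tarr_idt_idt)
    also have "\<dots> = ?a \<cdot> (?i r \<odot> h) \<cdot> asc K r (r \<boxtimes> x) (r \<boxtimes> y)"
      by (simp add: pentagon_assoc whisker_inv h0 whisker_left)
    finally show ?thesis .
  qed
  have h2: "h \<cdot> (?i (r \<boxtimes> x) \<odot> act y) = ?a \<cdot> (?i r \<odot> h) \<cdot> sw (r \<boxtimes> x) r (r \<boxtimes> y)"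
  proof -
    have "sw x r y \<cdot> (?i x \<odot> act y) = (?\<mu> \<odot> ?i (x \<boxtimes> y)) \<cdot> (sw x (r \<boxtimes> r) y \<cdot> (?i x \<odot> asc' r r y))"
      by (simp add: act_def whisker_left sw_nat_assoc)
    also have "\<dots> = ?a \<cdot> (?i r \<odot> sw x r y) \<cdot> sw x r (r \<boxtimes> y)"
      by (simp add: sw_tobj_2 act_def)
    finally have s: "sw x r y \<cdot> (?i x \<odot> act y) = ?a \<cdot> (?i r \<odot> sw x r y) \<cdot> sw x r (r \<boxtimes> y)" .
    have "h \<cdot> ((?i r \<odot> ?i x) \<odot> act y) = ?a \<cdot> (?i r \<odot> (sw x r y \<cdot> (?i x \<odot> act y))) \<cdot> asc K r x (r \<boxtimes> (r \<boxtimes> y))"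
      by (simp add: h0 asc_nat whisker_left del: tarr_idt_idt)
    also have "\<dots> = (?a \<cdot> (?i r \<odot> ?a)) \<cdot> (?i r \<odot> (?i r \<odot> sw x r y)) \<cdot> (?i r \<odot> sw x r (r \<boxtimes> y)) \<cdot> asc K r x (r \<boxtimes> (r \<boxtimes> y))"
      unfolding s by (simp add: whisker_left)
    also have "\<dots> = (?a \<cdot> (?i r \<odot> ?a) \<cdot> sw r r (r \<boxtimes> (x \<boxtimes> y))) \<cdot> (?i r \<odot> (?i r \<odot> sw x r y)) \<cdot> (?i r \<odot> sw x r (r \<boxtimes> y)) \<cdot> asc K r x (r \<boxtimes> (r \<boxtimes> y))"
    proof -
      have e: "?a \<cdot> (?i r \<odot> ?a) \<cdot> sw r r (r \<boxtimes> (x \<boxtimes> y)) = ?a \<cdot> (?i r \<odot> ?a)"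
        using act_sw[of ?Z] by (simp add: act_def)
      show ?thesis unfolding e ..
    qed
    also have "\<dots> = ?a \<cdot> (?i r \<odot> ?a) \<cdot> (?i r \<odot> (?i r \<odot> sw x r y)) \<cdot> (sw r r (x \<boxtimes> (r \<boxtimes> y)) \<cdot> (?i r \<odot> sw x r (r \<boxtimes> y)) \<cdot> asc K r x (r \<boxtimes> (r \<boxtimes> y)))"
      by (simp add: sw_nat_assoc)
    also have "\<dots> = ?a \<cdot> (?i r \<odot> h) \<cdot> sw (r \<boxtimes> x) r (r \<boxtimes> y)"
      by (simp add: sw_tobj_1[symmetric] h0 whisker_left)
    finally show ?thesis by simp
  qed
  have b: "h \<cdot> (rac ?X \<odot> ?i (fst ?Y)) = h \<cdot> (?i (fst ?X) \<odot> snd ?Y) \<cdot> asc K (fst ?X) r (fst ?Y)"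
  proof -
    have "h \<cdot> (rac ?X \<odot> ?i (fst ?Y)) = (h \<cdot> (act x \<odot> ?i (r \<boxtimes> y))) \<cdot> (brd K (r \<boxtimes> x) r \<odot> ?i (r \<boxtimes> y))"
      by (simp add: rac_def act_def whisker_right)
    also have "\<dots> = (h \<cdot> (?i (r \<boxtimes> x) \<odot> act y)) \<cdot> asc K (r \<boxtimes> x) r (r \<boxtimes> y)"
      unfolding h1 h2 by (simp add: sw_def)
    finally show ?thesis by (simp add: act_def)
  qed
  note d = descend_pj[OF _ _ _ _ b]
  show ?thesis
    by (rule that[of "descend K (pj ?X ?Y) h"]) (use d in \<open>simp_all add: ext_tensor_def h_def\<close>)
qed

text \<open>Brings extension of scalars under the dictionary of algebras: both records describe the
  \<open>R\<close>-algebra R \<otimes> A, and they are equal, not merely isomorphic.\<close>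

lemma ext_ring_roa:
  assumes A [simp]: "is_ring K A"
  shows "ext_ring K R A = roa (tensor_ring K R A) (in1 K R A)"
proof -
  let ?T = "tensor_ring K R A" and ?a = "r_ob A" and ?i = "idt K" and ?j1 = "in1 K R A" and ?j2 = "in2 K R A"
  let ?X = "ext_obj K R ?a"
  have al: "alg ?T ?j1" by (simp add: ring_mor_in1)
  note [simp] = md_AM(1)[OF al] md_AM(3-5)[OF al]
  have "prd K ?T ?j1 (?i (r \<boxtimes> ?a)) = prd K ?T ?j1 (prd K ?T ?j1 ?j2)" using prd_in1_in2[OF R_ring A] by simp
  also have "\<dots> = prd K ?T (?j1 \<cdot> r_mul R) ?j2 \<cdot> asc' r r ?a"
    by (simp add: ring_mor_mul[OF ring_mor_in1] prd_assoc)
  also have "\<dots> = prd K ?T ?j1 ?j2 \<cdot> (r_mul R \<odot> ?i ?a) \<cdot> asc' r r ?a"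
    by (simp add: reassoc[OF prd_cmp])
  also have "\<dots> = (r_mul R \<odot> ?i ?a) \<cdot> asc' r r ?a" using prd_in1_in2[OF R_ring A] by simp
  finally have AM: "AM ?T ?j1 = ?X" by (simp add: AM_def ext_obj_def)
  obtain t where t: "ext_tensor K R ?a ?a = (tn ?X ?X, t, ext_obj K R (?a \<boxtimes> ?a))"
    "t \<in> arrs K" "src K t = fst (tn ?X ?X)" "tgt K t = r \<boxtimes> (?a \<boxtimes> ?a)"
    "t \<cdot> pj ?X ?X = (r_mul R \<odot> idt K (?a \<boxtimes> ?a)) \<cdot> middle_swap K r ?a r ?a"
    by (rule ext_tensor_eq[of ?a ?a]) auto
  note [simp] = t(2-4)
  have "bm ?T ?j1 = (?i r \<odot> r_mul A) \<cdot> t"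
  proof (rule pj_epi[of _ ?X ?X])
    show "bm ?T ?j1 \<cdot> pj ?X ?X = ((?i r \<odot> r_mul A) \<cdot> t) \<cdot> pj ?X ?X"
    proof -
      have mT: "r_mul ?T = (r_mul R \<odot> r_mul A) \<cdot> middle_swap K r ?a r ?a" by (simp add: tensor_ring_def)
      have "bm ?T ?j1 \<cdot> pj ?X ?X = r_mul ?T" using md_AM(6)[OF al] unfolding AM .
      then show ?thesis unfolding mT by (simp add: t(5) tarr_cmp_tarr_assoc)
    qed
  qed (use md_AM(3,4)[OF al] in \<open>simp_all add: AM\<close>)
  then show ?thesis
    by (intro ring_obj.equality) (simp_all add: ext_ring_def AM t(1) ext_arr_def ext_unit_def in1_def[symmetric])
qed

lemma alg_unit: "alg R (idt K r)"
  by (simp add: ring_mor_idt)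

lemma AM_unit: "AM R (idt K r) = RR"
  by (simp add: AM_def regular_module_def prd_idt)

text \<open>The unit of modules is the algebra \<open>R\<close> over itself, so projections of a
  split algebra onto the unit are ring morphisms to \<open>R\<close> in \<open>K\<close>.\<close>

lemma unit_ring_L: "unit_ring L = roa R (idt K r)"
  by (intro ring_obj.equality) (simp_all add: unit_ring_def AM_unit bm_def lm_def)

lemma element_zero:
  assumes "md M" "ln RR M e" "e \<cdot> r_unit R = zro K (unt K) (fst M)"
  shows "e = zro K r (fst M)"
  by (rule mod_element_eq[OF assms(1,2)]) (use assms lin_zro[of RR M] in simp_all)

text \<open>The computations with R \<otimes> A are done in \<open>K\<close>; localisation and
  products take place in the module category, and the dictionary of algebras translates between the
  two.\<close>

lemma splits_iff:
  assumes A: "is_ring K A" "separable K A" and d: "has_degree K A d"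
  shows "splits K R A \<longleftrightarrow> (\<exists>u. ring_mor K (tower_ring K A d) R u)"
proof -
  let ?T = "tensor_ring K R A" and ?j1 = "in1 K R A" and ?j2 = "in2 K R A"
  let ?X = "roa ?T ?j1" and ?M = "AM ?T ?j1" and ?U = "unit_ring L" and ?t = "r \<boxtimes> r_ob A"
  let ?P = "prod_ring_list L (replicate d ?U)"
  note [simp] = A(1)
  note L = Mod_icsmc and Ls = Mod_smc
  have al: "alg ?T ?j1" by (simp add: ring_mor_in1)
  have ji: "ring_mor K R ?T ?j1" "ring_mor K A ?T ?j2" by (simp_all add: ring_mor_in1 ring_mor_in2)
  have X: "is_ring L ?X" by (rule is_ring_roa[OF al])
  have U: "is_ring L ?U" by (rule idempotent_complete_symmetric_monoidal_category.is_ring_unit[OF L])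
  have P: "is_ring L ?P" by (rule idempotent_complete_symmetric_monoidal_category.is_ring_prod_list[OF L]) (use U in simp)
  note M [simp] = md_AM(1)[OF al]
  have "degree K A = d" unfolding degree_def using d has_degree_unique[OF A] by blast
  then have sp: "splits K R A \<longleftrightarrow> rings_isomorphic L ?X ?P"
    unfolding splits_def ext_ring_roa[OF A(1)] by simp
  obtain c where c: "represents K A d (tower_ring K A d) c" by (rule tower_ring_represents[OF A])
  note T0 = representsD(1)[OF c]
  have fx: "f = prd K R (idt K r) (f \<cdot> ?j2)" if "ring_mor K ?T R f" "f \<cdot> ?j1 = idt K r" for f
    using prd_in1_in2_expand[OF _ _ _ that(1)] that(2) by simp
  show ?thesis
  proof
    assume "splits K R A"
    then have iso: "rings_isomorphic L ?X ?P" unfolding sp .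
    have "\<forall>C \<in> set (replicate d ?U). is_ring L C" using U by simp
    then obtain \<pi> e where pe0: "\<forall>i<length (replicate d ?U). ring_mor L ?X (replicate d ?U ! i) (\<pi> i) \<and> e i \<in> Hom L (unt L) (r_ob ?X) \<and>
        (\<forall>j<length (replicate d ?U). cmp L (\<pi> i) (e j) =
          (if i = j then r_unit (replicate d ?U ! i) else zro L (unt L) (r_ob (replicate d ?U ! i))))"
      using idempotent_complete_symmetric_monoidal_category.iso_prod_ring_list_points[OF L _ X iso] by blast
    have pe: "ring_mor L ?X ?U (\<pi> i)" "e i \<in> Hom L (unt L) (r_ob ?X)"
      "\<And>j. j<d \<Longrightarrow> cmp L (\<pi> i) (e j) = (if i = j then r_unit ?U else zro L (unt L) (r_ob ?U))" if i: "i < d" for i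
    proof -
      note n = nth_replicate[OF i, of ?U]
      have i': "i < length (replicate d ?U)" using i by simp
      note q = pe0[THEN spec, THEN mp, OF i', unfolded n]
      show "ring_mor L ?X ?U (\<pi> i)" "e i \<in> Hom L (unt L) (r_ob ?X)" using q by blast+
      fix j assume "j < d"
      then have "j < length (replicate d ?U)" by simp
      then show "cmp L (\<pi> i) (e j) = (if i = j then r_unit ?U else zro L (unt L) (r_ob ?U))" using q by blast
    qed
    define f where "f i = under (\<pi> i)" for i
    \<comment> \<open>Idempotents of the ring in modules are turned into elements in
      \<open>K\<close> by evaluating at the unit of \<open>R\<close>.\<close>
    define a where "a i = under (e i) \<cdot> r_unit R" for i
    have f: "\<pi> i = (?M, f i, RR)" "ring_mor K ?T R (f i)" "f i \<cdot> ?j1 = idt K r" if "i < d" for i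
    proof -
      have "ring_mor L ?X (roa R (idt K r)) (\<pi> i)" using pe(1)[OF that] unfolding unit_ring_L .
      from ring_mor_roa[OF al alg_unit this] obtain g where g: "\<pi> i = (?M, g, AM R (idt K r))" "ring_mor K ?T R g" "g \<cdot> ?j1 = idt K r" by blast
      have "f i = g" unfolding f_def g(1) by simp
      then show "\<pi> i = (?M, f i, RR)" "ring_mor K ?T R (f i)" "f i \<cdot> ?j1 = idt K r" using g unfolding AM_unit by blast+
    qed
    have e: "ln RR ?M (under (e i))" "e i = (RR, under (e i), ?M)" if "i < d" for i
    proof -
      have "e i \<in> Hom L RR ?M" using pe(2)[OF that] by (simp only: Mod_simps roa_simps)
      then obtain g where g: "e i = (RR, g, ?M)" "ln RR ?M g" unfolding Mod_Hom by blast
      show "ln RR ?M (under (e i))" "e i = (RR, under (e i), ?M)" unfolding g(1) fst_conv snd_conv by (rule g(2), rule refl)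
    qed
    note em = linD[OF e(1)]
    have am: "a i \<in> arrs K" "src K (a i) = unt K" "tgt K (a i) = ?t" if "i < d" for i
      using em[OF that] by (simp_all add: a_def)
    have fm: "f i \<in> arrs K" "src K (f i) = ?t" "tgt K (f i) = r" if "i < d" for i
      using ring_morD[OF f(2)[OF that]] by simp_all
    have fa: "f i \<cdot> a j = (if i = j then r_unit R else zro K (unt K) r)" if "i < d" "j < d" for i j
    proof -
      have "f i \<cdot> under (e j) = (if i = j then idt K r else zro K r r)"
        using arg_cong[OF pe(3)[OF that], of under] f(1)[OF that(1)] by (simp add: unit_ring_def split: if_splits)
      then have "(f i \<cdot> under (e j)) \<cdot> r_unit R = (if i = j then idt K r else zro K r r) \<cdot> r_unit R" by simp
      then show ?thesis using em[OF that(2)] fm[OF that(1)] by (simp add: a_def split: if_splits)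
    qed
    have x: "points K A R (\<lambda>i. f i \<cdot> ?j2) d"
      unfolding points_def
    proof (intro conjI allI impI)
      fix i assume i: "i < d"
      show "ring_mor K A R (f i \<cdot> ?j2)" by (rule ring_mor_cmp[OF ji(2) f(2)[OF i]]) simp_all
      fix j assume "j < i"
      then have j: "j < d" "i \<noteq> j" using i by auto
      note [simp] = fm[OF i] fm[OF j(1)] am[OF i]
      show "disjoint_mors K R (f i \<cdot> ?j2) (f j \<cdot> ?j2)"
        unfolding disjoint_mors_def
      proof (intro ballI impI)
        fix \<epsilon> assume e0: "\<epsilon> \<in> Hom K (unt K) r" and eq: "scl K R \<epsilon> (f i \<cdot> ?j2) = scl K R \<epsilon> (f j \<cdot> ?j2)"
        have [simp]: "\<epsilon> \<in> arrs K" "src K \<epsilon> = unt K" "tgt K \<epsilon> = r" using e0 by auto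
        \<comment> \<open>\<open>f i\<close> is determined by its restrictions to \<open>R\<close>
          and to \<open>A\<close>, and its restriction to \<open>R\<close> is the identity for every
          i.\<close>
        have s: "scl K R \<epsilon> (f i) = scl K R \<epsilon> (f j)"
          using eq by (subst (1 2) fx[OF f(2,3)]) (simp_all add: i j scl_prd_right)
        \<comment> \<open>Evaluation at the idempotent \<open>a i\<close> separates the two
          morphisms: its images under \<open>f i\<close> and \<open>f j\<close> are 1 and 0.\<close>
        have "scl K R \<epsilon> (f i \<cdot> a i) = scl K R \<epsilon> (f j \<cdot> a i)"
          using arg_cong[OF s, of "\<lambda>u. u \<cdot> a i"] by (simp add: scl_cmp)
        then show "\<epsilon> = zro K (unt K) r" using i j by (simp add: fa)
      qed
    qed
    show "\<exists>u. ring_mor K (tower_ring K A d) R u" using representsD(4)[OF c R_ring x] by blast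
  next
    assume "\<exists>u. ring_mor K (tower_ring K A d) R u"
    then obtain u where u: "ring_mor K (tower_ring K A d) R u" by blast
    define x where "x i = u \<cdot> c i" for i
    have x: "points K A R x d"
      unfolding x_def by (rule points_cmp[OF A T0 R_ring representsD(3)[OF c] u])
    note xm = pointsD(1)[OF x]
    define f where "f i = prd K R (idt K r) (x i)" for i
    have f: "ring_mor K ?T R (f i)" "f i \<cdot> ?j1 = idt K r" "f i \<cdot> ?j2 = x i" if "i < d" for i
      using prd_ring_mor[OF R_ring A(1) R_ring ring_mor_idt[OF R_ring] xm[OF that]] by (simp_all add: f_def)
    have jx: "ring_mor K A ?T (?j1 \<cdot> x i)" if "i < d" for i
      by (rule ring_mor_cmp[OF xm[OF that] ji(1)]) simp_all
    \<comment> \<open>\<open>a i\<close> cuts out the part of R \<otimes> A on which the generic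
      morphism \<open>in2\<close> agrees with the i-th given one, that is, the graph of
      \<open>x i\<close>.\<close>
    define a where "a i = eql K A ?T (?j1 \<cdot> x i) ?j2" for i
    note ae = eql[OF A is_ring_tensor[OF R_ring A(1)] jx ji(2), folded a_def]
    have am: "a i \<in> arrs K" "src K (a i) = unt K" "tgt K (a i) = ?t" if "i < d" for i
      using ae(1-3)[OF that] by simp_all
    have fm: "f i \<in> arrs K" "src K (f i) = ?t" "tgt K (f i) = r" if "i < d" for i
      using ring_morD[OF f(1)[OF that]] by simp_all
    have xa: "x i \<in> arrs K" "src K (x i) = r_ob A" "tgt K (x i) = r" if "i < d" for i
      using ring_morD[OF xm[OF that]] by simp_all
    have fa: "f i \<cdot> a i = r_unit R" if i: "i < d" for i
    proof -
      have "f i \<cdot> a i = eql K A R (f i \<cdot> ?j1 \<cdot> x i) (f i \<cdot> ?j2)"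
        by (rule ae(7)[OF i R_ring f(1)[OF i]])
      also have "\<dots> = eql K A R (x i) (x i)"
        using f(2,3)[OF i] xa[OF i] fm[OF i] by (simp add: reassoc[OF f(2)[OF i]])
      finally show ?thesis by (simp add: eql_self[OF A R_ring xm[OF i]])
    qed
    \<comment> \<open>On that part everything comes from \<open>R\<close> by way of
      \<open>f i\<close>; localising there gives back \<open>R\<close> itself.\<close>
    have sa: "scl K ?T (a i) (idt K ?t) = scl K ?T (a i) ?j1 \<cdot> f i" if i: "i < d" for i
    proof -
      note [simp] = am[OF i] fm[OF i] xa[OF i]
      have "scl K ?T (a i) (idt K ?t) = scl K ?T (a i) (prd K ?T ?j1 ?j2)"
        using prd_in1_in2[OF R_ring A(1)] by simp
      also have "\<dots> = prd K ?T ?j1 (scl K ?T (a i) (?j1 \<cdot> x i))"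
        by (simp add: scl_prd_right ae(5)[OF i])
      also have "\<dots> = scl K ?T (a i) (?j1 \<cdot> f i)"
        by (simp add: scl_prd_right f_def ring_mor_prd[OF ji(1)])
      finally show ?thesis by (simp add: scl_cmp)
    qed
    have orth: "scl K ?T (a i) (a j) = zro K (unt K) ?t" if i: "i < d" and j: "j < d" and ij: "i \<noteq> j" for i j
    proof -
      note [simp] = am[OF i] xa[OF i] am[OF j] xa[OF j]
      let ?s = "scl K ?T (a i) (a j)"
      \<comment> \<open>On the product of two such idempotents, \<open>x i\<close> and
        \<open>x j\<close> both agree with \<open>in2\<close>, hence with each other; disjointness
        makes the product zero.\<close>
      have "scl K ?T ?s (?j1 \<cdot> x j) = scl K ?T (a i) (scl K ?T (a j) ?j2)"
        by (simp add: scl_scl[symmetric] ae(5)[OF j])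
      also have "\<dots> = scl K ?T (a j) (scl K ?T (a i) (?j1 \<cdot> x i))"
        by (simp add: ae(5)[OF i] scl_scl scl_comm[of ?T "a i" "a j"])
      also have "\<dots> = scl K ?T ?s (?j1 \<cdot> x i)"
        by (simp add: scl_scl scl_comm[of ?T "a i" "a j"])
      finally have "scl K ?T ?s (?j1 \<cdot> x i) = scl K ?T ?s (?j1 \<cdot> x j)" ..
      moreover have "disjoint_mors K ?T (?j1 \<cdot> x i) (?j1 \<cdot> x j)"
        by (rule disjoint_cmp[OF A R_ring _ xm[OF i] xm[OF j] ji(1) pointsD(2)[OF x i j ij]]) simp
      ultimately show ?thesis unfolding disjoint_mors_def by simp
    qed
    have "\<forall>i. \<exists>\<epsilon>. i < d \<longrightarrow> ln RR ?M \<epsilon> \<and> \<epsilon> \<cdot> r_unit R = a i"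
      using mod_element[of ?M "a _"] am by (metis M roa_simps(4) tensor_ring_ob)
    then obtain \<epsilon> where \<epsilon>: "\<And>i. i < d \<Longrightarrow> ln RR ?M (\<epsilon> i)" "\<And>i. i < d \<Longrightarrow> \<epsilon> i \<cdot> r_unit R = a i" by metis
    let ?e = "\<lambda>i. (RR, \<epsilon> i, ?M)" and ?p = "\<lambda>i. (?M, f i, RR)"
    have lj: "ln RR ?M ?j1" by (rule md_AM(8)[OF al])
    have lid: "ln ?M ?M (idt K ?t)" using lin_idt[of ?M] by simp
    have loc: "is_loc L ?X (?e i) ?U (?p i)" if i: "i < d" for i
    proof -
      note [simp] = am[OF i] fm[OF i]
      have 1: "ring_mor L ?X ?U (?p i)"
        using roa_ring_mor(1)[OF al alg_unit f(1,2)[OF i]] by (simp add: unit_ring_L AM_unit)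
      have "scl L ?X (?e i) (RR, ?j1, ?M) = (RR, scl K ?T (a i) ?j1, ?M)"
        using scl_L[OF al \<epsilon>(1)[OF i] lj] \<epsilon>(2)[OF i] by simp
      have l: "ln RR ?M (scl K ?T (a i) ?j1)"
        unfolding lin_iff
        by (simp add: scl_cmp prd_cmp ring_mor_mul[OF ji(1)] scl_prd_right)
      have 2: "f i \<cdot> scl K ?T (a i) ?j1 = idt K r"
        by (simp add: ring_mor_scl[OF f(1)[OF i]] fa[OF i] f(2)[OF i])
      have 3: "scl L ?X (?e i) (?M, idt K ?t, ?M) = (?M, scl K ?T (a i) ?j1 \<cdot> f i, ?M)"
        using scl_L[OF al \<epsilon>(1)[OF i] lid] \<epsilon>(2)[OF i] sa[OF i] by simp
      show ?thesis
        unfolding is_loc_def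
      proof (intro conjI bexI[of _ "(RR, scl K ?T (a i) ?j1, ?M)"])
        show "?e i \<in> Hom L (unt L) (r_ob ?X)" using \<epsilon>(1)[OF i] by (simp add: Mod_Hom)
        show "(RR, scl K ?T (a i) ?j1, ?M) \<in> Hom L (r_ob ?U) (r_ob ?X)" using l by (simp add: Mod_Hom unit_ring_def)
        show "cmp L (?p i) (RR, scl K ?T (a i) ?j1, ?M) = idt L (r_ob ?U)" using 2 by (simp add: unit_ring_def)
        show "cmp L (RR, scl K ?T (a i) ?j1, ?M) (?p i) = scl L ?X (?e i) (idt L (r_ob ?X))" using 3 by simp
      qed (use X U 1 in simp_all)
    qed
    have orthL: "scl L ?X (?e i) (?e j) = zro L (unt L) (r_ob ?X)" if i: "i < d" and j: "j < d" and ij: "i \<noteq> j" for i j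
    proof -
      note [simp] = am[OF i] am[OF j] linD[OF \<epsilon>(1)[OF j]]
      have l: "ln RR ?M (scl K ?T (a i) (\<epsilon> j))"
        unfolding lin_iff using lin_act[OF \<epsilon>(1)[OF j]]
        by (simp add: scl_cmp prd_cmp scl_prd_right[symmetric])
      have "scl K ?T (a i) (\<epsilon> j) = zro K r ?t"
        using element_zero[OF M l] orth[OF i j ij] \<epsilon>(2)[OF j] by (simp add: scl_cmp)
      then show ?thesis using scl_L[OF al \<epsilon>(1)[OF i] \<epsilon>(1)[OF j]] \<epsilon>(2)[OF i] by simp
    qed
    obtain g p where g: "is_loc L ?X g ?P p" "\<And>i. i < d \<Longrightarrow> scl L ?X g (?e i) = ?e i"
      using idempotent_complete_symmetric_monoidal_category.prod_ring_list_loc[OF L X, of "replicate d ?U" ?e ?p] loc orthL by auto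
    note gD = idempotent_complete_symmetric_monoidal_category.is_locD[OF L g(1)]
    have gg: "scl L ?X g g = g" by (rule idempotent_complete_symmetric_monoidal_category.is_locE[OF L g(1)]) blast
    \<comment> \<open>\<open>h\<close> is the complement of \<open>g\<close>, and \<open>D\<close>
      is the factor it cuts out. The aim is to show that \<open>D\<close> vanishes.\<close>
    obtain h where h: "h \<in> arrs L" "src L h = unt L" "tgt L h = r_ob ?X" "add L g h = r_unit ?X"
      "scl L ?X g h = zro L (unt L) (r_ob ?X)" "scl L ?X h h = h"
      by (rule idempotent_complete_symmetric_monoidal_category.idempotent_complement[OF L X gD(3-5) gg])
    obtain D q where q: "is_loc L ?X h D q"
      by (rule idempotent_complete_symmetric_monoidal_category.ex_loc[OF L X h(1-3,6)])
    note qD = idempotent_complete_symmetric_monoidal_category.is_locD[OF L q]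
    define D' \<psi> where "D' = underlying_ring K R D" and "\<psi> = under (r_unit D)"
    have D: "D = roa D' \<psi>" and al': "alg D' \<psi>"
      unfolding D'_def \<psi>_def using ring_is_roa[OF qD(2)] by simp_all
    note [simp] = algD(1-4)[OF al'] md_AM(1)[OF al']
    obtain v where v: "q = (?M, v, AM D' \<psi>)" "ring_mor K ?T D' v"
      by (rule ring_mor_roa[OF al al' qD(6)[unfolded D]])
    note [simp] = ring_morD(1-3)[OF v(2)]
    \<comment> \<open>\<open>h\<close> is orthogonal to each idempotent of the list and becomes 1 in
      \<open>D\<close>, so every \<open>a i\<close> becomes zero there.\<close>
    have va: "v \<cdot> a i = zro K (unt K) (r_ob D')" if i: "i < d" for i
    proof -
      note e_in = idempotent_complete_symmetric_monoidal_category.is_locD(3-5)[OF L loc[OF i]]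
      have "?e i = scl L ?X (r_unit ?X) (?e i)"
        by (rule symmetric_monoidal_category.scl_unit[OF Ls X e_in(1,3), symmetric])
      also have "\<dots> = add L (scl L ?X g (?e i)) (scl L ?X h (?e i))"
        unfolding h(4)[symmetric]
        by (rule idempotent_complete_symmetric_monoidal_category.scl_add_left[OF L X gD(3) h(1) e_in(1) gD(4) h(2) gD(5) h(3) e_in(3)])
      finally have s: "?e i = add L (?e i) (scl L ?X h (?e i))" unfolding g(2)[OF i] .
      obtain h' where h': "h = (RR, h', ?M)" and lh: "ln RR ?M h'"
      proof -
        have "h \<in> Hom L RR ?M" using h(1-3) unfolding Hom_def by (simp only: Mod_simps roa_simps mem_Collect_eq simp_thms)
        then show ?thesis using that unfolding Mod_Hom by blast
      qed
      note [simp] = linD[OF lh] linD[OF \<epsilon>(1)[OF i]] am[OF i]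
      have sh: "scl L ?X h (?e i) = (RR, scl K ?T (h' \<cdot> r_unit R) (\<epsilon> i), ?M)"
        unfolding h' by (rule scl_L[OF al lh \<epsilon>(1)[OF i]]) simp
      have c: "\<epsilon> i \<boxplus> zro K r ?t = \<epsilon> i \<boxplus> scl K ?T (h' \<cdot> r_unit R) (\<epsilon> i)"
        using arg_cong[OF s, of under] by (simp add: sh)
      have "zro K r ?t = scl K ?T (h' \<cdot> r_unit R) (\<epsilon> i)"
        by (rule add_left_cancel[OF c]) simp_all
      then have s0: "scl K ?T (h' \<cdot> r_unit R) (\<epsilon> i) = zro K r ?t" by (rule sym)
      have z: "scl K ?T (h' \<cdot> r_unit R) (a i) = zro K (unt K) ?t"
        using arg_cong[OF s0, of "\<lambda>w. w \<cdot> r_unit R"] \<epsilon>(2)[OF i] by (simp add: scl_cmp)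
      have qh: "cmp L q h = r_unit D" by (rule idempotent_complete_symmetric_monoidal_category.is_locE[OF L q]) blast
      have "v \<cdot> h' = \<psi>" using arg_cong[OF qh, of under] by (simp add: v(1) h' D)
      then have "v \<cdot> h' \<cdot> r_unit R = r_unit D'" using algD(5)[OF al'] reassoc[of v h' \<psi> "r_unit R"] by simp
      then show ?thesis
        using arg_cong[OF z, of "\<lambda>w. v \<cdot> w"] by (simp add: ring_mor_scl[OF v(2)])
    qed
    \<comment> \<open>Over D' the d given morphisms and \<open>in2\<close> are pairwise disjoint.
      These are d + 1 morphisms, one more than a nonzero ring admits.\<close>
    let ?y = "\<lambda>i. if i < d then v \<cdot> ?j1 \<cdot> x i else v \<cdot> ?j2"
    have vj: "ring_mor K R D' (v \<cdot> ?j1)" "ring_mor K A D' (v \<cdot> ?j2)"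
      by (rule ring_mor_cmp[OF ji(1) v(2)], simp_all, rule ring_mor_cmp[OF ji(2) v(2)], simp_all)
    have y1: "points K A D' (\<lambda>i. (v \<cdot> ?j1) \<cdot> x i) d"
      by (rule points_cmp[OF A R_ring _ x vj(1)]) simp
    have y2: "points K A D' ?y d"
      using y1 xa unfolding points_def by auto
    have "points K A D' ?y (Suc d)"
      unfolding points_Suc
    proof (intro conjI allI impI y2)
      show "ring_mor K A D' (?y d)" using vj(2) by simp
      fix j assume j: "j < d"
      have m: "ring_mor K A D' (v \<cdot> ?j1 \<cdot> x j)" using pointsD(1)[OF y2 j] j by simp
      have "eql K A D' (v \<cdot> ?j1 \<cdot> x j) (v \<cdot> ?j2) = zro K (unt K) (r_ob D')"
        using ae(7)[OF j _ v(2)] va[OF j] by simp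
      then have "disjoint_mors K D' (v \<cdot> ?j1 \<cdot> x j) (v \<cdot> ?j2)"
        using disjoint_iff_eql[OF A _ m vj(2)] by simp
      then show "disjoint_mors K D' (?y d) (?y j)" using j by (simp add: disjoint_sym)
    qed
    then have "r_unit D' = zro K (unt K) (r_ob D')"
      using points_zero[OF A d, of D'] nonzero_ring_iff[of D'] by simp
    then have "\<psi> = zro K r (r_ob D')"
      using element_zero[OF md_AM(1,8)[OF al']] algD(5)[OF al'] by simp
    then have "r_unit D = zro L (unt L) (r_ob D)" by (simp add: D)
    then have "h = zro L (unt L) (r_ob ?X)"
      using idempotent_complete_symmetric_monoidal_category.loc_nonzero[OF L q]
        idempotent_complete_symmetric_monoidal_category.nonzero_ring_iff[OF L qD(2)] by blast
    then have "g = r_unit ?X"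
      using h(4) additive_category.add_zro[OF Mod_additive gD(3-5)] by simp
    then have "ring_iso L ?X ?P p"
      using g(1) by (intro idempotent_complete_symmetric_monoidal_category.loc_unit_iso[OF L]) simp
    then show "splits K R A" unfolding sp rings_isomorphic_def by blast
  qed
qed

end

section \<open>Splitting rings as factors of the splitting tower\<close>

context idempotent_complete_symmetric_monoidal_category
begin

lemma indecomposableD: "indecomposable K B \<Longrightarrow> is_ring K B" "indecomposable K B \<Longrightarrow> nonzero_ring K B"
  unfolding indecomposable_def by blast+

lemma not_nonzero_zero_ring: "\<not> nonzero_ring K (zero_ring K)"
  unfolding nonzero_ring_def using zero_ring_ob by blast

lemma splits_iff_mor:
  assumes "is_ring K A" "separable K A" "finite_degree K A" "is_ring K B" "separable K B"
  shows "splits K B A \<longleftrightarrow> (\<exists>u. ring_mor K (tower_ring K A (degree K A)) B u)"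
proof -
  interpret sep_ring K B by unfold_locales (use assms(4,5) in blast)+
  show ?thesis by (rule splits_iff[OF assms(1,2) has_degree_degree[OF assms(1-3)]])
qed

lemma loc_splitting_ring:
  assumes A: "is_ring K A" "separable K A" "finite_degree K A"
    and l: "is_loc K (tower_ring K A (degree K A)) e B p" and B: "indecomposable K B"
  shows "splitting_ring K B A"
proof -
  let ?d = "degree K A"
  let ?T = "tower_ring K A ?d"
  note d = has_degree_degree[OF A]
  have T: "is_ring K ?T" "separable K ?T" "finite_degree K ?T"
    using is_ring_tower separable_tower finite_degree_tower A d by blast+
  note Br = indecomposableD[OF B]
  have B_sep: "separable K B" by (rule finite_degree_loc(1)[OF T l])
  have B_fin: "sep_ring_fin K B"
    unfolding sep_ring_fin_def using Br(1) B_sep finite_degree_loc(2)[OF T l Br(2)] by blast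
  note pm = is_locD(6)[OF l]
  have B_splits: "splits K B A" using splits_iff_mor[OF A Br(1) B_sep] pm by blast
  obtain c where c: "represents K A ?d ?T c" by (rule tower_ring_represents[OF A(1,2)])
  note cp = representsD(3)[OF c]
  have z: "points K A B (\<lambda>i. p \<cdot> c i) ?d" by (rule points_cmp[OF A(1,2) T(1) Br(1) cp pm])
  have "iso_arrow K f"
    if C: "sep_ring_fin K C" and C_ind: "indecomposable K C" and C_splits: "splits K C A" and f: "ring_mor K C B f" for C f
  proof -
    have Cr: "is_ring K C" "separable K C" using C unfolding sep_ring_fin_def by blast+
    obtain q where q: "ring_mor K ?T C q" using splits_iff_mor[OF A Cr] C_splits by blast
    have qc: "points K A C (\<lambda>i. q \<cdot> c i) ?d" by (rule points_cmp[OF A(1,2) T(1) Cr(1) cp q])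
    have y: "points K A B (\<lambda>i. f \<cdot> q \<cdot> c i) ?d" by (rule points_cmp[OF A(1,2) Cr(1) Br(1) qc f])
    \<comment> \<open>Each morphism coming from \<open>p\<close> must meet one coming from
      \<open>C\<close>, and over the indecomposable \<open>B\<close> meeting means equality.\<close>
    have "\<exists>k<?d. f \<cdot> q \<cdot> c k = p \<cdot> c i" if i: "i < ?d" for i
    proof -
      note zi = pointsD(1)[OF z i]
      obtain k where k: "k < ?d" "eql K A B (f \<cdot> q \<cdot> c k) (p \<cdot> c i) \<noteq> zro K (unt K) (r_ob B)"
        by (rule points_exhaust[OF A(1,2) d Br y zi])
      note yk = pointsD(1)[OF y k(1)]
      have "\<not> disjoint_mors K B (f \<cdot> q \<cdot> c k) (p \<cdot> c i)"
        using k(2) disjoint_iff_eql[OF A(1,2) Br(1) yk zi] by blast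
      then show ?thesis using indecomposable_eq_or_disjoint[OF A(1,2) B yk zi] k(1) by blast
    qed
    then obtain \<sigma> where \<sigma>: "\<And>i. i < ?d \<Longrightarrow> \<sigma> i < ?d" "\<And>i. i < ?d \<Longrightarrow> f \<cdot> q \<cdot> c (\<sigma> i) = p \<cdot> c i" by metis
    have inj: "\<sigma> i \<noteq> \<sigma> j" if "i < ?d" "j < ?d" "i \<noteq> j" for i j
    proof
      assume "\<sigma> i = \<sigma> j"
      then have "p \<cdot> c i = p \<cdot> c j" using \<sigma>(2) that(1,2) by metis
      then have "disjoint_mors K B (p \<cdot> c i) (p \<cdot> c i)" using pointsD(2)[OF z that] by (simp only:)
      then show False using disjoint_self_zero Br by blast
    qed
    \<comment> \<open>The reindexing by \<sigma> takes place over \<open>C\<close>, where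
      injectivity of \<sigma> keeps the entries disjoint; the tuple so obtained is the lift of
      \<open>p\<close> along \<open>f\<close>.\<close>
    have "points K A C (\<lambda>i. q \<cdot> c (\<sigma> i)) ?d"
      unfolding points_def
    proof (intro conjI allI impI)
      fix i assume i: "i < ?d"
      show "ring_mor K A C (q \<cdot> c (\<sigma> i))" by (rule pointsD(1)[OF qc \<sigma>(1)[OF i]])
      fix j assume "j < i"
      then have j: "j < ?d" "i \<noteq> j" using i by auto
      show "disjoint_mors K C (q \<cdot> c (\<sigma> i)) (q \<cdot> c (\<sigma> j))"
        by (rule pointsD(2)[OF qc \<sigma>(1)[OF i] \<sigma>(1)[OF j(1)] inj[OF i j]])
    qed
    then obtain q' where q': "ring_mor K ?T C q'" "\<And>i. i < ?d \<Longrightarrow> q' \<cdot> c i = q \<cdot> c (\<sigma> i)"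
      using representsD(4)[OF c Cr(1)] by blast
    note [simp] = T(1) Br(1) Cr(1) ring_morD(1-3)[OF f] ring_morD(1-3)[OF q'(1)] is_locD(3-5,7-9)[OF l]
    have [simp]: "c i \<in> arrs K" "src K (c i) = r_ob A" "tgt K (c i) = r_ob ?T" if "i < ?d" for i
      using ring_morD[OF pointsD(1)[OF cp that]] by auto
    have fq: "f \<cdot> q' = p"
    proof (rule represents_unique[OF c Br(1) _ pm])
      show "ring_mor K ?T B (f \<cdot> q')" by (rule ring_mor_cmp[OF q'(1) f]) simp_all
      fix i assume i: "i < ?d"
      then have "(f \<cdot> q') \<cdot> c i = f \<cdot> (q' \<cdot> c i)" by simp
      also have "\<dots> = p \<cdot> c i" unfolding q'(2)[OF i] by (rule \<sigma>(2)[OF i])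
      finally show "(f \<cdot> q') \<cdot> c i = p \<cdot> c i" .
    qed
    have pe: "p \<cdot> e = r_unit B" and ee: "scl K ?T e e = e" by (rule is_locE[OF l], blast)+
    have "scl K C (q' \<cdot> e) (q' \<cdot> e) = q' \<cdot> e"
      using arg_cong[OF ee, of "\<lambda>w. q' \<cdot> w"] by (simp add: ring_mor_scl[OF q'(1)])
    then consider "q' \<cdot> e = r_unit C" | "q' \<cdot> e = zro K (unt K) (r_ob C)"
      using indecomposable_idempotent[OF C_ind, of "q' \<cdot> e"] by auto
    \<comment> \<open>If \<open>q' \<cdot> e\<close> were zero, so would be its image in
      \<open>B\<close>, which is 1.\<close>
    then have qe: "q' \<cdot> e = r_unit C"
    proof cases
      case 2
      have "r_unit B = (f \<cdot> q') \<cdot> e" unfolding fq pe ..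
      also have "\<dots> = zro K (unt K) (r_ob B)" using 2 by simp
      finally show ?thesis using nonzero_ring_iff[OF Br(1)] Br(2) by blast
    qed
    obtain s where s: "ring_mor K B C s" "s \<cdot> p = q'" by (rule loc_factor[OF l Cr(1) q'(1) qe])
    note [simp] = ring_morD(1-3)[OF s(1)]
    have fs: "f \<cdot> s = idt K (r_ob B)"
      by (rule is_loc_sect_cancel[OF l]) (simp_all add: s(2) fq)
    have fsf: "f \<cdot> s \<cdot> f = f" using reassoc[OF fs, of f] by simp
    have m: "ring_mor K C C (s \<cdot> f)" by (rule ring_mor_cmp[OF f s(1)]) simp_all
    have i: "ring_mor K C C (idt K (r_ob C))" by (rule ring_mor_idt) simp
    \<comment> \<open>\<open>s \<cdot> f\<close> and the identity become equal after composition
      with \<open>f\<close>, so over the nonzero \<open>B\<close> they cannot be disjoint. The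
      dichotomy for endomorphisms of the separable indecomposable ring \<open>C\<close> then makes
      them equal.\<close>
    have "\<not> disjoint_mors K C (s \<cdot> f) (idt K (r_ob C))"
    proof
      assume "disjoint_mors K C (s \<cdot> f) (idt K (r_ob C))"
      then have "disjoint_mors K B (f \<cdot> s \<cdot> f) (f \<cdot> idt K (r_ob C))"
        by (rule disjoint_cmp[OF Cr Cr(1) Br(1) m i f])
      then have "disjoint_mors K B f f" unfolding fsf by simp
      then show False using disjoint_self_zero Br by blast
    qed
    then have "s \<cdot> f = idt K (r_ob C)" using indecomposable_eq_or_disjoint[OF Cr C_ind m i] by blast
    then show "iso_arrow K f"
      unfolding iso_arrow_def inverse_arrows_def using fs by (intro exI[of _ s]) simp
  qed
  then show ?thesis unfolding splitting_ring_def using B_fin B B_splits by blast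
qed

lemma prod_ring_list_loc_mem:
  assumes "\<forall>A \<in> set As. is_ring K A" "A \<in> set As"
  shows "\<exists>e p. is_loc K (prod_ring_list K As) e A p"
  using assms
proof (induction As)
  case (Cons C As)
  have r: "is_ring K C" "is_ring K (prod_ring_list K As)" using Cons.prems(1) by auto
  show ?case
  proof (cases "A = C")
    case True
    then show ?thesis unfolding prod_ring_list_Cons using loc_prod_fst[OF r] by blast
  next
    case False
    then have "\<exists>e p. is_loc K (prod_ring_list K As) e A p" using Cons.IH Cons.prems by simp
    then show ?thesis unfolding prod_ring_list_Cons using loc_prod_fst[OF r] loc_cmp by blast
  qed
qed simp

text \<open>Of two idempotents with sum 1, one becomes 1 in an indecomposable ring, and the morphism
  factors through the corresponding localisation.\<close>

lemma prod_ring_list_mor: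
  assumes "\<forall>A \<in> set As. is_ring K A" and B: "indecomposable K B" and "ring_mor K (prod_ring_list K As) B q"
  shows "\<exists>A \<in> set As. \<exists>g. ring_mor K A B g"
  using assms(1,3)
proof (induction As arbitrary: q)
  case Nil
  then have "nonzero_ring K (zero_ring K)"
    using nonzero_ring_mor[OF is_ring_zero indecomposableD(1)[OF B] _ indecomposableD(2)[OF B]] by (simp add: prod_ring_list_def)
  then show ?case using not_nonzero_zero_ring by blast
next
  case (Cons C As)
  note Br = indecomposableD[OF B]
  let ?Q = "prod_ring_list K As"
  let ?P = "prod_ring K C ?Q"
  have r: "is_ring K C" "is_ring K ?Q" using Cons.prems(1) by auto
  have q: "ring_mor K ?P B q" using Cons.prems(2) unfolding prod_ring_list_Cons .
  obtain e d where ed: "is_loc K ?P e C (prod_pr1 K C ?Q)" "is_loc K ?P d ?Q (prod_pr2 K C ?Q)" "e \<boxplus> d = r_unit ?P"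
    using loc_prod_fst[OF r] by blast
  note [simp] = r is_ring_prod[OF r] Br(1) ring_morD(1-3)[OF q] is_locD(3-5)[OF ed(1)] is_locD(3-5)[OF ed(2)]
  have ee: "scl K ?P e e = e" by (rule is_locE[OF ed(1)])
  have "scl K B (q \<cdot> e) (q \<cdot> e) = q \<cdot> e"
    using arg_cong[OF ee, of "\<lambda>w. q \<cdot> w"] by (simp add: ring_mor_scl[OF q])
  then consider "q \<cdot> e = r_unit B" | "q \<cdot> e = zro K (unt K) (r_ob B)"
    using indecomposable_idempotent[OF B, of "q \<cdot> e"] by auto
  then show ?case
  proof cases
    case 1
    obtain v where "ring_mor K C B v" by (rule loc_factor[OF ed(1) Br(1) q 1])
    then show ?thesis by auto
  next
    case 2
    have "q \<cdot> d = q \<cdot> (e \<boxplus> d)" using 2 by (simp add: cmp_add)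
    also have "\<dots> = r_unit B" unfolding ed(3) by (rule ring_morD(4)[OF q])
    finally have "q \<cdot> d = r_unit B" .
    then obtain v where "ring_mor K ?Q B v" by (rule loc_factor[OF ed(2) Br(1) q])
    then show ?thesis using Cons.IH Cons.prems(1) by auto
  qed
qed

lemma splitting_ring_decomposition:
  assumes "nice K" and A: "is_ring K A" "separable K A" "finite_degree K A"
  obtains As where "As \<noteq> []" "\<And>B. B \<in> set As \<Longrightarrow> splitting_ring K B A"
    "\<And>B. B \<in> set As \<Longrightarrow> \<exists>e p. is_loc K (tower_ring K A (degree K A)) e B p"
    "\<And>B. splitting_ring K B A \<Longrightarrow> \<exists>B' \<in> set As. rings_isomorphic K B' B"
proof -
  let ?T = "tower_ring K A (degree K A)"
  note d = has_degree_degree[OF A]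
  have T: "is_ring K ?T" "separable K ?T" "finite_degree K ?T"
    using is_ring_tower separable_tower finite_degree_tower A d by blast+
  obtain As where As: "\<And>B. B \<in> set As \<Longrightarrow> indecomposable K B" "rings_isomorphic K ?T (prod_ring_list K As)"
    using \<open>nice K\<close> T unfolding nice_def sep_ring_fin_def by blast
  have r: "\<forall>B \<in> set As. is_ring K B" using As(1) indecomposableD(1) by blast
  let ?P = "prod_ring_list K As"
  have P: "is_ring K ?P" using r by simp
  obtain g where g: "ring_iso K ?T ?P g" using As(2) unfolding rings_isomorphic_def by blast
  obtain h where h: "ring_mor K ?P ?T h" using ring_iso_inverse[OF g T(1) P] unfolding ring_iso_def by blast
  have loc: "\<exists>e p. is_loc K ?T e B p" if "B \<in> set As" for B
    using prod_ring_list_loc_mem[OF r that] loc_cmp[OF ring_iso_loc[OF g T(1) P]] by blast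
  have spl: "splitting_ring K B A" if "B \<in> set As" for B
    using loc[OF that] loc_splitting_ring[OF A _ As(1)[OF that]] by blast
  \<comment> \<open>An empty product would be the zero ring, whereas A^[d] is nonzero by the choice
    of d.\<close>
  have "As \<noteq> []"
  proof
    assume "As = []"
    then have "ring_mor K (zero_ring K) ?T h" using h by (simp add: prod_ring_list_def)
    moreover have "nonzero_ring K ?T" using d unfolding has_degree_def by blast
    ultimately have "nonzero_ring K (zero_ring K)" using nonzero_ring_mor[OF is_ring_zero T(1)] by blast
    then show False using not_nonzero_zero_ring by blast
  qed
  moreover have "\<exists>B' \<in> set As. rings_isomorphic K B' B" if B: "splitting_ring K B A" for B
  proof -
    have B': "indecomposable K B" "is_ring K B" "separable K B" "splits K B A"
      using B unfolding splitting_ring_def sep_ring_fin_def by blast+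
    obtain q where q: "ring_mor K ?T B q" using splits_iff_mor[OF A B'(2,3)] B'(4) by blast
    obtain C f where C: "C \<in> set As" "ring_mor K C B f"
      using prod_ring_list_mor[OF r B'(1) ring_mor_cmp[OF h q P T(1) B'(2)]] by blast
    \<comment> \<open>The minimality of \<open>B\<close> is applied to the factor \<open>C\<close>,
      which is itself a splitting ring and hence splits \<open>A\<close>.\<close>
    have "iso_arrow K f" using B spl[OF C(1)] C(2) unfolding splitting_ring_def by blast
    then show ?thesis using C unfolding rings_isomorphic_def ring_iso_def by blast
  qed
  ultimately show ?thesis using that loc spl by blast
qed

end

theorem proposition6p9:
  fixes K :: "('o, 'm) smc" and A :: "('o, 'm) ring_obj"
  assumes "idempotent_complete_symmetric_monoidal_category K"
    and "nice K"
    and "is_ring K A" and "separable K A" and "finite_degree K A"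
  shows "(\<forall>B. indecomposable K B \<longrightarrow>
            (splitting_ring K B A \<longleftrightarrow> ring_factor K B (tower_ring K A (degree K A)))) \<and>
         (\<exists>B. splitting_ring K B A) \<and>
         (\<exists>S. finite S \<and> (\<forall>B \<in> S. splitting_ring K B A) \<and>
            (\<forall>B. splitting_ring K B A \<longrightarrow> (\<exists>B' \<in> S. rings_isomorphic K B B')))"
proof -
  interpret idempotent_complete_symmetric_monoidal_category K by (rule assms(1))
  note A = assms(3-5)
  let ?T = "tower_ring K A (degree K A)"
  have T: "is_ring K ?T" by (rule is_ring_tower[OF A(1,2)])
  obtain As where As: "As \<noteq> []" "\<And>B. B \<in> set As \<Longrightarrow> splitting_ring K B A"
    "\<And>B. B \<in> set As \<Longrightarrow> \<exists>e p. is_loc K ?T e B p"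
    "\<And>B. splitting_ring K B A \<Longrightarrow> \<exists>B' \<in> set As. rings_isomorphic K B' B"
    by (rule splitting_ring_decomposition[OF assms(2) A]) blast
  have ring: "is_ring K B" if "splitting_ring K B A" for B
    using that unfolding splitting_ring_def sep_ring_fin_def by blast
  have "splitting_ring K B A \<longleftrightarrow> ring_factor K B ?T" if B: "indecomposable K B" for B
  proof
    note Br = indecomposableD(1)[OF B]
    assume "splitting_ring K B A"
    then obtain C f where C: "C \<in> set As" "ring_iso K C B f" using As(4) unfolding rings_isomorphic_def by blast
    \<comment> \<open>An isomorphism is the localisation at the unit; composed with the projection
      onto \<open>C\<close> it exhibits \<open>B\<close> as a factor.\<close>
    have "is_loc K C (r_unit C) B f" by (rule ring_iso_loc[OF C(2) ring[OF As(2)[OF C(1)]] Br])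
    then have "\<exists>e p. is_loc K ?T e B p" using As(3)[OF C(1)] loc_cmp by blast
    then show "ring_factor K B ?T" unfolding ring_factor_iff[OF T Br] .
  next
    assume "ring_factor K B ?T"
    then show "splitting_ring K B A"
      unfolding ring_factor_iff[OF T indecomposableD(1)[OF B]] using loc_splitting_ring[OF A _ B] by blast
  qed
  moreover have "\<exists>B. splitting_ring K B A"
    using As(1,2) by (meson last_in_set)
  moreover have "\<forall>B. splitting_ring K B A \<longrightarrow> (\<exists>B' \<in> set As. rings_isomorphic K B B')"
    using As(2,4) ring rings_isomorphic_sym by meson
  ultimately show ?thesis using As(2) by (intro conjI exI[of _ "set As"]) auto
qed

end
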